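(* Let $n\in\{2,3\}$, $G=\mathbb R^n$, $T=\infty$, $Q=(0,\infty)\times\mathbb R^n$, and $Lu=-\Delta u+\lambda_0u$ with a constant $\lambda_0\ge0$. Let $b_1,\dots,b_s\in\mathbb R^n$ be distinct points satisfying condition (D): if $n=2$, no three of the points $b_j$ lie on the same straight line; if $n=3$, no four of the points $b_j$ lie on the same plane. For $j=1,2$ let $r_j$ be a positive integer, let $x_1^j,\dots,x_{r_j}^j\in\mathbb R^n\setminus\{b_1,\dots,b_s\}$ be distinct points, and let $q_1^j,\dots,q_{r_j}^j$ be nonzero real constants. Let $u_1,u_2$ be functions from the solution class described in the context such that, for $j=1,2$, $$\partial_tu_j+Lu_j=\sum_{i=1}^{r_j}q_i^j\,\delta(x-x_i^j)+f_0(t,x)\ \text{ in }Q,\qquad u_j|_{t=0}=u_0(x),\qquad u_j(b_k,t)=\psi_k(t),\quad k=1,\dots,s,$$ with the same data $f_0,u_0,\psi_1,\dots,\psi_s$ for both $j$. Let $r$ be an integer with $r\ge\max(r_1,r_2)$ and assume that $s\ge2r+1$ if $n=2$ and $s\ge3r+1$ if $n=3$. Then $u_1=u_2$, $r_1=r_2$, and, after a renumbering of the sources, $x_i^1=x_i^2$ and $q_i^1=q_i^2$ for all $i$. That is, the solution of the problem of recovering the number of sources, their locations and the constant intensities is unique.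
   Context: $\delta$ is the Dirac delta function. Data: for some sufficiently large $\lambda>0$, $e^{-\lambda t}f_0\in L_2(Q)$ and $u_0\in W_2^1(\mathbb R^n)$. Here $W_p^k$ denotes the Sobolev space and $W_2^{1,2}(Q)=W_2^1(0,\infty;L_2(G))\cap L_2(0,\infty;W_2^2(G))$. For such $\lambda$ there is a unique $w_0$ with $e^{-\lambda t}w_0\in W_2^{1,2}(Q)$, $\partial_tw_0+Lw_0=f_0$, $w_0|_{t=0}=u_0$. Fix $p\in(1,n/(n-1))$, let $1/p+1/q=1$, and let $W_p^{-1}(\mathbb R^n)$ be the dual of $W_q^1(\mathbb R^n)$ (so that $\delta(x-x_i)\in W_p^{-1}(\mathbb R^n)$). Solution class: a function $u$ solving the equation with sources located at $x_1,\dots,x_m$ belongs to the class if $u=w_0+w$, where $e^{-\lambda t}w\in L_2(0,\infty;W_p^1(\mathbb R^n))$, $e^{-\lambda t}w_t\in L_2(0,\infty;W_p^{-1}(\mathbb R^n))$, $w|_{t=0}=0$, the equation $w_t+Lw=\sum_{i=1}^mq_i\delta(x-x_i)$ holds in $W_p^{-1}(\mathbb R^n)$ for a.e. $t$, and $e^{-\lambda t}w\in W_2^{1,2}(Q_\varepsilon)$ for all $\varepsilon>0$, where $Q_\varepsilon=(0,\infty)\times\{x\in\mathbb R^n:\ |x-x_i|\ge\varepsilon\ \forall i\}$. The pointwise conditions at $b_k$ are understood for a.e. $t$ (they make sense since $b_k\neq x_i$ for all $i,k$). *)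

theory Defs
  imports "HOL-Analysis.Analysis"
begin

section \<open>Lebesgue and Sobolev spaces\<close>

text \<open>Elements of function spaces are represented by functions, not by classes modulo null sets;
  the norms below are therefore seminorms, and equality in a space means distance zero.\<close>

definition Lp :: "real \<Rightarrow> 'a::euclidean_space set \<Rightarrow> ('a \<Rightarrow> real) set" where
  "Lp p S = {f \<in> borel_measurable (lebesgue_on S). integrable (lebesgue_on S) (\<lambda>x. \<bar>f x\<bar> powr p)}"

definition Lp_norm :: "real \<Rightarrow> 'a::euclidean_space set \<Rightarrow> ('a \<Rightarrow> real) \<Rightarrow> real" where
  "Lp_norm p S f = (LINT x|lebesgue_on S. \<bar>f x\<bar> powr p) powr (1/p)"

text \<open>Iterated classical partial derivatives; the list contains the (basis) directions.\<close>

primrec partials :: "'a::euclidean_space list \<Rightarrow> ('a \<Rightarrow> real) \<Rightarrow> 'a \<Rightarrow> real" where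
  "partials [] f = f"
| "partials (b # bs) f = (\<lambda>x. frechet_derivative (partials bs f) (at x) b)"

definition smooth_fun :: "('a::euclidean_space \<Rightarrow> real) \<Rightarrow> bool" where
  "smooth_fun f \<longleftrightarrow> (\<forall>bs. set bs \<subseteq> Basis \<longrightarrow> partials bs f differentiable_on UNIV)"

definition test_funs :: "'a::euclidean_space set \<Rightarrow> ('a \<Rightarrow> real) set" where
  "test_funs S = {\<phi>. smooth_fun \<phi> \<and> (\<exists>K. compact K \<and> K \<subseteq> S \<and> (\<forall>x. x \<notin> K \<longrightarrow> \<phi> x = 0))}"

definition locally_integrable :: "'a::euclidean_space set \<Rightarrow> ('a \<Rightarrow> real) \<Rightarrow> bool" where
  "locally_integrable S f \<longleftrightarrow> (\<forall>K. compact K \<and> K \<subseteq> S \<longrightarrow> f absolutely_integrable_on K)"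

text \<open>In all that follows the spatial domain \<open>S\<close> is open.\<close>

definition weak_deriv ::
  "'a::euclidean_space set \<Rightarrow> 'a list \<Rightarrow> ('a \<Rightarrow> real) \<Rightarrow> ('a \<Rightarrow> real) \<Rightarrow> bool" where
  "weak_deriv S bs f g \<longleftrightarrow> locally_integrable S f \<and> locally_integrable S g \<and>
     (\<forall>\<phi>\<in>test_funs S. (LINT x|lebesgue_on S. f x * partials bs \<phi> x) =
        (-1) ^ length bs * (LINT x|lebesgue_on S. g x * \<phi> x))"

definition wderiv :: "'a::euclidean_space set \<Rightarrow> 'a list \<Rightarrow> ('a \<Rightarrow> real) \<Rightarrow> 'a \<Rightarrow> real" where
  "wderiv S bs f = (SOME g. weak_deriv S bs f g)"

text \<open>Lists of at most \<open>k\<close> basis vectors play the role of the multi-indices of order at most \<open>k\<close>.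
  A mixed derivative is counted once for each order of differentiation, so for \<open>k \<ge> 2\<close> the norm
  differs from the multi-index norm by constant weights on the summands.\<close>

definition dir_lists :: "nat \<Rightarrow> 'a::euclidean_space list set" where
  "dir_lists k = {bs. set bs \<subseteq> Basis \<and> length bs \<le> k}"

definition sobolev :: "nat \<Rightarrow> real \<Rightarrow> 'a::euclidean_space set \<Rightarrow> ('a \<Rightarrow> real) set" where
  "sobolev k p S = {f \<in> Lp p S. \<forall>bs\<in>dir_lists k. \<exists>g\<in>Lp p S. weak_deriv S bs f g}"

definition sobolev_norm ::
  "nat \<Rightarrow> real \<Rightarrow> 'a::euclidean_space set \<Rightarrow> ('a \<Rightarrow> real) \<Rightarrow> real" where
  "sobolev_norm k p S f =
     (\<Sum>bs\<in>dir_lists k. LINT x|lebesgue_on S. \<bar>wderiv S bs f x\<bar> powr p) powr (1/p)"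

text \<open>The dual of \<open>W\<^sub>q\<^sup>1(\<real>\<^sup>n)\<close>, which is \<open>W\<^sub>p\<^sup>-\<^sup>1(\<real>\<^sup>n)\<close> when \<open>1/p + 1/q = 1\<close>. Only the values of
  a functional on \<open>W\<^sub>q\<^sup>1\<close> are relevant.\<close>

definition sobolev_dual :: "real \<Rightarrow> (('a::euclidean_space \<Rightarrow> real) \<Rightarrow> real) set" where
  "sobolev_dual q = {F.
     (\<forall>\<eta>\<in>sobolev 1 q UNIV. \<forall>\<zeta>\<in>sobolev 1 q UNIV. \<forall>a b.
        F (\<lambda>x. a * \<eta> x + b * \<zeta> x) = a * F \<eta> + b * F \<zeta>) \<and>
     (\<exists>C. \<forall>\<eta>\<in>sobolev 1 q UNIV. \<bar>F \<eta>\<bar> \<le> C * sobolev_norm 1 q UNIV \<eta>)}"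

definition sobolev_dual_norm :: "real \<Rightarrow> (('a::euclidean_space \<Rightarrow> real) \<Rightarrow> real) \<Rightarrow> real" where
  "sobolev_dual_norm q F = (SUP \<eta>\<in>{\<eta> \<in> sobolev 1 q UNIV. sobolev_norm 1 q UNIV \<eta> \<le> 1}. \<bar>F \<eta>\<bar>)"

definition dual_embed :: "('a::euclidean_space \<Rightarrow> real) \<Rightarrow> ('a \<Rightarrow> real) \<Rightarrow> real" where
  "dual_embed f = (\<lambda>\<eta>. LINT x|lebesgue. f x * \<eta> x)"

text \<open>The value at \<open>x\<close> of a function that, after modification on a null set, is continuous
  near \<open>x\<close>.\<close>

definition has_point_value :: "('a::euclidean_space \<Rightarrow> real) \<Rightarrow> 'a \<Rightarrow> real \<Rightarrow> bool" where
  "has_point_value f x c \<longleftrightarrow> (\<exists>U g. open U \<and> x \<in> U \<and> continuous_on U g \<and>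
     (AE y in lebesgue. y \<in> U \<longrightarrow> g y = f y) \<and> g x = c)"

definition dirac :: "'a::euclidean_space \<Rightarrow> ('a \<Rightarrow> real) \<Rightarrow> real" where
  "dirac x = (\<lambda>\<eta>. THE c. has_point_value \<eta> x c)"


section \<open>Spaces of functions of time with values in a function space\<close>

text \<open>The value space is a set \<open>X\<close> of real functions on some type, with a seminorm \<open>N\<close>; it is
  instantiated both with Sobolev spaces and with spaces of functionals.\<close>

abbreviation time :: "real measure" where
  "time \<equiv> lebesgue_on {0<..}"

definition strongly_measurable ::
  "('c \<Rightarrow> real) set \<Rightarrow> (('c \<Rightarrow> real) \<Rightarrow> real) \<Rightarrow> (real \<Rightarrow> 'c \<Rightarrow> real) \<Rightarrow> bool" where
  "strongly_measurable X N u \<longleftrightarrow> (AE t in time. u t \<in> X) \<and>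
     (\<exists>s. (\<forall>k. simple_function time (s k) \<and> s k ` space time \<subseteq> X) \<and>
          (AE t in time. (\<lambda>k. N (\<lambda>c. s k t c - u t c)) \<longlonglongrightarrow> 0))"

definition bochner_L2 ::
  "('c \<Rightarrow> real) set \<Rightarrow> (('c \<Rightarrow> real) \<Rightarrow> real) \<Rightarrow> (real \<Rightarrow> 'c \<Rightarrow> real) set" where
  "bochner_L2 X N = {u. strongly_measurable X N u \<and> integrable time (\<lambda>t. (N (u t))\<^sup>2)}"

definition simple_integral_fun :: "(real \<Rightarrow> 'c \<Rightarrow> real) \<Rightarrow> 'c \<Rightarrow> real" where
  "simple_integral_fun s =
     (\<lambda>c. \<Sum>y\<in>s ` space time. measure time (s -` {y} \<inter> space time) * y c)"

text \<open>\<open>I\<close> is the Bochner integral of \<open>u\<close> over \<open>(0,\<infinity>)\<close> in \<open>X\<close>.\<close>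

definition has_bochner_integral_in ::
  "('c \<Rightarrow> real) set \<Rightarrow> (('c \<Rightarrow> real) \<Rightarrow> real) \<Rightarrow> (real \<Rightarrow> 'c \<Rightarrow> real) \<Rightarrow> ('c \<Rightarrow> real) \<Rightarrow> bool" where
  "has_bochner_integral_in X N u I \<longleftrightarrow> strongly_measurable X N u \<and> I \<in> X \<and>
     (\<exists>s. (\<forall>k. simple_function time (s k) \<and> s k ` space time \<subseteq> X \<and>
             emeasure time {t \<in> space time. s k t \<noteq> (\<lambda>c. 0)} \<noteq> \<infinity>) \<and>
          (\<lambda>k. \<integral>\<^sup>+t. ennreal (N (\<lambda>c. s k t c - u t c)) \<partial>time) \<longlonglongrightarrow> 0 \<and>
          (\<lambda>k. N (\<lambda>c. simple_integral_fun (s k) c - I c)) \<longlonglongrightarrow> 0)"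

text \<open>\<open>v\<close> is the distributional derivative of \<open>u\<close> on \<open>(0,\<infinity>)\<close> with values in \<open>X\<close>.\<close>

definition weak_time_deriv ::
  "('c \<Rightarrow> real) set \<Rightarrow> (('c \<Rightarrow> real) \<Rightarrow> real) \<Rightarrow>
     (real \<Rightarrow> 'c \<Rightarrow> real) \<Rightarrow> (real \<Rightarrow> 'c \<Rightarrow> real) \<Rightarrow> bool" where
  "weak_time_deriv X N u v \<longleftrightarrow> (\<forall>\<phi>\<in>test_funs {0<..}. \<exists>I.
     has_bochner_integral_in X N (\<lambda>t c. deriv \<phi> t * u t c) I \<and>
     has_bochner_integral_in X N (\<lambda>t c. \<phi> t * v t c) (\<lambda>c. - I c))"

definition bochner_W12 ::
  "('c \<Rightarrow> real) set \<Rightarrow> (('c \<Rightarrow> real) \<Rightarrow> real) \<Rightarrow> (real \<Rightarrow> 'c \<Rightarrow> real) set" where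
  "bochner_W12 X N = {u \<in> bochner_L2 X N. \<exists>v\<in>bochner_L2 X N. weak_time_deriv X N u v}"

text \<open>The trace at \<open>t = 0\<close> is the value at \<open>0\<close> of the representative that is continuous on
  \<open>[0,\<infinity>)\<close> with values in \<open>X\<close>.\<close>

definition has_initial_value ::
  "('c \<Rightarrow> real) set \<Rightarrow> (('c \<Rightarrow> real) \<Rightarrow> real) \<Rightarrow> (real \<Rightarrow> 'c \<Rightarrow> real) \<Rightarrow> ('c \<Rightarrow> real) \<Rightarrow> bool" where
  "has_initial_value X N u a \<longleftrightarrow> (\<exists>z.
     (\<forall>t\<ge>0. z t \<in> X \<and> ((\<lambda>\<tau>. N (\<lambda>c. z \<tau> c - z t c)) \<longlongrightarrow> 0) (at t within {0..})) \<and>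
     (AE t in time. N (\<lambda>c. z t c - u t c) = 0) \<and> N (\<lambda>c. z 0 c - a c) = 0)"

definition weighted :: "real \<Rightarrow> (real \<Rightarrow> 'c \<Rightarrow> real) \<Rightarrow> real \<Rightarrow> 'c \<Rightarrow> real" where
  "weighted lam u = (\<lambda>t c. exp (- lam * t) * u t c)"

text \<open>\<open>W\<^sub>2\<^sup>1\<^sup>,\<^sup>2((0,\<infinity>) \<times> S) = W\<^sub>2\<^sup>1(0,\<infinity>;L\<^sub>2(S)) \<inter> L\<^sub>2(0,\<infinity>;W\<^sub>2\<^sup>2(S))\<close>.\<close>

definition parabolic_sobolev :: "'a::euclidean_space set \<Rightarrow> (real \<Rightarrow> 'a \<Rightarrow> real) set" where
  "parabolic_sobolev S =
     bochner_W12 (Lp 2 S) (Lp_norm 2 S) \<inter> bochner_L2 (sobolev 2 2 S) (sobolev_norm 2 2 S)"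


section \<open>The parabolic problem with point sources\<close>

definition L_strong :: "real \<Rightarrow> ('a::euclidean_space \<Rightarrow> real) \<Rightarrow> 'a \<Rightarrow> real" where
  "L_strong lam0 f = (\<lambda>x. - (\<Sum>b\<in>Basis. wderiv UNIV [b, b] f x) + lam0 * f x)"

text \<open>The operator \<open>-\<Delta> + \<lambda>\<^sub>0\<close> from \<open>W\<^sub>p\<^sup>1(\<real>\<^sup>n)\<close> to \<open>W\<^sub>p\<^sup>-\<^sup>1(\<real>\<^sup>n)\<close>.\<close>

definition L_weak ::
  "real \<Rightarrow> ('a::euclidean_space \<Rightarrow> real) \<Rightarrow> ('a \<Rightarrow> real) \<Rightarrow> real" where
  "L_weak lam0 f = (\<lambda>\<eta>. LINT x|lebesgue.
     (\<Sum>b\<in>Basis. wderiv UNIV [b] f x * wderiv UNIV [b] \<eta> x) + lam0 * f x * \<eta> x)"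

definition regular_solution ::
  "real \<Rightarrow> real \<Rightarrow> (real \<Rightarrow> 'a::euclidean_space \<Rightarrow> real) \<Rightarrow> ('a \<Rightarrow> real) \<Rightarrow>
     (real \<Rightarrow> 'a \<Rightarrow> real) \<Rightarrow> bool" where
  "regular_solution lam lam0 f0 u0 w0 \<longleftrightarrow>
     weighted lam w0 \<in> parabolic_sobolev UNIV \<and>
     (\<exists>w0t. weak_time_deriv (Lp 2 UNIV) (Lp_norm 2 UNIV) w0 w0t \<and>
        (AE t in time. AE x in lebesgue. w0t t x + L_strong lam0 (w0 t) x = f0 t x)) \<and>
     has_initial_value (Lp 2 UNIV) (Lp_norm 2 UNIV) w0 u0"

text \<open>Sources of intensity \<open>qs i\<close> at \<open>xs i\<close> for \<open>i \<in> {1..m}\<close>. The sets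
  \<open>{x. \<forall>i. |x - x\<^sub>i| \<ge> \<epsilon>}\<close> and their interiors differ by a null set.\<close>

definition singular_solution ::
  "real \<Rightarrow> real \<Rightarrow> real \<Rightarrow> real \<Rightarrow> nat \<Rightarrow> (nat \<Rightarrow> 'a::euclidean_space) \<Rightarrow> (nat \<Rightarrow> real) \<Rightarrow>
     (real \<Rightarrow> 'a \<Rightarrow> real) \<Rightarrow> bool" where
  "singular_solution lam lam0 p q m xs qs w \<longleftrightarrow>
     weighted lam w \<in> bochner_L2 (sobolev 1 p UNIV) (sobolev_norm 1 p UNIV) \<and>
     (\<exists>wt. weak_time_deriv (sobolev_dual q) (sobolev_dual_norm q) (\<lambda>t. dual_embed (w t)) wt \<and>
        weighted lam wt \<in> bochner_L2 (sobolev_dual q) (sobolev_dual_norm q) \<and>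
        (AE t in time. \<forall>\<eta>\<in>sobolev 1 q UNIV.
           wt t \<eta> + L_weak lam0 (w t) \<eta> = (\<Sum>i=1..m. qs i * dirac (xs i) \<eta>))) \<and>
     has_initial_value (sobolev_dual q) (sobolev_dual_norm q) (\<lambda>t. dual_embed (w t)) (\<lambda>\<eta>. 0) \<and>
     (\<forall>\<epsilon>>0. weighted lam w \<in> parabolic_sobolev (interior {x. \<forall>i\<in>{1..m}. \<epsilon> \<le> norm (x - xs i)}))"

text \<open>Membership expresses that \<open>u\<close> solves \<open>\<partial>\<^sub>tu + Lu = \<Sum>\<^sub>i q\<^sub>i \<delta>(x - x\<^sub>i) + f\<^sub>0\<close>, \<open>u|\<^sub>t\<^sub>=\<^sub>0 = u\<^sub>0\<close>
  and has the required structure \<open>u = w\<^sub>0 + w\<close>.\<close>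

definition solution_class ::
  "real \<Rightarrow> real \<Rightarrow> real \<Rightarrow> real \<Rightarrow> (real \<Rightarrow> 'a::euclidean_space \<Rightarrow> real) \<Rightarrow> ('a \<Rightarrow> real) \<Rightarrow>
     nat \<Rightarrow> (nat \<Rightarrow> 'a) \<Rightarrow> (nat \<Rightarrow> real) \<Rightarrow> (real \<Rightarrow> 'a \<Rightarrow> real) set" where
  "solution_class lam lam0 p q f0 u0 m xs qs = {u. \<exists>w0 w.
     regular_solution lam lam0 f0 u0 w0 \<and> singular_solution lam lam0 p q m xs qs w \<and>
     (AE t in time. AE x in lebesgue. u t x = w0 t x + w t x)}"

definition condition_D :: "(real ^ 'n::finite) set \<Rightarrow> bool" where
  "condition_D B \<longleftrightarrow>
     (CARD('n) = 2 \<longrightarrow> (\<forall>T\<subseteq>B. card T = 3 \<longrightarrow> \<not> collinear T)) \<and>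
     (CARD('n) = 3 \<longrightarrow> (\<forall>T\<subseteq>B. card T = 4 \<longrightarrow> \<not> coplanar T))"

end

theory Submission
  imports Defs "HOL-Probability.Distributions"
begin

text \<open>The idea is to test the solutions with heat kernels. Up to a constant let \<open>H(s) = exp (-
  \<lambda>\<^sub>0 s) s powr (- n / 2) exp (- |x - m|\<^sup>2 / (4 s))\<close>, so that
  \<open>\<partial>\<^sub>s H = \<Delta> H - \<lambda>\<^sub>0 H\<close>. If \<open>w\<^sub>t + L w
  = \<Sum>\<^sub>i q\<^sub>i \<delta>(x - x\<^sub>i)\<close> and \<open>w\<close> vanishes at
  \<open>t = 0\<close>, then \<open>k(t, s) = \<langle>w(t), H(s)\<rangle>\<close> satisfies the
  transport equation \<open>k\<^sub>t = k\<^sub>s + S(s)\<close> with \<open>S(s) = \<Sum>\<^sub>i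
  q\<^sub>i H(s)(x\<^sub>i)\<close> and \<open>k(0, s) = 0\<close>. Integration along
  characteristics yields \<open>k(t, s) = A(s + t) - A(s)\<close> for any primitive \<open>A\<close>
  of \<open>S\<close> (\<open>transport_along_characteristics\<close>,
  \<open>singular_solution_heat_pair\<close>). The regular parts of the two solutions have the same
  pairings for the same reason, since their difference has no source
  (\<open>regular_solutions_heat_pair\<close>).

  Take \<open>m = b\<^sub>k\<close>. Both solutions have the same value at \<open>b\<^sub>k\<close>,
  and as \<open>s \<rightarrow> 0\<close> the kernel concentrates there
  (\<open>concentration\<close>). Hence \<open>A(s + t) - A(s) \<rightarrow> 0\<close> for a
  primitive \<open>A\<close> of \<open>S\<^sub>1 - S\<^sub>2\<close>, which forces \<open>A\<close>
  to be constant. In other words, if \<open>C(y)\<close> denotes the intensity of the first family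
  at \<open>y\<close> minus that of the second, then \<open>\<Sum>\<^sub>y C(y) exp (- |y -
  b\<^sub>k|\<^sup>2 / (4 s)) = 0\<close> for all \<open>s > 0\<close>. Exponentials are linearly
  independent, so on every sphere about every \<open>b\<^sub>k\<close> the weights sum to
  \<open>0\<close> (\<open>exponential_sum_zero\<close>).

  The rest is a count. There are at most \<open>2 r\<close> weighted points, so one sign occurs at
  most \<open>r\<close> times. If a point \<open>y\<close> of the other sign existed, then for every
  \<open>b\<^sub>k\<close> the sphere about \<open>b\<^sub>k\<close> through \<open>y\<close> would
  contain a point of the minority sign, that is, \<open>b\<^sub>k\<close> would lie on the
  hyperplane bisecting \<open>y\<close> and one of at most \<open>r\<close> points. By condition (D)
  each such hyperplane contains at most \<open>n\<close> of the \<open>b\<^sub>k\<close>, whereas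
  there are more than \<open>n r\<close> of them (\<open>balanced_weights_vanish\<close>). So all
  weights vanish and the sources coincide. Then \<open>S\<^sub>1 = S\<^sub>2\<close> for every
  centre \<open>m\<close>, the difference of the solutions is orthogonal to all Gaussians for almost
  every time, and it vanishes because Gaussians separate functions
  (\<open>AE_zero_if_orthogonal_to_gaussians\<close>).

  The solutions are given in terms of weak derivatives and Bochner integrals tested against smooth
  functions of compact support. Most of the work goes into extending these tests to Gaussians
  (\<open>weak_deriv_test_rapid\<close>), into bounding functionals on them uniformly
  (\<open>sobolev_dual_gauss_bound\<close>), and into passing from identities for almost every time
  to differentiability in time.\<close>

section \<open>Smooth functions of one variable\<close>

primrec diff_k :: "nat \<Rightarrow> (real \<Rightarrow> real) \<Rightarrow> bool" where
  "diff_k 0 f = True"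
| "diff_k (Suc k) f = ((\<forall>x. f field_differentiable at x) \<and> diff_k k (deriv f))"

definition smooth1 :: "(real \<Rightarrow> real) \<Rightarrow> bool" where
  "smooth1 f \<longleftrightarrow> (\<forall>k. diff_k k f)"

lemma diff_k_SucI:
  assumes "\<And>x. (f has_real_derivative g x) (at x)" "diff_k k g"
  shows "diff_k (Suc k) f"
proof -
  have "deriv f = g" using assms(1) by (auto intro!: DERIV_imp_deriv)
  then show ?thesis using assms by (auto simp: field_differentiable_def)
qed

lemma diff_k_SucD:
  assumes "diff_k (Suc k) f"
  shows "(f has_real_derivative deriv f x) (at x)" "diff_k k (deriv f)"
  using assms by (auto simp: field_differentiable_derivI)

lemma diff_k_Suc_imp: "diff_k (Suc k) f \<Longrightarrow> diff_k k f"
  by (induction k arbitrary: f) auto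

lemma diff_k_const: "diff_k k (\<lambda>x. c)"
proof (induction k arbitrary: c)
  case (Suc k) show ?case by (rule diff_k_SucI[OF _ Suc.IH[of 0]]) auto
qed auto

lemma diff_k_add: "diff_k k f \<Longrightarrow> diff_k k g \<Longrightarrow> diff_k k (\<lambda>x. f x + g x)"
proof (induction k arbitrary: f g)
  case (Suc k)
  show ?case
    by (rule diff_k_SucI[OF _ Suc.IH[OF diff_k_SucD(2)[OF Suc.prems(1)] diff_k_SucD(2)[OF Suc.prems(2)]]])
       (intro derivative_intros diff_k_SucD(1)[OF Suc.prems(1)] diff_k_SucD(1)[OF Suc.prems(2)])
qed auto

lemma diff_k_mult: "diff_k k f \<Longrightarrow> diff_k k g \<Longrightarrow> diff_k k (\<lambda>x. f x * g x)"
proof (induction k arbitrary: f g)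
  case (Suc k)
  note f = diff_k_SucD[OF Suc.prems(1)] and g = diff_k_SucD[OF Suc.prems(2)]
  have 1: "diff_k k (\<lambda>x. deriv f x * g x + deriv g x * f x)"
    by (rule diff_k_add[OF Suc.IH[OF f(2) diff_k_Suc_imp[OF Suc.prems(2)]]
          Suc.IH[OF g(2) diff_k_Suc_imp[OF Suc.prems(1)]]])
  show ?case
    by (rule diff_k_SucI[OF _ 1]) (rule DERIV_mult[OF f(1) g(1)])
qed auto

lemma diff_k_affine: "diff_k k f \<Longrightarrow> diff_k k (\<lambda>x. f (a * x + c))"
proof (induction k arbitrary: f)
  case (Suc k)
  note f = diff_k_SucD[OF Suc.prems(1)]
  show ?case
  proof (rule diff_k_SucI[of _ "\<lambda>x. deriv f (a * x + c) * a"])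
    show "((\<lambda>x. f (a * x + c)) has_real_derivative deriv f (a * x + c) * a) (at x)" for x
      by (rule DERIV_chain2[OF f(1)]) (auto intro!: derivative_eq_intros)
  qed (rule diff_k_mult[OF Suc.IH[OF f(2)] diff_k_const])
qed auto

text \<open>Exhibiting a family that is closed under differentiation gives all derivatives at once, without a
  formula for the iterated ones.\<close>

lemma smooth1_coinduct:
  assumes "f \<in> F" "\<And>g. g \<in> F \<Longrightarrow> \<exists>g'\<in>F. \<forall>x. (g has_real_derivative g' x) (at x)"
  shows "smooth1 f"
proof -
  have "\<forall>g\<in>F. diff_k k g" for k
  proof (induction k)
    case (Suc k) then show ?case using assms(2) diff_k_SucI by blast
  qed auto
  then show ?thesis using assms(1) by (auto simp: smooth1_def)
qed

lemma smooth1I: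
  assumes "\<And>x. (f has_real_derivative g x) (at x)" "smooth1 g"
  shows "smooth1 f"
  unfolding smooth1_def
proof
  fix k show "diff_k k f"
    using assms diff_k_SucI[OF assms(1)] by (cases k) (auto simp: smooth1_def simp del: diff_k.simps(2))
qed

lemma smooth1_deriv: "smooth1 f \<Longrightarrow> smooth1 (deriv f)"
  by (auto simp: smooth1_def dest: diff_k_SucD)

lemma smooth1_DERIV: "smooth1 f \<Longrightarrow> (f has_real_derivative deriv f x) (at x)"
  by (auto simp: smooth1_def intro: diff_k_SucD(1)[of 0])

lemma smooth1_funpow_deriv: "smooth1 f \<Longrightarrow> smooth1 ((deriv ^^ k) f)"
  by (induction k) (auto intro: smooth1_deriv)

lemma smooth1_continuous: "smooth1 f \<Longrightarrow> continuous_on A f"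
  by (meson DERIV_isCont continuous_at_imp_continuous_on smooth1_DERIV)

lemma smooth1_const: "smooth1 (\<lambda>x. c)"
  and smooth1_mult: "smooth1 f \<Longrightarrow> smooth1 g \<Longrightarrow> smooth1 (\<lambda>x. f x * g x)"
  and smooth1_add: "smooth1 f \<Longrightarrow> smooth1 g \<Longrightarrow> smooth1 (\<lambda>x. f x + g x)"
  and smooth1_affine: "smooth1 f \<Longrightarrow> smooth1 (\<lambda>x. f (a * x + c))"
  by (auto simp: smooth1_def intro: diff_k_const diff_k_mult diff_k_add diff_k_affine)

lemma smooth1_diff: "smooth1 f \<Longrightarrow> smooth1 g \<Longrightarrow> smooth1 (\<lambda>x. f x - g x)"
  using smooth1_add[of f "\<lambda>x. (-1) * g x"] smooth1_mult[of "\<lambda>x. -1" g] smooth1_const by simp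

lemma poly_times_exp_minus_tendsto_0:
  "((\<lambda>x::real. x ^ k * poly p x * exp (- x)) \<longlongrightarrow> 0) at_top"
proof (induction p arbitrary: k)
  case (pCons a p)
  have 1: "((\<lambda>x::real. x ^ k / exp x) \<longlongrightarrow> 0) at_top" by (rule tendsto_power_div_exp_0)
  have "((\<lambda>x::real. a * (x ^ k / exp x) + x ^ Suc k * poly p x * exp (- x)) \<longlongrightarrow> a * 0 + 0) at_top"
    by (intro tendsto_intros 1 pCons.IH)
  then show ?case by (simp add: exp_minus field_simps)
qed auto

text \<open>Every derivative of \<open>exp (- 1 / x)\<close> is a polynomial in \<open>1 / x\<close> times
  \<open>exp (- 1 / x)\<close>. With the polynomial as a parameter the family is closed under
  differentiation.\<close>

definition flat :: "real poly \<Rightarrow> real \<Rightarrow> real" where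
  "flat p x = (if x > 0 then poly p (1 / x) * exp (- (1 / x)) else 0)"

text \<open>At \<open>0\<close> the factor \<open>exp (- 1 / x)\<close> beats every power of \<open>1 /
  x\<close>, so that the difference quotients from the right tend to \<open>0\<close>.\<close>

lemma flat_DERIV: "(flat p has_real_derivative flat ([:0, 0, 1:] * (p - pderiv p)) x) (at x)"
proof -
  consider "x > 0" | "x < 0" | "x = 0" by linarith
  then show ?thesis
  proof cases
    case 1
    have "((\<lambda>x. poly p (1 / x) * exp (- (1 / x))) has_real_derivative
        flat ([:0, 0, 1:] * (p - pderiv p)) x) (at x)"
      using 1 by (auto intro!: derivative_eq_intros DERIV_chain2[OF poly_DERIV]
          simp: flat_def field_simps power2_eq_square)
    then show ?thesis
      by (rule has_field_derivative_transform_within_open[of _ _ _ "{0<..}"])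
         (use 1 in \<open>auto simp: flat_def\<close>)
  next
    case 2
    have "((\<lambda>x. 0) has_real_derivative flat ([:0, 0, 1:] * (p - pderiv p)) x) (at x)"
      using 2 by (auto simp: flat_def)
    then show ?thesis
      by (rule has_field_derivative_transform_within_open[of _ _ _ "{..<0}"])
         (use 2 in \<open>auto simp: flat_def\<close>)
  next
    case 3
    have "((\<lambda>h. flat p h / h) \<longlongrightarrow> 0) (at 0)"
    proof (subst filterlim_at_split, intro conjI)
      show "((\<lambda>h. flat p h / h) \<longlongrightarrow> 0) (at_left 0)"
        by (rule Lim_transform_eventually[OF tendsto_const])
           (auto simp: flat_def eventually_at_filter intro!: always_eventually)
      have "((\<lambda>h. (1 / h) ^ 1 * poly p (1 / h) * exp (- (1 / h))) \<longlongrightarrow> 0) (at_right 0)"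
        using filterlim_compose[OF poly_times_exp_minus_tendsto_0[of 1 p] filterlim_inverse_at_top_right]
        by (simp add: inverse_eq_divide)
      then show "((\<lambda>h. flat p h / h) \<longlongrightarrow> 0) (at_right 0)"
        by (rule Lim_transform_eventually)
           (auto simp: flat_def eventually_at_filter field_simps intro!: always_eventually)
    qed
    then show ?thesis unfolding 3 has_field_derivative_iff by (simp add: flat_def)
  qed
qed

lemma smooth1_flat: "smooth1 (flat p)"
  by (rule smooth1_coinduct[of _ "range flat"]) (use flat_DERIV in auto)

definition bump :: "real \<Rightarrow> real \<Rightarrow> real \<Rightarrow> real" where
  "bump a b x = flat 1 (x - a) * flat 1 (b - x)"

lemma flat_1: "flat 1 x = (if x > 0 then exp (- (1 / x)) else 0)"
  by (simp add: flat_def)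

lemma smooth1_bump: "smooth1 (bump a b)"
proof -
  have "smooth1 (\<lambda>x. flat 1 (1 * x + (-a)) * flat 1 ((-1) * x + b))"
    by (intro smooth1_mult smooth1_affine smooth1_flat)
  then show ?thesis by (simp add: bump_def[abs_def] diff_conv_add_uminus add.commute del: add_uminus_conv_diff)
qed

lemma bump_nonneg: "bump a b x \<ge> 0"
  and bump_pos: "a < x \<Longrightarrow> x < b \<Longrightarrow> bump a b x > 0"
  and bump_zero: "x \<notin> {a<..<b} \<Longrightarrow> bump a b x = 0"
  and bump_le_1: "bump a b x \<le> 1"
  by (auto simp: bump_def flat_1 mult_le_one)

section \<open>Products of functions of the coordinates\<close>

text \<open>Products of smooth functions of single coordinates are closed under partial differentiation, which
  acts on one factor at a time. They contain the Gaussians and enough test functions to approximate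
  the indicators of boxes, so the several-variable calculus below stays within this family.\<close>

definition prod_fun :: "('a::euclidean_space \<Rightarrow> real \<Rightarrow> real) \<Rightarrow> 'a \<Rightarrow> real" where
  "prod_fun f x = (\<Prod>i\<in>Basis. f i (x \<bullet> i))"

lemma prod_fun_has_derivative:
  assumes "\<And>i. i \<in> Basis \<Longrightarrow> smooth1 (f i)"
  shows "(prod_fun f has_derivative
    (\<lambda>h. \<Sum>i\<in>Basis. (h \<bullet> i) * prod_fun (f(i := deriv (f i))) x)) (at x)"
proof -
  have "((\<lambda>x. f i (x \<bullet> i)) has_derivative (\<lambda>h. (h \<bullet> i) * deriv (f i) (x \<bullet> i))) (at x)"
    if "i \<in> Basis" for i
    by (rule has_derivative_compose[of "\<lambda>x. x \<bullet> i" "\<lambda>h. h \<bullet> i" _ _ "f i" "\<lambda>h. h * deriv (f i) (x \<bullet> i)"])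
       (use smooth1_DERIV[OF assms[OF that]] in
         \<open>auto intro!: derivative_eq_intros simp: has_field_derivative_def mult_commute_abs\<close>)
  then have "(prod_fun f has_derivative
      (\<lambda>h. \<Sum>i\<in>Basis. ((h \<bullet> i) * deriv (f i) (x \<bullet> i)) * (\<Prod>j\<in>Basis - {i}. f j (x \<bullet> j)))) (at x)"
    unfolding prod_fun_def[abs_def] by (rule has_derivative_prod)
  moreover have "deriv (f i) (x \<bullet> i) * (\<Prod>j\<in>Basis - {i}. f j (x \<bullet> j)) = prod_fun (f(i := deriv (f i))) x"
    if "i \<in> Basis" for i
    unfolding prod_fun_def by (subst prod.remove[OF _ that]) (auto intro!: prod.cong)
  ultimately show ?thesis by (simp add: mult.assoc)
qed

lemma frechet_derivative_prod_fun:
  assumes "\<And>i. i \<in> Basis \<Longrightarrow> smooth1 (f i)" "j \<in> Basis"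
  shows "frechet_derivative (prod_fun f) (at x) j = prod_fun (f(j := deriv (f j))) x"
proof -
  have "frechet_derivative (prod_fun f) (at x) = (\<lambda>h. \<Sum>i\<in>Basis. (h \<bullet> i) * prod_fun (f(i := deriv (f i))) x)"
    by (rule frechet_derivative_at[symmetric]) (rule prod_fun_has_derivative[OF assms(1)])
  then have "frechet_derivative (prod_fun f) (at x) j = (\<Sum>i\<in>Basis. (j \<bullet> i) * prod_fun (f(i := deriv (f i))) x)"
    by simp
  also have "\<dots> = (\<Sum>i\<in>Basis. if i = j then prod_fun (f(i := deriv (f i))) x else 0)"
    by (intro sum.cong) (auto simp: inner_Basis assms(2))
  finally show ?thesis using assms(2) by simp
qed

lemma partials_prod_fun:
  assumes "\<And>i. i \<in> Basis \<Longrightarrow> smooth1 (f i)" "set bs \<subseteq> Basis"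
  shows "partials bs (prod_fun f) = prod_fun (\<lambda>i. (deriv ^^ count_list bs i) (f i))"
  using assms(2)
proof (induction bs)
  case (Cons b bs)
  then have IH: "partials bs (prod_fun f) = prod_fun (\<lambda>i. (deriv ^^ count_list bs i) (f i))" by auto
  have "frechet_derivative (prod_fun (\<lambda>i. (deriv ^^ count_list bs i) (f i))) (at x) b
     = prod_fun ((\<lambda>i. (deriv ^^ count_list bs i) (f i))(b := deriv ((deriv ^^ count_list bs b) (f b)))) x" for x
    using Cons.prems by (intro frechet_derivative_prod_fun smooth1_funpow_deriv assms) auto
  moreover have "(\<lambda>i. (deriv ^^ count_list bs i) (f i))(b := deriv ((deriv ^^ count_list bs b) (f b)))
     = (\<lambda>i. (deriv ^^ count_list (b # bs) i) (f i))" by auto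
  ultimately show ?case by (simp add: IH)
qed auto

lemma smooth_fun_prod_fun:
  assumes "\<And>i. i \<in> Basis \<Longrightarrow> smooth1 (f i)"
  shows "smooth_fun (prod_fun f)"
  unfolding smooth_fun_def
proof (intro allI impI)
  fix bs :: "'a list" assume "set bs \<subseteq> Basis"
  then have "partials bs (prod_fun f) = prod_fun (\<lambda>i. (deriv ^^ count_list bs i) (f i))"
    by (intro partials_prod_fun assms)
  moreover have "prod_fun (\<lambda>i. (deriv ^^ count_list bs i) (f i)) differentiable at x" for x
    by (rule differentiableI, rule prod_fun_has_derivative, rule smooth1_funpow_deriv, rule assms)
  ultimately show "partials bs (prod_fun f) differentiable_on UNIV"
    by (auto simp: differentiable_on_def)
qed

lemma prod_fun_test_fun:
  fixes S :: "'a::euclidean_space set"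
  assumes "\<And>i. i \<in> Basis \<Longrightarrow> smooth1 (f i)" "cbox a b \<subseteq> S"
    "\<And>i x. i \<in> Basis \<Longrightarrow> x \<notin> {a \<bullet> i..b \<bullet> i} \<Longrightarrow> f i x = 0"
  shows "prod_fun f \<in> test_funs S"
  unfolding test_funs_def
proof (intro CollectI conjI smooth_fun_prod_fun[OF assms(1)] exI[of _ "cbox a b"] allI impI)
  fix x assume "x \<notin> cbox a b"
  then obtain i where "i \<in> Basis" "x \<bullet> i \<notin> {a \<bullet> i..b \<bullet> i}" by (auto simp: mem_box)
  then show "prod_fun f x = 0" using assms(3) by (auto simp: prod_fun_def intro!: prod_zero)
qed (use assms in auto)

lemma prod_fun_real: "prod_fun (\<lambda>i. f) = f" for f :: "real \<Rightarrow> real"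
  by (auto simp: prod_fun_def)

lemma smooth1_test_fun:
  assumes "smooth1 f" "{a..b} \<subseteq> S" "\<And>x. x \<notin> {a..b} \<Longrightarrow> f x = 0"
  shows "f \<in> test_funs S"
  using prod_fun_test_fun[of "\<lambda>i. f" a b S] assms by (simp add: prod_fun_real)

section \<open>The fundamental lemma of the calculus of variations\<close>

text \<open>The open boxes are stable under intersection and generate the Borel sets, while the sets over which
  \<open>h\<close> integrates to \<open>0\<close> are closed under complements and countable
  disjoint unions.\<close>

lemma AE_zero_if_box_integrals_zero_integrable:
  fixes h :: "'a::euclidean_space \<Rightarrow> real"
  assumes h: "integrable lebesgue h"
    and zero: "\<And>a b. (LINT x|lebesgue. indicator (box a b) x * h x) = 0"
  shows "AE x in lebesgue. h x = 0"
proof -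
  have ih: "integrable lebesgue (\<lambda>x. indicator A x * h x)" if "A \<in> sets lebesgue" for A
    using integrable_mult_indicator[OF that h] by simp
  have "(\<lambda>n. LINT x|lebesgue. indicator (box (- (real n *\<^sub>R One)) (real n *\<^sub>R One)) x * h x) \<longlonglongrightarrow> (LINT x|lebesgue. h x)"
  proof (rule integral_dominated_convergence[where w = "\<lambda>x. norm (h x)"])
    show "AE x in lebesgue. (\<lambda>n. indicator (box (- (real n *\<^sub>R One)) (real n *\<^sub>R One)) x * h x) \<longlonglongrightarrow> h x"
    proof (rule AE_I2)
      fix x :: 'a
      obtain N :: nat where N: "real N > norm x" using reals_Archimedean2 by blast
      have "x \<in> box (- (real n *\<^sub>R One)) (real n *\<^sub>R One)" if "n \<ge> N" for n
        unfolding mem_box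
      proof
        fix i :: 'a assume i: "i \<in> Basis"
        have "\<bar>x \<bullet> i\<bar> \<le> norm x" using Basis_le_norm[OF i] .
        then have "\<bar>x \<bullet> i\<bar> < real n" using N that by linarith
        then show "(- (real n *\<^sub>R One)) \<bullet> i < x \<bullet> i \<and> x \<bullet> i < (real n *\<^sub>R One) \<bullet> i"
          using i by (simp add: abs_less_iff)
      qed
      then have "eventually (\<lambda>n. indicator (box (- (real n *\<^sub>R One)) (real n *\<^sub>R One)) x * h x = h x) sequentially"
        unfolding eventually_sequentially by (intro exI[of _ N]) simp
      then show "(\<lambda>n. indicator (box (- (real n *\<^sub>R One)) (real n *\<^sub>R One)) x * h x) \<longlonglongrightarrow> h x"
        by (rule tendsto_eventually)
    qed
    show "(\<lambda>x. indicator (box (- (real n *\<^sub>R One)) (real n *\<^sub>R One)) x * h x) \<in> borel_measurable lebesgue" for n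
      by (rule borel_measurable_integrable[OF ih]) simp
  qed (use h in \<open>auto simp: indicator_def\<close>)
  then have total: "(LINT x|lebesgue. h x) = 0"
    unfolding zero by (simp add: LIMSEQ_const_iff)
  have all: "(LINT x|lebesgue. indicator A x * h x) = 0" if "A \<in> sets borel" for A
  proof -
    have sets: "B \<in> sets lebesgue" if "B \<in> sigma_sets UNIV (range (\<lambda>(a, b). box a b :: 'a set))" for B
    proof -
      have "B \<in> sets borel" using that unfolding borel_eq_box by simp
      then show ?thesis by simp
    qed
    have "Int_stable (range (\<lambda>(a, b). box a b :: 'a set))"
      by (auto simp: Int_stable_def box_Int_box)
    moreover have "range (\<lambda>(a, b). box a b :: 'a set) \<subseteq> Pow UNIV" by simp
    moreover have "A \<in> sigma_sets UNIV (range (\<lambda>(a, b). box a b :: 'a set))"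
      using that unfolding borel_eq_box by simp
    ultimately show ?thesis
    proof (induction rule: sigma_sets_induct_disjoint)
      case (compl A)
      have "(\<lambda>x. indicator (UNIV - A) x * h x) = (\<lambda>x. h x - indicator A x * h x)"
        by (auto simp: indicator_def)
      then show ?case using compl ih[OF sets[OF compl(1)]] h total by (simp add: Bochner_Integration.integral_diff)
    next
      case (union A)
      have A: "A i \<in> sets lebesgue" for i
        using union(2) by (intro sets) auto
      have "(LINT x:(\<Union>i. A i)|lebesgue. h x) = (\<Sum>i. (LINT x:(A i)|lebesgue. h x))"
        by (rule lebesgue_integral_countable_add)
           (use A union(1) ih in \<open>auto simp: disjoint_family_on_def set_integrable_def\<close>)
      then show ?case using union(3) by (simp add: set_lebesgue_integral_def)
    qed (use zero in auto)
  qed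
  obtain h' where h': "h' \<in> borel_measurable lborel" "AE x in lborel. h x = h' x"
    using completion_ex_borel_measurable_real[of h lborel] h by auto
  have AE': "AE x in lebesgue. h x = h' x" using h'(2) by (rule AE_completion)
  have "integrable lebesgue h'"
    using h AE' h'(1) by (subst integrable_cong_AE[of _ _ h]) (auto intro: measurable_completion)
  then have ih': "integrable lborel h'" using h'(1) by (simp add: integrable_completion)
  have "AE x in lborel. h' x = 0"
  proof (rule sigma_finite_measure.density_zero[OF sigma_finite_lborel ih'])
    fix A :: "'a set" assume A: "A \<in> sets lborel"
    have "(LINT x|lebesgue. indicator A x * h' x) = (LINT x|lebesgue. indicator A x * h x)"
      using A AE' h'(1) h borel_measurable_integrable[OF ih[of A]]
      by (intro integral_cong_AE) (auto intro: measurable_completion)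
    also have "\<dots> = 0" using all A by simp
    finally show "(LINT x:A|lborel. h' x) = 0"
      using A h'(1) by (simp add: set_lebesgue_integral_def integral_completion)
  qed
  then show ?thesis using AE' AE_completion by fastforce
qed

lemma locally_integrable_indicator:
  assumes "locally_integrable UNIV g" "bounded K" "K \<in> sets lebesgue"
  shows "integrable lebesgue (\<lambda>x. indicator K x * g x)"
proof -
  obtain a where "K \<subseteq> cbox (-a) a" using bounded_subset_cbox_symmetric[OF assms(2)] by blast
  moreover have "set_integrable lebesgue (cbox (-a) a) g"
    using assms(1) by (auto simp: locally_integrable_def)
  ultimately show ?thesis using set_integrable_subset[of lebesgue "cbox (-a) a" g K] assms(3)
    by (simp add: set_integrable_def)
qed

lemma AE_zero_if_box_integrals_zero:
  fixes g :: "'a::euclidean_space \<Rightarrow> real"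
  assumes g: "locally_integrable UNIV g"
    and zero: "\<And>a b. (LINT x|lebesgue. indicator (box a b) x * g x) = 0"
  shows "AE x in lebesgue. g x = 0"
proof -
  define B where "B n = box (- (real n *\<^sub>R One)) (real n *\<^sub>R One :: 'a)" for n
  have "AE x in lebesgue. indicator (B n) x * g x = 0" for n
  proof (rule AE_zero_if_box_integrals_zero_integrable)
    show "integrable lebesgue (\<lambda>x. indicator (B n) x * g x)"
      by (rule locally_integrable_indicator[OF g]) (auto simp: B_def)
    show "(LINT x|lebesgue. indicator (box a b) x * (indicator (B n) x * g x)) = 0" for a b
    proof -
      have "(\<lambda>x. indicator (box a b) x * (indicator (B n) x * g x)) = (\<lambda>x. indicator (box a b \<inter> B n) x * g x)"
        by (auto simp: indicator_def)
      then show ?thesis unfolding B_def box_Int_box by (simp add: zero)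
    qed
  qed
  then have "AE x in lebesgue. \<forall>n. indicator (B n) x * g x = 0" unfolding AE_all_countable by blast
  then show ?thesis
  proof eventually_elim
    case (elim x)
    obtain N :: nat where N: "real N > norm x" using reals_Archimedean2 by blast
    have "x \<in> B N"
      unfolding mem_box B_def
    proof
      fix i :: 'a assume i: "i \<in> Basis"
      have "\<bar>x \<bullet> i\<bar> \<le> norm x" using Basis_le_norm[OF i] .
      then have "\<bar>x \<bullet> i\<bar> < real N" using N by linarith
      then show "(- (real N *\<^sub>R One)) \<bullet> i < x \<bullet> i \<and> x \<bullet> i < (real N *\<^sub>R One) \<bullet> i"
        using i by (simp add: abs_less_iff)
    qed
    then show ?case using elim[rule_format, of N] by simp
  qed
qed

text \<open>The indicator of a box is the bounded pointwise limit of products of smooth functions that vanish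
  outside the box.\<close>

lemma AE_zero_if_orthogonal_to_test_funs:
  fixes g :: "'a::euclidean_space \<Rightarrow> real"
  assumes g: "locally_integrable UNIV g"
    and zero: "\<And>\<phi>. \<phi> \<in> test_funs UNIV \<Longrightarrow> (LINT x|lebesgue. g x * \<phi> x) = 0"
  shows "AE x in lebesgue. g x = 0"
proof (rule AE_zero_if_box_integrals_zero[OF g])
  fix a b :: 'a
  \<comment> \<open>Stretched by the factor \<open>n + 1\<close>, the function \<open>flat 1\<close> converges to the indicator of the half line.\<close>
  define c where "c n i y = flat 1 (real (Suc n) * y + (- (real (Suc n) * (a \<bullet> i)))) * flat 1 ((- real (Suc n)) * y + real (Suc n) * (b \<bullet> i))"
    for n and i :: 'a and y
  have c: "c n i y = (if a \<bullet> i < y \<and> y < b \<bullet> i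
      then exp (- (1 / (real (Suc n) * (y - a \<bullet> i)))) * exp (- (1 / (real (Suc n) * (b \<bullet> i - y)))) else 0)" for n i y
    unfolding c_def flat_1 by (auto simp: algebra_simps simp flip: distrib_left)
      (metis (no_types, opaque_lifting) add.commute add_diff_cancel_left' diff_gt_0_iff_gt mult.commute of_nat_Suc of_nat_0_less_iff zero_less_Suc mult_less_cancel_left_pos right_diff_distrib distrib_left mult.right_neutral)+
  have smooth: "smooth1 (c n i)" for n i
    unfolding c_def by (intro smooth1_mult smooth1_affine smooth1_flat)
  have test: "prod_fun (c n) \<in> test_funs UNIV" for n
    by (rule prod_fun_test_fun[where a = a and b = b]) (auto simp: smooth c)
  have c01: "0 \<le> c n i y" "c n i y \<le> 1" for n i y by (auto simp: c mult_le_one)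
  have outside: "prod_fun (c n) x = 0" if "x \<notin> box a b" for n x
    using that by (auto simp: prod_fun_def mem_box c intro!: prod_zero)
  have meas: "prod_fun (c n) \<in> borel_measurable lebesgue" for n
    using prod_fun_has_derivative[of "c n", OF smooth]
    by (intro continuous_imp_measurable_on_sets_lebesgue[of UNIV, unfolded lebesgue_on_UNIV_eq]
        has_derivative_continuous_on[of UNIV]) (auto simp: has_derivative_at_withinI)
  have ind: "integrable lebesgue (\<lambda>x. indicator (box a b) x * g x)"
    by (rule locally_integrable_indicator[OF g]) auto
  have "(\<lambda>n. LINT x|lebesgue. prod_fun (c n) x * (indicator (box a b) x * g x)) \<longlonglongrightarrow>
      (LINT x|lebesgue. indicator (box a b) x * g x)"
  proof (rule integral_dominated_convergence[where w = "\<lambda>x. norm (indicator (box a b) x * g x)"])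
    show "AE x in lebesgue. (\<lambda>n. prod_fun (c n) x * (indicator (box a b) x * g x)) \<longlonglongrightarrow> indicator (box a b) x * g x"
    proof (rule AE_I2)
      fix x
      show "(\<lambda>n. prod_fun (c n) x * (indicator (box a b) x * g x)) \<longlonglongrightarrow> indicator (box a b) x * g x"
      proof (cases "x \<in> box a b")
        case True
        have lim: "(\<lambda>n. 1 / (real (Suc n) * d)) \<longlonglongrightarrow> 0" if "d > 0" for d
          using tendsto_mult[OF LIMSEQ_inverse_real_of_nat tendsto_const[of "1/d"]] by (simp add: field_simps)
        have "(\<lambda>n. c n i (x \<bullet> i)) \<longlonglongrightarrow> 1" if "i \<in> Basis" for i
        proof -
          have *: "a \<bullet> i < x \<bullet> i" "x \<bullet> i < b \<bullet> i" using True that by (auto simp: mem_box)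
          have "(\<lambda>n. exp (- (1 / (real (Suc n) * (x \<bullet> i - a \<bullet> i)))) * exp (- (1 / (real (Suc n) * (b \<bullet> i - x \<bullet> i)))))
            \<longlonglongrightarrow> exp (- 0) * exp (- 0)"
            by (intro tendsto_intros lim) (use * in auto)
          then show ?thesis using * by (simp add: c)
        qed
        then have "(\<lambda>n. prod_fun (c n) x) \<longlonglongrightarrow> (\<Prod>i\<in>(Basis::'a set). 1)"
          unfolding prod_fun_def by (intro tendsto_prod)
        from tendsto_mult[OF this tendsto_const] show ?thesis by simp
      qed auto
    qed
    show "AE x in lebesgue. norm (prod_fun (c n) x * (indicator (box a b) x * g x)) \<le> norm (indicator (box a b) x * g x)" for n
    proof (rule AE_I2)
      fix x
      have "\<bar>prod_fun (c n) x\<bar> \<le> 1" unfolding prod_fun_def abs_prod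
        using c01 by (intro prod_le_1) auto
      then show "norm (prod_fun (c n) x * (indicator (box a b) x * g x)) \<le> norm (indicator (box a b) x * g x)"
        by (simp add: abs_mult mult_left_le_one_le)
    qed
  qed (use ind meas in \<open>auto intro!: borel_measurable_times borel_measurable_integrable[OF ind]\<close>)
  moreover have "(LINT x|lebesgue. prod_fun (c n) x * (indicator (box a b) x * g x)) = 0" for n
  proof -
    have "(\<lambda>x. prod_fun (c n) x * (indicator (box a b) x * g x)) = (\<lambda>x. g x * prod_fun (c n) x)"
    proof
      fix x
      show "prod_fun (c n) x * (indicator (box a b) x * g x) = g x * prod_fun (c n) x"
        using outside[of x n] by (cases "x \<in> box a b") auto
    qed
    then show ?thesis using zero[OF test] by simp
  qed
  ultimately show "(LINT x|lebesgue. indicator (box a b) x * g x) = 0"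
    by (simp add: LIMSEQ_const_iff)
qed

section \<open>Integrals against rapidly decreasing functions\<close>

text \<open>All spaces \<open>L\<^sub>p\<close> with \<open>p \<ge> 1\<close> are contained in this one, so that
  the square integrable regular parts and the less integrable singular parts of solutions can be
  tested together. A majorant \<open>F + C\<close> carries the same information as a decomposition
  of \<open>f\<close> and is easier to supply.\<close>

definition L1_plus_Linf :: "('a::euclidean_space \<Rightarrow> real) \<Rightarrow> bool" where
  "L1_plus_Linf f \<longleftrightarrow> f \<in> borel_measurable lebesgue \<and>
     (\<exists>F C. integrable lebesgue F \<and> (\<forall>x. \<bar>f x\<bar> \<le> F x + C))"

lemma L1_plus_LinfE:
  assumes "L1_plus_Linf f"
  obtains F C where "integrable lebesgue F" "C \<ge> 0" "\<And>x. F x \<ge> 0" "\<And>x. \<bar>f x\<bar> \<le> F x + C"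
proof -
  obtain F C where F: "integrable lebesgue F" "\<forall>x. \<bar>f x\<bar> \<le> F x + C"
    using assms by (auto simp: L1_plus_Linf_def)
  show ?thesis
  proof (rule that[of "\<lambda>x. \<bar>F x\<bar>" "\<bar>C\<bar>"])
    show "\<bar>f x\<bar> \<le> \<bar>F x\<bar> + \<bar>C\<bar>" for x using F(2)[rule_format, of x] by linarith
  qed (use F in auto)
qed

lemma L1_plus_Linf_measurable: "L1_plus_Linf f \<Longrightarrow> f \<in> borel_measurable lebesgue"
  by (simp add: L1_plus_Linf_def)

lemma L1_plus_Linf_add:
  assumes "L1_plus_Linf f" "L1_plus_Linf g"
  shows "L1_plus_Linf (\<lambda>x. f x + g x)"
proof -
  obtain F C where F: "integrable lebesgue F" "\<And>x. \<bar>f x\<bar> \<le> F x + C"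
    using L1_plus_LinfE[OF assms(1)] by metis
  obtain G D where G: "integrable lebesgue G" "\<And>x. \<bar>g x\<bar> \<le> G x + D"
    using L1_plus_LinfE[OF assms(2)] by metis
  have "\<bar>f x + g x\<bar> \<le> (F x + G x) + (C + D)" for x using F(2)[of x] G(2)[of x] by linarith
  then show ?thesis using F G assms by (auto simp: L1_plus_Linf_def intro!: exI[of _ "\<lambda>x. F x + G x"])
qed

lemma L1_plus_Linf_cmult:
  assumes "L1_plus_Linf f" shows "L1_plus_Linf (\<lambda>x. c * f x)"
proof -
  obtain F C where F: "integrable lebesgue F" "\<And>x. \<bar>f x\<bar> \<le> F x + C"
    using L1_plus_LinfE[OF assms(1)] by metis
  have "\<bar>c * f x\<bar> \<le> \<bar>c\<bar> * F x + \<bar>c\<bar> * C" for x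
    using mult_left_mono[OF F(2)[of x], of "\<bar>c\<bar>"] by (simp add: abs_mult distrib_left)
  then show ?thesis using F assms by (auto simp: L1_plus_Linf_def intro!: exI[of _ "\<lambda>x. \<bar>c\<bar> * F x"])
qed

lemma L1_plus_Linf_diff:
  assumes "L1_plus_Linf f" "L1_plus_Linf g"
  shows "L1_plus_Linf (\<lambda>x. f x - g x)"
  using L1_plus_Linf_add[OF assms(1) L1_plus_Linf_cmult[OF assms(2), of "-1"]] by simp

lemma le_powr_add_1: "(x::real) \<le> x powr p + 1" if "p \<ge> 1" "x \<ge> 0"
proof (cases "x \<le> 1")
  case False
  then have "x powr 1 \<le> x powr p" using that by (intro powr_mono) auto
  then show ?thesis using False by simp
qed (smt (verit) powr_ge_zero)

lemma Lp_UNIV: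
  "f \<in> Lp p UNIV \<longleftrightarrow> f \<in> borel_measurable lebesgue \<and> integrable lebesgue (\<lambda>x. \<bar>f x\<bar> powr p)"
  by (simp add: Lp_def lebesgue_on_UNIV_eq)

lemma Lp_L1_plus_Linf:
  assumes "f \<in> Lp p UNIV" "p \<ge> 1" shows "L1_plus_Linf f"
  using assms le_powr_add_1[OF assms(2), of "\<bar>f x\<bar>" for x]
  by (auto simp: L1_plus_Linf_def Lp_UNIV intro!: exI[of _ "\<lambda>x. \<bar>f x\<bar> powr p"] exI[of _ 1])

lemma L1_plus_Linf_locally_integrable:
  assumes "L1_plus_Linf f" shows "locally_integrable UNIV f"
  unfolding locally_integrable_def
proof (intro allI impI)
  fix K :: "'a set" assume K: "compact K \<and> K \<subseteq> UNIV"
  obtain F C where F: "integrable lebesgue F" "C \<ge> 0" "\<And>x. F x \<ge> 0" "\<And>x. \<bar>f x\<bar> \<le> F x + C"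
    using L1_plus_LinfE[OF assms(1)] by metis
  have K': "K \<in> lmeasurable" using K by (simp add: lmeasurable_compact)
  then have [measurable]: "K \<in> sets lebesgue" by blast
  have "integrable lebesgue (\<lambda>x. indicator K x * C)"
    using K' by (simp add: fmeasurable_def)
  then show "f absolutely_integrable_on K"
    unfolding set_integrable_def
  proof (rule Bochner_Integration.integrable_bound[OF Bochner_Integration.integrable_add[OF F(1)]])
    show "(\<lambda>x. indicat_real K x *\<^sub>R f x) \<in> borel_measurable lebesgue"
      using L1_plus_Linf_measurable[OF assms] by measurable
    show "AE x in lebesgue. norm (indicat_real K x *\<^sub>R f x) \<le> norm (F x + indicat_real K x * C)"
      using F by (auto simp: indicator_def)
  qed
qed

text \<open>The functions against which every element of \<open>L\<^sub>1 + L\<^sub>\<infinity>\<close> can be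
  integrated.\<close>

definition bounded_integrable :: "('a::euclidean_space \<Rightarrow> real) \<Rightarrow> bool" where
  "bounded_integrable w \<longleftrightarrow> integrable lebesgue w \<and> (\<exists>K. \<forall>x. \<bar>w x\<bar> \<le> K)"

lemma integrable_majorant:
  assumes "L1_plus_Linf f" "bounded_integrable w"
  shows "integrable lebesgue (\<lambda>x. f x * w x)"
proof -
  obtain F C where F: "integrable lebesgue F" "C \<ge> 0" "\<And>x. F x \<ge> 0" "\<And>x. \<bar>f x\<bar> \<le> F x + C"
    using L1_plus_LinfE[OF assms(1)] by metis
  obtain K where w: "integrable lebesgue w" and K: "\<And>x. \<bar>w x\<bar> \<le> K"
    using assms(2) by (auto simp: bounded_integrable_def)
  have "integrable lebesgue (\<lambda>x. K * F x + C * \<bar>w x\<bar>)" using F(1) w by auto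
  then show ?thesis
  proof (rule Bochner_Integration.integrable_bound)
    show "(\<lambda>x. f x * w x) \<in> borel_measurable lebesgue"
      using L1_plus_Linf_measurable[OF assms(1)] borel_measurable_integrable[OF w] by measurable
    show "AE x in lebesgue. norm (f x * w x) \<le> norm (K * F x + C * \<bar>w x\<bar>)"
    proof (rule AE_I2)
      fix x
      have "\<bar>f x\<bar> * \<bar>w x\<bar> \<le> F x * \<bar>w x\<bar> + C * \<bar>w x\<bar>"
        using mult_right_mono[OF F(4)[of x], of "\<bar>w x\<bar>"] by (simp add: distrib_right)
      also have "F x * \<bar>w x\<bar> \<le> F x * K" by (intro mult_left_mono K F)
      finally show "norm (f x * w x) \<le> norm (K * F x + C * \<bar>w x\<bar>)" by (simp add: abs_mult mult.commute)
    qed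
  qed
qed

lemma bounded_integrable_bound:
  assumes "bounded_integrable w" "v \<in> borel_measurable lebesgue" "\<And>x. \<bar>v x\<bar> \<le> w x"
  shows "bounded_integrable v"
proof -
  obtain K where w: "integrable lebesgue w" and K: "\<And>x. \<bar>w x\<bar> \<le> K"
    using assms by (auto simp: bounded_integrable_def)
  have "integrable lebesgue v"
    by (rule Bochner_Integration.integrable_bound[OF w assms(2)])
       (use assms(3) abs_ge_self order_trans in \<open>fastforce simp del: abs_ge_self\<close>)
  moreover have "\<bar>v x\<bar> \<le> K" for x using assms(3)[of x] K[of x] by linarith
  ultimately show ?thesis by (auto simp: bounded_integrable_def)
qed

lemma integral_against_tendsto:
  fixes f :: "'a::euclidean_space \<Rightarrow> real"
  assumes f: "L1_plus_Linf f" and w: "bounded_integrable w"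
    and meas: "\<And>n. G n \<in> borel_measurable lebesgue" "g \<in> borel_measurable lebesgue"
    and bound: "\<And>n x. \<bar>G n x\<bar> \<le> w x"
    and lim: "\<And>x. (\<lambda>n::nat. G n x) \<longlonglongrightarrow> g x"
  shows "(\<lambda>n. LINT x|lebesgue. f x * G n x) \<longlonglongrightarrow> (LINT x|lebesgue. f x * g x)"
proof (rule integral_dominated_convergence[where w = "\<lambda>x. norm (f x * w x)"])
  show "(\<lambda>x. f x * g x) \<in> borel_measurable lebesgue" "(\<lambda>x. f x * G n x) \<in> borel_measurable lebesgue" for n
    using L1_plus_Linf_measurable[OF f] meas by measurable
  show "integrable lebesgue (\<lambda>x. norm (f x * w x))" by (intro integrable_norm integrable_majorant f w)
  show "AE x in lebesgue. (\<lambda>n. f x * G n x) \<longlonglongrightarrow> f x * g x" by (intro AE_I2 tendsto_intros lim)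
  show "AE x in lebesgue. norm (f x * G n x) \<le> norm (f x * w x)" for n
  proof (rule AE_I2)
    fix x
    have "\<bar>G n x\<bar> \<le> \<bar>w x\<bar>" using bound[of n x] by linarith
    then show "norm (f x * G n x) \<le> norm (f x * w x)" by (simp add: abs_mult mult_left_mono)
  qed
qed

lemma isCont_integral_against:
  fixes f :: "'a::euclidean_space \<Rightarrow> real" and G :: "real \<Rightarrow> 'a \<Rightarrow> real"
  assumes f: "L1_plus_Linf f" and w: "bounded_integrable w" and I: "open I" "s \<in> I"
    and meas: "\<And>s. s \<in> I \<Longrightarrow> G s \<in> borel_measurable lebesgue"
    and bound: "\<And>s x. s \<in> I \<Longrightarrow> \<bar>G s x\<bar> \<le> w x"
    and cont: "\<And>x. isCont (\<lambda>s. G s x) s"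
  shows "isCont (\<lambda>s. LINT x|lebesgue. f x * G s x) s"
  unfolding isCont_def tendsto_at_iff_sequentially comp_def
proof (intro allI impI)
  fix X :: "nat \<Rightarrow> real" assume X: "X \<longlonglongrightarrow> s"
  define Y where "Y n = (if X n \<in> I then X n else s)" for n
  have YI: "Y n \<in> I" for n using I by (auto simp: Y_def)
  have ev: "eventually (\<lambda>n. Y n = X n) sequentially"
    using topological_tendstoD[OF X I] by eventually_elim (auto simp: Y_def)
  then have Y: "Y \<longlonglongrightarrow> s" using X by (simp add: tendsto_cong)
  have "(\<lambda>n. LINT x|lebesgue. f x * G (Y n) x) \<longlonglongrightarrow> (LINT x|lebesgue. f x * G s x)"
    by (rule integral_against_tendsto[OF f w]) (use YI I meas bound isCont_tendsto_compose[OF cont Y] in auto)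
  moreover have "eventually (\<lambda>n. (LINT x|lebesgue. f x * G (Y n) x) = (LINT x|lebesgue. f x * G (X n) x)) sequentially"
    using ev by eventually_elim simp
  ultimately show "(\<lambda>n. LINT x|lebesgue. f x * G (X n) x) \<longlonglongrightarrow> (LINT x|lebesgue. f x * G s x)"
    by (simp add: tendsto_cong)
qed

text \<open>The difference quotients of \<open>G\<close> inherit the majorant \<open>w\<close> of
  \<open>G'\<close> from the mean value inequality on the convex set \<open>I\<close>, so dominated
  convergence applies to them.\<close>

lemma DERIV_integral_against:
  fixes f :: "'a::euclidean_space \<Rightarrow> real" and G G' :: "real \<Rightarrow> 'a \<Rightarrow> real"
  assumes f: "L1_plus_Linf f" and w: "bounded_integrable w" and I: "open I" "convex I" "s \<in> I"
    and meas: "\<And>s. s \<in> I \<Longrightarrow> G s \<in> borel_measurable lebesgue" "G' s \<in> borel_measurable lebesgue"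
    and bound: "\<And>s x. s \<in> I \<Longrightarrow> \<bar>G s x\<bar> \<le> w x" "\<And>s x. s \<in> I \<Longrightarrow> \<bar>G' s x\<bar> \<le> w x"
    and der: "\<And>s x. s \<in> I \<Longrightarrow> ((\<lambda>s. G s x) has_real_derivative G' s x) (at s)"
  shows "((\<lambda>s. LINT x|lebesgue. f x * G s x) has_real_derivative (LINT x|lebesgue. f x * G' s x)) (at s)"
  unfolding has_field_derivative_iff tendsto_at_iff_sequentially comp_def
proof (intro allI impI)
  fix X :: "nat \<Rightarrow> real" assume X: "X \<longlonglongrightarrow> s" and Xs: "\<forall>i. X i \<in> UNIV - {s}"
  define Q where "Q n x = (if X n \<in> I then (G (X n) x - G s x) / (X n - s) else G' s x)" for n x
  have ev: "eventually (\<lambda>n. X n \<in> I) sequentially"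
    using topological_tendstoD[OF X I(1,3)] .
  have "(\<lambda>n. LINT x|lebesgue. f x * Q n x) \<longlonglongrightarrow> (LINT x|lebesgue. f x * G' s x)"
  proof (rule integral_against_tendsto[OF f w])
    show "Q n \<in> borel_measurable lebesgue" for n
    proof (cases "X n \<in> I")
      case True
      then have [measurable]: "G (X n) \<in> borel_measurable lebesgue" "G s \<in> borel_measurable lebesgue"
        using meas I by auto
      show ?thesis using True by (simp add: Q_def[abs_def])
    qed (use meas in \<open>simp add: Q_def[abs_def]\<close>)
    show "\<bar>Q n x\<bar> \<le> w x" for n x
    proof (cases "X n \<in> I")
      case True
      have "norm (G (X n) x - G s x) \<le> w x * norm (X n - s)"
        by (rule field_differentiable_bound[OF I(2), of "\<lambda>s. G s x" "\<lambda>s. G' s x"])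
           (use True I bound der in \<open>auto intro: has_field_derivative_at_within\<close>)
      then show ?thesis using Xs True by (simp add: Q_def pos_divide_le_eq)
    qed (use bound I in \<open>auto simp: Q_def\<close>)
    show "(\<lambda>n. Q n x) \<longlonglongrightarrow> G' s x" for x
    proof -
      have "(\<lambda>n. (G (X n) x - G s x) / (X n - s)) \<longlonglongrightarrow> G' s x"
        using der[OF I(3), of x] X Xs unfolding has_field_derivative_iff tendsto_at_iff_sequentially comp_def by auto
      then show ?thesis
        by (rule Lim_transform_eventually) (use ev in \<open>auto simp: Q_def elim: eventually_mono\<close>)
    qed
  qed (use meas in auto)
  moreover have "eventually (\<lambda>n. (LINT x|lebesgue. f x * Q n x) =
     ((LINT x|lebesgue. f x * G (X n) x) - (LINT x|lebesgue. f x * G s x)) / (X n - s)) sequentially"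
    using ev
  proof eventually_elim
    case (elim n)
    have int: "integrable lebesgue (\<lambda>x. f x * G t x)" if "t \<in> I" for t
      by (intro integrable_majorant[OF f] bounded_integrable_bound[OF w]) (use that meas bound in auto)
    have "(LINT x|lebesgue. f x * Q n x) = (LINT x|lebesgue. (f x * G (X n) x - f x * G s x) / (X n - s))"
      using elim by (intro Bochner_Integration.integral_cong) (auto simp: Q_def algebra_simps)
    then show ?case using int[OF elim] int[OF I(3)] by (simp add: Bochner_Integration.integral_diff)
  qed
  ultimately show "(\<lambda>n. ((LINT x|lebesgue. f x * G (X n) x) - (LINT x|lebesgue. f x * G s x)) / (X n - s)) \<longlonglongrightarrow> (LINT x|lebesgue. f x * G' s x)"
    by (simp add: tendsto_cong)
qed

subsection \<open>Gaussians\<close>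

definition gauss :: "real \<Rightarrow> 'a::euclidean_space \<Rightarrow> 'a \<Rightarrow> real" where
  "gauss c m x = exp (- c * (norm (x - m))\<^sup>2)"

lemma gauss_pos: "gauss c m x > 0" and gauss_le_1: "c \<ge> 0 \<Longrightarrow> gauss c m x \<le> 1"
  by (auto simp: gauss_def)

lemma gauss_measurable [measurable]: "gauss c m \<in> borel_measurable borel"
  unfolding gauss_def[abs_def] by measurable

lemma gauss_measurable_lebesgue [measurable]: "gauss c m \<in> borel_measurable lebesgue"
  by (intro measurable_completion) simp

lemma gauss_eq_prod: "gauss c m x = (\<Prod>i\<in>Basis. exp (- c * (x \<bullet> i - m \<bullet> i)\<^sup>2))"
proof -
  have "(norm (x - m))\<^sup>2 = (\<Sum>i\<in>Basis. (x \<bullet> i - m \<bullet> i)\<^sup>2)"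
    by (subst power2_norm_eq_inner, subst euclidean_inner) (simp add: inner_diff_left power2_eq_square)
  then show ?thesis
    unfolding gauss_def exp_sum[OF finite_Basis, symmetric] sum_distrib_left[symmetric] by simp
qed

lemma integrable_gauss_real: "c > 0 \<Longrightarrow> integrable lborel (\<lambda>x::real. exp (- c * (x - m)\<^sup>2))"
proof -
  assume c: "c > 0"
  define \<sigma> where "\<sigma> = sqrt (1 / (2 * c))"
  have \<sigma>: "\<sigma>\<^sup>2 = 1 / (2 * c)" using c by (simp add: \<sigma>_def)
  have pos: "0 < sqrt (2 * pi * \<sigma>\<^sup>2)" using c by (simp add: \<sigma>)
  have "integrable lborel (\<lambda>x. sqrt (2 * pi * \<sigma>\<^sup>2) * normal_density m \<sigma> x)" using c
    by (intro integrable_mult_right integrable_normal_density) (simp add: \<sigma>_def)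
  also have "(\<lambda>x. sqrt (2 * pi * \<sigma>\<^sup>2) * normal_density m \<sigma> x) = (\<lambda>x. exp (- c * (x - m)\<^sup>2))"
    using pos c by (auto simp: normal_density_def \<sigma> field_simps)
  finally show ?thesis .
qed

lemma integrable_gauss: "c > 0 \<Longrightarrow> integrable lborel (gauss c m)"
proof (rule integrableI_nonneg)
  assume c: "c > 0"
  have "(\<integral>\<^sup>+x. gauss c m x \<partial>lborel) = (\<integral>\<^sup>+x. (\<Prod>i\<in>Basis. ennreal (exp (- c * (x \<bullet> i - m \<bullet> i)\<^sup>2))) \<partial>lborel)"
    unfolding gauss_eq_prod by (simp add: prod_ennreal)
  also have "\<dots> = (\<Prod>i\<in>Basis. (\<integral>\<^sup>+x. ennreal (exp (- c * (x - m \<bullet> i)\<^sup>2)) \<partial>lborel))"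
    by (rule nn_integral_lborel_prod) auto
  also have "\<dots> < \<infinity>"
  proof -
    have "(\<integral>\<^sup>+x. ennreal (exp (- c * (x - m \<bullet> i)\<^sup>2)) \<partial>lborel) < \<infinity>" for i
      using integrable_gauss_real[OF c, of "m \<bullet> i"] by (simp add: integrable_iff_bounded)
    then show ?thesis by (simp add: less_top[symmetric] ennreal_prod_eq_top)
  qed
  finally show "(\<integral>\<^sup>+x. gauss c m x \<partial>lborel) < \<infinity>" .
qed (auto simp: gauss_def)

lemma bounded_integrable_gauss: "c > 0 \<Longrightarrow> bounded_integrable (\<lambda>x. K * gauss c m x)"
  unfolding bounded_integrable_def
  using integrable_gauss[of c m] gauss_le_1[of c m] gauss_pos[of c m]
  by (auto simp: integrable_completion abs_mult abs_of_pos intro!: exI[of _ "\<bar>K\<bar>"] mult_left_le)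

lemma power_times_gauss_bound:
  assumes "c > 0"
  obtains K where "K \<ge> 0" "\<And>y::real. \<bar>y\<bar> ^ k * exp (- c * y\<^sup>2) \<le> K"
proof -
  have *: "\<bar>y\<bar> ^ k * exp (- c * y\<^sup>2) \<le> 1 + fact k / c ^ k" for y :: real
  proof -
    define z where "z = c * y\<^sup>2"
    have z: "z \<ge> 0" using assms by (simp add: z_def)
    have "z ^ k / fact k \<le> exp z"
    proof -
      have "(\<Sum>n\<in>{k}. inverse (fact n) * z ^ n) \<le> (\<Sum>n. inverse (fact n) * z ^ n)"
        using summable_exp[of z] z by (intro sum_le_suminf) auto
      then show ?thesis by (simp add: exp_def scaleR_conv_of_real field_simps)
    qed
    then have 1: "z ^ k * exp (- z) \<le> fact k" by (simp add: exp_minus field_simps)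
    have "\<bar>y\<bar> ^ k \<le> 1 + (y\<^sup>2) ^ k"
    proof (cases "\<bar>y\<bar> \<le> 1")
      case True then show ?thesis using power_le_one[of "\<bar>y\<bar>" k] by (smt (verit) abs_ge_zero zero_le_power zero_le_power2)
    next
      case False
      then have "\<bar>y\<bar> ^ k \<le> \<bar>y\<bar> ^ (2 * k)" by (intro power_increasing) auto
      then show ?thesis by (simp add: power_mult)
    qed
    then have "\<bar>y\<bar> ^ k * exp (- z) \<le> (1 + (y\<^sup>2) ^ k) * exp (- z)" by (intro mult_right_mono) auto
    also have "\<dots> = exp (- z) + z ^ k * exp (- z) / c ^ k" using assms by (simp add: z_def field_simps power_mult_distrib)
    also have "\<dots> \<le> 1 + fact k / c ^ k" using 1 z assms by (intro add_mono divide_right_mono) auto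
    finally show ?thesis by (simp add: z_def)
  qed
  show ?thesis by (rule that[OF _ *]) (use assms in auto)
qed

text \<open>A Gaussian with a smaller exponent absorbs every power of the distance.\<close>

lemma norm_power_times_gauss_bound:
  assumes "c > 0" "d < c"
  obtains K where "K \<ge> 0" "\<And>x m::'a::euclidean_space. norm (x - m) ^ k * gauss c m x \<le> K * gauss d m x"
proof -
  obtain K where K: "K \<ge> 0" "\<And>y::real. \<bar>y\<bar> ^ k * exp (- (c - d) * y\<^sup>2) \<le> K"
    using power_times_gauss_bound[of "c - d" k] assms by (metis diff_gt_0_iff_gt)
  show ?thesis
  proof (rule that[OF K(1)])
    fix x m :: 'a
    have "gauss c m x = exp (- (c - d) * (norm (x - m))\<^sup>2) * gauss d m x"
      by (simp add: gauss_def mult_exp_exp algebra_simps)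
    then show "norm (x - m) ^ k * gauss c m x \<le> K * gauss d m x"
      using mult_right_mono[OF K(2)[of "norm (x - m)"], of "gauss d m x"] gauss_pos[of d m x] by simp
  qed
qed

subsection \<open>The inequality of Hoelder\<close>

lemma Lp_norm_nonneg: "Lp_norm p S f \<ge> 0" by (simp add: Lp_norm_def)

lemma Lp_norm_powr:
  assumes "p > 0" shows "Lp_norm p S f powr p = (LINT x|lebesgue_on S. \<bar>f x\<bar> powr p)"
  using assms by (simp add: Lp_norm_def powr_powr)

lemma Lp_norm_eq_0:
  assumes "f \<in> Lp p S" "p > 0" "Lp_norm p S f = 0"
  shows "AE x in lebesgue_on S. f x = 0"
proof -
  have "(LINT x|lebesgue_on S. \<bar>f x\<bar> powr p) = 0" using Lp_norm_powr[of p S f] assms by simp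
  then have "AE x in lebesgue_on S. \<bar>f x\<bar> powr p = 0"
    using assms by (subst (asm) integral_nonneg_eq_0_iff_AE) (auto simp: Lp_def)
  then show ?thesis by simp
qed

lemma Hoelder_inequality:
  assumes pq: "p > 1" "q > 1" "1 / p + 1 / q = 1" and f: "f \<in> Lp p S" and g: "g \<in> Lp q S"
  shows "integrable (lebesgue_on S) (\<lambda>x. f x * g x)"
    and "\<bar>LINT x|lebesgue_on S. f x * g x\<bar> \<le> Lp_norm p S f * Lp_norm q S g"
proof -
  note [measurable] = f[unfolded Lp_def, simplified, THEN conjunct1] g[unfolded Lp_def, simplified, THEN conjunct1]
  have fi: "integrable (lebesgue_on S) (\<lambda>x. \<bar>f x\<bar> powr p)" and gi: "integrable (lebesgue_on S) (\<lambda>x. \<bar>g x\<bar> powr q)"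
    using f g by (auto simp: Lp_def)
  have young: "\<bar>f x * g x\<bar> \<le> \<bar>f x\<bar> powr p / p + \<bar>g x\<bar> powr q / q" for x
    using Youngs_inequality[OF pq, of "\<bar>f x\<bar>" "\<bar>g x\<bar>"] by (simp add: abs_mult)
  show int: "integrable (lebesgue_on S) (\<lambda>x. f x * g x)"
    by (rule Bochner_Integration.integrable_bound[of _ "\<lambda>x. \<bar>f x\<bar> powr p / p + \<bar>g x\<bar> powr q / q"])
       (use fi gi young abs_ge_self order_trans in \<open>fastforce simp del: abs_ge_self\<close>)+
  define A B where "A = Lp_norm p S f" and "B = Lp_norm q S g"
  show "\<bar>LINT x|lebesgue_on S. f x * g x\<bar> \<le> Lp_norm p S f * Lp_norm q S g"
  proof (cases "A = 0 \<or> B = 0")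
    case True
    then have "AE x in lebesgue_on S. f x * g x = 0"
      using Lp_norm_eq_0[OF f] Lp_norm_eq_0[OF g] pq by (auto simp: A_def B_def)
    then have "(LINT x|lebesgue_on S. f x * g x) = 0" by (intro integral_eq_zero_AE)
    then show ?thesis using Lp_norm_nonneg[of p S f] Lp_norm_nonneg[of q S g] by simp
  next
    case False
    then have pos: "A > 0" "B > 0" using Lp_norm_nonneg[of p S f] Lp_norm_nonneg[of q S g] by (auto simp: A_def B_def)
    have young': "\<bar>f x * g x\<bar> \<le> A * B * (\<bar>f x\<bar> powr p / (A powr p * p) + \<bar>g x\<bar> powr q / (B powr q * q))" for x
    proof -
      have "\<bar>f x\<bar> / A * (\<bar>g x\<bar> / B) \<le> (\<bar>f x\<bar> / A) powr p / p + (\<bar>g x\<bar> / B) powr q / q"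
        using pos by (intro Youngs_inequality[OF pq]) auto
      then have "\<bar>f x\<bar> / A * (\<bar>g x\<bar> / B) \<le> \<bar>f x\<bar> powr p / (A powr p * p) + \<bar>g x\<bar> powr q / (B powr q * q)"
        using pos by (simp add: powr_divide)
      from mult_left_mono[OF this, of "A * B"] show ?thesis using pos by (simp add: abs_mult field_simps)
    qed
    have "\<bar>LINT x|lebesgue_on S. f x * g x\<bar> \<le> (LINT x|lebesgue_on S. \<bar>f x * g x\<bar>)"
      using integral_norm_bound[of "lebesgue_on S" "\<lambda>x. f x * g x"] by simp
    also have "\<dots> \<le> (LINT x|lebesgue_on S. A * B * (\<bar>f x\<bar> powr p / (A powr p * p) + \<bar>g x\<bar> powr q / (B powr q * q)))"
      using int fi gi young' by (intro integral_mono) auto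
    also have "\<dots> = A * B * ((LINT x|lebesgue_on S. \<bar>f x\<bar> powr p) / (A powr p * p) + (LINT x|lebesgue_on S. \<bar>g x\<bar> powr q) / (B powr q * q))"
      using fi gi by (simp add: Bochner_Integration.integral_add)
    also have "\<dots> = A * B * (1 / p + 1 / q)"
    proof -
      have "(LINT x|lebesgue_on S. \<bar>f x\<bar> powr p) = A powr p" "(LINT x|lebesgue_on S. \<bar>g x\<bar> powr q) = B powr q"
        using pq by (simp_all add: A_def B_def Lp_norm_powr)
      then show ?thesis using pos by simp
    qed
    finally show ?thesis using pq by (simp add: A_def B_def)
  qed
qed

section \<open>Weak derivatives\<close>

lemma test_fun_partials_differentiable:
  assumes "\<phi> \<in> test_funs S" "set bs \<subseteq> Basis" shows "partials bs \<phi> differentiable_on UNIV"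
  using assms by (simp add: test_funs_def smooth_fun_def)

lemma test_fun_continuous:
  assumes "\<phi> \<in> test_funs S" shows "continuous_on UNIV \<phi>"
  using test_fun_partials_differentiable[OF assms, of "[]"] by (simp add: differentiable_imp_continuous_on)

lemma continuous_measurable_lebesgue:
  "continuous_on UNIV (f :: 'a::euclidean_space \<Rightarrow> real) \<Longrightarrow> f \<in> borel_measurable lebesgue"
  by (rule continuous_imp_measurable_on_sets_lebesgue[of UNIV, unfolded lebesgue_on_UNIV_eq]) auto

lemma compact_support_bounded:
  fixes f :: "'a::euclidean_space \<Rightarrow> real"
  assumes "continuous_on UNIV f" "compact K" "\<And>x. x \<notin> K \<Longrightarrow> f x = 0"
  obtains M where "M \<ge> 0" "\<And>x. \<bar>f x\<bar> \<le> M"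
proof -
  have "bounded (f ` K)"
    by (rule compact_imp_bounded[OF compact_continuous_image[OF continuous_on_subset[OF assms(1)] assms(2)]]) simp
  then obtain M where M: "\<And>x. x \<in> K \<Longrightarrow> \<bar>f x\<bar> \<le> M" by (auto simp: bounded_iff)
  have "\<bar>f x\<bar> \<le> max M 0" for x using M[of x] assms(3)[of x] by (cases "x \<in> K") auto
  then show ?thesis by (rule that[rotated]) simp
qed

lemma integrable_times_compact_support:
  fixes g f :: "'a::euclidean_space \<Rightarrow> real"
  assumes g: "locally_integrable UNIV g" and f: "continuous_on UNIV f" "compact K" "\<And>x. x \<notin> K \<Longrightarrow> f x = 0"
  shows "integrable lebesgue (\<lambda>x. g x * f x)"
proof -
  obtain M where M: "M \<ge> 0" "\<And>x. \<bar>f x\<bar> \<le> M" using compact_support_bounded[OF f] by metis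
  have K: "K \<in> sets lebesgue" using f(2) by (simp add: compact_imp_closed)
  have i: "integrable lebesgue (\<lambda>x. indicator K x * g x)"
    by (rule locally_integrable_indicator[OF g compact_imp_bounded[OF f(2)] K])
  have eq: "(\<lambda>x. g x * f x) = (\<lambda>x. (indicator K x * g x) * f x)"
  proof
    show "g x * f x = (indicator K x * g x) * f x" for x using f(3)[of x] by (cases "x \<in> K") auto
  qed
  show ?thesis
  proof (rule Bochner_Integration.integrable_bound[of _ "\<lambda>x. M * (indicator K x * g x)"])
    show "(\<lambda>x. g x * f x) \<in> borel_measurable lebesgue" unfolding eq
      by (intro borel_measurable_times borel_measurable_integrable[OF i] continuous_measurable_lebesgue f)
    show "AE x in lebesgue. norm (g x * f x) \<le> norm (M * (indicat_real K x * g x))"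
    proof (rule AE_I2)
      fix x
      have "norm (g x * f x) = norm (indicat_real K x * g x) * \<bar>f x\<bar>" using f(3)[of x] by (auto simp: indicator_def abs_mult)
      also have "\<dots> \<le> norm (indicat_real K x * g x) * M" by (intro mult_left_mono M) auto
      finally show "norm (g x * f x) \<le> norm (M * (indicat_real K x * g x))" using M(1) by (simp add: abs_mult mult_ac)
    qed
  qed (use i in auto)
qed

lemma integrable_times_test_fun:
  assumes "locally_integrable UNIV g" "\<phi> \<in> test_funs UNIV"
  shows "integrable lebesgue (\<lambda>x. g x * \<phi> x)"
proof -
  obtain K where "compact K" "\<And>x. x \<notin> K \<Longrightarrow> \<phi> x = 0" using assms(2) by (auto simp: test_funs_def)
  then show ?thesis by (rule integrable_times_compact_support[OF assms(1) test_fun_continuous[OF assms(2)]])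
qed

lemma weak_deriv_UNIV:
  "weak_deriv UNIV bs f g \<longleftrightarrow> locally_integrable UNIV f \<and> locally_integrable UNIV g \<and>
     (\<forall>\<phi>\<in>test_funs UNIV. (LINT x|lebesgue. f x * partials bs \<phi> x) = (-1) ^ length bs * (LINT x|lebesgue. g x * \<phi> x))"
  by (simp add: weak_deriv_def lebesgue_on_UNIV_eq)

lemma locally_integrable_diff:
  "locally_integrable S f \<Longrightarrow> locally_integrable S g \<Longrightarrow> locally_integrable S (\<lambda>x. f x - g x)"
  by (auto simp: locally_integrable_def)

lemma weak_deriv_unique:
  assumes "weak_deriv UNIV bs f g" "weak_deriv UNIV bs f g'"
  shows "AE x in lebesgue. g x = g' x"
proof -
  have l: "locally_integrable UNIV g" "locally_integrable UNIV g'"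
    using assms by (auto simp: weak_deriv_UNIV)
  have "AE x in lebesgue. g x - g' x = 0"
  proof (rule AE_zero_if_orthogonal_to_test_funs[OF locally_integrable_diff[OF l]])
    fix \<phi> :: "'a \<Rightarrow> real" assume \<phi>: "\<phi> \<in> test_funs UNIV"
    have "(-1) ^ length bs * (LINT x|lebesgue. g x * \<phi> x) = (-1) ^ length bs * (LINT x|lebesgue. g' x * \<phi> x)"
      using assms[unfolded weak_deriv_UNIV] \<phi> by simp
    then have "(LINT x|lebesgue. g x * \<phi> x) = (LINT x|lebesgue. g' x * \<phi> x)" by simp
    then show "(LINT x|lebesgue. (g x - g' x) * \<phi> x) = 0"
      using integrable_times_test_fun[OF l(1) \<phi>] integrable_times_test_fun[OF l(2) \<phi>]
      by (simp add: left_diff_distrib)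
  qed
  then show ?thesis by simp
qed

lemma weak_deriv_wderiv: "weak_deriv S bs f g \<Longrightarrow> weak_deriv S bs f (wderiv S bs f)"
  unfolding wderiv_def by (rule someI[where P = "weak_deriv S bs f"])

lemma wderiv_AE: "weak_deriv UNIV bs f g \<Longrightarrow> AE x in lebesgue. wderiv UNIV bs f x = g x"
  by (rule weak_deriv_unique[OF weak_deriv_wderiv])

lemma weak_deriv_cmult:
  assumes "weak_deriv UNIV bs f g" shows "weak_deriv UNIV bs (\<lambda>x. c * f x) (\<lambda>x. c * g x)"
  using assms by (auto simp: weak_deriv_UNIV locally_integrable_def mult.assoc)

lemma weak_deriv_Nil: "locally_integrable UNIV f \<Longrightarrow> weak_deriv UNIV [] f f"
  by (simp add: weak_deriv_UNIV)

lemma continuous_locally_integrable: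
  "continuous_on UNIV f \<Longrightarrow> locally_integrable UNIV (f :: 'a::euclidean_space \<Rightarrow> real)"
  unfolding locally_integrable_def
proof (intro allI impI)
  fix K :: "'a set" assume K: "compact K \<and> K \<subseteq> UNIV" and f: "continuous_on UNIV f"
  obtain a where "K \<subseteq> cbox (-a) a" using bounded_subset_cbox_symmetric[OF compact_imp_bounded] K by metis
  moreover have "f absolutely_integrable_on cbox (-a) a"
    by (intro absolutely_integrable_continuous continuous_on_subset[OF f]) auto
  moreover have "K \<in> sets lebesgue" using K by (simp add: compact_imp_closed)
  ultimately show "f absolutely_integrable_on K" by (meson set_integrable_subset)
qed

text \<open>Translation invariance gives the difference quotients of \<open>u\<close> the integral
  \<open>0\<close>, and they converge to the derivative under a bounded majorant of compact support.
  The product rule turns this into integration by parts.\<close>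

lemma integral_directional_derivative_zero:
  fixes u :: "'a::euclidean_space \<Rightarrow> real"
  assumes der: "\<And>x. (u has_derivative D x) (at x)" and cont: "continuous_on UNIV (\<lambda>x. D x b)"
    and K: "compact K" "\<And>x. x \<notin> K \<Longrightarrow> u x = 0"
  shows "(LINT x|lebesgue. D x b) = 0"
proof -
  have u_cont: "continuous_on UNIV u"
    using der by (intro has_derivative_continuous_on[of UNIV]) (auto intro: has_derivative_at_withinI)
  have D0: "D x b = 0" if "x \<notin> K" for x
  proof -
    have "(u has_derivative (\<lambda>_. 0)) (at x)"
      by (rule has_derivative_transform_within_open[of "\<lambda>_. 0" _ _ _ "- K"])
         (use that K compact_imp_closed in auto)
    then show ?thesis using has_derivative_unique[OF der[of x]] by metis
  qed
  obtain M where M: "M \<ge> 0" "\<And>x. \<bar>D x b\<bar> \<le> M"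
    using compact_support_bounded[OF cont K(1) D0] by metis
  obtain R where R: "\<And>x. x \<in> K \<Longrightarrow> norm x \<le> R" using compact_imp_bounded[OF K(1)] by (auto simp: bounded_iff)
  define B where "B = cball (0::'a) (R + norm b)"
  define h where "h n = inverse (real (Suc n))" for n
  have h: "h n > 0" "h n \<le> 1" for n by (auto simp: h_def field_simps)
  have hl: "h \<longlonglongrightarrow> 0" unfolding h_def by (rule LIMSEQ_inverse_real_of_nat)
  define Q where "Q n x = (u (x + h n *\<^sub>R b) - u x) / h n" for n x
  have Qb: "\<bar>Q n x\<bar> \<le> M * indicator B x" for n x
  proof (cases "x \<in> B")
    case True
    have g: "((\<lambda>t. u (x + t *\<^sub>R b)) has_real_derivative D (x + t *\<^sub>R b) b) (at t)" for t
    proof -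
      have "((\<lambda>t. u (x + t *\<^sub>R b)) has_derivative (\<lambda>r. D (x + t *\<^sub>R b) (r *\<^sub>R b))) (at t)"
        by (rule has_derivative_compose[OF _ der]) (auto intro!: derivative_eq_intros)
      moreover have "(\<lambda>r. D (x + t *\<^sub>R b) (r *\<^sub>R b)) = (\<lambda>r. D (x + t *\<^sub>R b) b * r)"
        using linear_scale[OF has_derivative_linear[OF der]] by (auto simp: mult.commute)
      ultimately show ?thesis by (simp add: has_field_derivative_def mult_commute_abs)
    qed
    have "norm (u (x + h n *\<^sub>R b) - u (x + 0 *\<^sub>R b)) \<le> M * norm (h n - 0)"
      by (rule field_differentiable_bound[of UNIV "\<lambda>t. u (x + t *\<^sub>R b)" "\<lambda>t. D (x + t *\<^sub>R b) b"])
         (use g M in auto)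
    then show ?thesis using h[of n] True by (simp add: Q_def pos_divide_le_eq)
  next
    case False
    then have "norm x > R + norm b" by (simp add: B_def)
    moreover have "norm (x + h n *\<^sub>R b) \<ge> norm x - norm b"
    proof -
      have "norm (h n *\<^sub>R b) \<le> norm b" using h[of n] by (simp add: mult_left_le_one_le)
      then show ?thesis by (smt (verit) norm_diff_ineq)
    qed
    ultimately have "x \<notin> K" "x + h n *\<^sub>R b \<notin> K"
      using R[of x] R[of "x + h n *\<^sub>R b"] norm_ge_zero[of b] by auto
    then show ?thesis using K(2) M(1) by (simp add: Q_def)
  qed
  have "(\<lambda>n. LINT x|lebesgue. Q n x) \<longlonglongrightarrow> (LINT x|lebesgue. D x b)"
  proof (rule integral_dominated_convergence[where w = "\<lambda>x. M * indicator B x"])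
    show "(\<lambda>x. D x b) \<in> borel_measurable lebesgue" by (rule continuous_measurable_lebesgue[OF cont])
    show "Q n \<in> borel_measurable lebesgue" for n unfolding Q_def[abs_def]
      using h[of n]
      by (intro continuous_measurable_lebesgue continuous_intros continuous_on_compose2[OF u_cont] u_cont) auto
    have "B \<in> lmeasurable" unfolding B_def by (rule lmeasurable_cball)
    then show "integrable lebesgue (\<lambda>x. M * indicator B x)"
      by (intro integrable_mult_right integrable_real_indicator) (auto simp: fmeasurable_def)
    show "AE x in lebesgue. (\<lambda>n. Q n x) \<longlonglongrightarrow> D x b"
    proof (rule AE_I2)
      fix x
      have "((\<lambda>t. u (x + t *\<^sub>R b)) has_derivative (\<lambda>r. D (x + 0 *\<^sub>R b) (r *\<^sub>R b))) (at 0)"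
        by (rule has_derivative_compose[OF _ der]) (auto intro!: derivative_eq_intros)
      moreover have "(\<lambda>r. D x (r *\<^sub>R b)) = (\<lambda>r. D x b * r)"
        using linear_scale[OF has_derivative_linear[OF der]] by (auto simp: mult.commute)
      ultimately have "((\<lambda>t. u (x + t *\<^sub>R b)) has_real_derivative D x b) (at 0)"
        by (simp add: has_field_derivative_def mult_commute_abs)
      then have "((\<lambda>t. (u (x + t *\<^sub>R b) - u x) / t) \<longlongrightarrow> D x b) (at 0)"
        by (simp add: has_field_derivative_iff)
      then show "(\<lambda>n. Q n x) \<longlonglongrightarrow> D x b" unfolding Q_def
        by (rule filterlim_compose) (use hl h(1) in \<open>auto simp: filterlim_at less_imp_neq[symmetric] intro!: always_eventually\<close>)
    qed
  qed (use Qb in auto)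
  moreover have "(LINT x|lebesgue. Q n x) = 0" for n
  proof -
    have u_borel[measurable]: "u \<in> borel_measurable borel"
      using u_cont by (simp add: borel_measurable_continuous_onI)
    have "integrable lebesgue (\<lambda>x. 1 * u x)"
      by (rule integrable_times_compact_support[OF continuous_locally_integrable[OF continuous_on_const] u_cont K])
    then have iu: "integrable lborel u" by (simp add: integrable_completion)
    have iu': "integrable lborel (\<lambda>x. u (x + v))" "(LINT x|lborel. u (x + v)) = (LINT x|lborel. u x)" for v
    proof -
      have "integrable (distr lborel borel ((+) v)) u" using iu by (simp add: lborel_distr_plus)
      then show "integrable lborel (\<lambda>x. u (x + v))"
        by (subst (asm) integrable_distr_eq) (auto simp: add.commute)
      have "(LINT x|distr lborel borel ((+) v). u x) = (LINT x|lborel. u (v + x))"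
        by (rule integral_distr) auto
      then show "(LINT x|lborel. u (x + v)) = (LINT x|lborel. u x)" by (simp add: lborel_distr_plus add.commute)
    qed
    have "(LINT x|lborel. Q n x) = 0" unfolding Q_def using iu iu' by simp
    moreover have "Q n \<in> borel_measurable lborel" unfolding Q_def[abs_def] by measurable
    ultimately show ?thesis by (simp add: integral_completion)
  qed
  ultimately show ?thesis by (simp add: LIMSEQ_const_iff)
qed

lemma test_fun_has_derivative:
  assumes "\<phi> \<in> test_funs S"
  shows "(\<phi> has_derivative frechet_derivative \<phi> (at x)) (at x)"
  using test_fun_partials_differentiable[OF assms, of "[]"]
  by (simp add: differentiable_on_def frechet_derivative_works)

lemma test_fun_partial_continuous:
  assumes "\<phi> \<in> test_funs S" "b \<in> Basis"
  shows "continuous_on UNIV (\<lambda>x. frechet_derivative \<phi> (at x) b)"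
  using test_fun_partials_differentiable[OF assms(1), of "[b]"] assms(2)
  by (simp add: differentiable_imp_continuous_on)

lemma weak_deriv_classical:
  fixes F :: "'a::euclidean_space \<Rightarrow> real"
  assumes der: "\<And>x. (F has_derivative D x) (at x)" and cont: "continuous_on UNIV (\<lambda>x. D x b)" and b: "b \<in> Basis"
  shows "weak_deriv UNIV [b] F (\<lambda>x. D x b)"
  unfolding weak_deriv_UNIV
proof (intro conjI ballI)
  have F_cont: "continuous_on UNIV F"
    using der by (intro has_derivative_continuous_on[of UNIV]) (auto intro: has_derivative_at_withinI)
  show l: "locally_integrable UNIV F" "locally_integrable UNIV (\<lambda>x. D x b)"
    using F_cont cont by (auto intro: continuous_locally_integrable)
  fix \<phi> :: "'a \<Rightarrow> real" assume \<phi>: "\<phi> \<in> test_funs UNIV"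
  note phi = test_fun_has_derivative[OF \<phi>] test_fun_continuous[OF \<phi>] test_fun_partial_continuous[OF \<phi> b]
  obtain K where K: "compact K" "\<And>x. x \<notin> K \<Longrightarrow> \<phi> x = 0" using \<phi> by (auto simp: test_funs_def)
  have D0: "frechet_derivative \<phi> (at x) b = 0" if "x \<notin> K" for x
  proof -
    have "(\<phi> has_derivative (\<lambda>_. 0)) (at x)"
      by (rule has_derivative_transform_within_open[of "\<lambda>_. 0" _ _ _ "- K"])
         (use that K compact_imp_closed in auto)
    then show ?thesis using has_derivative_unique[OF phi(1)[of x]] by metis
  qed
  have "(LINT x|lebesgue. F x * frechet_derivative \<phi> (at x) b + D x b * \<phi> x) = 0"
  proof (rule integral_directional_derivative_zero[where K = K and u = "\<lambda>x. F x * \<phi> x"])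
    show "((\<lambda>x. F x * \<phi> x) has_derivative (\<lambda>h. F x * frechet_derivative \<phi> (at x) h + D x h * \<phi> x)) (at x)" for x
      by (rule has_derivative_mult[OF der phi(1)])
  qed (use K phi F_cont cont in \<open>auto intro!: continuous_intros\<close>)
  moreover have "integrable lebesgue (\<lambda>x. F x * frechet_derivative \<phi> (at x) b)"
    by (rule integrable_times_compact_support[OF l(1) phi(3) K(1) D0])
  moreover have "integrable lebesgue (\<lambda>x. D x b * \<phi> x)"
    by (rule integrable_times_compact_support[OF l(2) phi(2) K])
  ultimately show "(LINT x|lebesgue. F x * partials [b] \<phi> x) = (-1) ^ length [b] * (LINT x|lebesgue. D x b * \<phi> x)"
    by simp
qed

section \<open>Testing with rapidly decreasing products\<close>

lemma funpow_deriv_add: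
  "smooth1 f \<Longrightarrow> smooth1 g \<Longrightarrow> (deriv ^^ k) (\<lambda>x. f x + g x) = (\<lambda>x. (deriv ^^ k) f x + (deriv ^^ k) g x)"
proof (induction k arbitrary: f g)
  case (Suc k)
  have "deriv (\<lambda>x. f x + g x) = (\<lambda>x. deriv f x + deriv g x)"
    by (intro ext DERIV_imp_deriv derivative_intros smooth1_DERIV Suc.prems)
  then show ?case
    using Suc.IH[OF smooth1_deriv[OF Suc.prems(1)] smooth1_deriv[OF Suc.prems(2)]]
    by (simp add: funpow_Suc_right del: funpow.simps)
qed auto

lemma funpow_deriv_cmult:
  "smooth1 f \<Longrightarrow> (deriv ^^ k) (\<lambda>x. c * f x) = (\<lambda>x. c * (deriv ^^ k) f x)"
proof (induction k arbitrary: f)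
  case (Suc k)
  have "deriv (\<lambda>x. c * f x) = (\<lambda>x. c * deriv f x)"
    by (intro ext DERIV_imp_deriv DERIV_cmult smooth1_DERIV Suc.prems)
  then show ?case
    using Suc.IH[OF smooth1_deriv[OF Suc.prems]]
    by (simp add: funpow_Suc_right del: funpow.simps)
qed auto

text \<open>Gaussian decay of all derivatives. It is preserved by differentiation, holds for polynomials times
  Gaussians, and makes every product of such functions integrable against \<open>L\<^sub>1 +
  L\<^sub>\<infinity>\<close>.\<close>

definition rapid :: "(real \<Rightarrow> real) \<Rightarrow> bool" where
  "rapid f \<longleftrightarrow> smooth1 f \<and> (\<forall>k. \<exists>K c. c > 0 \<and> (\<forall>y. \<bar>(deriv ^^ k) f y\<bar> \<le> K * exp (- c * y\<^sup>2)))"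

lemma rapid_smooth1: "rapid f \<Longrightarrow> smooth1 f"
  by (simp add: rapid_def)

lemma rapid_deriv: "rapid f \<Longrightarrow> rapid (deriv f)"
  unfolding rapid_def
proof safe
  fix k assume "\<forall>k. \<exists>K c. c > 0 \<and> (\<forall>y. \<bar>(deriv ^^ k) f y\<bar> \<le> K * exp (- c * y\<^sup>2))"
  from this[rule_format, of "Suc k"]
  show "\<exists>K c. c > 0 \<and> (\<forall>y. \<bar>(deriv ^^ k) (deriv f) y\<bar> \<le> K * exp (- c * y\<^sup>2))"
    by (simp add: funpow_Suc_right del: funpow.simps)
qed (auto intro: smooth1_deriv)

lemma rapid_funpow_deriv: "rapid f \<Longrightarrow> rapid ((deriv ^^ k) f)"
  by (induction k) (auto intro: rapid_deriv)

lemma poly_times_gauss_bound: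
  fixes p :: "real poly"
  assumes "c > 0"
  obtains K where "K \<ge> 0" "\<And>y. \<bar>poly p y\<bar> * exp (- c * y\<^sup>2) \<le> K"
proof -
  have "\<exists>K\<ge>0. \<forall>y. \<bar>y\<bar> ^ k * \<bar>poly p y\<bar> * exp (- c * y\<^sup>2) \<le> K" for k
  proof (induction p arbitrary: k)
    case (pCons a p)
    obtain K where K: "K \<ge> 0" "\<forall>y. \<bar>y\<bar> ^ Suc k * \<bar>poly p y\<bar> * exp (- c * y\<^sup>2) \<le> K"
      using pCons.IH[of "Suc k"] by blast
    obtain M where M: "M \<ge> 0" "\<And>y::real. \<bar>y\<bar> ^ k * exp (- c * y\<^sup>2) \<le> M"
      using power_times_gauss_bound[OF assms, of k] by metis
    have "\<bar>y\<bar> ^ k * \<bar>poly (pCons a p) y\<bar> * exp (- c * y\<^sup>2) \<le> \<bar>a\<bar> * M + K" for y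
    proof -
      have "\<bar>poly (pCons a p) y\<bar> \<le> \<bar>a\<bar> + \<bar>y\<bar> * \<bar>poly p y\<bar>"
        using abs_triangle_ineq[of a "y * poly p y"] by (simp add: abs_mult)
      then have "\<bar>y\<bar> ^ k * \<bar>poly (pCons a p) y\<bar> * exp (- c * y\<^sup>2) \<le> \<bar>y\<bar> ^ k * (\<bar>a\<bar> + \<bar>y\<bar> * \<bar>poly p y\<bar>) * exp (- c * y\<^sup>2)"
        by (intro mult_right_mono mult_left_mono) auto
      also have "\<dots> = \<bar>a\<bar> * (\<bar>y\<bar> ^ k * exp (- c * y\<^sup>2)) + \<bar>y\<bar> ^ Suc k * \<bar>poly p y\<bar> * exp (- c * y\<^sup>2)"
        by (simp add: algebra_simps)
      also have "\<dots> \<le> \<bar>a\<bar> * M + K" using K(2) M(2) by (intro add_mono mult_left_mono) auto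
      finally show ?thesis .
    qed
    then show ?case using K(1) M(1) by (intro exI[of _ "\<bar>a\<bar> * M + K"]) auto
  qed auto
  from this[of 0] show ?thesis using that by auto
qed

lemma rapid_poly_gauss:
  assumes c: "c > 0" shows "rapid (\<lambda>y. poly p (y - a) * exp (- c * (y - a)\<^sup>2))"
proof -
  define F where "F p y = poly p (y - a) * exp (- c * (y - a)\<^sup>2)" for p y
  define p' where "p' p = pderiv p - smult (2 * c) (pCons 0 p)" for p
  have D: "(F p has_real_derivative F (p' p) y) (at y)" for p y
    unfolding F_def p'_def
    by (rule derivative_eq_intros DERIV_chain2[OF poly_DERIV] refl | simp)+ (simp add: algebra_simps)
  have dF: "deriv (F p) = F (p' p)" for p by (intro ext DERIV_imp_deriv D)
  have s: "smooth1 (F p)" for p by (rule smooth1_coinduct[of _ "range F"]) (use D in auto)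
  have Fk: "(deriv ^^ k) (F p) = F ((p' ^^ k) p)" for k p by (induction k) (auto simp: dF)
  have "\<exists>K d. d > 0 \<and> (\<forall>y. \<bar>F p y\<bar> \<le> K * exp (- d * y\<^sup>2))" for p
  proof -
    obtain K where K: "K \<ge> 0" "\<And>y. \<bar>poly p y\<bar> * exp (- (c/2) * y\<^sup>2) \<le> K"
      using poly_times_gauss_bound[of "c/2" p] c by (metis half_gt_zero)
    have "\<bar>F p y\<bar> \<le> (K * exp (c/2 * a\<^sup>2)) * exp (- (c/4) * y\<^sup>2)" for y
    proof -
      have "0 \<le> (y - 2 * a)\<^sup>2" by simp
      then have "(y - a)\<^sup>2 \<ge> y\<^sup>2 / 2 - a\<^sup>2" by (simp add: power2_eq_square algebra_simps)
      from mult_left_mono[OF this, of "c/2"] have *: "exp (- (c/2) * (y - a)\<^sup>2) \<le> exp (c/2 * a\<^sup>2) * exp (- (c/4) * y\<^sup>2)"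
        using c by (simp add: mult_exp_exp algebra_simps)
      have "\<bar>F p y\<bar> = (\<bar>poly p (y - a)\<bar> * exp (- (c/2) * (y - a)\<^sup>2)) * exp (- (c/2) * (y - a)\<^sup>2)"
        by (simp add: F_def abs_mult mult.assoc mult_exp_exp)
      also have "\<dots> \<le> K * (exp (c/2 * a\<^sup>2) * exp (- (c/4) * y\<^sup>2))" using K * by (intro mult_mono) auto
      finally show ?thesis by (simp add: mult.assoc)
    qed
    then show ?thesis using c by (intro exI[of _ "K * exp (c/2 * a\<^sup>2)"] exI[of _ "c/4"]) auto
  qed
  then have "rapid (F p)" unfolding rapid_def Fk using s by blast
  then show ?thesis by (simp add: F_def[abs_def])
qed

text \<open>Multiplication by the dilated cutoffs \<open>\<theta> (y / N)\<close> turns a rapidly decreasing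
  function into test functions. Each derivative that falls on the cutoff produces a factor \<open>1
  / N\<close>, so in the limit only the derivatives of \<open>f\<close> remain, and all derivatives
  stay below a common Gaussian.\<close>

lemma rapid_cutoff:
  assumes "smooth1 \<theta>" "\<And>k. \<exists>M. \<forall>y. \<bar>(deriv ^^ k) \<theta> y\<bar> \<le> M" "rapid f"
  shows "(\<exists>K c. c > 0 \<and> (\<forall>n y. \<bar>(deriv ^^ k) (\<lambda>y. \<theta> (y / real (Suc n)) * f y) y\<bar> \<le> K * exp (- c * y\<^sup>2))) \<and>
    (\<forall>y. (\<lambda>n. (deriv ^^ k) (\<lambda>y. \<theta> (y / real (Suc n)) * f y) y) \<longlonglongrightarrow> \<theta> 0 * (deriv ^^ k) f y)"
  using assms
proof (induction k arbitrary: \<theta> f)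
  case 0
  obtain M where M: "\<And>y. \<bar>\<theta> y\<bar> \<le> M" using 0(2)[of 0] by auto
  have M0: "M \<ge> 0" using M[of 0] by linarith
  obtain K c where K: "c > 0" "\<And>y. \<bar>f y\<bar> \<le> K * exp (- c * y\<^sup>2)"
    using 0(3) unfolding rapid_def by (metis funpow_0)
  have "\<bar>\<theta> (y / real (Suc n)) * f y\<bar> \<le> (M * K) * exp (- c * y\<^sup>2)" for n y
    using mult_mono[OF M[of "y / real (Suc n)"] K(2)[of y]] M0 by (simp add: abs_mult mult.assoc)
  moreover have "(\<lambda>n. \<theta> (y / real (Suc n)) * f y) \<longlonglongrightarrow> \<theta> 0 * f y" for y
  proof -
    have "(\<lambda>n. y / real (Suc n)) \<longlonglongrightarrow> 0"
      using tendsto_mult[OF tendsto_const[of y] LIMSEQ_inverse_real_of_nat] by (simp add: field_simps)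
    moreover have "isCont \<theta> 0" using smooth1_DERIV[OF 0(1)] by (rule DERIV_isCont)
    ultimately show ?thesis by (intro tendsto_intros) (rule isCont_tendsto_compose)
  qed
  ultimately show ?case using K(1) by auto
next
  case (Suc k)
  have b: "\<exists>M. \<forall>y. \<bar>(deriv ^^ k) (deriv \<theta>) y\<bar> \<le> M" for k
    using Suc.prems(2)[of "Suc k"] by (simp add: funpow_Suc_right del: funpow.simps)
  have s: "smooth1 (\<lambda>y. \<psi> (y / real (Suc n)))" if "smooth1 \<psi>" for \<psi> n
    using smooth1_affine[OF that, of "1 / real (Suc n)" 0] by simp
  note s1 = smooth1_mult[OF s[OF smooth1_deriv[OF Suc.prems(1)]] rapid_smooth1[OF Suc.prems(3)]]
  note s2 = smooth1_mult[OF s[OF Suc.prems(1)] smooth1_deriv[OF rapid_smooth1[OF Suc.prems(3)]]]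
  have eq: "(deriv ^^ Suc k) (\<lambda>y. \<theta> (y / real (Suc n)) * f y) =
      (\<lambda>y. inverse (real (Suc n)) * (deriv ^^ k) (\<lambda>y. deriv \<theta> (y / real (Suc n)) * f y) y +
        (deriv ^^ k) (\<lambda>y. \<theta> (y / real (Suc n)) * deriv f y) y)" for n
  proof -
    have "deriv (\<lambda>y. \<theta> (y / real (Suc n)) * f y) =
        (\<lambda>y. inverse (real (Suc n)) * (deriv \<theta> (y / real (Suc n)) * f y) + \<theta> (y / real (Suc n)) * deriv f y)"
    proof (intro ext DERIV_imp_deriv)
      fix y
      have 1: "((\<lambda>y. \<theta> (y / real (Suc n))) has_real_derivative deriv \<theta> (y / real (Suc n)) * (1 / real (Suc n))) (at y)"
        by (rule DERIV_chain2[OF smooth1_DERIV[OF Suc.prems(1)]]) (auto intro!: derivative_eq_intros)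
      show "((\<lambda>y. \<theta> (y / real (Suc n)) * f y) has_real_derivative
        inverse (real (Suc n)) * (deriv \<theta> (y / real (Suc n)) * f y) + \<theta> (y / real (Suc n)) * deriv f y) (at y)"
        by (rule DERIV_cong[OF DERIV_mult[OF 1 smooth1_DERIV[OF rapid_smooth1[OF Suc.prems(3)]]]])
           (simp add: divide_inverse mult_ac)
    qed
    then show ?thesis
      unfolding funpow_Suc_right comp_def
      by (simp only: funpow_deriv_add[OF smooth1_mult[OF smooth1_const s1] s2] funpow_deriv_cmult[OF s1])
  qed
  obtain K1 c1 where 1: "c1 > 0" "\<And>n y. \<bar>(deriv ^^ k) (\<lambda>y. deriv \<theta> (y / real (Suc n)) * f y) y\<bar> \<le> K1 * exp (- c1 * y\<^sup>2)"
    and l1: "\<And>y. (\<lambda>n. (deriv ^^ k) (\<lambda>y. deriv \<theta> (y / real (Suc n)) * f y) y) \<longlonglongrightarrow> deriv \<theta> 0 * (deriv ^^ k) f y"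
    using Suc.IH[OF smooth1_deriv[OF Suc.prems(1)] b Suc.prems(3)] by metis
  obtain K2 c2 where 2: "c2 > 0" "\<And>n y. \<bar>(deriv ^^ k) (\<lambda>y. \<theta> (y / real (Suc n)) * deriv f y) y\<bar> \<le> K2 * exp (- c2 * y\<^sup>2)"
    and l2: "\<And>y. (\<lambda>n. (deriv ^^ k) (\<lambda>y. \<theta> (y / real (Suc n)) * deriv f y) y) \<longlonglongrightarrow> \<theta> 0 * (deriv ^^ k) (deriv f) y"
    using Suc.IH[OF Suc.prems(1,2) rapid_deriv[OF Suc.prems(3)]] by metis
  have K: "K1 \<ge> 0" "K2 \<ge> 0" using 1(2)[of 0 0] 2(2)[of 0 0] by auto
  have "\<bar>(deriv ^^ Suc k) (\<lambda>y. \<theta> (y / real (Suc n)) * f y) y\<bar> \<le> (K1 + K2) * exp (- min c1 c2 * y\<^sup>2)" for n y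
  proof -
    have e: "exp (- c1 * y\<^sup>2) \<le> exp (- min c1 c2 * y\<^sup>2)" "exp (- c2 * y\<^sup>2) \<le> exp (- min c1 c2 * y\<^sup>2)"
      by (simp_all add: mult_right_mono)
    have "\<bar>inverse (real (Suc n)) * (deriv ^^ k) (\<lambda>y. deriv \<theta> (y / real (Suc n)) * f y) y\<bar> \<le>
        \<bar>(deriv ^^ k) (\<lambda>y. deriv \<theta> (y / real (Suc n)) * f y) y\<bar>"
      unfolding abs_mult by (rule mult_left_le_one_le) (auto simp: field_simps)
    also have "\<dots> \<le> K1 * exp (- min c1 c2 * y\<^sup>2)"
      using 1(2)[of n y] mult_left_mono[OF e(1) K(1)] by linarith
    finally have "\<bar>inverse (real (Suc n)) * (deriv ^^ k) (\<lambda>y. deriv \<theta> (y / real (Suc n)) * f y) y\<bar> \<le> K1 * exp (- min c1 c2 * y\<^sup>2)" .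
    moreover have "\<bar>(deriv ^^ k) (\<lambda>y. \<theta> (y / real (Suc n)) * deriv f y) y\<bar> \<le> K2 * exp (- min c1 c2 * y\<^sup>2)"
      using 2(2)[of n y] mult_left_mono[OF e(2) K(2)] by linarith
    ultimately show ?thesis unfolding eq distrib_right by linarith
  qed
  moreover have "(\<lambda>n. (deriv ^^ Suc k) (\<lambda>y. \<theta> (y / real (Suc n)) * f y) y) \<longlonglongrightarrow> \<theta> 0 * (deriv ^^ Suc k) f y" for y
  proof -
    have "(\<lambda>n. inverse (real (Suc n)) * (deriv ^^ k) (\<lambda>y. deriv \<theta> (y / real (Suc n)) * f y) y +
        (deriv ^^ k) (\<lambda>y. \<theta> (y / real (Suc n)) * deriv f y) y) \<longlonglongrightarrow> 0 * (deriv \<theta> 0 * (deriv ^^ k) f y) + \<theta> 0 * (deriv ^^ k) (deriv f) y"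
      by (intro tendsto_intros LIMSEQ_inverse_real_of_nat l1 l2)
    then show ?thesis unfolding eq by (simp add: funpow_Suc_right del: funpow.simps)
  qed
  ultimately show ?case using 1(1) 2(1) by (intro conjI exI[of _ "K1 + K2"] exI[of _ "min c1 c2"]) auto
qed

lemma prod_fun_gauss_bound:
  fixes f :: "'i \<Rightarrow> 'a::euclidean_space \<Rightarrow> real \<Rightarrow> real"
  assumes "\<And>i. i \<in> Basis \<Longrightarrow> \<exists>K c. c > 0 \<and> (\<forall>n y. \<bar>f n i y\<bar> \<le> K * exp (- c * y\<^sup>2))"
  obtains K c where "K \<ge> 0" "c > 0" "\<And>n x. \<bar>prod_fun (f n) x\<bar> \<le> K * gauss c 0 x"
proof -
  obtain K c where Kc: "\<And>i. i \<in> Basis \<Longrightarrow> c i > 0" "\<And>i n y. i \<in> Basis \<Longrightarrow> \<bar>f n i y\<bar> \<le> K i * exp (- c i * y\<^sup>2)"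
    using assms by metis
  have K0: "K i \<ge> 0" if "i \<in> Basis" for i
    using Kc(2)[OF that, of undefined 0] by simp
  define d where "d = Min (c ` Basis)"
  have d: "d > 0" "\<And>i. i \<in> Basis \<Longrightarrow> d \<le> c i" using Kc(1) by (auto simp: d_def)
  have "\<bar>prod_fun (f n) x\<bar> \<le> (\<Prod>i\<in>Basis. K i) * gauss d 0 x" for n x
  proof -
    have "\<bar>prod_fun (f n) x\<bar> = (\<Prod>i\<in>Basis. \<bar>f n i (x \<bullet> i)\<bar>)" by (simp add: prod_fun_def abs_prod)
    also have "\<dots> \<le> (\<Prod>i\<in>Basis. K i * exp (- d * (x \<bullet> i)\<^sup>2))"
    proof (intro prod_mono conjI)
      fix i :: 'a assume i: "i \<in> Basis"
      have "exp (- c i * (x \<bullet> i)\<^sup>2) \<le> exp (- d * (x \<bullet> i)\<^sup>2)" using d(2)[OF i] by (simp add: mult_right_mono)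
      from mult_left_mono[OF this K0[OF i]] show "\<bar>f n i (x \<bullet> i)\<bar> \<le> K i * exp (- d * (x \<bullet> i)\<^sup>2)"
        using Kc(2)[OF i, of n "x \<bullet> i"] by linarith
    qed auto
    also have "\<dots> = (\<Prod>i\<in>Basis. K i) * gauss d 0 x" by (simp add: gauss_eq_prod prod.distrib)
    finally show ?thesis .
  qed
  moreover have "(\<Prod>i\<in>Basis. K i) \<ge> 0" using K0 by (simp add: prod_nonneg)
  ultimately show ?thesis using that d(1) by blast
qed

lemma prod_fun_smooth_measurable:
  assumes "\<And>i. i \<in> Basis \<Longrightarrow> smooth1 (f i)"
  shows "continuous_on UNIV (prod_fun f)" "prod_fun f \<in> borel_measurable lebesgue"
proof -
  show "continuous_on UNIV (prod_fun f)"
    using prod_fun_has_derivative[of f, OF assms]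
    by (intro has_derivative_continuous_on[of UNIV]) (auto intro: has_derivative_at_withinI)
  then show "prod_fun f \<in> borel_measurable lebesgue" by (rule continuous_measurable_lebesgue)
qed

text \<open>Cutting off the factors gives genuine test functions. Their derivatives converge below a common
  Gaussian majorant, against which both functions are integrable because they lie in
  \<open>L\<^sub>1 + L\<^sub>\<infinity>\<close>; hence compact support of the test function can be
  replaced by rapid decrease.\<close>

lemma weak_deriv_test_rapid:
  fixes f g :: "'a::euclidean_space \<Rightarrow> real"
  assumes wd: "weak_deriv UNIV bs f g" and bs: "set bs \<subseteq> Basis"
    and f: "L1_plus_Linf f" and g: "L1_plus_Linf g" and F: "\<And>i. i \<in> Basis \<Longrightarrow> rapid (F i)"
  shows "(LINT x|lebesgue. f x * partials bs (prod_fun F) x) = (-1) ^ length bs * (LINT x|lebesgue. g x * prod_fun F x)"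
proof -
  \<comment> \<open>The factor \<open>exp 2\<close> normalizes the cutoff to \<open>\<theta> 0 = 1\<close>.\<close>
  define \<theta> where "\<theta> y = exp 2 * bump (-1) 1 y" for y
  have \<theta>: "smooth1 \<theta>" "\<theta> 0 = 1"
    unfolding \<theta>_def by (intro smooth1_mult smooth1_const smooth1_bump) (simp add: bump_def flat_1 mult_exp_exp)
  have \<theta>0: "\<theta> y = 0" if "y \<notin> {-1..1}" for y
    using that by (auto simp: \<theta>_def bump_zero)
  have \<theta>b: "\<exists>M. \<forall>y. \<bar>(deriv ^^ k) \<theta> y\<bar> \<le> M" for k
  proof -
    have "(deriv ^^ k) \<theta> y = 0" if "y \<notin> {-1..1}" for y
      using that
    proof (induction k arbitrary: y)
      case (Suc k)
      have "((deriv ^^ k) \<theta> has_real_derivative 0) (at y)"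
        by (rule has_field_derivative_transform_within_open[of "\<lambda>_. 0" _ _ "- {-1..1}"])
           (use Suc in auto)
      then show ?case by (simp add: DERIV_imp_deriv)
    qed (use \<theta>0 in auto)
    then show ?thesis
      using compact_support_bounded[of "(deriv ^^ k) \<theta>" "{-1..1}"] smooth1_continuous[OF smooth1_funpow_deriv[OF \<theta>(1)]]
      by (metis compact_Icc)
  qed
  define H where "H n i y = \<theta> (y / real (Suc n)) * F i y" for n :: nat and i y
  have H_smooth: "smooth1 (H n i)" if "i \<in> Basis" for n i
    unfolding H_def by (rule smooth1_mult)
      (use smooth1_affine[OF \<theta>(1), of "1 / real (Suc n)" 0] rapid_smooth1[OF F[OF that]] in simp_all)
  have test: "prod_fun (H n) \<in> test_funs UNIV" for n
  proof (rule prod_fun_test_fun[where a = "- (real (Suc n) *\<^sub>R One)" and b = "real (Suc n) *\<^sub>R One"])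
    fix i :: 'a and y :: real
    assume "i \<in> Basis" "y \<notin> {(- (real (Suc n) *\<^sub>R One)) \<bullet> i..(real (Suc n) *\<^sub>R One) \<bullet> i}"
    then have "y \<notin> {- real (Suc n)..real (Suc n)}" by simp
    then have "y / real (Suc n) \<notin> {-1..1}" by (auto simp: field_simps)
    then show "H n i y = 0" using \<theta>0 by (simp add: H_def)
  qed (auto intro: H_smooth)
  have conv: "(\<lambda>n. LINT x|lebesgue. h x * partials cs (prod_fun (H n)) x) \<longlonglongrightarrow> (LINT x|lebesgue. h x * partials cs (prod_fun F) x)"
    if h: "L1_plus_Linf h" and cs: "set cs \<subseteq> Basis" for h cs
  proof -
    define k where "k i = count_list cs i" for i
    have cut: "\<exists>K c. c > 0 \<and> (\<forall>n y. \<bar>(deriv ^^ k i) (H n i) y\<bar> \<le> K * exp (- c * y\<^sup>2))"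
      "(\<lambda>n. (deriv ^^ k i) (H n i) y) \<longlonglongrightarrow> (deriv ^^ k i) (F i) y" if "i \<in> Basis" for i y
      using rapid_cutoff[OF \<theta>(1) \<theta>b F[OF that], of "k i"] \<theta>(2) unfolding H_def by auto
    obtain K c where Kc: "K \<ge> 0" "c > 0" "\<And>n x. \<bar>prod_fun (\<lambda>i. (deriv ^^ k i) (H n i)) x\<bar> \<le> K * gauss c 0 x"
      using prod_fun_gauss_bound[of "\<lambda>n i. (deriv ^^ k i) (H n i)", OF cut(1)] by metis
    have eq: "partials cs (prod_fun (H n)) = prod_fun (\<lambda>i. (deriv ^^ k i) (H n i))" for n
      unfolding k_def by (rule partials_prod_fun[OF H_smooth cs])
    have eqF: "partials cs (prod_fun F) = prod_fun (\<lambda>i. (deriv ^^ k i) (F i))"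
      unfolding k_def by (rule partials_prod_fun[OF rapid_smooth1[OF F] cs])
    show ?thesis
      unfolding eq eqF
    proof (rule integral_against_tendsto[OF h bounded_integrable_gauss[OF Kc(2), of K 0]])
      show "(\<lambda>n. prod_fun (\<lambda>i. (deriv ^^ k i) (H n i)) x) \<longlonglongrightarrow> prod_fun (\<lambda>i. (deriv ^^ k i) (F i)) x" for x
        unfolding prod_fun_def by (intro tendsto_prod cut(2))
    qed (intro prod_fun_smooth_measurable smooth1_funpow_deriv H_smooth rapid_smooth1[OF F] Kc(3) | assumption)+
  qed
  have "(\<lambda>n. LINT x|lebesgue. f x * partials bs (prod_fun (H n)) x) = (\<lambda>n. (-1) ^ length bs * (LINT x|lebesgue. g x * partials [] (prod_fun (H n)) x))"
    using wd test by (auto simp: weak_deriv_UNIV)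
  then have "(\<lambda>n. LINT x|lebesgue. f x * partials bs (prod_fun (H n)) x) \<longlonglongrightarrow> (-1) ^ length bs * (LINT x|lebesgue. g x * partials [] (prod_fun F) x)"
    by (simp only:) (intro tendsto_mult tendsto_const conv g; simp)
  with conv[OF f bs] show ?thesis by (auto dest: LIMSEQ_unique)
qed

section \<open>Sobolev norms and functionals on Gaussians\<close>

lemma dir_lists_1: "dir_lists 1 = insert [] ((\<lambda>b. [b]) ` (Basis :: 'a::euclidean_space set))"
proof -
  have "bs \<in> insert [] ((\<lambda>b. [b]) ` (Basis :: 'a set))" if "set bs \<subseteq> Basis" "length bs \<le> 1" for bs :: "'a list"
    using that by (cases bs) auto
  then show ?thesis by (auto simp: dir_lists_def)
qed

lemma sobolev_norm_1:
  "sobolev_norm 1 q UNIV (f :: 'a::euclidean_space \<Rightarrow> real) =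
    ((LINT x|lebesgue. \<bar>wderiv UNIV [] f x\<bar> powr q) + (\<Sum>b\<in>Basis. LINT x|lebesgue. \<bar>wderiv UNIV [b] f x\<bar> powr q)) powr (1 / q)"
  unfolding sobolev_norm_def dir_lists_1
  by (subst sum.insert) (auto simp: lebesgue_on_UNIV_eq sum.reindex inj_on_def)

lemma wderiv_measurable:
  assumes "weak_deriv UNIV bs f g" shows "wderiv UNIV bs f \<in> borel_measurable lebesgue"
proof -
  have "locally_integrable UNIV (wderiv UNIV bs f)" using weak_deriv_wderiv[OF assms] by (simp add: weak_deriv_UNIV)
  then have i: "integrable lebesgue (\<lambda>x. indicator (ball 0 (real n)) x * wderiv UNIV bs f x)" for n
    by (rule locally_integrable_indicator) auto
  show ?thesis
  proof (rule borel_measurable_LIMSEQ_real[OF _ borel_measurable_integrable[OF i]])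
    fix x :: 'a
    obtain N :: nat where N: "real N > norm x" using reals_Archimedean2 by blast
    have "eventually (\<lambda>n. indicator (ball 0 (real n)) x * wderiv UNIV bs f x = wderiv UNIV bs f x) sequentially"
      unfolding eventually_sequentially by (rule exI[of _ N]) (use N in auto)
    then show "(\<lambda>n. indicator (ball 0 (real n)) x * wderiv UNIV bs f x) \<longlonglongrightarrow> wderiv UNIV bs f x"
      by (rule tendsto_eventually)
  qed
qed

lemma wderiv_Lp:
  assumes "weak_deriv UNIV bs f g" "g \<in> Lp p UNIV"
  shows "wderiv UNIV bs f \<in> Lp p UNIV"
proof -
  have m: "wderiv UNIV bs f \<in> borel_measurable lebesgue" by (rule wderiv_measurable[OF assms(1)])
  have "integrable lebesgue (\<lambda>x. \<bar>wderiv UNIV bs f x\<bar> powr p)"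
    using assms(2) wderiv_AE[OF assms(1)] m
    by (subst integrable_cong_AE[where g = "\<lambda>x. \<bar>g x\<bar> powr p"]) (auto simp: Lp_UNIV)
  then show ?thesis using m by (simp add: Lp_UNIV)
qed

lemma sobolev_weak_deriv:
  assumes "f \<in> sobolev k p UNIV" "set bs \<subseteq> Basis" "length bs \<le> k"
  shows "weak_deriv UNIV bs f (wderiv UNIV bs f)" "wderiv UNIV bs f \<in> Lp p UNIV"
proof -
  obtain g where "g \<in> Lp p UNIV" "weak_deriv UNIV bs f g"
    using assms by (auto simp: sobolev_def dir_lists_def)
  then show "weak_deriv UNIV bs f (wderiv UNIV bs f)" "wderiv UNIV bs f \<in> Lp p UNIV"
    using weak_deriv_wderiv wderiv_Lp by blast+
qed

lemma sobolev_cmult: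
  assumes "f \<in> sobolev k p UNIV" shows "(\<lambda>x. c * f x) \<in> sobolev k p UNIV"
proof -
  have L: "(\<lambda>x. c * g x) \<in> Lp p UNIV" if "g \<in> Lp p UNIV" for g :: "'a \<Rightarrow> real"
    using that by (auto simp: Lp_UNIV abs_mult powr_mult)
  show ?thesis
    using assms L weak_deriv_cmult unfolding sobolev_def by blast
qed

lemma weighted_mem_sobolev:
  assumes "weighted lam w t \<in> sobolev k p UNIV" shows "w t \<in> sobolev k p UNIV"
  using sobolev_cmult[OF assms, of "exp (lam * t)"] by (simp add: weighted_def mult_exp_exp flip: mult.assoc)

lemma Lp_norm_le_sobolev_norm:
  assumes f: "f \<in> sobolev 1 q UNIV" and q: "q > 0"
  shows "Lp_norm q UNIV f \<le> sobolev_norm 1 q UNIV f"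
proof -
  note w = sobolev_weak_deriv[OF f, of "[]", simplified]
  have "weak_deriv UNIV [] f f" using w(1) by (intro weak_deriv_Nil) (simp add: weak_deriv_UNIV)
  then have AE: "AE x in lebesgue. wderiv UNIV [] f x = f x" by (rule wderiv_AE)
  have "(LINT x|lebesgue. \<bar>f x\<bar> powr q) = (LINT x|lebesgue. \<bar>wderiv UNIV [] f x\<bar> powr q)"
    using AE f wderiv_measurable[OF w(1)]
    by (intro integral_cong_AE) (auto simp: sobolev_def Lp_UNIV)
  moreover have "0 \<le> (\<Sum>b\<in>Basis. LINT x|lebesgue. \<bar>wderiv UNIV [b] f x\<bar> powr q)"
    by (intro sum_nonneg) simp
  ultimately show ?thesis using q
    unfolding Lp_norm_def sobolev_norm_1 lebesgue_on_UNIV_eq by (intro powr_mono2) auto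
qed

text \<open>The explicit bound on the norm depends on \<open>F\<close> only through its majorant. It is this
  uniformity that later bounds a functional on all Gaussians of a compact time interval at once.\<close>

lemma sobolev_1I:
  fixes F :: "'a::euclidean_space \<Rightarrow> real"
  assumes der: "\<And>x. (F has_derivative D x) (at x)" and cont: "\<And>b. b \<in> Basis \<Longrightarrow> continuous_on UNIV (\<lambda>x. D x b)"
    and bound: "\<And>x. \<bar>F x\<bar> \<le> w x" "\<And>x b. b \<in> Basis \<Longrightarrow> \<bar>D x b\<bar> \<le> w x"
    and w: "integrable lebesgue (\<lambda>x. w x powr q)" and q: "q > 0"
  shows "F \<in> sobolev 1 q UNIV"
    and "sobolev_norm 1 q UNIV F \<le> ((real DIM('a) + 1) * (LINT x|lebesgue. w x powr q)) powr (1 / q)"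
proof -
  have F_cont: "continuous_on UNIV F"
    using der by (intro has_derivative_continuous_on[of UNIV]) (auto intro: has_derivative_at_withinI)
  have L: "G \<in> Lp q UNIV" "(LINT x|lebesgue. \<bar>G x\<bar> powr q) \<le> (LINT x|lebesgue. w x powr q)"
    if "continuous_on UNIV G" "\<And>x. \<bar>G x\<bar> \<le> w x" for G
  proof -
    have m [measurable]: "G \<in> borel_measurable lebesgue" by (rule continuous_measurable_lebesgue[OF that(1)])
    have le: "\<bar>G x\<bar> powr q \<le> w x powr q" for x using that(2)[of x] q by (intro powr_mono2) auto
    have i: "integrable lebesgue (\<lambda>x. \<bar>G x\<bar> powr q)"
      by (rule Bochner_Integration.integrable_bound[OF w]) (use le in auto)
    then show "G \<in> Lp q UNIV" by (simp add: Lp_UNIV m)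
    show "(LINT x|lebesgue. \<bar>G x\<bar> powr q) \<le> (LINT x|lebesgue. w x powr q)"
      by (rule integral_mono[OF i w]) (rule le)
  qed
  have wd: "weak_deriv UNIV [] F F" "\<And>b. b \<in> Basis \<Longrightarrow> weak_deriv UNIV [b] F (\<lambda>x. D x b)"
    using weak_deriv_classical[OF der cont] weak_deriv_Nil[OF continuous_locally_integrable[OF F_cont]] by auto
  show "F \<in> sobolev 1 q UNIV"
    unfolding sobolev_def dir_lists_1 using wd L[OF F_cont bound(1)] L[OF cont bound(2)] by auto
  have wm: "(LINT x|lebesgue. \<bar>wderiv UNIV bs F x\<bar> powr q) \<le> (LINT x|lebesgue. w x powr q)"
    if "weak_deriv UNIV bs F G" "continuous_on UNIV G" "\<And>x. \<bar>G x\<bar> \<le> w x" for bs G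
  proof -
    have "(LINT x|lebesgue. \<bar>wderiv UNIV bs F x\<bar> powr q) = (LINT x|lebesgue. \<bar>G x\<bar> powr q)"
      using wderiv_AE[OF that(1)] wderiv_measurable[OF that(1)] continuous_measurable_lebesgue[OF that(2)]
      by (intro integral_cong_AE) auto
    then show ?thesis using L(2)[OF that(2,3)] by simp
  qed
  have "(LINT x|lebesgue. \<bar>wderiv UNIV [] F x\<bar> powr q) + (\<Sum>b\<in>Basis. LINT x|lebesgue. \<bar>wderiv UNIV [b] F x\<bar> powr q)
     \<le> (LINT x|lebesgue. w x powr q) + (\<Sum>b\<in>(Basis::'a set). LINT x|lebesgue. w x powr q)"
    by (intro add_mono sum_mono wm[OF wd(1) F_cont bound(1)] wm[OF wd(2) cont bound(2)])
  also have "\<dots> = (real DIM('a) + 1) * (LINT x|lebesgue. w x powr q)" by (simp add: algebra_simps)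
  finally show "sobolev_norm 1 q UNIV F \<le> ((real DIM('a) + 1) * (LINT x|lebesgue. w x powr q)) powr (1 / q)"
    unfolding sobolev_norm_1 using q by (intro powr_mono2) (auto intro!: add_nonneg_nonneg sum_nonneg)
qed

subsection \<open>The dual norm\<close>

text \<open>The supremum that defines the norm is taken over a bounded set because of the bound contained in the
  definition of the dual space, so each member is below it.\<close>

lemma sobolev_dual_norm_upper:
  assumes Z: "Z \<in> sobolev_dual q" and \<eta>: "\<eta> \<in> sobolev 1 q UNIV" "sobolev_norm 1 q UNIV \<eta> \<le> 1"
  shows "\<bar>Z \<eta>\<bar> \<le> sobolev_dual_norm q Z"
proof -
  obtain C where C: "\<And>\<eta>. \<eta> \<in> sobolev 1 q UNIV \<Longrightarrow> \<bar>Z \<eta>\<bar> \<le> C * sobolev_norm 1 q UNIV \<eta>"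
    using Z unfolding sobolev_dual_def by blast
  have "\<bar>Z \<zeta>\<bar> \<le> \<bar>C\<bar>" if "\<zeta> \<in> sobolev 1 q UNIV" "sobolev_norm 1 q UNIV \<zeta> \<le> 1" for \<zeta>
  proof -
    have n: "sobolev_norm 1 q UNIV \<zeta> \<ge> 0" by (simp add: sobolev_norm_def)
    have "\<bar>Z \<zeta>\<bar> \<le> C * sobolev_norm 1 q UNIV \<zeta>" by (rule C[OF that(1)])
    also have "\<dots> \<le> \<bar>C\<bar> * 1" using that n by (intro mult_mono) auto
    finally show ?thesis by simp
  qed
  then have "bdd_above ((\<lambda>\<eta>. \<bar>Z \<eta>\<bar>) ` {\<eta> \<in> sobolev 1 q UNIV. sobolev_norm 1 q UNIV \<eta> \<le> 1})"
    by (intro bdd_aboveI[of _ "\<bar>C\<bar>"]) auto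
  then show ?thesis unfolding sobolev_dual_norm_def using \<eta> by (intro cSUP_upper) auto
qed

lemma sobolev_dual_cmult:
  assumes "Z \<in> sobolev_dual q" "\<eta> \<in> sobolev 1 q UNIV" shows "Z (\<lambda>x. a * \<eta> x) = a * Z \<eta>"
proof -
  have "\<And>a b. Z (\<lambda>x. a * \<eta> x + b * \<eta> x) = a * Z \<eta> + b * Z \<eta>" using assms unfolding sobolev_dual_def by blast
  from this[of a 0] show ?thesis by simp
qed

lemma sobolev_dual_lincomb:
  assumes "Z \<in> sobolev_dual q" "Y \<in> sobolev_dual q" shows "(\<lambda>\<eta>. a * Z \<eta> + b * Y \<eta>) \<in> sobolev_dual q"
proof -
  obtain C D where C: "\<And>\<eta>. \<eta> \<in> sobolev 1 q UNIV \<Longrightarrow> \<bar>Z \<eta>\<bar> \<le> C * sobolev_norm 1 q UNIV \<eta>"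
    and D: "\<And>\<eta>. \<eta> \<in> sobolev 1 q UNIV \<Longrightarrow> \<bar>Y \<eta>\<bar> \<le> D * sobolev_norm 1 q UNIV \<eta>"
    using assms unfolding sobolev_dual_def by blast
  have "\<bar>a * Z \<eta> + b * Y \<eta>\<bar> \<le> (\<bar>a\<bar> * C + \<bar>b\<bar> * D) * sobolev_norm 1 q UNIV \<eta>" if "\<eta> \<in> sobolev 1 q UNIV" for \<eta>
  proof -
    have "\<bar>a * Z \<eta> + b * Y \<eta>\<bar> \<le> \<bar>a\<bar> * \<bar>Z \<eta>\<bar> + \<bar>b\<bar> * \<bar>Y \<eta>\<bar>" by (metis abs_mult abs_triangle_ineq)
    also have "\<dots> \<le> \<bar>a\<bar> * (C * sobolev_norm 1 q UNIV \<eta>) + \<bar>b\<bar> * (D * sobolev_norm 1 q UNIV \<eta>)"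
      by (intro add_mono mult_left_mono C D that) auto
    finally show ?thesis by (simp add: algebra_simps)
  qed
  moreover have "a * Z (\<lambda>x. c * \<eta> x + d * \<zeta> x) + b * Y (\<lambda>x. c * \<eta> x + d * \<zeta> x) =
      c * (a * Z \<eta> + b * Y \<eta>) + d * (a * Z \<zeta> + b * Y \<zeta>)" if "\<eta> \<in> sobolev 1 q UNIV" "\<zeta> \<in> sobolev 1 q UNIV" for \<eta> \<zeta> c d
  proof -
    have "Z (\<lambda>x. c * \<eta> x + d * \<zeta> x) = c * Z \<eta> + d * Z \<zeta>" "Y (\<lambda>x. c * \<eta> x + d * \<zeta> x) = c * Y \<eta> + d * Y \<zeta>"
      using assms that unfolding sobolev_dual_def by blast+
    then show ?thesis by (simp add: algebra_simps)
  qed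
  ultimately show ?thesis unfolding sobolev_dual_def by blast
qed

lemma gauss_powr: "gauss d m x powr q = gauss (d * q) m x"
  by (simp add: gauss_def powr_def algebra_simps)

text \<open>A functional sees \<open>F\<close> only through its Sobolev norm, and a Gaussian majorant of
  \<open>F\<close> and of its partial derivatives bounds that norm; division by \<open>K * W\<close>
  brings \<open>F\<close> into the unit ball. The constant \<open>W\<close> depends neither on
  \<open>F\<close> nor on the functional.\<close>

lemma sobolev_dual_gauss_bound:
  fixes m :: "'a::euclidean_space"
  assumes q: "q > 0" and d: "d > 0"
  obtains W where "W > 0" "\<And>(Z :: ('a \<Rightarrow> real) \<Rightarrow> real) F D K. Z \<in> sobolev_dual q \<Longrightarrow> K > 0 \<Longrightarrow> (\<And>x. (F has_derivative D x) (at x)) \<Longrightarrow>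
      (\<And>b. b \<in> Basis \<Longrightarrow> continuous_on UNIV (\<lambda>x. D x b)) \<Longrightarrow>
      (\<And>x. \<bar>F x\<bar> \<le> K * gauss d m x) \<Longrightarrow> (\<And>x b. b \<in> Basis \<Longrightarrow> \<bar>D x b\<bar> \<le> K * gauss d m x) \<Longrightarrow>
      \<bar>Z F\<bar> \<le> K * W * sobolev_dual_norm q Z"
proof -
  define J where "J = (LINT x|lebesgue. gauss (d * q) m x)"
  have J0: "J \<ge> 0" unfolding J_def by (intro integral_nonneg_AE) (simp add: gauss_pos less_imp_le)
  define W where "W = ((real DIM('a) + 1) * J) powr (1 / q) + 1"
  have W: "W > 0" unfolding W_def by (smt (verit) powr_ge_zero)
  show ?thesis
  proof (rule that[OF W])
    fix Z :: "('a \<Rightarrow> real) \<Rightarrow> real" and F D K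
    assume Z: "Z \<in> sobolev_dual q" and K: "K > 0" and der: "\<And>x. (F has_derivative D x) (at x)"
      and cont: "\<And>b. b \<in> Basis \<Longrightarrow> continuous_on UNIV (\<lambda>x. D x b)"
      and bound: "\<And>x. \<bar>F x\<bar> \<le> K * gauss d m x" "\<And>x b. b \<in> Basis \<Longrightarrow> \<bar>D x b\<bar> \<le> K * gauss d m x"
    define w where "w x = gauss d m x / W" for x :: 'a
    have wi: "(\<lambda>x. w x powr q) = (\<lambda>x. gauss (d * q) m x / W powr q)"
      using W by (auto simp: w_def powr_divide gauss_powr gauss_pos less_imp_le)
    have gi: "integrable lebesgue (gauss (d * q) m)"
      using bounded_integrable_gauss[of "d * q" 1 m] d q by (simp add: bounded_integrable_def)
    note S = sobolev_1I[of "\<lambda>x. F x / (K * W)" "\<lambda>x h. D x h / (K * W)" w q]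
    have der': "((\<lambda>x. F x / (K * W)) has_derivative (\<lambda>h. D x h / (K * W))) (at x)" for x
      by (rule bounded_linear.has_derivative[OF bounded_linear_divide der])
    have S: "(\<lambda>x. F x / (K * W)) \<in> sobolev 1 q UNIV"
      "sobolev_norm 1 q UNIV (\<lambda>x. F x / (K * W)) \<le> ((real DIM('a) + 1) * (LINT x|lebesgue. w x powr q)) powr (1 / q)"
      by (rule S; use der' cont bound K W gi q in \<open>auto simp: w_def[abs_def] wi[unfolded w_def[abs_def]] field_simps intro!: continuous_intros\<close>)+
    have "((real DIM('a) + 1) * (LINT x|lebesgue. w x powr q)) powr (1 / q) = (((real DIM('a) + 1) * J) / W powr q) powr (1 / q)"
      unfolding wi J_def by simp
    also have "\<dots> = ((real DIM('a) + 1) * J) powr (1 / q) / W"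
      using J0 W q by (simp add: powr_divide powr_powr)
    also have "\<dots> \<le> 1" using W by (simp add: W_def)
    finally have "\<bar>Z (\<lambda>x. F x / (K * W))\<bar> \<le> sobolev_dual_norm q Z"
      using sobolev_dual_norm_upper[OF Z S(1)] S(2) by linarith
    moreover have "Z F = K * W * Z (\<lambda>x. F x / (K * W))"
      using sobolev_dual_cmult[OF Z S(1), of "K * W"] K W by simp
    ultimately show "\<bar>Z F\<bar> \<le> K * W * sobolev_dual_norm q Z" using K W by (simp add: abs_mult)
  qed
qed

lemma dual_embed_mem_sobolev_dual:
  fixes f :: "'a::euclidean_space \<Rightarrow> real"
  assumes pq: "p > 1" "q > 1" "1 / p + 1 / q = 1" and f: "f \<in> Lp p UNIV"
  shows "dual_embed f \<in> sobolev_dual q"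
proof -
  have L: "\<eta> \<in> Lp q UNIV" if "\<eta> \<in> sobolev 1 q UNIV" for \<eta> :: "'a \<Rightarrow> real" using that by (simp add: sobolev_def)
  note H = Hoelder_inequality[OF pq f, unfolded lebesgue_on_UNIV_eq]
  have "\<bar>dual_embed f \<eta>\<bar> \<le> Lp_norm p UNIV f * sobolev_norm 1 q UNIV \<eta>" if \<eta>: "\<eta> \<in> sobolev 1 q UNIV" for \<eta>
  proof -
    have "\<bar>dual_embed f \<eta>\<bar> \<le> Lp_norm p UNIV f * Lp_norm q UNIV \<eta>" unfolding dual_embed_def by (rule H(2)[OF L[OF \<eta>]])
    also have "\<dots> \<le> Lp_norm p UNIV f * sobolev_norm 1 q UNIV \<eta>"
      using pq by (intro mult_left_mono Lp_norm_le_sobolev_norm \<eta> Lp_norm_nonneg) auto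
    finally show ?thesis .
  qed
  moreover have "dual_embed f (\<lambda>x. a * \<eta> x + b * \<zeta> x) = a * dual_embed f \<eta> + b * dual_embed f \<zeta>"
    if "\<eta> \<in> sobolev 1 q UNIV" "\<zeta> \<in> sobolev 1 q UNIV" for \<eta> \<zeta> a b
  proof -
    have "dual_embed f (\<lambda>x. a * \<eta> x + b * \<zeta> x) = (LINT x|lebesgue. a * (f x * \<eta> x) + b * (f x * \<zeta> x))"
      unfolding dual_embed_def by (simp add: algebra_simps)
    also have "\<dots> = a * dual_embed f \<eta> + b * dual_embed f \<zeta>"
      using H(1)[OF L[OF that(1)]] H(1)[OF L[OF that(2)]] by (simp add: dual_embed_def)
    finally show ?thesis .
  qed
  ultimately show ?thesis unfolding sobolev_dual_def by blast
qed

section \<open>Gaussian solutions of the adjoint heat equation\<close>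

text \<open>Differentiating the heat kernel in its time parameter produces the factor \<open>|x -
  m|\<^sup>2\<close>. Its splitting into coordinates matches the second partial derivatives of the
  Gaussian.\<close>

definition quad_gauss :: "real \<Rightarrow> 'a \<Rightarrow> 'a \<Rightarrow> 'a::euclidean_space \<Rightarrow> real" where
  "quad_gauss c m b x = ((x - m) \<bullet> b)\<^sup>2 * gauss c m x"

lemma gauss_has_derivative:
  "(gauss c m has_derivative (\<lambda>h. - (2 * c) * ((x - m) \<bullet> h) * gauss c m x)) (at x)"
proof -
  have "((\<lambda>x. exp (- c * ((x - m) \<bullet> (x - m)))) has_derivative
      (\<lambda>h. - (2 * c) * ((x - m) \<bullet> h) * gauss c m x)) (at x)"
    unfolding gauss_def power2_norm_eq_inner
    by (rule derivative_eq_intros refl | simp)+ (auto simp: algebra_simps inner_commute)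
  then show ?thesis by (simp add: gauss_def[abs_def] power2_norm_eq_inner)
qed

lemma quad_gauss_has_derivative:
  "(quad_gauss c m b has_derivative
     (\<lambda>h. (2 * ((x - m) \<bullet> b) * (h \<bullet> b) - 2 * c * ((x - m) \<bullet> b)\<^sup>2 * ((x - m) \<bullet> h)) * gauss c m x)) (at x)"
proof -
  have "((\<lambda>x. ((x - m) \<bullet> b)\<^sup>2) has_derivative (\<lambda>h. 2 * ((x - m) \<bullet> b) * (h \<bullet> b))) (at x)"
    by (rule derivative_eq_intros refl | simp)+ (simp add: mult_ac)
  from has_derivative_mult[OF this gauss_has_derivative[of c m x]] show ?thesis
    unfolding quad_gauss_def[abs_def] by (rule has_derivative_eq_rhs) (auto simp: algebra_simps)
qed

lemma gauss_eq_prod_fun: "gauss c m = prod_fun (\<lambda>i y. poly 1 (y - m \<bullet> i) * exp (- c * (y - m \<bullet> i)\<^sup>2))"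
  by (rule ext) (simp add: gauss_eq_prod prod_fun_def)

lemma continuous_on_gauss [continuous_intros]: "continuous_on A (gauss c m)"
  unfolding gauss_def[abs_def] by (intro continuous_intros)

lemma partials_gauss:
  "b \<in> Basis \<Longrightarrow> partials [b] (gauss c m) = (\<lambda>x. - (2 * c) * ((x - m) \<bullet> b) * gauss c m x)"
  by (simp add: frechet_derivative_at[OF gauss_has_derivative, symmetric])

lemma partials2_gauss:
  assumes b: "b \<in> Basis"
  shows "partials [b, b] (gauss c m) = (\<lambda>x. 4 * c\<^sup>2 * quad_gauss c m b x - 2 * c * gauss c m x)"
proof
  fix x
  have "((\<lambda>x. (- (2 * c) * ((x - m) \<bullet> b)) * gauss c m x) has_derivative
      (\<lambda>h. (- (2 * c) * ((x - m) \<bullet> b)) * (- (2 * c) * ((x - m) \<bullet> h) * gauss c m x) + (- (2 * c) * (h \<bullet> b)) * gauss c m x)) (at x)"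
    by (rule has_derivative_mult[OF _ gauss_has_derivative]) (rule derivative_eq_intros refl | simp)+
  from frechet_derivative_at[OF this, symmetric]
  have "partials [b, b] (gauss c m) x = (- (2 * c) * ((x - m) \<bullet> b)) * (- (2 * c) * ((x - m) \<bullet> b) * gauss c m x) + (- (2 * c) * (b \<bullet> b)) * gauss c m x"
    using partials_gauss[OF b, of c m] by simp
  then show "partials [b, b] (gauss c m) x = 4 * c\<^sup>2 * quad_gauss c m b x - 2 * c * gauss c m x"
    using b by (simp add: quad_gauss_def power2_eq_square algebra_simps)
qed

lemma weak_deriv_test_gauss:
  assumes "weak_deriv UNIV bs f g" "set bs \<subseteq> Basis" "L1_plus_Linf f" "L1_plus_Linf g" "c > 0"
  shows "(LINT x|lebesgue. f x * partials bs (gauss c m) x) = (-1) ^ length bs * (LINT x|lebesgue. g x * gauss c m x)"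
  unfolding gauss_eq_prod_fun
  by (rule weak_deriv_test_rapid[OF assms(1-4)]) (intro rapid_poly_gauss assms)

text \<open>A partial derivative of a Gaussian is again a product of rapidly decreasing functions and hence
  admissible as a test function.\<close>

lemma weak_deriv_test_gauss_partial:
  assumes wd: "weak_deriv UNIV [b] f g" and b: "b \<in> Basis" and fg: "L1_plus_Linf f" "L1_plus_Linf g" and c: "c > 0"
  shows "(LINT x|lebesgue. g x * partials [b] (gauss c m) x) = - (LINT x|lebesgue. f x * partials [b, b] (gauss c m) x)"
proof -
  define F where "F i y = poly 1 (y - m \<bullet> i) * exp (- c * (y - m \<bullet> i)\<^sup>2)" for i y
  have F: "rapid (F i)" for i unfolding F_def by (rule rapid_poly_gauss[OF c])
  have G: "gauss c m = prod_fun F" unfolding F_def by (rule gauss_eq_prod_fun)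
  have p1: "partials [b] (prod_fun F) = prod_fun (\<lambda>i. (deriv ^^ count_list [b] i) (F i))"
    by (rule partials_prod_fun) (use b F rapid_smooth1 in auto)
  have p2: "partials [b, b] (prod_fun F) = partials [b] (partials [b] (prod_fun F))" by simp
  show ?thesis
    unfolding G p2 unfolding p1
    using weak_deriv_test_rapid[OF wd _ fg, of "\<lambda>i. (deriv ^^ count_list [b] i) (F i)"] b F
    by (simp add: rapid_funpow_deriv del: partials.simps)
qed

lemma wderiv_gauss:
  assumes "b \<in> Basis"
  shows "AE x in lebesgue. wderiv UNIV [b] (gauss c m) x = partials [b] (gauss c m) x"
proof -
  have "weak_deriv UNIV [b] (gauss c m) (\<lambda>x. - (2 * c) * ((x - m) \<bullet> b) * gauss c m x)"
    by (rule weak_deriv_classical[OF gauss_has_derivative _ assms]) (intro continuous_intros)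
  then show ?thesis unfolding partials_gauss[OF assms] by (rule wderiv_AE)
qed

subsection \<open>Uniform bounds\<close>

text \<open>For time parameters in a compact interval the exponents \<open>1 / (4 * s)\<close> are bounded below
  by a positive number, and a single Gaussian with a smaller exponent absorbs the polynomial
  factors. The bounds cover the two families of functions on which functionals are evaluated and
  their first derivatives.\<close>

lemma heat_gauss_uniform_bounds:
  assumes ab: "0 < \<alpha>" "\<alpha> \<le> \<beta>"
  obtains K d where "K > 0" "d > 0"
    "\<And>s m x::'a::euclidean_space. s \<in> {\<alpha>..\<beta>} \<Longrightarrow> \<bar>gauss (1 / (4 * s)) m x\<bar> \<le> K * gauss d m x"
    "\<And>s m x h::'a. s \<in> {\<alpha>..\<beta>} \<Longrightarrow> h \<in> Basis \<Longrightarrow>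
       \<bar>- (2 * (1 / (4 * s))) * ((x - m) \<bullet> h) * gauss (1 / (4 * s)) m x\<bar> \<le> K * gauss d m x"
    "\<And>s m b x::'a. s \<in> {\<alpha>..\<beta>} \<Longrightarrow> b \<in> Basis \<Longrightarrow> \<bar>quad_gauss (1 / (4 * s)) m b x\<bar> \<le> K * gauss d m x"
    "\<And>s m b x h::'a. s \<in> {\<alpha>..\<beta>} \<Longrightarrow> b \<in> Basis \<Longrightarrow> h \<in> Basis \<Longrightarrow>
       \<bar>(2 * ((x - m) \<bullet> b) * (h \<bullet> b) - 2 * (1 / (4 * s)) * ((x - m) \<bullet> b)\<^sup>2 * ((x - m) \<bullet> h)) * gauss (1 / (4 * s)) m x\<bar> \<le> K * gauss d m x"
    "\<And>s m x::'a. s \<in> {\<alpha>..\<beta>} \<Longrightarrow> \<bar>(norm (x - m))\<^sup>2 / (4 * s\<^sup>2) * gauss (1 / (4 * s)) m x\<bar> \<le> K * gauss d m x"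
proof -
  define c where "c = 1 / (4 * \<beta>)"
  define d where "d = c / 2"
  have \<beta>: "\<beta> > 0" using ab by simp
  have c: "c > 0" "d > 0" "d < c" using \<beta> by (auto simp: c_def d_def field_simps)
  obtain K1 where K1: "K1 \<ge> 0" "\<And>x m::'a. norm (x - m) ^ 1 * gauss c m x \<le> K1 * gauss d m x"
    using norm_power_times_gauss_bound[OF c(1,3), of 1] by metis
  obtain K2 where K2: "K2 \<ge> 0" "\<And>x m::'a. norm (x - m) ^ 2 * gauss c m x \<le> K2 * gauss d m x"
    using norm_power_times_gauss_bound[OF c(1,3), of 2] by metis
  obtain K3 where K3: "K3 \<ge> 0" "\<And>x m::'a. norm (x - m) ^ 3 * gauss c m x \<le> K3 * gauss d m x"
    using norm_power_times_gauss_bound[OF c(1,3), of 3] by metis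
  define K where "K = 1 + K1 / (2 * \<alpha>) + 2 * K1 + K2 + K3 / (2 * \<alpha>) + K2 / (4 * \<alpha>\<^sup>2)"
  have K: "K > 0" "1 \<le> K" "K1 / (2 * \<alpha>) \<le> K" "K2 \<le> K" "2 * K1 + K3 / (2 * \<alpha>) \<le> K" "K2 / (4 * \<alpha>\<^sup>2) \<le> K"
    using K1(1) K2(1) K3(1) ab unfolding K_def by (auto simp: add_pos_nonneg add_nonneg_nonneg)
  have g: "gauss (1 / (4 * s)) m x \<le> gauss c m x" if "s \<in> {\<alpha>..\<beta>}" for s and m x :: 'a
  proof -
    have "c \<le> 1 / (4 * s)" unfolding c_def using that ab by (intro divide_left_mono) auto
    from mult_right_mono[OF this, of "(norm (x - m))\<^sup>2"] show ?thesis by (simp add: gauss_def)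
  qed
  have gd: "gauss c m x \<le> gauss d m x" for m x :: 'a
    using c unfolding gauss_def by (simp add: mult_right_mono)
  have up: "P * gauss d m x \<le> K * gauss d m x" if "P \<le> K" for P and m x :: 'a
    using that gauss_pos[of d m x] by (simp add: mult_right_mono)
  have inv: "0 < 1 / s" "1 / s \<le> 1 / \<alpha>" if "s \<in> {\<alpha>..\<beta>}" for s
    using that ab by (auto intro!: divide_left_mono)
  show ?thesis
  proof (rule that[OF K(1) c(2)])
    fix s :: real and m x :: 'a assume s: "s \<in> {\<alpha>..\<beta>}"
    note g = g[OF s, of m x] and gp = gauss_pos[of "1 / (4 * s)" m x] and gc = gauss_pos[of c m x] and inv = inv[OF s]
    show "\<bar>gauss (1 / (4 * s)) m x\<bar> \<le> K * gauss d m x"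
      unfolding abs_of_pos[OF gp]
      using g gd[of m x] mult_right_mono[OF K(2), of "gauss d m x"] gauss_pos[of d m x] by linarith
    show "\<bar>(norm (x - m))\<^sup>2 / (4 * s\<^sup>2) * gauss (1 / (4 * s)) m x\<bar> \<le> K * gauss d m x"
    proof -
      have "(norm (x - m))\<^sup>2 / (4 * s\<^sup>2) * gauss (1 / (4 * s)) m x \<le> (norm (x - m))\<^sup>2 / (4 * \<alpha>\<^sup>2) * gauss c m x"
        using s ab gp by (intro mult_mono g divide_left_mono) auto
      also have "\<dots> = ((norm (x - m))\<^sup>2 * gauss c m x) / (4 * \<alpha>\<^sup>2)" by simp
      also have "\<dots> \<le> (K2 * gauss d m x) / (4 * \<alpha>\<^sup>2)" using K2(2)[of x m] by (intro divide_right_mono) auto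
      also have "\<dots> \<le> K * gauss d m x" using up[OF K(6), of m x] by simp
      finally show ?thesis using gp by (simp add: abs_mult)
    qed
    fix h :: 'a assume h: "h \<in> Basis"
    show "\<bar>- (2 * (1 / (4 * s))) * ((x - m) \<bullet> h) * gauss (1 / (4 * s)) m x\<bar> \<le> K * gauss d m x"
    proof -
      have "\<bar>- (2 * (1 / (4 * s))) * ((x - m) \<bullet> h) * gauss (1 / (4 * s)) m x\<bar> = (1 / s) / 2 * \<bar>(x - m) \<bullet> h\<bar> * gauss (1 / (4 * s)) m x"
        using inv gp s ab by (simp add: abs_mult)
      also have "\<dots> \<le> (1 / \<alpha>) / 2 * norm (x - m) * gauss c m x"
        using inv gp ab by (intro mult_mono g Basis_le_norm h) auto
      also have "\<dots> = (norm (x - m) ^ 1 * gauss c m x) / (2 * \<alpha>)" by simp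
      also have "\<dots> \<le> (K1 * gauss d m x) / (2 * \<alpha>)" using K1(2)[of x m] ab by (intro divide_right_mono) auto
      also have "\<dots> \<le> K * gauss d m x" using up[OF K(3), of m x] by simp
      finally show ?thesis .
    qed
  next
    fix s :: real and m b x :: 'a assume s: "s \<in> {\<alpha>..\<beta>}" and b: "b \<in> Basis"
    note g = g[OF s, of m x] and gp = gauss_pos[of "1 / (4 * s)" m x] and gc = gauss_pos[of c m x] and inv = inv[OF s]
    have sq: "((x - m) \<bullet> b)\<^sup>2 \<le> (norm (x - m))\<^sup>2"
      using power_mono[OF Basis_le_norm[OF b, of "x - m"], of 2] by simp
    show "\<bar>quad_gauss (1 / (4 * s)) m b x\<bar> \<le> K * gauss d m x"
    proof -
      have "\<bar>quad_gauss (1 / (4 * s)) m b x\<bar> \<le> (norm (x - m))\<^sup>2 * gauss c m x"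
        unfolding quad_gauss_def abs_mult using gp sq by (intro mult_mono) (auto intro: g)
      also have "\<dots> \<le> K2 * gauss d m x" by (rule K2(2))
      also have "\<dots> \<le> K * gauss d m x" by (rule up[OF K(4)])
      finally show ?thesis .
    qed
    fix h :: 'a assume h: "h \<in> Basis"
    show "\<bar>(2 * ((x - m) \<bullet> b) * (h \<bullet> b) - 2 * (1 / (4 * s)) * ((x - m) \<bullet> b)\<^sup>2 * ((x - m) \<bullet> h)) * gauss (1 / (4 * s)) m x\<bar> \<le> K * gauss d m x"
    proof -
      have "\<bar>2 * ((x - m) \<bullet> b) * (h \<bullet> b)\<bar> \<le> 2 * norm (x - m) * 1"
        unfolding abs_mult using Basis_le_norm[OF b, of "x - m"] Basis_le_norm[OF b, of h] h
        by (intro mult_mono) auto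
      moreover have "\<bar>2 * (1 / (4 * s)) * ((x - m) \<bullet> b)\<^sup>2 * ((x - m) \<bullet> h)\<bar> \<le> (1 / \<alpha>) / 2 * (norm (x - m))\<^sup>2 * norm (x - m)"
      proof -
        have "\<bar>2 * (1 / (4 * s)) * ((x - m) \<bullet> b)\<^sup>2 * ((x - m) \<bullet> h)\<bar> = (1 / s) / 2 * ((x - m) \<bullet> b)\<^sup>2 * \<bar>(x - m) \<bullet> h\<bar>"
          using s ab by (simp add: abs_mult)
        also have "\<dots> \<le> (1 / \<alpha>) / 2 * (norm (x - m))\<^sup>2 * norm (x - m)"
          using inv ab by (intro mult_mono sq Basis_le_norm h) auto
        finally show ?thesis .
      qed
      ultimately have "\<bar>2 * ((x - m) \<bullet> b) * (h \<bullet> b) - 2 * (1 / (4 * s)) * ((x - m) \<bullet> b)\<^sup>2 * ((x - m) \<bullet> h)\<bar>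
          \<le> 2 * norm (x - m) + norm (x - m) ^ 3 / (2 * \<alpha>)"
        using abs_triangle_ineq4[of "2 * ((x - m) \<bullet> b) * (h \<bullet> b)" "2 * (1 / (4 * s)) * ((x - m) \<bullet> b)\<^sup>2 * ((x - m) \<bullet> h)"]
        by (simp add: power3_eq_cube power2_eq_square del: abs_mult)
      then have "\<bar>(2 * ((x - m) \<bullet> b) * (h \<bullet> b) - 2 * (1 / (4 * s)) * ((x - m) \<bullet> b)\<^sup>2 * ((x - m) \<bullet> h)) * gauss (1 / (4 * s)) m x\<bar>
          \<le> (2 * norm (x - m) + norm (x - m) ^ 3 / (2 * \<alpha>)) * gauss c m x"
        unfolding abs_mult using gp ab by (intro mult_mono) (auto intro: g)
      also have "\<dots> = 2 * (norm (x - m) ^ 1 * gauss c m x) + (norm (x - m) ^ 3 * gauss c m x) / (2 * \<alpha>)"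
        by (simp add: algebra_simps add_divide_distrib)
      also have "\<dots> \<le> 2 * (K1 * gauss d m x) + (K3 * gauss d m x) / (2 * \<alpha>)"
        using K1(2)[of x m] K3(2)[of x m] ab by (intro add_mono divide_right_mono mult_left_mono) auto
      also have "\<dots> = (2 * K1 + K3 / (2 * \<alpha>)) * gauss d m x" by (simp add: algebra_simps)
      also have "\<dots> \<le> K * gauss d m x" by (rule up[OF K(5)])
      finally show ?thesis .
    qed
  qed
qed

subsection \<open>The heat equation in the time parameter\<close>

text \<open>Multiplied by this factor, the Gaussian with exponent \<open>1 / (4 * s)\<close> is up to a constant
  the kernel of the semigroup generated by \<open>\<Delta> - \<lambda>\<^sub>0\<close>. The type
  argument supplies the dimension.\<close>

definition heat_factor :: "real \<Rightarrow> 'a::euclidean_space itself \<Rightarrow> real \<Rightarrow> real" where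
  "heat_factor lam0 T s = exp (- lam0 * s) * s powr (- real DIM('a) / 2)"

lemma heat_factor_pos: "s > 0 \<Longrightarrow> heat_factor lam0 T s > 0"
  by (simp add: heat_factor_def)

lemma heat_factor_DERIV:
  assumes "s > 0"
  shows "(heat_factor lam0 TYPE('a::euclidean_space) has_real_derivative
     - (real DIM('a) / (2 * s) + lam0) * heat_factor lam0 TYPE('a) s) (at s)"
proof -
  have "s powr (- real DIM('a) / 2 - 1) = s powr (- real DIM('a) / 2) / s"
    using assms by (simp add: powr_diff)
  then show ?thesis
    unfolding heat_factor_def[abs_def] using assms
    by (auto intro!: derivative_eq_intros simp: field_simps)
qed

lemma heat_factor_continuous: "continuous_on {0<..} (heat_factor lam0 T)"
  unfolding heat_factor_def[abs_def] by (intro continuous_intros) auto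

lemma gauss_time_DERIV:
  "s > 0 \<Longrightarrow> ((\<lambda>s. gauss (1 / (4 * s)) m x) has_real_derivative
     (norm (x - m))\<^sup>2 / (4 * s\<^sup>2) * gauss (1 / (4 * s)) m x) (at s)"
  unfolding gauss_def by (auto intro!: derivative_eq_intros simp: field_simps power2_eq_square)

lemma sum_quad_gauss: "(\<Sum>b\<in>Basis. quad_gauss c m b x) = (norm (x - m))\<^sup>2 * gauss c m x"
proof -
  have "(norm (x - m))\<^sup>2 = (\<Sum>b\<in>Basis. ((x - m) \<bullet> b)\<^sup>2)"
    by (subst power2_norm_eq_inner, subst euclidean_inner) (simp add: power2_eq_square)
  then show ?thesis by (simp add: quad_gauss_def sum_distrib_right)
qed

lemma quad_gauss_measurable [measurable]: "quad_gauss c m b \<in> borel_measurable lebesgue"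
  by (intro continuous_measurable_lebesgue) (auto simp: quad_gauss_def[abs_def] intro!: continuous_intros)

lemma bounded_integrable_quad_gauss:
  assumes "b \<in> Basis" "s > 0" shows "bounded_integrable (quad_gauss (1 / (4 * s)) m b)"
proof -
  obtain K d where "K > 0" "d > 0" "\<And>x. \<bar>quad_gauss (1 / (4 * s)) m b x\<bar> \<le> K * gauss d m x"
    using heat_gauss_uniform_bounds[OF assms(2) order_refl, where 'a = 'a] assms(1) by (metis atLeastAtMost_singleton insertI1)
  then show ?thesis by (intro bounded_integrable_bound[OF bounded_integrable_gauss[of d K m]]) auto
qed

text \<open>A functional applied to the heat kernel centred at \<open>m\<close>, and to the derivative of the
  kernel in \<open>s\<close>. Functionals are allowed in place of functions because the
  representative of a singular solution that is continuous in time takes values in the dual Sobolev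
  space.\<close>

definition heat_pair :: "real \<Rightarrow> 'a::euclidean_space \<Rightarrow> (('a \<Rightarrow> real) \<Rightarrow> real) \<Rightarrow> real \<Rightarrow> real" where
  "heat_pair lam0 m Z s = heat_factor lam0 TYPE('a) s * Z (gauss (1 / (4 * s)) m)"

definition heat_pair' :: "real \<Rightarrow> 'a::euclidean_space \<Rightarrow> (('a \<Rightarrow> real) \<Rightarrow> real) \<Rightarrow> real \<Rightarrow> real" where
  "heat_pair' lam0 m Z s = heat_factor lam0 TYPE('a) s *
     ((\<Sum>b\<in>Basis. Z (quad_gauss (1 / (4 * s)) m b)) / (4 * s\<^sup>2) - (real DIM('a) / (2 * s) + lam0) * Z (gauss (1 / (4 * s)) m))"

lemma heat_pair_DERIV:
  fixes f :: "'a::euclidean_space \<Rightarrow> real"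
  assumes f: "L1_plus_Linf f" and s: "s > 0"
  shows "(heat_pair lam0 m (dual_embed f) has_real_derivative heat_pair' lam0 m (dual_embed f) s) (at s)"
proof -
  have s2: "0 < s / 2" "s / 2 \<le> 2 * s" using s by auto
  obtain K d where K: "K > 0" "d > 0"
    "\<And>r x. r \<in> {s / 2 .. 2 * s} \<Longrightarrow> \<bar>gauss (1 / (4 * r)) m x\<bar> \<le> K * gauss d m x"
    "\<And>r x. r \<in> {s / 2 .. 2 * s} \<Longrightarrow> \<bar>(norm (x - m))\<^sup>2 / (4 * r\<^sup>2) * gauss (1 / (4 * r)) m x\<bar> \<le> K * gauss d m x"
    using heat_gauss_uniform_bounds[OF s2, where 'a = 'a] by metis
  have "((\<lambda>s. LINT x|lebesgue. f x * gauss (1 / (4 * s)) m x) has_real_derivative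
      (LINT x|lebesgue. f x * ((norm (x - m))\<^sup>2 / (4 * s\<^sup>2) * gauss (1 / (4 * s)) m x))) (at s)"
  proof (rule DERIV_integral_against[OF f bounded_integrable_gauss[OF K(2), of K m], where I = "{s / 2 <..< 2 * s}"])
    show "(\<lambda>x. (norm (x - m))\<^sup>2 / (4 * s\<^sup>2) * gauss (1 / (4 * s)) m x) \<in> borel_measurable lebesgue"
      using s by (intro continuous_measurable_lebesgue continuous_intros) auto
    show "((\<lambda>s. gauss (1 / (4 * s)) m x) has_real_derivative
        (norm (x - m))\<^sup>2 / (4 * r\<^sup>2) * gauss (1 / (4 * r)) m x) (at r)" if "r \<in> {s / 2 <..< 2 * s}" for r x
      using that s by (intro gauss_time_DERIV) auto
  qed (use s K in auto)
  also have "(LINT x|lebesgue. f x * ((norm (x - m))\<^sup>2 / (4 * s\<^sup>2) * gauss (1 / (4 * s)) m x)) =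
     (LINT x|lebesgue. (\<Sum>b\<in>Basis. f x * quad_gauss (1 / (4 * s)) m b x) / (4 * s\<^sup>2))"
    unfolding sum_distrib_left[symmetric] sum_quad_gauss by (intro Bochner_Integration.integral_cong) auto
  also have "\<dots> = (\<Sum>b\<in>Basis. dual_embed f (quad_gauss (1 / (4 * s)) m b)) / (4 * s\<^sup>2)"
    unfolding dual_embed_def using integrable_majorant[OF f bounded_integrable_quad_gauss[OF _ s]]
    by (simp add: Bochner_Integration.integral_sum)
  finally have "((\<lambda>s. dual_embed f (gauss (1 / (4 * s)) m)) has_real_derivative
     (\<Sum>b\<in>Basis. dual_embed f (quad_gauss (1 / (4 * s)) m b)) / (4 * s\<^sup>2)) (at s)"
    unfolding dual_embed_def .
  from DERIV_mult[OF heat_factor_DERIV[OF s, where 'a = 'a, of lam0] this]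
  show ?thesis unfolding heat_pair_def[abs_def] heat_pair'_def by (rule DERIV_cong) (simp add: algebra_simps)
qed

lemma heat_pair'_continuous:
  fixes f :: "'a::euclidean_space \<Rightarrow> real"
  assumes f: "L1_plus_Linf f"
  shows "continuous_on {0<..} (heat_pair' lam0 m (dual_embed f))"
proof -
  have q: "isCont (\<lambda>s. dual_embed f (quad_gauss (1 / (4 * s)) m b)) s" if s: "s > 0" and b: "b \<in> Basis" for s b
  proof -
    have s2: "0 < s / 2" "s / 2 \<le> 2 * s" using s by auto
    obtain K d where K: "K > 0" "d > 0"
      "\<And>r x. r \<in> {s / 2 .. 2 * s} \<Longrightarrow> \<bar>quad_gauss (1 / (4 * r)) m b x\<bar> \<le> K * gauss d m x"
      using heat_gauss_uniform_bounds[OF s2, where 'a = 'a] b by metis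
    show ?thesis unfolding dual_embed_def
    proof (rule isCont_integral_against[OF f bounded_integrable_gauss[OF K(2), of K m], where I = "{s / 2 <..< 2 * s}"])
      show "isCont (\<lambda>s. quad_gauss (1 / (4 * s)) m b x) s" for x
        unfolding quad_gauss_def gauss_def using s by (intro continuous_intros) auto
    qed (use s K in auto)
  qed
  have g: "continuous_on {0<..} (heat_pair lam0 m (dual_embed f))"
    by (rule DERIV_continuous_on[OF has_field_derivative_at_within[OF heat_pair_DERIV[OF f]]]) simp
  have "continuous_on {0<..} (\<lambda>s. heat_factor lam0 TYPE('a) s * ((\<Sum>b\<in>Basis. dual_embed f (quad_gauss (1 / (4 * s)) m b)) / (4 * s\<^sup>2))
      - (real DIM('a) / (2 * s) + lam0) * heat_pair lam0 m (dual_embed f) s)"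
    using q by (intro continuous_intros heat_factor_continuous g continuous_at_imp_continuous_on) auto
  then show ?thesis unfolding heat_pair'_def[abs_def] heat_pair_def by (simp add: algebra_simps)
qed

text \<open>The kernel satisfies the heat equation \<open>\<partial>\<^sub>s H = \<Delta> H - \<lambda>\<^sub>0
  H\<close>. Integrated against \<open>f\<close> it converts the spatial operator, once its
  derivatives have been moved to the kernel, into a derivative in \<open>s\<close>.\<close>

lemma laplace_heat_kernel:
  fixes f :: "'a::euclidean_space \<Rightarrow> real"
  assumes f: "L1_plus_Linf f" and s: "s > 0"
  shows "heat_pair' lam0 m (dual_embed f) s = heat_factor lam0 TYPE('a) s *
     ((\<Sum>b\<in>Basis. LINT x|lebesgue. f x * partials [b, b] (gauss (1 / (4 * s)) m) x) - lam0 * (LINT x|lebesgue. f x * gauss (1 / (4 * s)) m x))"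
proof -
  have i: "integrable lebesgue (\<lambda>x. f x * gauss (1 / (4 * s)) m x)"
    using integrable_majorant[OF f bounded_integrable_gauss[of "1 / (4 * s)" 1 m]] s by simp
  have "(LINT x|lebesgue. f x * partials [b, b] (gauss (1 / (4 * s)) m) x) =
      dual_embed f (quad_gauss (1 / (4 * s)) m b) / (4 * s\<^sup>2) - dual_embed f (gauss (1 / (4 * s)) m) / (2 * s)" if "b \<in> Basis" for b
  proof -
    have "(LINT x|lebesgue. f x * partials [b, b] (gauss (1 / (4 * s)) m) x) =
        (LINT x|lebesgue. f x * quad_gauss (1 / (4 * s)) m b x / (4 * s\<^sup>2) - f x * gauss (1 / (4 * s)) m x / (2 * s))"
      unfolding partials2_gauss[OF that] using s
      by (intro Bochner_Integration.integral_cong) (auto simp: field_simps power2_eq_square)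
    then show ?thesis
      using i integrable_majorant[OF f bounded_integrable_quad_gauss[OF that s, of m]] by (simp add: dual_embed_def)
  qed
  then have "(\<Sum>b\<in>Basis. LINT x|lebesgue. f x * partials [b, b] (gauss (1 / (4 * s)) m) x) =
      (\<Sum>b\<in>Basis. dual_embed f (quad_gauss (1 / (4 * s)) m b)) / (4 * s\<^sup>2) - real DIM('a) * dual_embed f (gauss (1 / (4 * s)) m) / (2 * s)"
    by (simp add: sum_subtractf sum_divide_distrib)
  then show ?thesis unfolding heat_pair'_def dual_embed_def by (simp only:) (simp add: algebra_simps)
qed

section \<open>Transport along characteristics\<close>

lemma primitive_exists:
  fixes f :: "real \<Rightarrow> real"
  assumes f: "continuous_on S f" and S: "open S" "convex S" "c \<in> S"
  obtains F where "\<And>x. x \<in> S \<Longrightarrow> (F has_real_derivative f x) (at x)"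
proof
  fix x assume x: "x \<in> S"
  then obtain e where e: "e > 0" "cball x e \<subseteq> S" using S(1) open_contains_cball by blast
  define a b where "a = min c (x - e)" and "b = max c (x + e)"
  have "x - e \<in> S" "x + e \<in> S" using e by (auto simp: subset_iff dist_real_def)
  then have "a \<in> S" "b \<in> S" using S(3) by (auto simp: a_def b_def min_def max_def)
  then have "closed_segment a b \<subseteq> S" using S(2) by (rule closed_segment_subset)
  moreover have ab: "a \<le> b" "a \<le> c" "c \<le> b" "x \<in> {a<..<b}" using e(1) by (auto simp: a_def b_def)
  ultimately have "{a..b} \<subseteq> S" by (simp add: closed_segment_eq_real_ivl)
  then have "continuous_on {a..b} f" by (rule continuous_on_subset[OF f])
  then have "((\<lambda>u. LBINT y=c..u. f y) has_vector_derivative f x) (at x within {a..b})"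
    using ab by (intro interval_integral_FTC2) auto
  then show "((\<lambda>u. LBINT y=c..u. f y) has_real_derivative f x) (at x)"
    using ab(4) by (simp add: has_real_derivative_iff_has_vector_derivative at_within_Icc_at)
qed

lemma LINT_time: "(LINT t|time. f t) = (LINT t|lebesgue. indicator {0<..} t * f t)" for f :: "real \<Rightarrow> real"
  by (subst integral_restrict_space) auto

text \<open>The lemma of du Bois-Reymond for continuous functions. The test functions are primitives of the
  difference of two rescaled bumps, so that they approximate the indicator of an interval while
  their derivatives concentrate at its end points; the limit is the integrated form \<open>\<zeta> b
  - \<zeta> a = \<integral> \<gamma>\<close>.\<close>

lemma weak_derivative_imp_derivative:
  fixes \<zeta> \<gamma> :: "real \<Rightarrow> real"
  assumes \<zeta>: "continuous_on {0..} \<zeta>" and \<gamma>: "continuous_on {0..} \<gamma>"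
    and weak: "\<And>\<phi>. \<phi> \<in> test_funs {0<..} \<Longrightarrow> (LINT t|time. deriv \<phi> t * \<zeta> t) = - (LINT t|time. \<phi> t * \<gamma> t)"
    and t: "t > 0"
  shows "(\<zeta> has_real_derivative \<gamma> t) (at t)"
proof -
  define B where "B = bump (-1) 1"
  have B: "smooth1 B" "\<And>x. B x \<ge> 0" "\<And>x. \<bar>B x\<bar> \<le> 1" "\<And>x. x \<in> {-1<..<1} \<Longrightarrow> B x > 0" "\<And>x. x \<notin> {-1<..<1} \<Longrightarrow> B x = 0"
    using bump_nonneg[of "-1" 1] bump_le_1[of "-1" 1] by (auto simp: B_def smooth1_bump bump_pos bump_zero)
  obtain R0 where R0: "\<And>x. (R0 has_real_derivative B x) (at x)"
    using primitive_exists[OF smooth1_continuous[OF B(1), of UNIV]] by auto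
  define R where "R x = R0 x - R0 (-1)" for x
  have R: "(R has_real_derivative B x) (at x)" for x
    unfolding R_def by (auto intro!: derivative_eq_intros R0)
  define m where "m = R 1"
  have R_low: "R x = 0" if "x \<le> -1" for x
  proof -
    have "(R has_real_derivative 0) (at x within {..-1})" if "x \<in> {..-1}" for x
      using has_field_derivative_at_within[OF R[of x]] B(5)[of x] that by simp
    then have "\<exists>c. \<forall>x\<in>{..-1}. R x = c"
      by (intro has_field_derivative_zero_constant) auto
    then obtain c where "\<And>x. x \<le> -1 \<Longrightarrow> R x = c" by auto
    from this[of x] this[of "-1"] show ?thesis using that by (simp add: R_def)
  qed
  have R_high: "R x = m" if "x \<ge> 1" for x
  proof -
    have "(R has_real_derivative 0) (at x within {1..})" if "x \<in> {1..}" for x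
      using has_field_derivative_at_within[OF R[of x]] B(5)[of x] that by simp
    then have "\<exists>c. \<forall>x\<in>{1..}. R x = c"
      by (intro has_field_derivative_zero_constant) auto
    then obtain c where "\<And>x. x \<ge> 1 \<Longrightarrow> R x = c" by auto
    from this[of x] this[of 1] show ?thesis using that by (simp add: m_def)
  qed
  have R_mono: "R x \<le> R y" if "x \<le> y" for x y
    by (rule DERIV_nonneg_imp_nondecreasing[OF that]) (use R B(2) in blast)
  have R_range: "0 \<le> R x" "R x \<le> m" for x
    using R_mono[of "min x (-1)" x] R_low[of "min x (-1)"] R_mono[of x "max x 1"] R_high[of "max x 1"] by auto
  have m: "m > 0"
  proof -
    have "\<exists>y. (R has_real_derivative y) (at x) \<and> 0 < y" if "-1 < x" "x < 1" for x
      using R[of x] B(4)[of x] that by auto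
    moreover have "continuous_on {-1..1} R"
      by (rule DERIV_continuous_on[OF has_field_derivative_at_within[OF R]])
    ultimately have "R (-1) < R 1"
      using DERIV_pos_imp_increasing_open[of "-1" 1 R] by simp
    then show ?thesis using R_low[of "-1"] by (simp add: m_def)
  qed
  have int_B: "(LINT x|lebesgue. B x) = m"
  proof -
    have "(B has_integral (R 1 - R (-1))) {-1..1}"
      by (rule fundamental_theorem_of_calculus)
         (use R in \<open>auto simp: has_real_derivative_iff_has_vector_derivative[symmetric] intro: has_field_derivative_at_within\<close>)
    then have "integral {-1..1} B = m" using R_low[of "-1"] by (simp add: m_def integral_unique)
    moreover have "set_integrable lebesgue {-1..1} B"
      using absolutely_integrable_continuous[of "-1" 1 B] smooth1_continuous[OF B(1)] by simp
    ultimately have "(LINT x:{-1..1}|lebesgue. B x) = m" by (simp add: set_lebesgue_integral_eq_integral)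
    moreover have "(LINT x:{-1..1}|lebesgue. B x) = (LINT x|lebesgue. B x)"
      unfolding set_lebesgue_integral_def
    proof (rule Bochner_Integration.integral_cong[OF refl])
      show "indicator {-1..1} x *\<^sub>R B x = B x" for x
        using B(5)[of x] by (cases "x \<in> {-1..1}") auto
    qed
    ultimately show ?thesis by simp
  qed
  \<comment> \<open>Constant continuation to negative arguments replaces integrals over the half line by integrals over the line.\<close>
  define z g where "z x = \<zeta> (max 0 x)" and "g x = \<gamma> (max 0 x)" for x
  have zg: "continuous_on UNIV z" "continuous_on UNIV g"
    unfolding z_def g_def by (intro continuous_on_compose2[OF \<zeta>] continuous_on_compose2[OF \<gamma>] continuous_intros; auto)+
  have main: "\<zeta> b - \<zeta> a = (LINT x|lebesgue. indicator {a..b} x * g x)" if ab: "0 < a" "a < b" for a b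
  proof -
    \<comment> \<open>The width of the bumps is at most \<open>a / 2\<close>, which keeps the support of the test functions inside the open half line.\<close>
    define \<delta> where "\<delta> n = a / 2 * inverse (real (Suc n))" for n
    have \<delta>: "\<delta> n > 0" "\<delta> n \<le> a / 2" for n using ab by (auto simp: \<delta>_def field_simps)
    have \<delta>0: "\<delta> \<longlonglongrightarrow> 0" unfolding \<delta>_def using tendsto_mult[OF tendsto_const[of "a/2"] LIMSEQ_inverse_real_of_nat] by simp
    define \<phi> where "\<phi> n x = R ((x - a) / \<delta> n) - R ((x - b) / \<delta> n)" for n x
    define \<phi>' where "\<phi>' n x = B ((x - a) / \<delta> n) / \<delta> n - B ((x - b) / \<delta> n) / \<delta> n" for n x
    have aff: "(x - c) / \<delta> n = (1 / \<delta> n) * x + (- c / \<delta> n)" for x c n by (simp add: diff_divide_distrib)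
    have d: "(\<phi> n has_real_derivative \<phi>' n x) (at x)" for n x
      unfolding \<phi>_def \<phi>'_def using \<delta>(1)[of n]
      by (auto intro!: derivative_eq_intros DERIV_chain2[OF R] simp: field_simps)
    have "smooth1 (\<phi>' n)" for n
    proof -
      have "smooth1 (\<lambda>x. (1 / \<delta> n) * B ((1 / \<delta> n) * x + (- a / \<delta> n)) - (1 / \<delta> n) * B ((1 / \<delta> n) * x + (- b / \<delta> n)))"
        by (intro smooth1_diff smooth1_mult smooth1_const smooth1_affine B)
      then show ?thesis unfolding \<phi>'_def[abs_def] aff by simp
    qed
    then have s: "smooth1 (\<phi> n)" for n using smooth1I[OF d] by blast
    have \<phi>0: "\<phi> n x = 0" if x: "x \<notin> {a/2..b + a/2}" for n x
    proof -
      consider "x < a / 2" | "x > b + a / 2" using x by force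
      then show ?thesis
      proof cases
        case 1
        then have "(x - a) / \<delta> n \<le> -1" "(x - b) / \<delta> n \<le> -1" using \<delta>[of n] ab by (auto simp: pos_divide_le_eq)
        then show ?thesis by (simp add: \<phi>_def R_low)
      next
        case 2
        then have "(x - a) / \<delta> n \<ge> 1" "(x - b) / \<delta> n \<ge> 1" using \<delta>[of n] ab by (auto simp: pos_le_divide_eq)
        then show ?thesis by (simp add: \<phi>_def R_high)
      qed
    qed
    have \<phi>b: "\<bar>\<phi> n x\<bar> \<le> m" for n x using R_range[of "(x - a) / \<delta> n"] R_range[of "(x - b) / \<delta> n"] by (simp add: \<phi>_def)
    have "\<phi> n \<in> test_funs {0<..}" for n
      by (rule smooth1_test_fun[OF s, of "a/2" "b + a/2"]) (use ab \<phi>0 in auto)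
    from weak[OF this] have w: "(LINT t|time. \<phi>' n t * \<zeta> t) = - (LINT t|time. \<phi> n t * \<gamma> t)" for n
      using DERIV_imp_deriv[OF d] by simp
    have \<phi>'0: "\<phi>' n x = 0" if "x \<le> 0" for n x
    proof -
      have "(x - a) / \<delta> n \<le> -1" "(x - b) / \<delta> n \<le> -1" using \<delta>[of n] ab that by (auto simp: pos_divide_le_eq)
      then show ?thesis by (simp add: \<phi>'_def B)
    qed
    have e1: "(LINT t|time. \<phi> n t * \<gamma> t) = (LINT x|lebesgue. \<phi> n x * g x)" for n
      unfolding LINT_time
    proof (rule Bochner_Integration.integral_cong[OF refl])
      show "indicator {0<..} x * (\<phi> n x * \<gamma> x) = \<phi> n x * g x" for x
        using ab \<phi>0[of x n] by (cases "x > 0") (auto simp: g_def)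
    qed
    have e2: "(LINT t|time. \<phi>' n t * \<zeta> t) = (LINT x|lebesgue. \<phi>' n x * z x)" for n
      unfolding LINT_time
    proof (rule Bochner_Integration.integral_cong[OF refl])
      show "indicator {0<..} x * (\<phi>' n x * \<zeta> x) = \<phi>' n x * z x" for x
        using \<phi>'0[of x n] by (cases "x > 0") (auto simp: z_def)
    qed
    have l1: "(\<lambda>n. LINT x|lebesgue. \<phi> n x * g x) \<longlonglongrightarrow> (LINT x|lebesgue. m * (indicator {a..b} x * g x))"
    proof (rule integral_dominated_convergence[where w = "\<lambda>x. m * \<bar>indicator {a/2..b + a/2} x * g x\<bar>"])
      have g': "set_integrable lebesgue {c..d} g" for c d
        using absolutely_integrable_continuous[of c d g] continuous_on_subset[OF zg(2)] by simp
      show "integrable lebesgue (\<lambda>x. m * \<bar>indicator {a/2..b + a/2} x * g x\<bar>)"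
        using g'[of "a/2" "b + a/2"] by (simp add: set_integrable_def)
      show "(\<lambda>x. m * (indicator {a..b} x * g x)) \<in> borel_measurable lebesgue"
        using g'[of a b] by (auto simp: set_integrable_def)
      show "(\<lambda>x. \<phi> n x * g x) \<in> borel_measurable lebesgue" for n
        by (intro continuous_measurable_lebesgue continuous_intros smooth1_continuous s zg)
      show "AE x in lebesgue. norm (\<phi> n x * g x) \<le> m * \<bar>indicator {a/2..b + a/2} x * g x\<bar>" for n
      proof (rule AE_I2)
        fix x
        show "norm (\<phi> n x * g x) \<le> m * \<bar>indicator {a/2..b + a/2} x * g x\<bar>"
          using \<phi>0[of x n] mult_right_mono[OF \<phi>b[of n x], of "\<bar>g x\<bar>"] by (cases "x \<in> {a/2..b + a/2}") (auto simp: abs_mult)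
      qed
      have "AE x in lebesgue. x \<noteq> a \<and> x \<noteq> b"
        by (rule AE_completion) (intro AE_conjI AE_lborel_singleton)
      then show "AE x in lebesgue. (\<lambda>n. \<phi> n x * g x) \<longlonglongrightarrow> m * (indicator {a..b} x * g x)"
      proof eventually_elim
        case (elim x)
        have R_ev_high: "eventually (\<lambda>n. R ((x - c) / \<delta> n) = m) sequentially" if "x > c" for c
        proof -
          have "eventually (\<lambda>n. \<delta> n < x - c) sequentially" using order_tendstoD(2)[OF \<delta>0] that by simp
          then show ?thesis by eventually_elim (use \<delta>(1) in \<open>auto intro!: R_high simp: pos_le_divide_eq\<close>)
        qed
        have R_ev_low: "eventually (\<lambda>n. R ((x - c) / \<delta> n) = 0) sequentially" if "x < c" for c
        proof -
          have "eventually (\<lambda>n. \<delta> n < c - x) sequentially" using order_tendstoD(2)[OF \<delta>0] that by simp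
          then show ?thesis by eventually_elim (use \<delta>(1) in \<open>auto intro!: R_low simp: pos_divide_le_eq\<close>)
        qed
        consider "x < a" | "a < x" "x < b" | "b < x" using elim by linarith
        then have "eventually (\<lambda>n. \<phi> n x * g x = m * (indicator {a..b} x * g x)) sequentially"
        proof cases
          case 1
          with ab have "x < b" by simp
          show ?thesis using R_ev_low[OF 1] R_ev_low[OF \<open>x < b\<close>] by eventually_elim (use 1 in \<open>auto simp: \<phi>_def\<close>)
        next
          case 2
          show ?thesis using R_ev_high[OF 2(1)] R_ev_low[OF 2(2)] by eventually_elim (use 2 in \<open>auto simp: \<phi>_def\<close>)
        next
          case 3
          with ab have "a < x" by simp
          show ?thesis using R_ev_high[OF 3] R_ev_high[OF \<open>a < x\<close>] by eventually_elim (use 3 in \<open>auto simp: \<phi>_def\<close>)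
        qed
        then show ?case by (rule tendsto_eventually)
      qed
    qed
    have conc: "(\<lambda>n. LINT x|lebesgue. B ((x - c) / \<delta> n) / \<delta> n * z x) \<longlonglongrightarrow> m * z c"
      and conc_int: "\<And>n. integrable lebesgue (\<lambda>x. B ((x - c) / \<delta> n) / \<delta> n * z x)" for c
    proof -
      have "bounded (z ` {c - a / 2..c + a / 2})"
        by (intro compact_imp_bounded compact_continuous_image continuous_on_subset[OF zg(1)]) auto
      then obtain M where M0: "\<forall>y\<in>z ` {c - a / 2..c + a / 2}. norm y \<le> M"
        unfolding bounded_iff by blast
      have M: "\<bar>z x\<bar> \<le> M" if "x \<in> {c - a / 2..c + a / 2}" for x
        using M0[rule_format, OF imageI[OF that]] by simp
      have bnd: "\<bar>B y * z (c + \<delta> n * y)\<bar> \<le> M * indicator {-1..1} y" for y n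
      proof (cases "y \<in> {-1<..<1}")
        case True
        have "\<bar>\<delta> n * y\<bar> \<le> a / 2 * 1" unfolding abs_mult using \<delta>[of n] True by (intro mult_mono) auto
        then have "\<bar>z (c + \<delta> n * y)\<bar> \<le> M" by (intro M) (auto simp: abs_le_iff)
        from mult_mono[OF B(3)[of y] this] show ?thesis using True by (simp add: abs_mult)
      next
        case False
        then have "B y = 0" by (rule B)
        moreover have "M \<ge> 0" using M[of c] ab by (auto intro: order_trans[OF abs_ge_zero])
        ultimately show ?thesis by (simp add: indicator_def)
      qed
      have iM: "integrable lebesgue (\<lambda>y. M * indicator {-1..1::real} y)"
        by (intro integrable_mult_right integrable_real_indicator) auto
      have meas: "(\<lambda>y. B y * z (c + \<delta> n * y)) \<in> borel_measurable lebesgue" for n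
        by (intro continuous_measurable_lebesgue continuous_intros smooth1_continuous B continuous_on_compose2[OF zg(1)]) auto
      have iB: "integrable lebesgue (\<lambda>y. B y * z (c + \<delta> n * y))" for n
        by (rule Bochner_Integration.integrable_bound[OF iM meas]) (use bnd in \<open>auto simp: order_trans[OF _ abs_ge_self]\<close>)
      have sub: "(\<lambda>y. B ((c + \<delta> n * y - c) / \<delta> n) / \<delta> n * z (c + \<delta> n * y)) = (\<lambda>y. B y * z (c + \<delta> n * y) / \<delta> n)" for n
        using \<delta>(1)[of n] by auto
      show "integrable lebesgue (\<lambda>x. B ((x - c) / \<delta> n) / \<delta> n * z x)" for n
        using lebesgue_integrable_real_affine_iff[of "\<delta> n" "\<lambda>x. B ((x - c) / \<delta> n) / \<delta> n * z x" c] \<delta>(1)[of n] iB[of n]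
        unfolding sub by auto
      have "(LINT x|lebesgue. B ((x - c) / \<delta> n) / \<delta> n * z x) = (LINT y|lebesgue. B y * z (c + \<delta> n * y))" for n
        using lebesgue_integral_real_affine[of "\<delta> n" "\<lambda>x. B ((x - c) / \<delta> n) / \<delta> n * z x" c] \<delta>(1)[of n]
        unfolding sub by simp
      moreover have "(\<lambda>n. LINT y|lebesgue. B y * z (c + \<delta> n * y)) \<longlonglongrightarrow> (LINT y|lebesgue. B y * z c)"
      proof (rule integral_dominated_convergence[OF _ meas iM])
        have "isCont z c" using zg(1) by (simp add: continuous_on_eq_continuous_at)
        have "(\<lambda>n. c + \<delta> n * y) \<longlonglongrightarrow> c + 0 * y" for y by (intro tendsto_intros \<delta>0)
        then show "AE y in lebesgue. (\<lambda>n. B y * z (c + \<delta> n * y)) \<longlonglongrightarrow> B y * z c"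
          by (intro AE_I2 tendsto_mult tendsto_const isCont_tendsto_compose[OF \<open>isCont z c\<close>]) simp
        show "(\<lambda>y. B y * z c) \<in> borel_measurable lebesgue"
          by (intro continuous_measurable_lebesgue continuous_intros smooth1_continuous B)
      qed (use bnd in auto)
      ultimately show "(\<lambda>n. LINT x|lebesgue. B ((x - c) / \<delta> n) / \<delta> n * z x) \<longlonglongrightarrow> m * z c"
        by (simp add: int_B)
    qed
    have "(LINT x|lebesgue. \<phi>' n x * z x) = (LINT x|lebesgue. B ((x - a) / \<delta> n) / \<delta> n * z x) - (LINT x|lebesgue. B ((x - b) / \<delta> n) / \<delta> n * z x)" for n
      unfolding \<phi>'_def left_diff_distrib by (rule Bochner_Integration.integral_diff[OF conc_int conc_int])
    then have "(\<lambda>n. LINT x|lebesgue. \<phi>' n x * z x) \<longlonglongrightarrow> m * z a - m * z b"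
      by (simp only:) (intro tendsto_diff conc)
    moreover have "(\<lambda>n. LINT x|lebesgue. \<phi>' n x * z x) \<longlonglongrightarrow> - (LINT x|lebesgue. m * (indicator {a..b} x * g x))"
      using tendsto_minus[OF l1] w unfolding e1 e2 by simp
    ultimately have "m * z a - m * z b = - (LINT x|lebesgue. m * (indicator {a..b} x * g x))" by (rule LIMSEQ_unique)
    then have "m * (z b - z a) = m * (LINT x|lebesgue. indicator {a..b} x * g x)" by (simp add: algebra_simps)
    then show ?thesis using m ab by (simp add: z_def)
  qed
  define a where "a = t / 2"
  have a: "0 < a" "a < t" using t by (auto simp: a_def)
  have "((\<lambda>u. integral {a..u} g) has_real_derivative g t) (at t within {a..t + 1})"
    by (rule integral_has_real_derivative) (use a continuous_on_subset[OF zg(2)] in auto)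
  then have D: "((\<lambda>u. \<zeta> a + integral {a..u} g) has_real_derivative g t) (at t)"
    using a by (auto simp: at_within_Icc_at intro!: derivative_eq_intros)
  have E: "\<zeta> a + integral {a..u} g = \<zeta> u" if "u > a" for u
  proof -
    have "set_integrable lebesgue {a..u} g"
      using absolutely_integrable_continuous[of a u g] continuous_on_subset[OF zg(2)] by simp
    then have "(LINT x|lebesgue. indicator {a..u} x * g x) = integral {a..u} g"
      using set_lebesgue_integral_eq_integral(2)[of "{a..u}" g] by (simp add: set_lebesgue_integral_def)
    then show ?thesis using main[OF a(1) that] by simp
  qed
  have "(\<zeta> has_real_derivative g t) (at t)"
    by (rule has_field_derivative_transform_within_open[OF D, where S = "{a<..}"]) (use a E in auto)
  then show ?thesis using t by (simp add: g_def)
qed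

text \<open>A null set contains no interval. The lemma carries statements that are continuous in time from
  almost every to every time.\<close>

lemma AE_time_dense:
  assumes "AE t in time. P t" "t \<ge> 0"
  obtains \<tau> where "\<And>n. P (\<tau> n)" "\<And>n. \<tau> n > t" "\<tau> \<longlonglongrightarrow> t"
proof -
  have "\<exists>\<tau>. P \<tau> \<and> t < \<tau> \<and> \<tau> < t + inverse (real (Suc n))" for n
  proof (rule ccontr)
    define h where "h = inverse (real (Suc n))"
    have h: "h > 0" by (simp add: h_def)
    assume "\<not> (\<exists>\<tau>. P \<tau> \<and> t < \<tau> \<and> \<tau> < t + inverse (real (Suc n)))"
    then have no: "\<And>\<tau>. t < \<tau> \<Longrightarrow> \<tau> < t + h \<Longrightarrow> \<not> P \<tau>" by (auto simp: h_def)
    have "AE \<tau> in lebesgue. \<tau> \<in> {0<..} \<longrightarrow> P \<tau>"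
      using assms(1) by (subst (asm) AE_restrict_space_iff) auto
    then have "AE \<tau> in lebesgue. \<tau> \<notin> {t<..<t + h}"
    proof eventually_elim
      case (elim \<tau>)
      then show ?case using no[of \<tau>] assms(2) by auto
    qed
    then have "{t<..<t + h} \<in> null_sets lebesgue"
      by (subst (asm) AE_iff_null_sets[symmetric]) auto
    then have "emeasure lebesgue {t<..<t + h} = 0" by blast
    then show False using h by simp
  qed
  then obtain \<tau> where \<tau>: "\<And>n. P (\<tau> n)" "\<And>n. t < \<tau> n" "\<And>n. \<tau> n < t + inverse (real (Suc n))" by metis
  have "(\<lambda>n. t + inverse (real (Suc n))) \<longlonglongrightarrow> t + 0"
    by (intro tendsto_intros LIMSEQ_inverse_real_of_nat)
  then have "(\<lambda>n. t + inverse (real (Suc n))) \<longlonglongrightarrow> t" by simp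
  then have "\<tau> \<longlonglongrightarrow> t"
    by (rule real_tendsto_sandwich[OF _ _ tendsto_const, rotated 2]) (use \<tau> in \<open>auto intro!: always_eventually less_imp_le\<close>)
  then show ?thesis using \<tau>(1,2) that by blast
qed

text \<open>The equation is \<open>k\<^sub>t = k\<^sub>s + S(s)\<close> with \<open>l\<close> in the role of
  \<open>k\<^sub>s\<close>, and along the characteristic \<open>r \<mapsto> (r, s + t - r)\<close>
  the function \<open>k + A\<close> is constant. The assumptions are what testing an evolution
  equation provides: the equation holds in the sense of distributions in time, the derivative in
  \<open>s\<close> exists for almost every time, and \<open>\<nu> \<tau> t\<close>, the distance
  between the values of the solution at two times, controls the oscillation of \<open>k\<close> and
  \<open>l\<close> in time locally uniformly in \<open>s\<close>. Together they make
  \<open>k\<close> differentiable in both variables.\<close>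

lemma transport_along_characteristics:
  fixes k l \<nu> :: "real \<Rightarrow> real \<Rightarrow> real" and S A :: "real \<Rightarrow> real"
  assumes nu: "\<And>t. t \<ge> 0 \<Longrightarrow> ((\<lambda>\<tau>. \<nu> \<tau> t) \<longlongrightarrow> 0) (at t within {0..})"
    and bound: "\<And>\<alpha> \<beta>. 0 < \<alpha> \<Longrightarrow> \<alpha> \<le> \<beta> \<Longrightarrow> \<exists>C. \<forall>s\<in>{\<alpha>..\<beta>}. \<forall>t\<ge>0. \<forall>\<tau>\<ge>0. \<bar>k \<tau> s - k t s\<bar> \<le> C * \<nu> \<tau> t \<and> \<bar>l \<tau> s - l t s\<bar> \<le> C * \<nu> \<tau> t"
    and der: "AE t in time. (\<forall>s>0. (k t has_real_derivative l t s) (at s)) \<and> continuous_on {0<..} (l t)"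
    and weak: "\<And>s \<phi>. s > 0 \<Longrightarrow> \<phi> \<in> test_funs {0<..} \<Longrightarrow> (LINT t|time. deriv \<phi> t * k t s) = - (LINT t|time. \<phi> t * (l t s + S s))"
    and A: "\<And>s. s > 0 \<Longrightarrow> (A has_real_derivative S s) (at s)"
    and init: "\<And>s. s > 0 \<Longrightarrow> k 0 s = 0"
    and t: "t \<ge> 0" and s: "s > 0"
  shows "k t s = A (s + t) - A s"
proof -
  have unif: "\<exists>C\<ge>0. \<forall>s\<in>{\<alpha>..\<beta>}. \<forall>t\<ge>0. \<forall>\<tau>\<ge>0. \<bar>k \<tau> s - k t s\<bar> \<le> C * \<bar>\<nu> \<tau> t\<bar> \<and> \<bar>l \<tau> s - l t s\<bar> \<le> C * \<bar>\<nu> \<tau> t\<bar>"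
    if ab: "0 < \<alpha>" "\<alpha> \<le> \<beta>" for \<alpha> \<beta>
  proof -
    obtain C where C: "\<And>s t \<tau>. s \<in> {\<alpha>..\<beta>} \<Longrightarrow> t \<ge> 0 \<Longrightarrow> \<tau> \<ge> 0 \<Longrightarrow> \<bar>k \<tau> s - k t s\<bar> \<le> C * \<nu> \<tau> t \<and> \<bar>l \<tau> s - l t s\<bar> \<le> C * \<nu> \<tau> t"
      using bound[OF ab] by blast
    have "C * \<nu> \<tau> t \<le> \<bar>C\<bar> * \<bar>\<nu> \<tau> t\<bar>" for \<tau> t using abs_ge_self[of "C * \<nu> \<tau> t"] by (simp add: abs_mult)
    then have "\<bar>k \<tau> s - k t s\<bar> \<le> \<bar>C\<bar> * \<bar>\<nu> \<tau> t\<bar> \<and> \<bar>l \<tau> s - l t s\<bar> \<le> \<bar>C\<bar> * \<bar>\<nu> \<tau> t\<bar>"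
      if "s \<in> {\<alpha>..\<beta>}" "t \<ge> 0" "\<tau> \<ge> 0" for s t \<tau>
      using C[OF that] order_trans by blast
    then show ?thesis by (intro exI[of _ "\<bar>C\<bar>"]) auto
  qed
  have cont_t: "continuous_on {0..} (\<lambda>t. k t s)" "continuous_on {0..} (\<lambda>t. l t s)" if s: "s > 0" for s
  proof -
    obtain C where C: "\<And>t \<tau>. t \<ge> 0 \<Longrightarrow> \<tau> \<ge> 0 \<Longrightarrow> \<bar>k \<tau> s - k t s\<bar> \<le> C * \<bar>\<nu> \<tau> t\<bar> \<and> \<bar>l \<tau> s - l t s\<bar> \<le> C * \<bar>\<nu> \<tau> t\<bar>"
      using unif[OF s order_refl] by auto
    have *: "((\<lambda>\<tau>. C * \<bar>\<nu> \<tau> t\<bar>) \<longlongrightarrow> 0) (at t within {0..})" if "t \<ge> 0" for t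
      using tendsto_mult[OF tendsto_const[of C] tendsto_rabs[OF nu[OF that]]] by simp
    have "((\<lambda>\<tau>. k \<tau> s - k t s) \<longlongrightarrow> 0) (at t within {0..})" "((\<lambda>\<tau>. l \<tau> s - l t s) \<longlongrightarrow> 0) (at t within {0..})" if "t \<ge> 0" for t
      by (rule Lim_null_comparison[OF _ *[OF that]]; use C[OF that] in \<open>auto simp: eventually_at_filter intro!: always_eventually\<close>)+
    then show "continuous_on {0..} (\<lambda>t. k t s)" "continuous_on {0..} (\<lambda>t. l t s)"
      unfolding continuous_on_def by (auto simp: LIM_zero_iff intro: LIM_zero_cancel)
  qed
  have dt: "((\<lambda>t. k t s) has_real_derivative l t s + S s) (at t)" if "t > 0" "s > 0" for t s
    by (rule weak_derivative_imp_derivative) (use that cont_t weak in \<open>auto intro!: continuous_intros\<close>)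
  \<comment> \<open>The derivative in \<open>s\<close> is known only for almost every \<open>t\<close>; the uniform continuity in \<open>t\<close> carries it
    over to all \<open>t\<close>.\<close>
  have ds: "(k t has_real_derivative l t s) (at s)" and lc: "isCont (l t) s" if ts: "t \<ge> 0" "s > 0" for t s
  proof -
    obtain \<tau> where \<tau>: "\<And>n. (\<forall>s>0. (k (\<tau> n) has_real_derivative l (\<tau> n) s) (at s)) \<and> continuous_on {0<..} (l (\<tau> n))"
      "\<And>n. \<tau> n > t" "\<tau> \<longlonglongrightarrow> t" using AE_time_dense[OF der ts(1)] by metis
    have \<tau>0: "\<tau> n \<ge> 0" for n using \<tau>(2)[of n] ts(1) by linarith
    define J where "J = {s / 2 <..< 2 * s}"
    have J: "open J" "convex J" "s \<in> J" "J \<subseteq> {0<..}" "J \<subseteq> {s / 2 .. 2 * s}" using ts by (auto simp: J_def)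
    obtain C where C: "C \<ge> 0" "\<And>s' t \<tau>. s' \<in> {s / 2 .. 2 * s} \<Longrightarrow> t \<ge> 0 \<Longrightarrow> \<tau> \<ge> 0 \<Longrightarrow>
        \<bar>k \<tau> s' - k t s'\<bar> \<le> C * \<bar>\<nu> \<tau> t\<bar> \<and> \<bar>l \<tau> s' - l t s'\<bar> \<le> C * \<bar>\<nu> \<tau> t\<bar>"
      using unif[of "s / 2" "2 * s"] ts by auto
    have nu0: "(\<lambda>n. C * \<bar>\<nu> (\<tau> n) t\<bar>) \<longlonglongrightarrow> 0"
    proof -
      have "filterlim \<tau> (at t within {0..}) sequentially"
        using \<tau>(3) \<tau>0 less_imp_neq[OF \<tau>(2)] by (auto simp: filterlim_at intro!: always_eventually)
      then have "(\<lambda>n. \<nu> (\<tau> n) t) \<longlonglongrightarrow> 0" by (rule filterlim_compose[OF nu[OF ts(1)]])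
      from tendsto_mult[OF tendsto_const[of C] tendsto_rabs[OF this]] show ?thesis by simp
    qed
    have nle: "\<forall>\<^sub>F n in sequentially. \<forall>x\<in>J. \<bar>l (\<tau> n) x - l t x\<bar> \<le> e \<and> \<bar>k (\<tau> n) x - k t x\<bar> \<le> e" if "e > 0" for e
      using order_tendstoD(2)[OF nu0 that]
    proof eventually_elim
      case (elim n)
      show ?case
      proof
        fix x assume "x \<in> J"
        then have "x \<in> {s / 2 .. 2 * s}" using J by auto
        from C(2)[OF this ts(1) \<tau>0[of n]] elim
        show "\<bar>l (\<tau> n) x - l t x\<bar> \<le> e \<and> \<bar>k (\<tau> n) x - k t x\<bar> \<le> e" by linarith
      qed
    qed
    have klim: "(\<lambda>n. k (\<tau> n) x) \<longlonglongrightarrow> k t x" if "x \<in> J" for x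
      unfolding lim_sequentially dist_real_def
    proof (intro allI impI)
      fix r :: real assume "r > 0"
      then have "\<forall>\<^sub>F n in sequentially. \<bar>k (\<tau> n) x - k t x\<bar> < r"
        using nle[of "r/2"] that by (auto elim!: eventually_mono)
      then show "\<exists>no. \<forall>n\<ge>no. \<bar>k (\<tau> n) x - k t x\<bar> < r" by (simp add: eventually_sequentially)
    qed
    have "\<exists>g. \<forall>x\<in>J. (\<lambda>n. k (\<tau> n) x) \<longlonglongrightarrow> g x \<and> (g has_derivative (*) (l t x)) (at x within J)"
    proof (rule has_derivative_sequence[where f = "\<lambda>n. k (\<tau> n)" and f' = "\<lambda>n x. (*) (l (\<tau> n) x)"])
      show "convex J" "s \<in> J" "(\<lambda>n. k (\<tau> n) s) \<longlonglongrightarrow> k t s" by (fact J(2) J(3) klim[OF J(3)])+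
      show "(k (\<tau> n) has_derivative (*) (l (\<tau> n) x)) (at x within J)" if "x \<in> J" for n x
        using \<tau>(1)[of n] J that by (auto simp: has_field_derivative_def intro: has_derivative_at_withinI)
      show "\<forall>\<^sub>F n in sequentially. \<forall>x\<in>J. \<forall>h. norm (l (\<tau> n) x * h - l t x * h) \<le> e * norm h" if "e > 0" for e
        using nle[OF that]
      proof eventually_elim
        case (elim n)
        show ?case
        proof (intro ballI allI)
          fix x h assume "x \<in> J"
          have "norm (l (\<tau> n) x * h - l t x * h) = \<bar>l (\<tau> n) x - l t x\<bar> * norm h"
            unfolding left_diff_distrib[symmetric] by (simp add: abs_mult)
          also have "\<dots> \<le> e * norm h" using elim \<open>x \<in> J\<close> by (intro mult_right_mono) auto
          finally show "norm (l (\<tau> n) x * h - l t x * h) \<le> e * norm h" .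
        qed
      qed
    qed
    then obtain g where g: "\<And>x. x \<in> J \<Longrightarrow> (\<lambda>n. k (\<tau> n) x) \<longlonglongrightarrow> g x" "\<And>x. x \<in> J \<Longrightarrow> (g has_derivative (*) (l t x)) (at x within J)"
      by blast
    have gk: "g x = k t x" if "x \<in> J" for x using g(1)[OF that] klim[OF that] by (rule LIMSEQ_unique)
    have "(g has_real_derivative l t s) (at s)"
      using g(2)[OF J(3)] unfolding at_within_open[OF J(3,1)] has_field_derivative_def .
    then show "(k t has_real_derivative l t s) (at s)"
      by (rule has_field_derivative_transform_within_open[OF _ J(1,3)]) (rule gk)
    have "continuous_on J (l t)"
    proof (rule uniform_limit_theorem[of _ "\<lambda>n. l (\<tau> n)" sequentially])
      show "\<forall>\<^sub>F n in sequentially. continuous_on J (l (\<tau> n))"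
        using \<tau>(1) J(4) continuous_on_subset by (intro always_eventually) blast
      show "uniform_limit J (\<lambda>n. l (\<tau> n)) (l t) sequentially"
        unfolding uniform_limit_iff dist_real_def
      proof (intro allI impI)
        fix e :: real assume "e > 0"
        then show "\<forall>\<^sub>F n in sequentially. \<forall>x\<in>J. \<bar>l (\<tau> n) x - l t x\<bar> < e"
          using nle[of "e/2"] by (auto elim!: eventually_mono)
      qed
    qed simp
    then show "isCont (l t) s" using J by (simp add: continuous_on_eq_continuous_at)
  qed
  have joint: "continuous (at (t, s) within {0..} \<times> {0<..}) (\<lambda>(t, s). f t s)"
    if ts: "t \<ge> 0" "s > 0" and f: "isCont (f t) s" "f = k \<or> f = l" for f :: "real \<Rightarrow> real \<Rightarrow> real" and t s
    unfolding continuous_within_sequentially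
  proof (intro allI impI)
    fix X :: "nat \<Rightarrow> real \<times> real" assume X: "(\<forall>n. X n \<in> {0..} \<times> {0<..}) \<and> X \<longlonglongrightarrow> (t, s)"
    define \<tau> \<sigma> where "\<tau> n = fst (X n)" and "\<sigma> n = snd (X n)" for n
    have \<tau>: "\<tau> \<longlonglongrightarrow> t" "\<And>n. \<tau> n \<ge> 0" and \<sigma>: "\<sigma> \<longlonglongrightarrow> s"
      using X tendsto_fst[of X "(t, s)"] tendsto_snd[of X "(t, s)"] by (auto simp: \<tau>_def[abs_def] \<sigma>_def[abs_def] mem_Times_iff)
    obtain C where C: "C \<ge> 0" "\<And>s' t \<tau>. s' \<in> {s / 2 .. 2 * s} \<Longrightarrow> t \<ge> 0 \<Longrightarrow> \<tau> \<ge> 0 \<Longrightarrow>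
        \<bar>k \<tau> s' - k t s'\<bar> \<le> C * \<bar>\<nu> \<tau> t\<bar> \<and> \<bar>l \<tau> s' - l t s'\<bar> \<le> C * \<bar>\<nu> \<tau> t\<bar>"
      using unif[of "s / 2" "2 * s"] ts by auto
    define \<mu> where "\<mu> \<tau> = (if \<tau> = t then 0 else C * \<bar>\<nu> \<tau> t\<bar>)" for \<tau>
    have "((\<lambda>\<tau>. C * \<bar>\<nu> \<tau> t\<bar>) \<longlongrightarrow> C * \<bar>0\<bar>) (at t within {0..})"
      by (intro tendsto_intros nu ts)
    then have "((\<lambda>\<tau>. C * \<bar>\<nu> \<tau> t\<bar>) \<longlongrightarrow> \<mu> t) (at t within {0..})" by (simp add: \<mu>_def)
    then have "(\<mu> \<longlongrightarrow> \<mu> t) (at t within {0..})"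
      by (rule Lim_transform_eventually) (auto simp: \<mu>_def eventually_at_filter intro!: always_eventually)
    then have "(\<mu> \<circ> \<tau>) \<longlonglongrightarrow> \<mu> t"
      using \<tau> continuous_within_sequentially[of t "{0..}" \<mu>] by (simp add: continuous_within)
    then have 1: "(\<lambda>n. \<mu> (\<tau> n)) \<longlonglongrightarrow> 0" by (simp add: \<mu>_def comp_def)
    have 2: "(\<lambda>n. f t (\<sigma> n)) \<longlonglongrightarrow> f t s" by (rule isCont_tendsto_compose[OF f(1) \<sigma>])
    have "\<forall>\<^sub>F n in sequentially. \<sigma> n \<in> {s / 2 <..< 2 * s}"
      by (rule topological_tendstoD[OF \<sigma>]) (use ts in auto)
    then have ev: "\<forall>\<^sub>F n in sequentially. norm (f (\<tau> n) (\<sigma> n) - f t (\<sigma> n)) \<le> \<mu> (\<tau> n)"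
    proof eventually_elim
      case (elim n)
      have "\<sigma> n \<in> {s / 2 .. 2 * s}" using elim by auto
      from C(2)[OF this ts(1) \<tau>(2)[of n]] f(2) show ?case by (auto simp: \<mu>_def)
    qed
    have "(\<lambda>n. f (\<tau> n) (\<sigma> n) - f t (\<sigma> n)) \<longlonglongrightarrow> 0" by (rule Lim_null_comparison[OF ev 1])
    from tendsto_add[OF this 2] have "(\<lambda>n. f (\<tau> n) (\<sigma> n)) \<longlonglongrightarrow> f t s" by simp
    then show "((\<lambda>(t, s). f t s) \<circ> X) \<longlonglongrightarrow> (case (t, s) of (t, s) \<Rightarrow> f t s)"
      by (simp add: comp_def \<tau>_def \<sigma>_def case_prod_beta)
  qed
  define P where "P = {0::real<..} \<times> {0::real<..}"
  have P: "open P" unfolding P_def by (intro open_Times) auto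
  have total: "((\<lambda>(t, s). k t s) has_derivative (\<lambda>(dt, ds). (l t s + S s) * dt + l t s * ds)) (at (t, s))"
    if ts: "t > 0" "s > 0" for t s
  proof -
    have "((\<lambda>(t, s). k t s) has_derivative (\<lambda>(dt, ds). (l t s + S s) * dt + blinfun_apply (blinfun_mult_right (l t s)) ds)) (at (t, s) within {0<..} \<times> {0<..})"
    proof (rule has_derivative_partialsI[where fy = "\<lambda>t s. blinfun_mult_right (l t s)"])
      show "((\<lambda>x. k x s) has_derivative (*) (l t s + S s)) (at t within {0<..})"
        using dt[OF ts] by (auto simp: has_field_derivative_def intro: has_derivative_at_withinI)
      show "(k t' has_derivative blinfun_apply (blinfun_mult_right (l t' s'))) (at s' within {0<..})"
        if "t' \<in> {0<..}" "s' \<in> {0<..}" for t' s'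
        using ds[of t' s'] that by (auto simp: has_field_derivative_def intro: has_derivative_at_withinI)
      have "continuous (at (t, s) within {0<..} \<times> {0<..}) (\<lambda>(t, s). l t s)"
        by (rule continuous_within_subset[OF joint]) (use ts lc in auto)
      then have "continuous (at (t, s) within {0<..} \<times> {0<..}) (\<lambda>x. blinfun_mult_right (case x of (t, s) \<Rightarrow> l t s))"
        by (rule bounded_linear.continuous[OF bounded_linear_blinfun_mult_right])
      then show "continuous (at (t, s) within {0<..} \<times> {0<..}) (\<lambda>(t, s). blinfun_mult_right (l t s))"
        by (simp add: case_prod_beta')
    qed (use ts in auto)
    moreover have "at (t, s) within {0<..} \<times> {0<..} = at (t, s)"
      using at_within_open[OF _ P, of "(t, s)"] ts by (simp add: P_def)
    ultimately show ?thesis by simp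
  qed
  define g where "g r = k r (s + t - r) + A (s + t - r)" for r
  have A_cont: "continuous_on {0<..} A"
    by (rule DERIV_continuous_on[OF has_field_derivative_at_within[OF A]]) simp
  have "g t = g 0"
  proof (cases "t = 0")
    case False
    show ?thesis
    proof (rule DERIV_isconst_end[of 0 t g])
      show "0 < t" using t False by simp
      have "continuous_on ({0..} \<times> {0<..}) (\<lambda>(t, s). k t s)"
        unfolding continuous_on_eq_continuous_within using joint DERIV_isCont[OF ds] by auto
      then have "continuous_on {0..t} (\<lambda>r. (\<lambda>(t, s). k t s) (r, s + t - r))"
        by (rule continuous_on_compose2) (use s in \<open>auto intro!: continuous_intros\<close>)
      moreover have "continuous_on {0..t} (\<lambda>r. A (s + t - r))"
        by (rule continuous_on_compose2[OF A_cont]) (use s in \<open>auto intro!: continuous_intros\<close>)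
      ultimately show "continuous_on {0..t} g" unfolding g_def by (auto intro!: continuous_intros)
      show "(g has_real_derivative 0) (at r)" if r: "0 < r" "r < t" for r
      proof -
        have pos: "s + t - r > 0" using r s by simp
        have "((\<lambda>r. (r, s + t - r)) has_derivative (\<lambda>h. (h, - h))) (at r)"
          by (auto intro!: derivative_eq_intros)
        from has_derivative_compose[OF this total[OF r(1) pos]]
        have "((\<lambda>r. k r (s + t - r)) has_derivative (\<lambda>h. (l r (s + t - r) + S (s + t - r)) * h + l r (s + t - r) * (- h))) (at r)"
          by simp
        moreover have "(\<lambda>h. (l r (s + t - r) + S (s + t - r)) * h + l r (s + t - r) * (- h)) = (\<lambda>h. S (s + t - r) * h)"
          by (auto simp: algebra_simps)
        ultimately have "((\<lambda>r. k r (s + t - r)) has_derivative (\<lambda>h. S (s + t - r) * h)) (at r)" by simp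
        then have "((\<lambda>r. k r (s + t - r)) has_real_derivative S (s + t - r)) (at r)"
          by (simp add: has_field_derivative_def)
        moreover have "((\<lambda>r. A (s + t - r)) has_real_derivative S (s + t - r) * (-1)) (at r)"
          by (rule DERIV_chain2[where f = A and g = "\<lambda>r. s + t - r" and x = r])
             (use A[OF pos] in \<open>auto intro!: derivative_eq_intros\<close>)
        from DERIV_add[OF calculation this] show ?thesis unfolding g_def by simp
      qed
    qed
  qed simp
  then show ?thesis using init[of "s + t"] s t by (simp add: g_def)
qed

section \<open>Bounded functionals and the Bochner integral\<close>

lemma borel_measurable_time_AE:
  fixes f g :: "real \<Rightarrow> real"
  assumes f: "f \<in> borel_measurable time" and ae: "AE t in time. f t = g t"
  shows "g \<in> borel_measurable time"
proof -
  have "(\<lambda>t. indicator {0<..} t *\<^sub>R f t) \<in> borel_measurable lebesgue"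
    using f by (subst (asm) borel_measurable_restrict_space_iff) auto
  moreover have "AE t in lebesgue. t \<in> {0<..} \<longrightarrow> f t = g t"
    using ae by (subst (asm) AE_restrict_space_iff) auto
  then have "AE t in lebesgue. indicator {0<..} t *\<^sub>R f t = indicator {0<..} t *\<^sub>R g t"
    by eventually_elim (auto simp: indicator_def)
  ultimately have "(\<lambda>t. indicator {0<..} t *\<^sub>R g t) \<in> borel_measurable lebesgue"
    by (rule borel_measurable_AE)
  then show ?thesis by (subst borel_measurable_restrict_space_iff) auto
qed

text \<open>Applying a bounded linear functional to functions with values in \<open>X\<close> reduces their
  integrals and weak time derivatives to scalar ones. The seminorm \<open>N\<close> enters only
  through the bound of the functional, so that \<open>L\<^sub>2\<close> and the dual Sobolev space
  are covered alike.\<close>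

locale bounded_functional =
  fixes X :: "('c \<Rightarrow> real) set" and N :: "('c \<Rightarrow> real) \<Rightarrow> real" and \<L> :: "('c \<Rightarrow> real) \<Rightarrow> real" and C :: real
  assumes closed: "\<And>f g a b. f \<in> X \<Longrightarrow> g \<in> X \<Longrightarrow> (\<lambda>c. a * f c + b * g c) \<in> X"
    and lin: "\<And>f g a b. f \<in> X \<Longrightarrow> g \<in> X \<Longrightarrow> \<L> (\<lambda>c. a * f c + b * g c) = a * \<L> f + b * \<L> g"
    and bound: "\<And>f. f \<in> X \<Longrightarrow> \<bar>\<L> f\<bar> \<le> C * N f"
    and C_pos: "C > 0"
begin

lemma zero: "f \<in> X \<Longrightarrow> (\<lambda>c. 0) \<in> X" "f \<in> X \<Longrightarrow> \<L> (\<lambda>c. 0) = 0"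
  using closed[of f f 0 0] lin[of f f 0 0] by auto

lemma scale: "f \<in> X \<Longrightarrow> \<L> (\<lambda>c. a * f c) = a * \<L> f"
  using lin[of f f a 0] by simp

lemma diff: "f \<in> X \<Longrightarrow> g \<in> X \<Longrightarrow> (\<lambda>c. f c - g c) \<in> X" "f \<in> X \<Longrightarrow> g \<in> X \<Longrightarrow> \<L> (\<lambda>c. f c - g c) = \<L> f - \<L> g"
  using closed[of f g 1 "-1"] lin[of f g 1 "-1"] by auto

lemma sum:
  assumes "finite Y" "Y \<subseteq> X" "Y \<noteq> {}"
  shows "(\<lambda>c. \<Sum>y\<in>Y. a y * y c) \<in> X \<and> \<L> (\<lambda>c. \<Sum>y\<in>Y. a y * y c) = (\<Sum>y\<in>Y. a y * \<L> y)"
  using assms(1,3,2)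
proof (induction Y rule: finite_ne_induct)
  case (singleton y)
  then show ?case using closed[of y y "a y" 0] scale[of y "a y"] by simp
next
  case (insert y Y)
  then show ?case using closed[of y "\<lambda>c. \<Sum>y\<in>Y. a y * y c" "a y" 1] lin[of y "\<lambda>c. \<Sum>y\<in>Y. a y * y c" "a y" 1] by simp
qed

lemma limit:
  assumes "(\<lambda>k. N (\<lambda>c. f k c - g c)) \<longlonglongrightarrow> 0" "\<And>k. f k \<in> X" "g \<in> X"
  shows "(\<lambda>k. \<L> (f k)) \<longlonglongrightarrow> \<L> g"
proof -
  have "(\<lambda>k. C * N (\<lambda>c. f k c - g c)) \<longlonglongrightarrow> 0"
    using tendsto_mult[OF tendsto_const[of C] assms(1)] by simp
  then have "(\<lambda>k. \<L> (f k) - \<L> g) \<longlonglongrightarrow> 0"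
    by (rule Lim_null_comparison[rotated])
       (use bound[OF diff(1)[OF assms(2,3)]] diff(2)[OF assms(2,3)] in \<open>auto intro!: always_eventually\<close>)
  then show ?thesis by (rule LIM_zero_cancel)
qed

lemma simple:
  fixes s :: "real \<Rightarrow> 'c \<Rightarrow> real"
  assumes s: "simple_function time s" "s ` space time \<subseteq> X" and fin: "emeasure time {t \<in> space time. s t \<noteq> (\<lambda>c. 0)} \<noteq> \<infinity>"
  shows "integrable time (\<lambda>t. \<L> (s t))" "(LINT t|time. \<L> (s t)) = \<L> (simple_integral_fun s)" "simple_integral_fun s \<in> X"
proof -
  define Y where "Y = s ` space time"
  have Y: "finite Y" "Y \<subseteq> X" "Y \<noteq> {}" using s by (auto simp: Y_def simple_function_def)
  define A where "A y = s -` {y} \<inter> space time" for y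
  have A[measurable]: "A y \<in> sets time" for y
  proof (cases "y \<in> Y")
    case False
    then have "A y = {}" by (auto simp: A_def Y_def)
    then show ?thesis by simp
  qed (use s(1) in \<open>auto simp: simple_function_def A_def Y_def\<close>)
  have fin': "emeasure time (A y) < \<infinity>" if "y \<noteq> (\<lambda>c. 0)" for y
  proof -
    have "{t \<in> space time. s t \<noteq> (\<lambda>c. 0)} = s -` (Y - {\<lambda>c. 0}) \<inter> space time" by (auto simp: Y_def)
    also have "\<dots> = (\<Union>y\<in>Y - {\<lambda>c. 0}. A y)" by (auto simp: A_def)
    finally have "{t \<in> space time. s t \<noteq> (\<lambda>c. 0)} \<in> sets time" using Y(1) by auto
    moreover have "A y \<subseteq> {t \<in> space time. s t \<noteq> (\<lambda>c. 0)}" using that by (auto simp: A_def)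
    ultimately have "emeasure time (A y) \<le> emeasure time {t \<in> space time. s t \<noteq> (\<lambda>c. 0)}" by (intro emeasure_mono)
    also have "\<dots> < \<infinity>" using fin by (simp add: less_top[symmetric])
    finally show ?thesis .
  qed
  have i: "integrable time (\<lambda>t. indicator (A y) t * \<L> y)" "(LINT t|time. indicator (A y) t * \<L> y) = measure time (A y) * \<L> y"
    if "y \<in> Y" for y
  proof -
    have "integrable time (\<lambda>t. indicator (A y) t * \<L> y) \<and> (LINT t|time. indicator (A y) t * \<L> y) = measure time (A y) * \<L> y"
    proof (cases "y = (\<lambda>c. 0)")
      case True
      then have "\<L> y = 0" using zero(2) that Y by blast
      then show ?thesis by simp
    next
      case False
      have "integrable time (indicator (A y) :: real \<Rightarrow> real)" using fin'[OF False] by (intro integrable_real_indicator A)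
      then show ?thesis by (simp add: A_def Int_absorb2 space_restrict_space)
    qed
    then show "integrable time (\<lambda>t. indicator (A y) t * \<L> y)" "(LINT t|time. indicator (A y) t * \<L> y) = measure time (A y) * \<L> y" by auto
  qed
  have eq: "\<L> (s t) = (\<Sum>y\<in>Y. indicator (A y) t * \<L> y)" if "t \<in> space time" for t
  proof -
    have "(\<Sum>y\<in>Y. indicator (A y) t * \<L> y) = (\<Sum>y\<in>Y. if y = s t then \<L> y else 0)"
      using that by (intro sum.cong) (auto simp: A_def)
    then show ?thesis using Y(1) that by (simp add: Y_def)
  qed
  have "integrable time (\<lambda>t. \<Sum>y\<in>Y. indicator (A y) t * \<L> y)" using i by (intro Bochner_Integration.integrable_sum) auto
  then show "integrable time (\<lambda>t. \<L> (s t))" by (subst Bochner_Integration.integrable_cong[OF refl eq]) auto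
  have "(LINT t|time. \<L> (s t)) = (LINT t|time. (\<Sum>y\<in>Y. indicator (A y) t * \<L> y))"
    by (rule Bochner_Integration.integral_cong[OF refl eq])
  also have "\<dots> = (\<Sum>y\<in>Y. measure time (A y) * \<L> y)"
  proof -
    have "(LINT t|time. (\<Sum>y\<in>Y. indicator (A y) t * \<L> y)) = (\<Sum>y\<in>Y. LINT t|time. indicator (A y) t * \<L> y)"
      by (rule Bochner_Integration.integral_sum[OF i(1)])
    also have "\<dots> = (\<Sum>y\<in>Y. measure time (A y) * \<L> y)" by (rule sum.cong[OF refl i(2)])
    finally show ?thesis .
  qed
  finally show "(LINT t|time. \<L> (s t)) = \<L> (simple_integral_fun s)"
    using sum[OF Y, of "\<lambda>y. measure time (A y)"] by (simp add: simple_integral_fun_def Y_def A_def)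
  show "simple_integral_fun s \<in> X"
    using sum[OF Y, of "\<lambda>y. measure time (A y)"] by (simp add: simple_integral_fun_def Y_def A_def)
qed

text \<open>After application of the functional the simple functions that define the integral converge in
  \<open>L\<^sub>1\<close>. Measurability of the limit comes from the second sequence, the one that
  converges almost everywhere.\<close>

lemma bochner_integral:
  assumes int: "has_bochner_integral_in X N u I"
  shows "integrable time (\<lambda>t. \<L> (u t))" "(LINT t|time. \<L> (u t)) = \<L> I"
proof -
  have uX: "AE t in time. u t \<in> X" and IX: "I \<in> X"
    using int by (auto simp: has_bochner_integral_in_def strongly_measurable_def)
  have "\<exists>s. (\<forall>k. simple_function time (s k) \<and> s k ` space time \<subseteq> X) \<and> (AE t in time. (\<lambda>k. N (\<lambda>c. s k t c - u t c)) \<longlonglongrightarrow> 0)"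
    using int unfolding has_bochner_integral_in_def strongly_measurable_def by (elim conjE)
  then obtain s' where s'0: "\<forall>k. simple_function time (s' k) \<and> s' k ` space time \<subseteq> X"
    and s'3: "AE t in time. (\<lambda>k. N (\<lambda>c. s' k t c - u t c)) \<longlonglongrightarrow> 0"
    by (elim exE conjE)
  note s' = s'0[rule_format, THEN conjunct1] s'0[rule_format, THEN conjunct2] s'3
  have "\<exists>s. (\<forall>k. simple_function time (s k) \<and> s k ` space time \<subseteq> X \<and> emeasure time {t \<in> space time. s k t \<noteq> (\<lambda>c. 0)} \<noteq> \<infinity>) \<and>
      (\<lambda>k. \<integral>\<^sup>+t. ennreal (N (\<lambda>c. s k t c - u t c)) \<partial>time) \<longlonglongrightarrow> 0 \<and>
      (\<lambda>k. N (\<lambda>c. simple_integral_fun (s k) c - I c)) \<longlonglongrightarrow> 0"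
    using int unfolding has_bochner_integral_in_def by (elim conjE)
  then obtain s where s0: "\<forall>k. simple_function time (s k) \<and> s k ` space time \<subseteq> X \<and> emeasure time {t \<in> space time. s k t \<noteq> (\<lambda>c. 0)} \<noteq> \<infinity>"
    and L1: "(\<lambda>k. \<integral>\<^sup>+t. ennreal (N (\<lambda>c. s k t c - u t c)) \<partial>time) \<longlonglongrightarrow> 0"
    and SI: "(\<lambda>k. N (\<lambda>c. simple_integral_fun (s k) c - I c)) \<longlonglongrightarrow> 0"
    by (elim exE conjE)
  note s = s0[rule_format, THEN conjunct1] s0[rule_format, THEN conjunct2, THEN conjunct1] s0[rule_format, THEN conjunct2, THEN conjunct2]
  have AE_space: "AE t in time. t \<in> space time" by (rule AE_space)
  have meas: "(\<lambda>t. \<L> (u t)) \<in> borel_measurable time"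
  proof (rule borel_measurable_time_AE)
    have m: "(\<lambda>t. \<L> (s' k t)) \<in> borel_measurable time" for k
      using simple_function_compose[OF s'(1), of \<L> k] by (auto simp: comp_def intro: borel_measurable_simple_function)
    show "(\<lambda>t. lim (\<lambda>k. \<L> (s' k t))) \<in> borel_measurable time"
      by (rule borel_measurable_lim_metric[OF m])
    show "AE t in time. lim (\<lambda>k. \<L> (s' k t)) = \<L> (u t)"
      using uX s'(3) AE_space
    proof eventually_elim
      case (elim t)
      have "s' k t \<in> X" for k using s'(2)[of k] elim by auto
      then show ?case by (intro limI limit elim)
    qed
  qed
  note S = simple[OF s(1,2,3)]
  have mS[measurable]: "(\<lambda>t. \<L> (s k t)) \<in> borel_measurable time" for k
    by (rule borel_measurable_integrable[OF S(1)])
  note [measurable] = meas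
  have conv: "(\<lambda>k. \<integral>\<^sup>+t. norm (\<L> (s k t) - \<L> (u t)) \<partial>time) \<longlonglongrightarrow> 0"
  proof (rule tendsto_sandwich[OF _ _ tendsto_const])
    have "(\<lambda>k. ennreal C * (\<integral>\<^sup>+t. ennreal (N (\<lambda>c. s k t c - u t c)) \<partial>time)) \<longlonglongrightarrow> ennreal C * 0"
      by (intro tendsto_intros L1) auto
    then show "(\<lambda>k. ennreal C * (\<integral>\<^sup>+t. ennreal (N (\<lambda>c. s k t c - u t c)) \<partial>time)) \<longlonglongrightarrow> 0" by simp
    show "\<forall>\<^sub>F k in sequentially. (\<integral>\<^sup>+t. norm (\<L> (s k t) - \<L> (u t)) \<partial>time) \<le> ennreal C * (\<integral>\<^sup>+t. ennreal (N (\<lambda>c. s k t c - u t c)) \<partial>time)"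
    proof (intro always_eventually allI)
      fix k
      have "(\<integral>\<^sup>+t. norm (\<L> (s k t) - \<L> (u t)) \<partial>time) = (\<integral>\<^sup>+t. ennreal C * (ennreal (norm (\<L> (s k t) - \<L> (u t)) / C)) \<partial>time)"
        using C_pos by (intro nn_integral_cong) (simp flip: ennreal_mult')
      also have "\<dots> = ennreal C * (\<integral>\<^sup>+t. ennreal (norm (\<L> (s k t) - \<L> (u t)) / C) \<partial>time)"
        by (rule nn_integral_cmult) measurable
      also have "\<dots> \<le> ennreal C * (\<integral>\<^sup>+t. ennreal (N (\<lambda>c. s k t c - u t c)) \<partial>time)"
      proof (intro mult_left_mono nn_integral_mono_AE)
        show "AE t in time. ennreal (norm (\<L> (s k t) - \<L> (u t)) / C) \<le> ennreal (N (\<lambda>c. s k t c - u t c))"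
          using uX AE_space
        proof eventually_elim
          case (elim t)
          have "s k t \<in> X" using s(2)[of k] elim by auto
          from bound[OF diff(1)[OF this elim(1)]] diff(2)[OF this elim(1)] show ?case
            using C_pos by (intro ennreal_leI) (simp add: pos_divide_le_eq mult.commute)
        qed
      qed simp
      finally show "(\<integral>\<^sup>+t. norm (\<L> (s k t) - \<L> (u t)) \<partial>time) \<le> ennreal C * (\<integral>\<^sup>+t. ennreal (N (\<lambda>c. s k t c - u t c)) \<partial>time)" .
    qed
  qed auto
  show int_u: "integrable time (\<lambda>t. \<L> (u t))"
  proof (rule integrableI_bounded[OF meas])
    have "\<forall>\<^sub>F k in sequentially. (\<integral>\<^sup>+t. norm (\<L> (s k t) - \<L> (u t)) \<partial>time) < 1"
      using order_tendstoD(2)[OF conv] by simp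
    then obtain k where k: "(\<integral>\<^sup>+t. norm (\<L> (s k t) - \<L> (u t)) \<partial>time) < 1"
      by (auto simp: eventually_sequentially)
    have "(\<integral>\<^sup>+t. norm (\<L> (u t)) \<partial>time) \<le> (\<integral>\<^sup>+t. ennreal (norm (\<L> (s k t))) + ennreal (norm (\<L> (s k t) - \<L> (u t))) \<partial>time)"
    proof (intro nn_integral_mono)
      fix t
      have "norm (\<L> (u t)) \<le> norm (\<L> (s k t)) + norm (\<L> (s k t) - \<L> (u t))"
        by (simp add: norm_triangle_sub abs_minus_commute)
      then show "ennreal (norm (\<L> (u t))) \<le> ennreal (norm (\<L> (s k t))) + ennreal (norm (\<L> (s k t) - \<L> (u t)))"
        by (simp add: ennreal_leI flip: ennreal_plus)
    qed
    also have "\<dots> = (\<integral>\<^sup>+t. norm (\<L> (s k t)) \<partial>time) + (\<integral>\<^sup>+t. norm (\<L> (s k t) - \<L> (u t)) \<partial>time)"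
      by (rule nn_integral_add) measurable
    also have "\<dots> < \<infinity>"
      using S(1)[of k] k unfolding integrable_iff_bounded by (auto simp: less_top[symmetric])
    finally show "(\<integral>\<^sup>+t. norm (\<L> (u t)) \<partial>time) < \<infinity>" .
  qed
  have "(\<lambda>k. LINT t|time. \<L> (s k t)) \<longlonglongrightarrow> (LINT t|time. \<L> (u t))"
    by (rule tendsto_L1_int[OF S(1) int_u conv])
  moreover have "(\<lambda>k. LINT t|time. \<L> (s k t)) \<longlonglongrightarrow> \<L> I"
    unfolding S(2) by (rule limit[OF SI S(3) IX])
  ultimately show "(LINT t|time. \<L> (u t)) = \<L> I" by (rule LIMSEQ_unique)
qed

text \<open>Homogeneity is demanded for all functions because \<open>v t\<close> is known to be in
  \<open>X\<close> only after multiplication by \<open>\<phi> t\<close>, which may vanish.\<close>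

lemma weak_time_deriv_pairing:
  assumes wd: "weak_time_deriv X N u v" and hom: "\<forall>f a. \<L> (\<lambda>c. a * f c) = a * \<L> f" and \<phi>: "\<phi> \<in> test_funs {0<..}"
  shows "AE t in time. (\<lambda>c. \<phi> t * v t c) \<in> X" "integrable time (\<lambda>t. deriv \<phi> t * \<L> (u t))"
    "integrable time (\<lambda>t. \<phi> t * \<L> (v t))" "(LINT t|time. deriv \<phi> t * \<L> (u t)) = - (LINT t|time. \<phi> t * \<L> (v t))"
proof -
  obtain I where I: "has_bochner_integral_in X N (\<lambda>t c. deriv \<phi> t * u t c) I"
      "has_bochner_integral_in X N (\<lambda>t c. \<phi> t * v t c) (\<lambda>c. - I c)"
    using wd \<phi> by (auto simp: weak_time_deriv_def)
  show "AE t in time. (\<lambda>c. \<phi> t * v t c) \<in> X" using I(2) by (simp add: has_bochner_integral_in_def strongly_measurable_def)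
  show "integrable time (\<lambda>t. deriv \<phi> t * \<L> (u t))" "integrable time (\<lambda>t. \<phi> t * \<L> (v t))"
    using bochner_integral(1)[OF I(1)] bochner_integral(1)[OF I(2)] by (simp_all add: hom)
  have "\<L> (\<lambda>c. - I c) = - \<L> I" using hom[rule_format, of "-1" I] by simp
  then show "(LINT t|time. deriv \<phi> t * \<L> (u t)) = - (LINT t|time. \<phi> t * \<L> (v t))"
    using bochner_integral(2)[OF I(1)] bochner_integral(2)[OF I(2)] by (simp add: hom)
qed

end

section \<open>Testing the solutions with the heat kernel\<close>

lemma integral_time_cong_AE:
  fixes f g :: "real \<Rightarrow> real"
  assumes "integrable time f" "AE t in time. f t = g t"
  shows "(LINT t|time. g t) = (LINT t|time. f t)"
proof -
  have "f \<in> borel_measurable time" using assms(1) by simp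
  then have "(LINT t|time. f t) = (LINT t|time. g t)"
    using borel_measurable_time_AE[OF _ assms(2)] assms(2) by (intro integral_cong_AE)
  then show ?thesis by simp
qed

lemma dual_embed_diff:
  assumes "L1_plus_Linf f" "L1_plus_Linf g" "bounded_integrable \<eta>"
  shows "dual_embed (\<lambda>x. f x - g x) \<eta> = dual_embed f \<eta> - dual_embed g \<eta>"
  using integrable_majorant[OF assms(1,3)] integrable_majorant[OF assms(2,3)]
  by (simp add: dual_embed_def left_diff_distrib)

lemma dual_embed_cong_AE:
  assumes "AE x in lebesgue. f x = g x" "L1_plus_Linf f" "L1_plus_Linf g" "bounded_integrable \<eta>"
  shows "dual_embed f \<eta> = dual_embed g \<eta>"
  unfolding dual_embed_def
  using assms(1) integrable_majorant[OF assms(2,4)] integrable_majorant[OF assms(3,4)]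
  by (intro integral_cong_AE) (auto intro: borel_measurable_integrable)

lemma bounded_integrable_heat_gauss: "s > 0 \<Longrightarrow> bounded_integrable (gauss (1 / (4 * s)) m)"
  using bounded_integrable_gauss[of "1 / (4 * s)" 1 m] by simp

lemma heat_pair_dual_embed_diff:
  assumes "L1_plus_Linf f" "L1_plus_Linf g" "s > 0"
  shows "heat_pair lam0 m (dual_embed (\<lambda>x. f x - g x)) s = heat_pair lam0 m (dual_embed f) s - heat_pair lam0 m (dual_embed g) s"
    "heat_pair' lam0 m (dual_embed (\<lambda>x. f x - g x)) s = heat_pair' lam0 m (dual_embed f) s - heat_pair' lam0 m (dual_embed g) s"
proof -
  note g = dual_embed_diff[OF assms(1,2) bounded_integrable_heat_gauss[OF assms(3)]]
  have q: "(\<Sum>b\<in>Basis. dual_embed (\<lambda>x. f x - g x) (quad_gauss (1 / (4 * s)) m b)) =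
      (\<Sum>b\<in>Basis. dual_embed f (quad_gauss (1 / (4 * s)) m b)) - (\<Sum>b\<in>Basis. dual_embed g (quad_gauss (1 / (4 * s)) m b))"
    unfolding sum_subtractf[symmetric] by (intro sum.cong refl dual_embed_diff assms bounded_integrable_quad_gauss)
  show "heat_pair lam0 m (dual_embed (\<lambda>x. f x - g x)) s = heat_pair lam0 m (dual_embed f) s - heat_pair lam0 m (dual_embed g) s"
    unfolding heat_pair_def g by (rule right_diff_distrib)
  show "heat_pair' lam0 m (dual_embed (\<lambda>x. f x - g x)) s = heat_pair' lam0 m (dual_embed f) s - heat_pair' lam0 m (dual_embed g) s"
    unfolding heat_pair'_def g q by (simp add: algebra_simps diff_divide_distrib)
qed

lemma heat_pair_cong_AE:
  assumes "AE x in lebesgue. f x = g x" "L1_plus_Linf f" "L1_plus_Linf g" "s > 0"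
  shows "heat_pair lam0 m (dual_embed f) s = heat_pair lam0 m (dual_embed g) s"
    "heat_pair' lam0 m (dual_embed f) s = heat_pair' lam0 m (dual_embed g) s"
  using dual_embed_cong_AE[OF assms(1-3) bounded_integrable_heat_gauss[OF assms(4)]]
    dual_embed_cong_AE[OF assms(1-3) bounded_integrable_quad_gauss[OF _ assms(4)]]
  by (simp_all add: heat_pair_def heat_pair'_def)

text \<open>A common Lipschitz bound for both pairings, in the form that
  \<open>transport_along_characteristics\<close> asks for; \<open>n\<close> stands for the distance
  of \<open>Z\<close> and \<open>Y\<close> in whichever space they belong to.\<close>

lemma heat_pair_bound:
  fixes m :: "'a::euclidean_space"
  assumes ab: "0 < \<alpha>" "\<alpha> \<le> \<beta>" and M: "M > 0"
  obtains C where "\<And>s n Z Y. s \<in> {\<alpha>..\<beta>} \<Longrightarrow> \<bar>Z (gauss (1 / (4 * s)) m) - Y (gauss (1 / (4 * s)) m)\<bar> \<le> M * n \<Longrightarrow>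
     (\<And>b. b \<in> Basis \<Longrightarrow> \<bar>Z (quad_gauss (1 / (4 * s)) m b) - Y (quad_gauss (1 / (4 * s)) m b)\<bar> \<le> M * n) \<Longrightarrow>
     \<bar>heat_pair lam0 m Z s - heat_pair lam0 m Y s\<bar> \<le> C * n \<and> \<bar>heat_pair' lam0 m Z s - heat_pair' lam0 m Y s\<bar> \<le> C * n"
proof -
  define h where "h = heat_factor lam0 TYPE('a)"
  have "bounded (h ` {\<alpha>..\<beta>})" unfolding h_def
    by (intro compact_imp_bounded compact_continuous_image continuous_on_subset[OF heat_factor_continuous]) (use ab in auto)
  then obtain H where H: "\<forall>y\<in>h ` {\<alpha>..\<beta>}. norm y \<le> H" unfolding bounded_iff by blast
  have H0: "H \<ge> 0" using H[rule_format, OF imageI[of \<alpha>]] ab by (auto intro: order_trans[OF norm_ge_zero])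
  define D where "D = real DIM('a) / (4 * \<alpha>\<^sup>2) + (real DIM('a) / (2 * \<alpha>) + \<bar>lam0\<bar>)"
  have D0: "D \<ge> 0" using ab by (simp add: D_def)
  show ?thesis
  proof (rule that[of "H * M * (1 + D)"])
    fix s n Z Y
    assume s: "s \<in> {\<alpha>..\<beta>}" and g: "\<bar>Z (gauss (1 / (4 * s)) m) - Y (gauss (1 / (4 * s)) m)\<bar> \<le> M * n"
      and qd: "\<And>b. b \<in> Basis \<Longrightarrow> \<bar>Z (quad_gauss (1 / (4 * s)) m b) - Y (quad_gauss (1 / (4 * s)) m b)\<bar> \<le> M * n"
    define G where "G = Z (gauss (1 / (4 * s)) m) - Y (gauss (1 / (4 * s)) m)"
    define Q where "Q b = Z (quad_gauss (1 / (4 * s)) m b) - Y (quad_gauss (1 / (4 * s)) m b)" for b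
    have Mn: "M * n \<ge> 0" using g by linarith
    then have n0: "n \<ge> 0" using M by (simp add: zero_le_mult_iff)
    have hs: "\<bar>h s\<bar> \<le> H" using H s by auto
    have e1: "heat_pair lam0 m Z s - heat_pair lam0 m Y s = h s * G"
      by (simp add: heat_pair_def h_def G_def algebra_simps)
    have e2: "heat_pair' lam0 m Z s - heat_pair' lam0 m Y s = h s * ((\<Sum>b\<in>Basis. Q b) / (4 * s\<^sup>2) - (real DIM('a) / (2 * s) + lam0) * G)"
      by (simp add: heat_pair'_def h_def G_def Q_def sum_subtractf diff_divide_distrib algebra_simps)
    have "\<bar>\<Sum>b\<in>Basis. Q b\<bar> \<le> real DIM('a) * (M * n)"
    proof -
      have "\<bar>\<Sum>b\<in>Basis. Q b\<bar> \<le> (\<Sum>b\<in>(Basis::'a set). \<bar>Q b\<bar>)" by (rule sum_abs)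
      also have "\<dots> \<le> (\<Sum>b\<in>(Basis::'a set). M * n)" using qd by (intro sum_mono) (simp add: Q_def)
      finally show ?thesis by simp
    qed
    then have b1: "\<bar>(\<Sum>b\<in>Basis. Q b) / (4 * s\<^sup>2)\<bar> \<le> real DIM('a) * (M * n) / (4 * \<alpha>\<^sup>2)"
      unfolding abs_divide using s ab by (intro frac_le) auto
    have "real DIM('a) / (2 * s) \<le> real DIM('a) / (2 * \<alpha>)" using s ab by (intro divide_left_mono) auto
    then have "\<bar>real DIM('a) / (2 * s) + lam0\<bar> \<le> real DIM('a) / (2 * \<alpha>) + \<bar>lam0\<bar>"
      using s ab by (intro order_trans[OF abs_triangle_ineq] add_mono) auto
    then have b2: "\<bar>(real DIM('a) / (2 * s) + lam0) * G\<bar> \<le> (real DIM('a) / (2 * \<alpha>) + \<bar>lam0\<bar>) * (M * n)"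
      unfolding abs_mult using g by (intro mult_mono) (auto simp: G_def)
    have "\<bar>(\<Sum>b\<in>Basis. Q b) / (4 * s\<^sup>2) - (real DIM('a) / (2 * s) + lam0) * G\<bar> \<le> D * (M * n)"
    proof -
      have "D * (M * n) = real DIM('a) * (M * n) / (4 * \<alpha>\<^sup>2) + (real DIM('a) / (2 * \<alpha>) + \<bar>lam0\<bar>) * (M * n)"
        by (simp add: D_def algebra_simps)
      then show ?thesis
        using b1 b2 abs_triangle_ineq4[of "(\<Sum>b\<in>Basis. Q b) / (4 * s\<^sup>2)" "(real DIM('a) / (2 * s) + lam0) * G"] by linarith
    qed
    then have "\<bar>heat_pair' lam0 m Z s - heat_pair' lam0 m Y s\<bar> \<le> H * (D * (M * n))"
      unfolding e2 abs_mult using hs H0 by (intro mult_mono) auto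
    also have "\<dots> \<le> H * M * (1 + D) * n" using H0 Mn by (simp add: algebra_simps)
    finally have 2: "\<bar>heat_pair' lam0 m Z s - heat_pair' lam0 m Y s\<bar> \<le> H * M * (1 + D) * n" .
    have "\<bar>heat_pair lam0 m Z s - heat_pair lam0 m Y s\<bar> \<le> H * (M * n)"
      unfolding e1 abs_mult using hs H0 g by (intro mult_mono) (auto simp: G_def)
    also have "\<dots> \<le> H * M * (1 + D) * n" using H0 Mn D0 M n0 by (simp add: algebra_simps)
    finally show "\<bar>heat_pair lam0 m Z s - heat_pair lam0 m Y s\<bar> \<le> H * M * (1 + D) * n \<and>
        \<bar>heat_pair' lam0 m Z s - heat_pair' lam0 m Y s\<bar> \<le> H * M * (1 + D) * n" using 2 by simp
  qed
qed

subsection \<open>Two solutions with square integrable data\<close>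

lemma Lp_2: "f \<in> Lp 2 UNIV \<longleftrightarrow> f \<in> borel_measurable lebesgue \<and> integrable lebesgue (\<lambda>x. (f x)\<^sup>2)"
  by (simp add: Lp_UNIV)

lemma Lp_2_lincomb:
  assumes "f \<in> Lp 2 UNIV" "g \<in> Lp 2 UNIV" shows "(\<lambda>x. a * f x + b * g x) \<in> Lp 2 UNIV"
proof -
  have i: "integrable lebesgue (\<lambda>x. 2 * a\<^sup>2 * (f x)\<^sup>2 + 2 * b\<^sup>2 * (g x)\<^sup>2)"
    using assms by (auto simp: Lp_2)
  have m: "(\<lambda>x. a * f x + b * g x) \<in> borel_measurable lebesgue" using assms by (auto simp: Lp_2)
  have "(a * f x + b * g x)\<^sup>2 \<le> 2 * a\<^sup>2 * (f x)\<^sup>2 + 2 * b\<^sup>2 * (g x)\<^sup>2" for x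
    using zero_le_power2[of "a * f x - b * g x"] by (simp add: power2_eq_square algebra_simps)
  then have "integrable lebesgue (\<lambda>x. (a * f x + b * g x)\<^sup>2)"
    using m by (intro Bochner_Integration.integrable_bound[OF i]) (auto intro!: AE_I2)
  then show ?thesis using m by (simp add: Lp_2)
qed

lemma Lp_2_diff: "f \<in> Lp 2 UNIV \<Longrightarrow> g \<in> Lp 2 UNIV \<Longrightarrow> (\<lambda>x. f x - g x) \<in> Lp 2 UNIV"
  using Lp_2_lincomb[of f g 1 "-1"] by simp

lemma gauss_bounded_Lp:
  assumes "\<eta> \<in> borel_measurable lebesgue" "\<And>x. \<bar>\<eta> x\<bar> \<le> K * gauss d m x" "d > 0" "K > 0" "q > 0"
  shows "\<eta> \<in> Lp q UNIV" "Lp_norm q UNIV \<eta> \<le> K * Lp_norm q UNIV (gauss d m)"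
proof -
  have gi: "integrable lebesgue (gauss (d * q) m)"
    using bounded_integrable_gauss[of "d * q" 1 m] assms by (simp add: bounded_integrable_def)
  have le: "\<bar>\<eta> x\<bar> powr q \<le> K powr q * gauss (d * q) m x" for x
    using powr_mono2[OF _ _ assms(2)[of x], of q] assms gauss_pos[of d m x]
    by (simp add: powr_mult gauss_powr)
  have i: "integrable lebesgue (\<lambda>x. \<bar>\<eta> x\<bar> powr q)"
    using assms(1) le by (intro Bochner_Integration.integrable_bound[OF integrable_mult_right[OF gi, of "K powr q"]]) (auto intro!: AE_I2 simp: gauss_pos less_imp_le)
  then show "\<eta> \<in> Lp q UNIV" using assms by (simp add: Lp_UNIV)
  have "(LINT x|lebesgue. \<bar>\<eta> x\<bar> powr q) \<le> (LINT x|lebesgue. K powr q * gauss (d * q) m x)"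
    by (rule integral_mono[OF i]) (use gi le in auto)
  then have "Lp_norm q UNIV \<eta> \<le> (K powr q * (LINT x|lebesgue. gauss (d * q) m x)) powr (1 / q)"
    unfolding Lp_norm_def lebesgue_on_UNIV_eq using assms by (intro powr_mono2) auto
  also have "\<dots> = K * Lp_norm q UNIV (gauss d m)"
    unfolding Lp_norm_def lebesgue_on_UNIV_eq using assms gauss_pos[of d m] gauss_pos[of "d * q" m]
    by (subst powr_mult) (auto simp: powr_powr gauss_powr less_imp_le)
  finally show "Lp_norm q UNIV \<eta> \<le> K * Lp_norm q UNIV (gauss d m)" .
qed

lemma dual_embed_Lp_2_bound:
  assumes "f \<in> Lp 2 UNIV" "\<eta> \<in> Lp 2 UNIV"
  shows "integrable lebesgue (\<lambda>x. f x * \<eta> x)" "\<bar>dual_embed f \<eta>\<bar> \<le> Lp_norm 2 UNIV f * Lp_norm 2 UNIV \<eta>"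
  using Hoelder_inequality[of 2 2 f UNIV \<eta>] assms by (auto simp: dual_embed_def lebesgue_on_UNIV_eq)

lemma bounded_functional_Lp_2:
  assumes "\<eta> \<in> Lp 2 UNIV"
  shows "bounded_functional (Lp 2 UNIV) (Lp_norm 2 UNIV) (\<lambda>f. dual_embed f \<eta>) (Lp_norm 2 UNIV \<eta> + 1)"
proof
  fix f g :: "'a \<Rightarrow> real" and a b :: real
  assume f: "f \<in> Lp 2 UNIV"
  have "\<bar>dual_embed f \<eta>\<bar> \<le> Lp_norm 2 UNIV \<eta> * Lp_norm 2 UNIV f"
    using dual_embed_Lp_2_bound(2)[OF f assms] by (simp add: mult.commute)
  also have "\<dots> \<le> (Lp_norm 2 UNIV \<eta> + 1) * Lp_norm 2 UNIV f"
    using Lp_norm_nonneg[of 2 UNIV f] by (intro mult_right_mono) auto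
  finally show "\<bar>dual_embed f \<eta>\<bar> \<le> (Lp_norm 2 UNIV \<eta> + 1) * Lp_norm 2 UNIV f" .
  assume g: "g \<in> Lp 2 UNIV"
  show "(\<lambda>x. a * f x + b * g x) \<in> Lp 2 UNIV" by (rule Lp_2_lincomb[OF f g])
  have "dual_embed (\<lambda>x. a * f x + b * g x) \<eta> = (LINT x|lebesgue. a * (f x * \<eta> x) + b * (g x * \<eta> x))"
    unfolding dual_embed_def by (simp add: algebra_simps)
  then show "dual_embed (\<lambda>x. a * f x + b * g x) \<eta> = a * dual_embed f \<eta> + b * dual_embed g \<eta>"
    using dual_embed_Lp_2_bound(1)[OF f assms] dual_embed_Lp_2_bound(1)[OF g assms] by (simp add: dual_embed_def)
qed (use Lp_norm_nonneg[of 2 UNIV \<eta>] in linarith)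

lemma bochner_L2_AE_mem: "u \<in> bochner_L2 X N \<Longrightarrow> AE t in time. u t \<in> X"
  by (auto simp: bochner_L2_def strongly_measurable_def)

text \<open>Both derivatives of the operator are moved to the Gaussian, which solves the heat equation; the
  spatial operator thereby becomes \<open>- \<partial>\<^sub>s\<close>.\<close>

lemma L_strong_test_gauss:
  fixes f :: "'a::euclidean_space \<Rightarrow> real"
  assumes f: "f \<in> sobolev 2 2 UNIV" and s: "s > 0"
  shows "heat_factor lam0 TYPE('a) s * dual_embed (L_strong lam0 f) (gauss (1 / (4 * s)) m) = - heat_pair' lam0 m (dual_embed f) s"
    and "L_strong lam0 f \<in> Lp 2 UNIV"
proof -
  define \<eta> where "\<eta> = gauss (1 / (4 * s)) m"
  have fL: "f \<in> Lp 2 UNIV" using f by (simp add: sobolev_def)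
  have wd: "weak_deriv UNIV [b, b] f (wderiv UNIV [b, b] f)" "wderiv UNIV [b, b] f \<in> Lp 2 UNIV" if "b \<in> Basis" for b
    using sobolev_weak_deriv[OF f, of "[b, b]"] that by auto
  have \<eta>2: "\<eta> \<in> Lp 2 UNIV"
    using gauss_bounded_Lp(1)[of \<eta> 1 "1 / (4 * s)" m 2] s gauss_pos[of "1 / (4 * s)" m] by (auto simp: \<eta>_def less_imp_le)
  have i: "integrable lebesgue (\<lambda>x. wderiv UNIV [b, b] f x * \<eta> x)" if "b \<in> Basis" for b
    by (rule dual_embed_Lp_2_bound(1)[OF wd(2)[OF that] \<eta>2])
  have i0: "integrable lebesgue (\<lambda>x. f x * \<eta> x)" by (rule dual_embed_Lp_2_bound(1)[OF fL \<eta>2])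
  have t: "(LINT x|lebesgue. f x * partials [b, b] \<eta> x) = (LINT x|lebesgue. wderiv UNIV [b, b] f x * \<eta> x)" if "b \<in> Basis" for b
    unfolding \<eta>_def using weak_deriv_test_gauss[OF wd(1)[OF that] _ Lp_L1_plus_Linf[OF fL] Lp_L1_plus_Linf[OF wd(2)[OF that]]] s that by simp
  have "dual_embed (L_strong lam0 f) \<eta> = (LINT x|lebesgue. - (\<Sum>b\<in>Basis. wderiv UNIV [b, b] f x * \<eta> x) + lam0 * (f x * \<eta> x))"
    unfolding dual_embed_def L_strong_def
    by (intro Bochner_Integration.integral_cong refl) (simp add: algebra_simps sum_distrib_left)
  also have "\<dots> = - (\<Sum>b\<in>Basis. LINT x|lebesgue. wderiv UNIV [b, b] f x * \<eta> x) + lam0 * (LINT x|lebesgue. f x * \<eta> x)"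
    using i i0 by (subst Bochner_Integration.integral_add) (auto simp: Bochner_Integration.integral_sum)
  also have "\<dots> = - ((\<Sum>b\<in>Basis. LINT x|lebesgue. f x * partials [b, b] \<eta> x) - lam0 * (LINT x|lebesgue. f x * \<eta> x))"
    using t by simp
  finally have E: "dual_embed (L_strong lam0 f) \<eta> = - ((\<Sum>b\<in>Basis. LINT x|lebesgue. f x * partials [b, b] \<eta> x) - lam0 * (LINT x|lebesgue. f x * \<eta> x))" .
  have f1: "L1_plus_Linf f" by (rule Lp_L1_plus_Linf[OF fL]) simp
  show "heat_factor lam0 TYPE('a) s * dual_embed (L_strong lam0 f) (gauss (1 / (4 * s)) m) = - heat_pair' lam0 m (dual_embed f) s"
    unfolding laplace_heat_kernel[OF f1 s] \<eta>_def[symmetric] E by (rule mult_minus_right)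
  have sum: "(\<lambda>x. \<Sum>b\<in>B. wderiv UNIV [b, b] f x) \<in> Lp 2 UNIV" if "finite B" "B \<subseteq> Basis" for B
    using that
  proof (induction B rule: finite_induct)
    case (insert b B)
    then show ?case using Lp_2_lincomb[OF wd(2)[of b] insert.IH, of 1 1] by simp
  qed (simp add: Lp_2)
  show "L_strong lam0 f \<in> Lp 2 UNIV"
    using Lp_2_lincomb[OF sum[OF finite_Basis order_refl] fL, of "-1" lam0] by (simp add: L_strong_def[abs_def])
qed

text \<open>The difference of the time-continuous representatives vanishes initially and solves the homogeneous
  equation, since \<open>f\<^sub>0\<close> cancels almost everywhere. Its pairing with the heat
  kernel therefore satisfies the transport equation with zero right-hand side and zero initial
  values.\<close>

lemma regular_solutions_heat_pair:
  fixes w1 w2 :: "real \<Rightarrow> 'a::euclidean_space \<Rightarrow> real"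
  assumes r1: "regular_solution lam lam0 f0 u0 w1" and r2: "regular_solution lam lam0 f0 u0 w2" and u0: "u0 \<in> Lp 2 UNIV"
  shows "AE t in time. w1 t \<in> Lp 2 UNIV \<and> w2 t \<in> Lp 2 UNIV \<and>
    (\<forall>m. \<forall>s>0. heat_pair lam0 m (dual_embed (w1 t)) s = heat_pair lam0 m (dual_embed (w2 t)) s)"
proof -
  have sob: "AE t in time. w t \<in> sobolev 2 2 UNIV" if "regular_solution lam lam0 f0 u0 w" for w
  proof -
    have "AE t in time. weighted lam w t \<in> sobolev 2 2 UNIV"
      using that bochner_L2_AE_mem unfolding regular_solution_def parabolic_sobolev_def by blast
    then show ?thesis by eventually_elim (rule weighted_mem_sobolev)
  qed
  have Lp: "w \<in> Lp 2 UNIV" if "w \<in> sobolev 2 2 UNIV" for w :: "'a \<Rightarrow> real" using that by (simp add: sobolev_def)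
  obtain v1 where v1: "weak_time_deriv (Lp 2 UNIV) (Lp_norm 2 UNIV) w1 v1"
    "AE t in time. AE x in lebesgue. v1 t x + L_strong lam0 (w1 t) x = f0 t x"
    using r1 unfolding regular_solution_def by blast
  obtain v2 where v2: "weak_time_deriv (Lp 2 UNIV) (Lp_norm 2 UNIV) w2 v2"
    "AE t in time. AE x in lebesgue. v2 t x + L_strong lam0 (w2 t) x = f0 t x"
    using r2 unfolding regular_solution_def by blast
  have "\<exists>z. (\<forall>t\<ge>0. z t \<in> Lp 2 UNIV \<and> ((\<lambda>\<tau>. Lp_norm 2 UNIV (\<lambda>c. z \<tau> c - z t c)) \<longlongrightarrow> 0) (at t within {0..})) \<and>
      (AE t in time. AE x in lebesgue. z t x = w t x) \<and> (AE x in lebesgue. z 0 x = u0 x)"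
    if w: "regular_solution lam lam0 f0 u0 w" for w
  proof -
    obtain z where z: "\<forall>t\<ge>0. z t \<in> Lp 2 UNIV \<and> ((\<lambda>\<tau>. Lp_norm 2 UNIV (\<lambda>c. z \<tau> c - z t c)) \<longlongrightarrow> 0) (at t within {0..})"
      "AE t in time. Lp_norm 2 UNIV (\<lambda>c. z t c - w t c) = 0" "Lp_norm 2 UNIV (\<lambda>c. z 0 c - u0 c) = 0"
      using w unfolding regular_solution_def has_initial_value_def by blast
    have "AE t in time. t \<in> space time" by (rule AE_space)
    then have "AE t in time. AE x in lebesgue. z t x = w t x"
      using z(2) sob[OF w]
    proof eventually_elim
      case (elim t)
      then have "(\<lambda>c. z t c - w t c) \<in> Lp 2 UNIV" using z(1) Lp by (intro Lp_2_diff) auto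
      from Lp_norm_eq_0[OF this, unfolded lebesgue_on_UNIV_eq] elim show ?case by simp
    qed
    moreover have "AE x in lebesgue. z 0 x = u0 x"
      using Lp_norm_eq_0[OF Lp_2_diff[of "z 0" u0], unfolded lebesgue_on_UNIV_eq] z(1,3) u0 by simp
    ultimately show ?thesis using z(1) by blast
  qed
  note ex = this
  obtain z1 where z1: "\<And>t. t \<ge> 0 \<Longrightarrow> z1 t \<in> Lp 2 UNIV" "\<And>t. t \<ge> 0 \<Longrightarrow> ((\<lambda>\<tau>. Lp_norm 2 UNIV (\<lambda>c. z1 \<tau> c - z1 t c)) \<longlongrightarrow> 0) (at t within {0..})"
    "AE t in time. AE x in lebesgue. z1 t x = w1 t x" "AE x in lebesgue. z1 0 x = u0 x"
    using ex[OF r1] by blast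
  obtain z2 where z2: "\<And>t. t \<ge> 0 \<Longrightarrow> z2 t \<in> Lp 2 UNIV" "\<And>t. t \<ge> 0 \<Longrightarrow> ((\<lambda>\<tau>. Lp_norm 2 UNIV (\<lambda>c. z2 \<tau> c - z2 t c)) \<longlongrightarrow> 0) (at t within {0..})"
    "AE t in time. AE x in lebesgue. z2 t x = w2 t x" "AE x in lebesgue. z2 0 x = u0 x"
    using ex[OF r2] by blast
  have LL: "L1_plus_Linf f" if "f \<in> Lp 2 UNIV" for f :: "'a \<Rightarrow> real" using Lp_L1_plus_Linf[OF that] by simp
  define Z where "Z t = (\<lambda>x. z1 t x - z2 t x)" for t
  have Z: "Z t \<in> Lp 2 UNIV" if "t \<ge> 0" for t unfolding Z_def by (intro Lp_2_diff z1 z2 that)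
  have AE_all: "AE t in time. t > 0 \<and> w1 t \<in> sobolev 2 2 UNIV \<and> w2 t \<in> sobolev 2 2 UNIV \<and>
      (AE x in lebesgue. z1 t x = w1 t x) \<and> (AE x in lebesgue. z2 t x = w2 t x) \<and>
      (AE x in lebesgue. v1 t x + L_strong lam0 (w1 t) x = f0 t x) \<and> (AE x in lebesgue. v2 t x + L_strong lam0 (w2 t) x = f0 t x)"
    using AE_space[of time] sob[OF r1] sob[OF r2] z1(3) z2(3) v1(2) v2(2) by eventually_elim simp
  have pairZ: "heat_pair lam0 m (dual_embed (Z t)) s = heat_pair lam0 m (dual_embed (w1 t)) s - heat_pair lam0 m (dual_embed (w2 t)) s"
    "heat_pair' lam0 m (dual_embed (Z t)) s = heat_pair' lam0 m (dual_embed (w1 t)) s - heat_pair' lam0 m (dual_embed (w2 t)) s"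
    if "t > 0" "w1 t \<in> Lp 2 UNIV" "w2 t \<in> Lp 2 UNIV" "AE x in lebesgue. z1 t x = w1 t x" "AE x in lebesgue. z2 t x = w2 t x" "s > 0" for t m s
    unfolding Z_def
    using that(1) heat_pair_dual_embed_diff[OF LL[OF z1(1)[of t]] LL[OF z2(1)[of t]] that(6), where ?lam0.0 = lam0 and m = m]
      heat_pair_cong_AE[OF that(4) LL[OF z1(1)] LL[OF that(2)] that(6), where ?lam0.0 = lam0 and m = m]
      heat_pair_cong_AE[OF that(5) LL[OF z2(1)] LL[OF that(3)] that(6), where ?lam0.0 = lam0 and m = m] by auto
  have zero: "heat_pair lam0 m (dual_embed (Z t)) s = 0" if t: "t \<ge> 0" and s: "s > 0" for t s m
  proof -
    have "heat_pair lam0 m (dual_embed (Z t)) s = (\<lambda>_. 0) (s + t) - (\<lambda>_. 0) s"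
    proof (rule transport_along_characteristics[where S = "\<lambda>_. 0" and A = "\<lambda>_. 0"
          and k = "\<lambda>t. heat_pair lam0 m (dual_embed (Z t))" and t = t and s = s and l = "\<lambda>t. heat_pair' lam0 m (dual_embed (Z t))"
          and \<nu> = "\<lambda>\<tau> t. Lp_norm 2 UNIV (\<lambda>c. z1 \<tau> c - z1 t c) + Lp_norm 2 UNIV (\<lambda>c. z2 \<tau> c - z2 t c)"])
      show "((\<lambda>\<tau>. Lp_norm 2 UNIV (\<lambda>c. z1 \<tau> c - z1 t c) + Lp_norm 2 UNIV (\<lambda>c. z2 \<tau> c - z2 t c)) \<longlongrightarrow> 0) (at t within {0..})"
        if "t \<ge> 0" for t
        using tendsto_add[OF z1(2)[OF that] z2(2)[OF that]] by simp
    next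
      fix \<alpha> \<beta> :: real assume ab: "0 < \<alpha>" "\<alpha> \<le> \<beta>"
      obtain K d where K: "K > 0" "d > 0"
        "\<And>s x. s \<in> {\<alpha>..\<beta>} \<Longrightarrow> \<bar>gauss (1 / (4 * s)) m x\<bar> \<le> K * gauss d m x"
        "\<And>s b x. s \<in> {\<alpha>..\<beta>} \<Longrightarrow> b \<in> Basis \<Longrightarrow> \<bar>quad_gauss (1 / (4 * s)) m b x\<bar> \<le> K * gauss d m x"
        using heat_gauss_uniform_bounds[OF ab, where 'a = 'a] by metis
      define M where "M = K * Lp_norm 2 UNIV (gauss d m) + 1"
      have M: "M > 0" using K(1) Lp_norm_nonneg[of 2 UNIV "gauss d m"] by (simp add: M_def add_nonneg_pos)
      obtain C where C: "\<And>s n Z Y. s \<in> {\<alpha>..\<beta>} \<Longrightarrow> \<bar>Z (gauss (1 / (4 * s)) m) - Y (gauss (1 / (4 * s)) m)\<bar> \<le> M * n \<Longrightarrow>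
         (\<And>b. b \<in> Basis \<Longrightarrow> \<bar>Z (quad_gauss (1 / (4 * s)) m b) - Y (quad_gauss (1 / (4 * s)) m b)\<bar> \<le> M * n) \<Longrightarrow>
         \<bar>heat_pair lam0 m Z s - heat_pair lam0 m Y s\<bar> \<le> C * n \<and> \<bar>heat_pair' lam0 m Z s - heat_pair' lam0 m Y s\<bar> \<le> C * n"
        using heat_pair_bound[OF ab M, of m lam0] by blast
      have B: "\<bar>dual_embed (Z \<tau>) \<eta> - dual_embed (Z t) \<eta>\<bar> \<le> M * (Lp_norm 2 UNIV (\<lambda>c. z1 \<tau> c - z1 t c) + Lp_norm 2 UNIV (\<lambda>c. z2 \<tau> c - z2 t c))"
        if t: "t \<ge> 0" "\<tau> \<ge> 0" and \<eta>: "\<eta> \<in> borel_measurable lebesgue" "\<And>x. \<bar>\<eta> x\<bar> \<le> K * gauss d m x" for t \<tau> \<eta>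
      proof -
        note G = gauss_bounded_Lp[OF \<eta> K(2,1), of 2, simplified]
        have le: "Lp_norm 2 UNIV \<eta> \<le> M" using G(2) by (simp add: M_def)
        note i = dual_embed_Lp_2_bound(1)[OF _ G(1)]
        have d: "\<bar>dual_embed (\<lambda>c. f c - g c) \<eta>\<bar> \<le> M * Lp_norm 2 UNIV (\<lambda>c. f c - g c)"
          if "f \<in> Lp 2 UNIV" "g \<in> Lp 2 UNIV" for f g
          using dual_embed_Lp_2_bound(2)[OF Lp_2_diff[OF that] G(1)] mult_left_mono[OF le Lp_norm_nonneg[of 2 UNIV "\<lambda>c. f c - g c"]]
          by (simp add: mult.commute)
        have e: "dual_embed (Z \<tau>) \<eta> - dual_embed (Z t) \<eta> = dual_embed (\<lambda>c. z1 \<tau> c - z1 t c) \<eta> - dual_embed (\<lambda>c. z2 \<tau> c - z2 t c) \<eta>"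
          using i[OF z1(1)[OF t(1)]] i[OF z1(1)[OF t(2)]] i[OF z2(1)[OF t(1)]] i[OF z2(1)[OF t(2)]]
          by (simp add: dual_embed_def Z_def left_diff_distrib)
        show ?thesis unfolding e distrib_left
          using d[OF z1(1)[OF t(2)] z1(1)[OF t(1)]] d[OF z2(1)[OF t(2)] z2(1)[OF t(1)]] by linarith
      qed
      show "\<exists>C. \<forall>s\<in>{\<alpha>..\<beta>}. \<forall>t\<ge>0. \<forall>\<tau>\<ge>0.
         \<bar>heat_pair lam0 m (dual_embed (Z \<tau>)) s - heat_pair lam0 m (dual_embed (Z t)) s\<bar> \<le> C * (Lp_norm 2 UNIV (\<lambda>c. z1 \<tau> c - z1 t c) + Lp_norm 2 UNIV (\<lambda>c. z2 \<tau> c - z2 t c)) \<and>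
         \<bar>heat_pair' lam0 m (dual_embed (Z \<tau>)) s - heat_pair' lam0 m (dual_embed (Z t)) s\<bar> \<le> C * (Lp_norm 2 UNIV (\<lambda>c. z1 \<tau> c - z1 t c) + Lp_norm 2 UNIV (\<lambda>c. z2 \<tau> c - z2 t c))"
        by (intro exI[of _ C] ballI allI impI C B) (use K(3,4) in auto)
    next
      show "AE t in time. (\<forall>s>0. (heat_pair lam0 m (dual_embed (Z t)) has_real_derivative heat_pair' lam0 m (dual_embed (Z t)) s) (at s)) \<and>
          continuous_on {0<..} (heat_pair' lam0 m (dual_embed (Z t)))"
        using AE_space[of time]
      proof eventually_elim
        case (elim t)
        then have "L1_plus_Linf (Z t)" by (intro LL Z) simp
        then show ?case using heat_pair_DERIV heat_pair'_continuous by blast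
      qed
    next
      fix s :: real and \<phi> :: "real \<Rightarrow> real" assume s: "s > 0" and \<phi>: "\<phi> \<in> test_funs {0<..}"
      define h where "h = heat_factor lam0 TYPE('a) s"
      define \<eta> where "\<eta> = gauss (1 / (4 * s)) m"
      have \<eta>2: "\<eta> \<in> Lp 2 UNIV"
        using gauss_bounded_Lp(1)[of \<eta> 1 "1 / (4 * s)" m 2] s gauss_pos[of "1 / (4 * s)" m] by (auto simp: \<eta>_def less_imp_le)
      interpret bf: bounded_functional "Lp 2 UNIV" "Lp_norm 2 UNIV" "\<lambda>f. dual_embed f \<eta>" "Lp_norm 2 UNIV \<eta> + 1"
        by (rule bounded_functional_Lp_2[OF \<eta>2])
      have hom: "\<forall>f a. dual_embed (\<lambda>c. a * f c) \<eta> = a * dual_embed f \<eta>" by (simp add: dual_embed_def mult.assoc)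
      note p1 = bf.weak_time_deriv_pairing[OF v1(1) hom \<phi>] and p2 = bf.weak_time_deriv_pairing[OF v2(1) hom \<phi>]
      have hp: "heat_pair lam0 m (dual_embed f) s = h * dual_embed f \<eta>" for f by (simp add: heat_pair_def h_def \<eta>_def)
      have "(LINT t|time. deriv \<phi> t * heat_pair lam0 m (dual_embed (Z t)) s) =
          (LINT t|time. h * (deriv \<phi> t * dual_embed (w1 t) \<eta>) - h * (deriv \<phi> t * dual_embed (w2 t) \<eta>))"
      proof (rule integral_time_cong_AE)
        show "integrable time (\<lambda>t. h * (deriv \<phi> t * dual_embed (w1 t) \<eta>) - h * (deriv \<phi> t * dual_embed (w2 t) \<eta>))"
          using p1(2) p2(2) by auto
        show "AE t in time. h * (deriv \<phi> t * dual_embed (w1 t) \<eta>) - h * (deriv \<phi> t * dual_embed (w2 t) \<eta>) = deriv \<phi> t * heat_pair lam0 m (dual_embed (Z t)) s"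
          using AE_all
        proof eventually_elim
          case (elim t)
          have P: "heat_pair lam0 m (dual_embed (Z t)) s = heat_pair lam0 m (dual_embed (w1 t)) s - heat_pair lam0 m (dual_embed (w2 t)) s"
            by (rule pairZ(1)) (use elim Lp s in auto)
          show ?case unfolding P unfolding hp by (simp add: algebra_simps)
        qed
      qed
      also have "\<dots> = h * (LINT t|time. deriv \<phi> t * dual_embed (w1 t) \<eta>) - h * (LINT t|time. deriv \<phi> t * dual_embed (w2 t) \<eta>)"
        using p1(2) p2(2) by simp
      also have "\<dots> = - (LINT t|time. h * (\<phi> t * dual_embed (v1 t) \<eta>) - h * (\<phi> t * dual_embed (v2 t) \<eta>))"
        using p1(3) p2(3) unfolding p1(4) p2(4) by simp
      also have "(LINT t|time. h * (\<phi> t * dual_embed (v1 t) \<eta>) - h * (\<phi> t * dual_embed (v2 t) \<eta>)) =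
          (LINT t|time. \<phi> t * (heat_pair' lam0 m (dual_embed (Z t)) s + 0))"
      proof (rule integral_time_cong_AE[symmetric])
        show "integrable time (\<lambda>t. h * (\<phi> t * dual_embed (v1 t) \<eta>) - h * (\<phi> t * dual_embed (v2 t) \<eta>))"
          using p1(3) p2(3) by auto
        show "AE t in time. h * (\<phi> t * dual_embed (v1 t) \<eta>) - h * (\<phi> t * dual_embed (v2 t) \<eta>) = \<phi> t * (heat_pair' lam0 m (dual_embed (Z t)) s + 0)"
          using AE_all p1(1) p2(1)
        proof eventually_elim
          case (elim t)
          show ?case
          proof (cases "\<phi> t = 0")
            case False
            \<comment> \<open>Membership of the time derivatives in \<open>L\<^sub>2\<close> is known only where the test function does not vanish.\<close>
            have v: "v1 t \<in> Lp 2 UNIV" "v2 t \<in> Lp 2 UNIV"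
              using Lp_2_lincomb[OF elim(2) elim(2), of "1 / \<phi> t" 0] Lp_2_lincomb[OF elim(3) elim(3), of "1 / \<phi> t" 0] False by simp_all
            note L1 = L_strong_test_gauss(1)[of "w1 t" s lam0 m] L_strong_test_gauss(2)[of "w1 t" s lam0]
              and L2 = L_strong_test_gauss(1)[of "w2 t" s lam0 m] L_strong_test_gauss(2)[of "w2 t" s lam0]
            have w: "w1 t \<in> sobolev 2 2 UNIV" "w2 t \<in> sobolev 2 2 UNIV" using elim by auto
            have bi: "bounded_integrable \<eta>" unfolding \<eta>_def by (rule bounded_integrable_heat_gauss[OF s])
            have "AE x in lebesgue. v1 t x + L_strong lam0 (w1 t) x = f0 t x" "AE x in lebesgue. v2 t x + L_strong lam0 (w2 t) x = f0 t x"
              using elim(1) by auto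
            then have ae: "AE x in lebesgue. v1 t x - v2 t x = L_strong lam0 (w2 t) x - L_strong lam0 (w1 t) x"
              by eventually_elim simp
            have "dual_embed (v1 t) \<eta> - dual_embed (v2 t) \<eta> = dual_embed (\<lambda>x. v1 t x - v2 t x) \<eta>"
              by (rule dual_embed_diff[symmetric]) (intro LL v bi)+
            also have "\<dots> = dual_embed (\<lambda>x. L_strong lam0 (w2 t) x - L_strong lam0 (w1 t) x) \<eta>"
              by (rule dual_embed_cong_AE[OF ae _ _ bi]) (intro LL Lp_2_diff v L1(2) L2(2) w s)+
            also have "\<dots> = dual_embed (L_strong lam0 (w2 t)) \<eta> - dual_embed (L_strong lam0 (w1 t)) \<eta>"
              by (rule dual_embed_diff) (intro LL L1(2) L2(2) w s bi)+
            finally have "h * dual_embed (v1 t) \<eta> - h * dual_embed (v2 t) \<eta> = h * dual_embed (L_strong lam0 (w2 t)) \<eta> - h * dual_embed (L_strong lam0 (w1 t)) \<eta>"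
              by (simp flip: right_diff_distrib)
            also have "\<dots> = heat_pair' lam0 m (dual_embed (w1 t)) s - heat_pair' lam0 m (dual_embed (w2 t)) s"
              using L1(1)[OF w(1) s] L2(1)[OF w(2) s] by (simp add: h_def \<eta>_def)
            also have "\<dots> = heat_pair' lam0 m (dual_embed (Z t)) s"
              by (rule pairZ(2)[symmetric]) (use elim(1) Lp s in auto)
            finally have "\<phi> t * (h * dual_embed (v1 t) \<eta> - h * dual_embed (v2 t) \<eta>) = \<phi> t * heat_pair' lam0 m (dual_embed (Z t)) s"
              by simp
            then show ?thesis by (simp add: algebra_simps)
          qed simp
        qed
      qed
      finally show "(LINT t|time. deriv \<phi> t * heat_pair lam0 m (dual_embed (Z t)) s) = - (LINT t|time. \<phi> t * (heat_pair' lam0 m (dual_embed (Z t)) s + 0))" .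
    next
      fix s :: real assume s: "s > 0"
      have "AE x in lebesgue. z1 0 x = z2 0 x" using z1(4) z2(4) by eventually_elim simp
      then have "heat_pair lam0 m (dual_embed (z1 0)) s = heat_pair lam0 m (dual_embed (z2 0)) s"
        by (rule heat_pair_cong_AE(1)[OF _ LL LL s]) (auto intro: z1 z2)
      then show "heat_pair lam0 m (dual_embed (Z 0)) s = 0"
        using heat_pair_dual_embed_diff(1)[OF LL[OF z1(1)[of 0]] LL[OF z2(1)[of 0]] s, where ?lam0.0 = lam0 and m = m] by (simp add: Z_def)
    qed (use t s in auto)
    then show ?thesis by simp
  qed
  show ?thesis
    using AE_all
  proof eventually_elim
    case (elim t)
    have "heat_pair lam0 m (dual_embed (w1 t)) s = heat_pair lam0 m (dual_embed (w2 t)) s" if s: "s > 0" for m s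
    proof -
      have "heat_pair lam0 m (dual_embed (Z t)) s = heat_pair lam0 m (dual_embed (w1 t)) s - heat_pair lam0 m (dual_embed (w2 t)) s"
        by (rule pairZ(1)) (use elim Lp s in auto)
      then show ?thesis using zero[of t s m] elim s by simp
    qed
    then show ?case using elim Lp by blast
  qed
qed

subsection \<open>Solutions with point sources\<close>

text \<open>Two continuous functions that agree almost everywhere near \<open>x\<close> agree at
  \<open>x\<close>, because a nonempty open set is not a null set.\<close>

lemma has_point_value_unique:
  fixes f :: "'a::euclidean_space \<Rightarrow> real"
  assumes "has_point_value f x c" "has_point_value f x c'"
  shows "c = c'"
proof -
  obtain U g where U: "open U" "x \<in> U" "continuous_on U g" "AE y in lebesgue. y \<in> U \<longrightarrow> g y = f y" "g x = c"
    using assms(1) by (auto simp: has_point_value_def)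
  obtain V h where V: "open V" "x \<in> V" "continuous_on V h" "AE y in lebesgue. y \<in> V \<longrightarrow> h y = f y" "h x = c'"
    using assms(2) by (auto simp: has_point_value_def)
  define W where "W = U \<inter> V"
  have W: "open W" "x \<in> W" using U V by (auto simp: W_def)
  have "continuous_on W (\<lambda>y. g y - h y)"
    by (intro continuous_intros continuous_on_subset[OF U(3)] continuous_on_subset[OF V(3)]) (auto simp: W_def)
  from continuous_open_preimage[OF this W(1), of "- {0}"]
  have "open ((\<lambda>y. g y - h y) -` (- {0}) \<inter> W)" by (simp add: Int_commute open_Compl)
  moreover have "AE y in lebesgue. y \<notin> (\<lambda>y. g y - h y) -` (- {0}) \<inter> W"
    using U(4) V(4) by eventually_elim (auto simp: W_def)
  then have "negligible ((\<lambda>y. g y - h y) -` (- {0}) \<inter> W)"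
    using calculation by (subst (asm) AE_iff_null_sets[symmetric]) (auto simp: negligible_iff_null_sets)
  ultimately have "(\<lambda>y. g y - h y) -` (- {0}) \<inter> W = {}" using open_not_negligible by blast
  then show ?thesis using W(2) U(5) V(5) by auto
qed

lemma dirac_continuous:
  fixes \<eta> :: "'a::euclidean_space \<Rightarrow> real"
  assumes "continuous_on UNIV \<eta>" shows "dirac x \<eta> = \<eta> x"
  unfolding dirac_def
proof (rule the_equality)
  show *: "has_point_value \<eta> x (\<eta> x)" unfolding has_point_value_def
    using assms by (intro exI[of _ UNIV] exI[of _ \<eta>]) auto
  show "c = \<eta> x" if "has_point_value \<eta> x c" for c by (rule has_point_value_unique[OF that *])
qed

lemma heat_gauss_bounds:
  fixes m :: "'a::euclidean_space"
  assumes ab: "0 < \<alpha>" "\<alpha> \<le> \<beta>"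
  shows "\<exists>K>0. \<exists>d>0. \<forall>s\<in>{\<alpha>..\<beta>}. \<forall>x. \<bar>gauss (1 / (4 * s)) m x\<bar> \<le> K * gauss d m x \<and>
    (\<forall>h\<in>Basis. \<bar>- (2 * (1 / (4 * s))) * ((x - m) \<bullet> h) * gauss (1 / (4 * s)) m x\<bar> \<le> K * gauss d m x) \<and>
    (\<forall>b\<in>Basis. \<bar>quad_gauss (1 / (4 * s)) m b x\<bar> \<le> K * gauss d m x) \<and>
    (\<forall>b\<in>Basis. \<forall>h\<in>Basis. \<bar>(2 * ((x - m) \<bullet> b) * (h \<bullet> b) - 2 * (1 / (4 * s)) * ((x - m) \<bullet> b)\<^sup>2 * ((x - m) \<bullet> h)) * gauss (1 / (4 * s)) m x\<bar> \<le> K * gauss d m x)"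
  by (rule heat_gauss_uniform_bounds[OF ab, where 'a = 'a], intro exI conjI ballI allI) assumption+

lemma continuous_on_gauss_partial:
  "continuous_on UNIV (\<lambda>x. - (2 * c) * ((x - m) \<bullet> b) * gauss c m x)"
  "continuous_on UNIV (\<lambda>x. (2 * ((x - m) \<bullet> b) * (h \<bullet> b) - 2 * c * ((x - m) \<bullet> b)\<^sup>2 * ((x - m) \<bullet> h)) * gauss c m x)"
  by (intro continuous_intros)+

lemma gauss_mem_sobolev:
  fixes m :: "'a::euclidean_space"
  assumes "s > 0" "q > 0" shows "gauss (1 / (4 * s)) m \<in> sobolev 1 q UNIV"
proof -
  obtain K d where K0: "K > 0" "d > 0" and B: "\<forall>r\<in>{s..s}. \<forall>x. \<bar>gauss (1 / (4 * r)) m x\<bar> \<le> K * gauss d m x \<and>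
      (\<forall>h\<in>Basis. \<bar>- (2 * (1 / (4 * r))) * ((x - m) \<bullet> h) * gauss (1 / (4 * r)) m x\<bar> \<le> K * gauss d m x)"
    using heat_gauss_bounds[OF assms(1) order_refl, of m] by blast
  have B': "\<bar>gauss (1 / (4 * s)) m x\<bar> \<le> K * gauss d m x"
    "h \<in> Basis \<Longrightarrow> \<bar>- (2 * (1 / (4 * s))) * ((x - m) \<bullet> h) * gauss (1 / (4 * s)) m x\<bar> \<le> K * gauss d m x" for x h
    using B[rule_format, of s x] by auto
  note K = K0 B'
  have "integrable lebesgue (\<lambda>x. K powr q * gauss (d * q) m x)"
    using bounded_integrable_gauss[of "d * q" "K powr q" m] K assms by (simp add: bounded_integrable_def)
  then have w: "integrable lebesgue (\<lambda>x. (K * gauss d m x) powr q)"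
    using K gauss_pos[of d m] by (simp add: powr_mult gauss_powr less_imp_le)
  show ?thesis
    by (rule sobolev_1I(1)[OF gauss_has_derivative continuous_on_gauss_partial(1) K(3,4) w assms(2)])
qed

lemma sobolev_dual_heat_gauss_bound:
  fixes m :: "'a::euclidean_space"
  assumes ab: "0 < \<alpha>" "\<alpha> \<le> \<beta>" and q: "q > 0"
  shows "\<exists>M>0. \<forall>Z\<in>sobolev_dual q. \<forall>s\<in>{\<alpha>..\<beta>}. \<bar>Z (gauss (1 / (4 * s)) m)\<bar> \<le> M * sobolev_dual_norm q Z \<and>
    (\<forall>b\<in>Basis. \<bar>Z (quad_gauss (1 / (4 * s)) m b)\<bar> \<le> M * sobolev_dual_norm q Z)"
proof -
  obtain K d where K0: "K > 0" "d > 0" and B: "\<forall>s\<in>{\<alpha>..\<beta>}. \<forall>x. \<bar>gauss (1 / (4 * s)) m x\<bar> \<le> K * gauss d m x \<and>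
    (\<forall>h\<in>Basis. \<bar>- (2 * (1 / (4 * s))) * ((x - m) \<bullet> h) * gauss (1 / (4 * s)) m x\<bar> \<le> K * gauss d m x) \<and>
    (\<forall>b\<in>Basis. \<bar>quad_gauss (1 / (4 * s)) m b x\<bar> \<le> K * gauss d m x) \<and>
    (\<forall>b\<in>Basis. \<forall>h\<in>Basis. \<bar>(2 * ((x - m) \<bullet> b) * (h \<bullet> b) - 2 * (1 / (4 * s)) * ((x - m) \<bullet> b)\<^sup>2 * ((x - m) \<bullet> h)) * gauss (1 / (4 * s)) m x\<bar> \<le> K * gauss d m x)"
    using heat_gauss_bounds[OF ab, of m] by blast
  have K: "K > 0" "d > 0"
    "\<And>s x. s \<in> {\<alpha>..\<beta>} \<Longrightarrow> \<bar>gauss (1 / (4 * s)) m x\<bar> \<le> K * gauss d m x"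
    "\<And>s x h. s \<in> {\<alpha>..\<beta>} \<Longrightarrow> h \<in> Basis \<Longrightarrow> \<bar>- (2 * (1 / (4 * s))) * ((x - m) \<bullet> h) * gauss (1 / (4 * s)) m x\<bar> \<le> K * gauss d m x"
    "\<And>s b x. s \<in> {\<alpha>..\<beta>} \<Longrightarrow> b \<in> Basis \<Longrightarrow> \<bar>quad_gauss (1 / (4 * s)) m b x\<bar> \<le> K * gauss d m x"
    "\<And>s b x h. s \<in> {\<alpha>..\<beta>} \<Longrightarrow> b \<in> Basis \<Longrightarrow> h \<in> Basis \<Longrightarrow>
       \<bar>(2 * ((x - m) \<bullet> b) * (h \<bullet> b) - 2 * (1 / (4 * s)) * ((x - m) \<bullet> b)\<^sup>2 * ((x - m) \<bullet> h)) * gauss (1 / (4 * s)) m x\<bar> \<le> K * gauss d m x"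
    using K0 B[rule_format] by auto
  obtain W where W: "W > 0" "\<And>(Z :: ('a \<Rightarrow> real) \<Rightarrow> real) F D K. Z \<in> sobolev_dual q \<Longrightarrow> K > 0 \<Longrightarrow> (\<And>x. (F has_derivative D x) (at x)) \<Longrightarrow>
      (\<And>b. b \<in> Basis \<Longrightarrow> continuous_on UNIV (\<lambda>x. D x b)) \<Longrightarrow>
      (\<And>x. \<bar>F x\<bar> \<le> K * gauss d m x) \<Longrightarrow> (\<And>x b. b \<in> Basis \<Longrightarrow> \<bar>D x b\<bar> \<le> K * gauss d m x) \<Longrightarrow>
      \<bar>Z F\<bar> \<le> K * W * sobolev_dual_norm q Z"
    using sobolev_dual_gauss_bound[OF q K(2), of m] by blast
  show ?thesis
  proof (intro exI[of _ "K * W"] conjI ballI)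
    show "K * W > 0" using K W by simp
    fix Z :: "('a \<Rightarrow> real) \<Rightarrow> real" and s assume Z: "Z \<in> sobolev_dual q" and s: "s \<in> {\<alpha>..\<beta>}"
    show "\<bar>Z (gauss (1 / (4 * s)) m)\<bar> \<le> K * W * sobolev_dual_norm q Z"
      by (rule W(2)[OF Z K(1) gauss_has_derivative continuous_on_gauss_partial(1) K(3)[OF s] K(4)[OF s]])
    fix b :: 'a assume b: "b \<in> Basis"
    show "\<bar>Z (quad_gauss (1 / (4 * s)) m b)\<bar> \<le> K * W * sobolev_dual_norm q Z"
    proof (rule W(2)[OF Z K(1) quad_gauss_has_derivative])
      fix h :: 'a assume h: "h \<in> Basis"
      show "continuous_on UNIV (\<lambda>x. (2 * ((x - m) \<bullet> b) * (h \<bullet> b) - 2 * (1 / (4 * s)) * ((x - m) \<bullet> b)\<^sup>2 * ((x - m) \<bullet> h)) * gauss (1 / (4 * s)) m x)"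
        by (rule continuous_on_gauss_partial(2))
      show "\<bar>(2 * ((x - m) \<bullet> b) * (h \<bullet> b) - 2 * (1 / (4 * s)) * ((x - m) \<bullet> b)\<^sup>2 * ((x - m) \<bullet> h)) * gauss (1 / (4 * s)) m x\<bar> \<le> K * gauss d m x" for x
        by (rule K(6)[OF s b h])
    qed (rule K(5)[OF s b])
  qed
qed

lemma bounded_functional_sobolev_dual:
  assumes M: "M > 0" and bd: "\<And>Z. Z \<in> sobolev_dual q \<Longrightarrow> \<bar>Z \<eta>\<bar> \<le> M * sobolev_dual_norm q Z"
  shows "bounded_functional (sobolev_dual q) (sobolev_dual_norm q) (\<lambda>Z. Z \<eta>) M"
  by standard (use M bd sobolev_dual_lincomb in auto)

text \<open>The form contains one derivative of \<open>f\<close>, which is moved to the Gaussian by testing with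
  a partial derivative of it.\<close>

lemma L_weak_test_gauss:
  fixes f :: "'a::euclidean_space \<Rightarrow> real"
  assumes f: "f \<in> sobolev 1 p UNIV" and p: "p \<ge> 1" and s: "s > 0"
  shows "heat_factor lam0 TYPE('a) s * L_weak lam0 f (gauss (1 / (4 * s)) m) = - heat_pair' lam0 m (dual_embed f) s"
proof -
  define \<eta> where "\<eta> = gauss (1 / (4 * s)) m"
  have f1: "L1_plus_Linf f" using f p by (intro Lp_L1_plus_Linf[of _ p]) (auto simp: sobolev_def)
  have wd: "weak_deriv UNIV [b] f (wderiv UNIV [b] f)" "L1_plus_Linf (wderiv UNIV [b] f)" if "b \<in> Basis" for b
    using sobolev_weak_deriv[OF f, of "[b]"] that p by (auto intro: Lp_L1_plus_Linf)
  obtain K d where K0: "K > 0" "d > 0" and B: "\<forall>r\<in>{s..s}. \<forall>x. \<forall>h\<in>Basis. \<bar>- (2 * (1 / (4 * r))) * ((x - m) \<bullet> h) * gauss (1 / (4 * r)) m x\<bar> \<le> K * gauss d m x"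
    using heat_gauss_bounds[OF s order_refl, of m] by blast
  have B': "h \<in> Basis \<Longrightarrow> \<bar>- (2 * (1 / (4 * s))) * ((x - m) \<bullet> h) * \<eta> x\<bar> \<le> K * gauss d m x" for x h
    using B[rule_format, of s h x] by (simp add: \<eta>_def)
  note K = K0 B'
  have bi: "bounded_integrable \<eta>" unfolding \<eta>_def by (rule bounded_integrable_heat_gauss[OF s])
  have bi': "bounded_integrable (partials [b] \<eta>)" if "b \<in> Basis" for b
  proof (rule bounded_integrable_bound[OF bounded_integrable_gauss[OF K(2), of K m]])
    show "partials [b] \<eta> \<in> borel_measurable lebesgue"
      unfolding \<eta>_def partials_gauss[OF that] by (intro continuous_measurable_lebesgue continuous_on_gauss_partial)
    show "\<bar>partials [b] \<eta> x\<bar> \<le> K * gauss d m x" for x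
      using K(3)[OF that, of x] unfolding \<eta>_def partials_gauss[OF that] .
  qed
  have i: "integrable lebesgue (\<lambda>x. wderiv UNIV [b] f x * partials [b] \<eta> x)" if "b \<in> Basis" for b
    by (rule integrable_majorant[OF wd(2)[OF that] bi'[OF that]])
  have i0: "integrable lebesgue (\<lambda>x. f x * \<eta> x)" by (rule integrable_majorant[OF f1 bi])
  have meas: "wderiv UNIV [b] \<eta> \<in> borel_measurable lebesgue" if "b \<in> Basis" for b
    unfolding \<eta>_def by (rule wderiv_measurable[OF weak_deriv_classical[OF gauss_has_derivative continuous_on_gauss_partial(1) that]])
  have ae: "AE x in lebesgue. \<forall>b\<in>Basis. wderiv UNIV [b] \<eta> x = partials [b] \<eta> x"
    unfolding \<eta>_def by (intro AE_finite_allI wderiv_gauss) auto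
  have J: "integrable lebesgue (\<lambda>x. (\<Sum>b\<in>Basis. wderiv UNIV [b] f x * partials [b] \<eta> x) + lam0 * (f x * \<eta> x))"
    using i i0 by (intro Bochner_Integration.integrable_add Bochner_Integration.integrable_sum) auto
  have "L_weak lam0 f \<eta> = (LINT x|lebesgue. (\<Sum>b\<in>Basis. wderiv UNIV [b] f x * partials [b] \<eta> x) + lam0 * (f x * \<eta> x))"
    unfolding L_weak_def
  proof (rule integral_cong_AE)
    have "wderiv UNIV [b] f \<in> borel_measurable lebesgue" if "b \<in> Basis" for b
      using wd(2)[OF that] by (rule L1_plus_Linf_measurable)
    then show "(\<lambda>x. (\<Sum>b\<in>Basis. wderiv UNIV [b] f x * wderiv UNIV [b] \<eta> x) + lam0 * f x * \<eta> x) \<in> borel_measurable lebesgue"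
      using meas borel_measurable_integrable[OF i0] L1_plus_Linf_measurable[OF f1] bi
      by (intro borel_measurable_add borel_measurable_sum borel_measurable_times) (auto simp: bounded_integrable_def)
    show "AE x in lebesgue. (\<Sum>b\<in>Basis. wderiv UNIV [b] f x * wderiv UNIV [b] \<eta> x) + lam0 * f x * \<eta> x =
        (\<Sum>b\<in>Basis. wderiv UNIV [b] f x * partials [b] \<eta> x) + lam0 * (f x * \<eta> x)"
      using ae by eventually_elim (simp del: partials.simps add: mult.assoc)
  qed (rule borel_measurable_integrable[OF J])
  also have "\<dots> = (\<Sum>b\<in>Basis. LINT x|lebesgue. wderiv UNIV [b] f x * partials [b] \<eta> x) + lam0 * (LINT x|lebesgue. f x * \<eta> x)"
    using i i0 by (subst Bochner_Integration.integral_add)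
      (auto simp: Bochner_Integration.integral_sum simp del: partials.simps intro!: Bochner_Integration.integrable_sum)
  also have "(\<Sum>b\<in>Basis. LINT x|lebesgue. wderiv UNIV [b] f x * partials [b] \<eta> x) = (\<Sum>b\<in>Basis. - (LINT x|lebesgue. f x * partials [b, b] \<eta> x))"
    unfolding \<eta>_def using s by (intro sum.cong refl weak_deriv_test_gauss_partial wd f1) auto
  also have "\<dots> + lam0 * (LINT x|lebesgue. f x * \<eta> x) = - ((\<Sum>b\<in>Basis. LINT x|lebesgue. f x * partials [b, b] \<eta> x) - lam0 * (LINT x|lebesgue. f x * \<eta> x))"
    by (simp add: sum_negf del: partials.simps)
  finally have E: "L_weak lam0 f \<eta> = - ((\<Sum>b\<in>Basis. LINT x|lebesgue. f x * partials [b, b] \<eta> x) - lam0 * (LINT x|lebesgue. f x * \<eta> x))" .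
  show ?thesis
    unfolding laplace_heat_kernel[OF f1 s] \<eta>_def[symmetric] E by (rule mult_minus_right)
qed

text \<open>The sources tested with the heat kernel: the inhomogeneity of the transport equation in
  \<open>s\<close>.\<close>

definition source_density :: "real \<Rightarrow> nat \<Rightarrow> (nat \<Rightarrow> 'a::euclidean_space) \<Rightarrow> (nat \<Rightarrow> real) \<Rightarrow> 'a \<Rightarrow> real \<Rightarrow> real" where
  "source_density lam0 n xs qs m s = heat_factor lam0 TYPE('a) s * (\<Sum>i=1..n. qs i * gauss (1 / (4 * s)) m (xs i))"

text \<open>Testing the equation with the heat kernel gives the transport equation with inhomogeneity
  \<open>source_density\<close> and zero initial values. It is solved for the time-continuous
  representative \<open>z\<close>, whose values are functionals; \<open>z\<close> agrees with
  \<open>w\<close> on Gaussians for almost every time, since a functional of dual norm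
  \<open>0\<close> vanishes on them.\<close>

lemma singular_solution_heat_pair:
  fixes w :: "real \<Rightarrow> 'a::euclidean_space \<Rightarrow> real"
  assumes sing: "singular_solution lam lam0 p q n xs qs w" and pq: "p > 1" "q > 1" "1 / p + 1 / q = 1"
  shows "AE t in time. w t \<in> Lp p UNIV \<and> (\<forall>m A. (\<forall>s>0. (A has_real_derivative source_density lam0 n xs qs m s) (at s)) \<longrightarrow>
     (\<forall>s>0. heat_pair lam0 m (dual_embed (w t)) s = A (s + t) - A s))"
proof -
  have q0: "q > 0" using pq by simp
  have sob: "AE t in time. w t \<in> sobolev 1 p UNIV"
  proof -
    have "AE t in time. weighted lam w t \<in> sobolev 1 p UNIV"
      using sing unfolding singular_solution_def by (elim conjE) (rule bochner_L2_AE_mem)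
    then show ?thesis by eventually_elim (rule weighted_mem_sobolev)
  qed
  obtain wt where wt: "weak_time_deriv (sobolev_dual q) (sobolev_dual_norm q) (\<lambda>t. dual_embed (w t)) wt"
    "AE t in time. \<forall>\<eta>\<in>sobolev 1 q UNIV. wt t \<eta> + L_weak lam0 (w t) \<eta> = (\<Sum>i=1..n. qs i * dirac (xs i) \<eta>)"
    using sing unfolding singular_solution_def by blast
  obtain z where z: "\<forall>t\<ge>0. z t \<in> sobolev_dual q \<and> ((\<lambda>\<tau>. sobolev_dual_norm q (\<lambda>c. z \<tau> c - z t c)) \<longlongrightarrow> 0) (at t within {0..})"
    "AE t in time. sobolev_dual_norm q (\<lambda>c. z t c - dual_embed (w t) c) = 0" "sobolev_dual_norm q (\<lambda>c. z 0 c - 0) = 0"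
    using sing unfolding singular_solution_def has_initial_value_def by blast
  have dd: "(\<lambda>c. Z c - Y c) \<in> sobolev_dual q" if "Z \<in> sobolev_dual q" "Y \<in> sobolev_dual q" for Z Y :: "('a \<Rightarrow> real) \<Rightarrow> real"
    using sobolev_dual_lincomb[OF that, of 1 "-1"] by simp
  have null: "Z (gauss (1 / (4 * s)) m) = Y (gauss (1 / (4 * s)) m)" "b \<in> Basis \<Longrightarrow> Z (quad_gauss (1 / (4 * s)) m b) = Y (quad_gauss (1 / (4 * s)) m b)"
    if ZY: "Z \<in> sobolev_dual q" "Y \<in> sobolev_dual q" "sobolev_dual_norm q (\<lambda>c. Z c - Y c) = 0" "s > 0" for Z Y :: "('a \<Rightarrow> real) \<Rightarrow> real" and s m b
  proof -
    obtain M where M0: "\<forall>Z\<in>sobolev_dual q. \<forall>r\<in>{s..s}. \<bar>Z (gauss (1 / (4 * r)) m)\<bar> \<le> M * sobolev_dual_norm q Z \<and>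
        (\<forall>b\<in>Basis. \<bar>Z (quad_gauss (1 / (4 * r)) m b)\<bar> \<le> M * sobolev_dual_norm q Z)"
      using sobolev_dual_heat_gauss_bound[OF ZY(4) order_refl q0, of m] by blast
    have M: "\<bar>Z (gauss (1 / (4 * s)) m) - Y (gauss (1 / (4 * s)) m)\<bar> \<le> 0"
      "b \<in> Basis \<Longrightarrow> \<bar>Z (quad_gauss (1 / (4 * s)) m b) - Y (quad_gauss (1 / (4 * s)) m b)\<bar> \<le> 0"
      using M0[rule_format, OF dd[OF ZY(1,2)], of s] ZY(3) by auto
    show "Z (gauss (1 / (4 * s)) m) = Y (gauss (1 / (4 * s)) m)" using M(1) by simp
    show "Z (quad_gauss (1 / (4 * s)) m b) = Y (quad_gauss (1 / (4 * s)) m b)" if "b \<in> Basis" using M(2)[OF that] by simp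
  qed
  have AE_all: "AE t in time. t > 0 \<and> w t \<in> sobolev 1 p UNIV \<and> L1_plus_Linf (w t) \<and>
     (\<forall>\<eta>\<in>sobolev 1 q UNIV. wt t \<eta> + L_weak lam0 (w t) \<eta> = (\<Sum>i=1..n. qs i * dirac (xs i) \<eta>)) \<and>
     (\<forall>m s. s > 0 \<longrightarrow> heat_pair lam0 m (z t) s = heat_pair lam0 m (dual_embed (w t)) s \<and> heat_pair' lam0 m (z t) s = heat_pair' lam0 m (dual_embed (w t)) s)"
    using AE_space[of time] sob wt(2) z(2)
  proof eventually_elim
    case (elim t)
    then have t: "t > 0" by simp
    have wL: "w t \<in> Lp p UNIV" using elim(2) by (simp add: sobolev_def)
    have de: "dual_embed (w t) \<in> sobolev_dual q" by (rule dual_embed_mem_sobolev_dual[OF pq wL])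
    have zt: "z t \<in> sobolev_dual q" using z(1) t by simp
    have "heat_pair lam0 m (z t) s = heat_pair lam0 m (dual_embed (w t)) s \<and> heat_pair' lam0 m (z t) s = heat_pair' lam0 m (dual_embed (w t)) s"
      if "s > 0" for m s
      using null[OF zt de elim(4) that] by (simp add: heat_pair_def heat_pair'_def)
    then show ?case using t elim(2,3) Lp_L1_plus_Linf[OF wL] pq by auto
  qed
  have main: "heat_pair lam0 m (z t) s = A (s + t) - A s"
    if A: "\<And>s. s > 0 \<Longrightarrow> (A has_real_derivative source_density lam0 n xs qs m s) (at s)" and t: "t \<ge> 0" and s: "s > 0" for m A t s
  proof (rule transport_along_characteristics[where S = "source_density lam0 n xs qs m" and A = A
          and k = "\<lambda>t. heat_pair lam0 m (z t)" and t = t and s = s and l = "\<lambda>t. heat_pair' lam0 m (z t)"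
          and \<nu> = "\<lambda>\<tau> t. sobolev_dual_norm q (\<lambda>c. z \<tau> c - z t c)"])
    show "((\<lambda>\<tau>. sobolev_dual_norm q (\<lambda>c. z \<tau> c - z t c)) \<longlongrightarrow> 0) (at t within {0..})" if "t \<ge> 0" for t
      using z(1) that by blast
  next
    fix \<alpha> \<beta> :: real assume ab: "0 < \<alpha>" "\<alpha> \<le> \<beta>"
    obtain M where M0: "M > 0" "\<forall>Z\<in>sobolev_dual q. \<forall>s\<in>{\<alpha>..\<beta>}. \<bar>Z (gauss (1 / (4 * s)) m)\<bar> \<le> M * sobolev_dual_norm q Z \<and>
        (\<forall>b\<in>Basis. \<bar>Z (quad_gauss (1 / (4 * s)) m b)\<bar> \<le> M * sobolev_dual_norm q Z)"
      using sobolev_dual_heat_gauss_bound[OF ab q0, of m] by blast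
    have M: "M > 0" "\<bar>Z (gauss (1 / (4 * s)) m)\<bar> \<le> M * sobolev_dual_norm q Z"
      "b \<in> Basis \<Longrightarrow> \<bar>Z (quad_gauss (1 / (4 * s)) m b)\<bar> \<le> M * sobolev_dual_norm q Z"
      if "Z \<in> sobolev_dual q" "s \<in> {\<alpha>..\<beta>}" for Z s b
      using M0(1) M0(2)[rule_format, OF that] by auto
    obtain C where C: "\<And>s n Z Y. s \<in> {\<alpha>..\<beta>} \<Longrightarrow> \<bar>Z (gauss (1 / (4 * s)) m) - Y (gauss (1 / (4 * s)) m)\<bar> \<le> M * n \<Longrightarrow>
       (\<And>b. b \<in> Basis \<Longrightarrow> \<bar>Z (quad_gauss (1 / (4 * s)) m b) - Y (quad_gauss (1 / (4 * s)) m b)\<bar> \<le> M * n) \<Longrightarrow>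
       \<bar>heat_pair lam0 m Z s - heat_pair lam0 m Y s\<bar> \<le> C * n \<and> \<bar>heat_pair' lam0 m Z s - heat_pair' lam0 m Y s\<bar> \<le> C * n"
      using heat_pair_bound[OF ab M0(1), of m lam0] by blast
    show "\<exists>C. \<forall>s\<in>{\<alpha>..\<beta>}. \<forall>t\<ge>0. \<forall>\<tau>\<ge>0.
       \<bar>heat_pair lam0 m (z \<tau>) s - heat_pair lam0 m (z t) s\<bar> \<le> C * sobolev_dual_norm q (\<lambda>c. z \<tau> c - z t c) \<and>
       \<bar>heat_pair' lam0 m (z \<tau>) s - heat_pair' lam0 m (z t) s\<bar> \<le> C * sobolev_dual_norm q (\<lambda>c. z \<tau> c - z t c)"
    proof (intro exI[of _ C] ballI allI impI)
      fix s t \<tau> :: real assume "s \<in> {\<alpha>..\<beta>}" "t \<ge> 0" "\<tau> \<ge> 0"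
      then have "(\<lambda>c. z \<tau> c - z t c) \<in> sobolev_dual q" using z(1) dd by blast
      from M(2,3)[OF this \<open>s \<in> {\<alpha>..\<beta>}\<close>]
      show "\<bar>heat_pair lam0 m (z \<tau>) s - heat_pair lam0 m (z t) s\<bar> \<le> C * sobolev_dual_norm q (\<lambda>c. z \<tau> c - z t c) \<and>
         \<bar>heat_pair' lam0 m (z \<tau>) s - heat_pair' lam0 m (z t) s\<bar> \<le> C * sobolev_dual_norm q (\<lambda>c. z \<tau> c - z t c)"
        by (intro C[OF \<open>s \<in> {\<alpha>..\<beta>}\<close>])
    qed
  next
    show "AE t in time. (\<forall>s>0. (heat_pair lam0 m (z t) has_real_derivative heat_pair' lam0 m (z t) s) (at s)) \<and> continuous_on {0<..} (heat_pair' lam0 m (z t))"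
      using AE_all
    proof eventually_elim
      case (elim t)
      then have w: "L1_plus_Linf (w t)" and e: "\<And>s. s > 0 \<Longrightarrow> heat_pair lam0 m (z t) s = heat_pair lam0 m (dual_embed (w t)) s"
        "\<And>s. s > 0 \<Longrightarrow> heat_pair' lam0 m (z t) s = heat_pair' lam0 m (dual_embed (w t)) s" by auto
      have "(heat_pair lam0 m (z t) has_real_derivative heat_pair' lam0 m (z t) s) (at s)" if "s > 0" for s
        unfolding e(2)[OF that]
        by (rule has_field_derivative_transform_within_open[OF heat_pair_DERIV[OF w that], of "{0<..}"]) (use that e(1) in auto)
      moreover have "continuous_on {0<..} (heat_pair' lam0 m (z t))"
        using heat_pair'_continuous[OF w, of lam0 m] by (rule continuous_on_cong[THEN iffD1, rotated -1]) (use e(2) in auto)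
      ultimately show ?case by blast
    qed
  next
    fix s :: real and \<phi> :: "real \<Rightarrow> real" assume s: "s > 0" and \<phi>: "\<phi> \<in> test_funs {0<..}"
    define h where "h = heat_factor lam0 TYPE('a) s"
    define \<eta> where "\<eta> = gauss (1 / (4 * s)) m"
    have \<eta>s: "\<eta> \<in> sobolev 1 q UNIV" unfolding \<eta>_def by (rule gauss_mem_sobolev[OF s q0])
    obtain M where M: "M > 0" "\<forall>Z\<in>sobolev_dual q. \<forall>r\<in>{s..s}. \<bar>Z (gauss (1 / (4 * r)) m)\<bar> \<le> M * sobolev_dual_norm q Z"
      using sobolev_dual_heat_gauss_bound[OF s order_refl q0, of m] by blast
    interpret bf: bounded_functional "sobolev_dual q" "sobolev_dual_norm q" "\<lambda>Z. Z \<eta>" M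
      by (rule bounded_functional_sobolev_dual[OF M(1)]) (use M(2)[rule_format, of _ s] in \<open>simp add: \<eta>_def\<close>)
    note pr = bf.weak_time_deriv_pairing[OF wt(1) _ \<phi>, simplified]
    have hp: "heat_pair lam0 m (dual_embed f) s = h * dual_embed f \<eta>" for f by (simp add: heat_pair_def h_def \<eta>_def)
    have "(LINT t|time. deriv \<phi> t * heat_pair lam0 m (z t) s) = (LINT t|time. h * (deriv \<phi> t * dual_embed (w t) \<eta>))"
    proof (rule integral_time_cong_AE)
      show "integrable time (\<lambda>t. h * (deriv \<phi> t * dual_embed (w t) \<eta>))" using pr(2) by simp
      show "AE t in time. h * (deriv \<phi> t * dual_embed (w t) \<eta>) = deriv \<phi> t * heat_pair lam0 m (z t) s"
        using AE_all by eventually_elim (use s in \<open>simp add: hp\<close>)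
    qed
    also have "\<dots> = - (LINT t|time. h * (\<phi> t * wt t \<eta>))" using pr(4) by simp
    also have "(LINT t|time. h * (\<phi> t * wt t \<eta>)) = (LINT t|time. \<phi> t * (heat_pair' lam0 m (z t) s + source_density lam0 n xs qs m s))"
    proof (rule integral_time_cong_AE[symmetric])
      show "integrable time (\<lambda>t. h * (\<phi> t * wt t \<eta>))" using pr(3) by simp
      show "AE t in time. h * (\<phi> t * wt t \<eta>) = \<phi> t * (heat_pair' lam0 m (z t) s + source_density lam0 n xs qs m s)"
        using AE_all
      proof eventually_elim
        case (elim t)
        have "dirac x \<eta> = \<eta> x" for x by (rule dirac_continuous) (simp add: \<eta>_def continuous_on_gauss)
        then have "wt t \<eta> = - L_weak lam0 (w t) \<eta> + (\<Sum>i=1..n. qs i * \<eta> (xs i))" using elim \<eta>s by (auto simp: algebra_simps)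
        then have "h * wt t \<eta> = - (h * L_weak lam0 (w t) \<eta>) + h * (\<Sum>i=1..n. qs i * \<eta> (xs i))"
          by (simp only: distrib_left mult_minus_right)
        also have "\<dots> = heat_pair' lam0 m (z t) s + source_density lam0 n xs qs m s"
          using L_weak_test_gauss[of "w t" p s lam0 m] elim s pq by (simp add: h_def \<eta>_def source_density_def)
        finally show ?case by (simp add: mult.left_commute)
      qed
    qed
    finally show "(LINT t|time. deriv \<phi> t * heat_pair lam0 m (z t) s) = - (LINT t|time. \<phi> t * (heat_pair' lam0 m (z t) s + source_density lam0 n xs qs m s))" .
  next
    fix s :: real assume s: "s > 0"
    have "(\<lambda>c. 0 * z 0 c + 0 * z 0 c) \<in> sobolev_dual q" using z(1) by (intro sobolev_dual_lincomb) auto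
    then have "(\<lambda>c :: 'a \<Rightarrow> real. 0) \<in> sobolev_dual q" by simp
    from null(1)[OF _ this z(3) s, of m] z(1) show "heat_pair lam0 m (z 0) s = 0" by (simp add: heat_pair_def)
  qed (use A t s in auto)
  show ?thesis
    using AE_all
  proof eventually_elim
    case (elim t)
    have "w t \<in> Lp p UNIV" using elim by (simp add: sobolev_def)
    moreover have "heat_pair lam0 m (dual_embed (w t)) s = A (s + t) - A s"
      if "\<forall>s>0. (A has_real_derivative source_density lam0 n xs qs m s) (at s)" "s > 0" for m A s
      using main[of A m t s] that elim by auto
    ultimately show ?case by blast
  qed
qed

section \<open>Concentration of the heat kernel\<close>

definition gauss_mass :: "'a::euclidean_space itself \<Rightarrow> real" where
  "gauss_mass T = (LINT x|lebesgue. gauss (1 / 4) (0 :: 'a) x)"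

text \<open>Substitution \<open>x = m + \<surd>s y\<close>.\<close>

lemma integral_heat_gauss:
  fixes m :: "'a::euclidean_space"
  assumes s: "s > 0"
  shows "s powr (- real DIM('a) / 2) * (LINT x|lebesgue. gauss (1 / (4 * s)) m x) = gauss_mass TYPE('a)"
proof -
  define c where "c = sqrt s"
  have c: "c > 0" "c\<^sup>2 = s" using s by (auto simp: c_def)
  have "(LINT x|lborel. gauss (1 / (4 * s)) m x) =
      (LINT x|density (distr lborel borel (\<lambda>x. m + c *\<^sub>R x)) (\<lambda>_. ennreal (\<bar>c\<bar> ^ DIM('a))). gauss (1 / (4 * s)) m x)"
    using lborel_affine[of c m] c by simp
  also have "\<dots> = (LINT x|distr lborel borel (\<lambda>x. m + c *\<^sub>R x). c ^ DIM('a) *\<^sub>R gauss (1 / (4 * s)) m x)"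
    using c by (subst integral_density) auto
  also have "\<dots> = (LINT x|lborel. c ^ DIM('a) *\<^sub>R gauss (1 / (4 * s)) m (m + c *\<^sub>R x))"
    by (subst integral_distr) auto
  also have "(\<lambda>x. c ^ DIM('a) *\<^sub>R gauss (1 / (4 * s)) m (m + c *\<^sub>R x)) = (\<lambda>x. c ^ DIM('a) * gauss (1 / 4) (0 :: 'a) x)"
    using c s by (auto simp: gauss_def power_mult_distrib)
  also have "(LINT x|lborel. c ^ DIM('a) * gauss (1 / 4) (0 :: 'a) x) = c ^ DIM('a) * (LINT x|lborel. gauss (1 / 4) (0 :: 'a) x)" by simp
  finally have "(LINT x|lebesgue. gauss (1 / (4 * s)) m x) = c ^ DIM('a) * gauss_mass TYPE('a)"
    by (simp add: gauss_mass_def integral_completion)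
  moreover have "c ^ DIM('a) = s powr (real DIM('a) / 2)"
    using s by (simp add: c_def powr_half_sqrt[symmetric] powr_powr flip: powr_realpow)
  ultimately show ?thesis using s by (simp flip: mult.assoc powr_add)
qed

lemma gauss_mass_pos: "gauss_mass TYPE('a::euclidean_space) > 0"
proof -
  have i: "integrable lebesgue (gauss (1 / 4) (0 :: 'a))"
    using bounded_integrable_gauss[of "1/4" 1 "0 :: 'a"] by (simp add: bounded_integrable_def)
  have "gauss_mass TYPE('a) \<ge> 0" unfolding gauss_mass_def by (intro integral_nonneg_AE) (simp add: gauss_pos less_imp_le)
  moreover have "gauss_mass TYPE('a) \<noteq> 0"
  proof
    assume "gauss_mass TYPE('a) = 0"
    then have "AE x in lebesgue. gauss (1 / 4) (0 :: 'a) x = 0"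
      unfolding gauss_mass_def using i by (subst (asm) integral_nonneg_eq_0_iff_AE) (auto simp: gauss_pos less_imp_le)
    then have "AE x in (lebesgue :: 'a measure). x \<notin> UNIV"
      by eventually_elim (use gauss_pos in \<open>auto simp: less_le\<close>)
    then have "negligible (UNIV :: 'a set)"
      by (subst (asm) AE_iff_null_sets[symmetric]) (auto simp: negligible_iff_null_sets)
    then show False using open_not_negligible[of "UNIV :: 'a set"] by simp
  qed
  ultimately show ?thesis by simp
qed

text \<open>Half of the exponent provides the decay as \<open>s \<rightarrow> 0\<close>, the other half an
  integrable majorant independent of \<open>s\<close>.\<close>

lemma heat_gauss_far_bound:
  fixes m x :: "'a::euclidean_space"
  assumes s: "0 < s" "s \<le> 1"
  shows "gauss (1 / (4 * s)) m x \<le> exp (- (norm (x - m))\<^sup>2 / (8 * s)) * gauss (1 / 8) m x"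
proof -
  have "(norm (x - m))\<^sup>2 * (1 / 8) \<le> (norm (x - m))\<^sup>2 * (1 / (8 * s))"
    using s by (intro mult_left_mono) (auto simp: field_simps)
  then show ?thesis by (simp add: gauss_def mult_exp_exp)
qed

text \<open>Near \<open>m\<close> the function is small and the kernel has constant mass. At distance at least
  \<open>\<delta>\<close> the kernel is below \<open>exp (- \<delta>\<^sup>2 / (8 * s))\<close>
  times a fixed Gaussian, and this factor beats the power \<open>s powr (- n / 2)\<close>.\<close>

lemma concentration:
  fixes f :: "'a::euclidean_space \<Rightarrow> real"
  assumes f: "L1_plus_Linf f" and pv: "has_point_value f m 0" and lam0: "lam0 \<ge> 0"
  shows "((\<lambda>s. heat_pair lam0 m (dual_embed f) s) \<longlongrightarrow> 0) (at_right 0)"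
proof -
  obtain U g where U: "open U" "m \<in> U" "continuous_on U g" "AE x in lebesgue. x \<in> U \<longrightarrow> g x = f x" "g m = 0"
    using pv by (auto simp: has_point_value_def)
  define \<kappa> where "\<kappa> = gauss_mass TYPE('a)"
  have \<kappa>: "\<kappa> > 0" by (simp add: \<kappa>_def gauss_mass_pos)
  define J where "J = (LINT x|lebesgue. \<bar>f x\<bar> * gauss (1 / 8) m x)"
  have fa: "L1_plus_Linf (\<lambda>x. \<bar>f x\<bar>)" using f by (auto simp: L1_plus_Linf_def)
  have iJ: "integrable lebesgue (\<lambda>x. \<bar>f x\<bar> * gauss (1 / 8) m x)"
    using integrable_majorant[OF fa bounded_integrable_gauss[of "1/8" 1 m]] by simp
  have J0: "J \<ge> 0" unfolding J_def by (intro integral_nonneg_AE AE_I2) (simp add: gauss_pos less_imp_le)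
  show ?thesis
    unfolding tendsto_iff dist_real_def
  proof (intro allI impI)
    fix e :: real assume e: "e > 0"
    define e' where "e' = e / (2 * \<kappa>)"
    have e': "e' > 0" using e \<kappa> by (simp add: e'_def)
    have "isCont g m" using U(1-3) by (simp add: continuous_on_eq_continuous_at)
    then have "(g \<longlongrightarrow> g m) (nhds m)" unfolding isCont_def tendsto_at_iff_tendsto_nhds .
    from tendstoD[OF this e'] have "\<forall>\<^sub>F x in nhds m. dist (g x) 0 < e'" by (simp add: U(5))
    moreover have "\<forall>\<^sub>F x in nhds m. x \<in> U" using U by (simp add: eventually_nhds_in_open)
    ultimately have "\<forall>\<^sub>F x in nhds m. \<bar>g x\<bar> < e' \<and> x \<in> U" by eventually_elim simp
    then obtain \<delta> where \<delta>: "\<delta> > 0" "\<And>x. dist x m < \<delta> \<Longrightarrow> \<bar>g x\<bar> < e' \<and> x \<in> U"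
      unfolding eventually_nhds_metric by blast
    obtain K where K: "K \<ge> 0" "\<And>y::real. \<bar>y\<bar> ^ Suc DIM('a) * exp (- (\<delta>\<^sup>2 / 8) * y\<^sup>2) \<le> K"
      using power_times_gauss_bound[of "\<delta>\<^sup>2 / 8" "Suc DIM('a)"] \<delta>(1) by (metis divide_pos_pos zero_less_numeral zero_less_power)
    have pair: "\<bar>heat_pair lam0 m (dual_embed f) s\<bar> \<le> e' * \<kappa> + K * sqrt s * J" if s: "0 < s" "s \<le> 1" for s
    proof -
      define h where "h = s powr (- real DIM('a) / 2)"
      have h: "h > 0" using s by (simp add: h_def)
      have far: "h * exp (- \<delta>\<^sup>2 / (8 * s)) \<le> K * sqrt s"
      proof -
        define y where "y = 1 / sqrt s"
        have y: "y > 0" "y\<^sup>2 = 1 / s" using s by (auto simp: y_def power_divide)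
        have "y ^ DIM('a) = h"
          using s by (simp add: y_def h_def powr_minus powr_half_sqrt[symmetric] powr_powr powr_minus_divide power_one_over inverse_eq_divide flip: powr_realpow)
        moreover have "y ^ Suc DIM('a) * exp (- (\<delta>\<^sup>2 / 8) * y\<^sup>2) \<le> K" using K(2)[of y] y by simp
        ultimately have "y * (h * exp (- \<delta>\<^sup>2 / (8 * s))) \<le> K" using y by (simp add: mult.assoc)
        then show ?thesis using s by (simp add: y_def field_simps)
      qed
      have gi: "integrable lebesgue (gauss (1 / (4 * s)) m)"
        using bounded_integrable_heat_gauss[OF s(1), of m] by (simp add: bounded_integrable_def)
      have fi: "integrable lebesgue (\<lambda>x. f x * gauss (1 / (4 * s)) m x)"
        by (rule integrable_majorant[OF f bounded_integrable_heat_gauss[OF s(1)]])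
      have "\<bar>LINT x|lebesgue. f x * gauss (1 / (4 * s)) m x\<bar> \<le> (LINT x|lebesgue. \<bar>f x * gauss (1 / (4 * s)) m x\<bar>)"
        using integral_norm_bound[of lebesgue "\<lambda>x. f x * gauss (1 / (4 * s)) m x"] by simp
      also have "\<dots> \<le> (LINT x|lebesgue. e' * gauss (1 / (4 * s)) m x + exp (- \<delta>\<^sup>2 / (8 * s)) * (\<bar>f x\<bar> * gauss (1 / 8) m x))"
      proof (rule integral_mono_AE)
        show "AE x in lebesgue. \<bar>f x * gauss (1 / (4 * s)) m x\<bar> \<le> e' * gauss (1 / (4 * s)) m x + exp (- \<delta>\<^sup>2 / (8 * s)) * (\<bar>f x\<bar> * gauss (1 / 8) m x)"
          using U(4)
        proof eventually_elim
          case (elim x)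
          note gp = gauss_pos[of "1 / (4 * s)" m x] gauss_pos[of "1 / 8" m x]
          show ?case
          proof (cases "dist x m < \<delta>")
            case True
            then have "\<bar>f x\<bar> \<le> e'" using \<delta>(2)[OF True] elim by auto
            then have "\<bar>f x\<bar> * gauss (1 / (4 * s)) m x \<le> e' * gauss (1 / (4 * s)) m x" using gp by (intro mult_right_mono) auto
            moreover have "0 \<le> exp (- \<delta>\<^sup>2 / (8 * s)) * (\<bar>f x\<bar> * gauss (1 / 8) m x)" using gp by simp
            ultimately show ?thesis unfolding abs_mult abs_of_pos[OF gp(1)] by linarith
          next
            case False
            then have "\<delta>\<^sup>2 \<le> (norm (x - m))\<^sup>2" using \<delta>(1) by (intro power_mono) (auto simp: dist_norm)
            then have "exp (- (norm (x - m))\<^sup>2 / (8 * s)) \<le> exp (- \<delta>\<^sup>2 / (8 * s))"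
              using s by (simp add: divide_right_mono)
            then have "gauss (1 / (4 * s)) m x \<le> exp (- \<delta>\<^sup>2 / (8 * s)) * gauss (1 / 8) m x"
              using heat_gauss_far_bound[OF s, of m x] gp by (meson mult_right_mono order_trans less_imp_le)
            then have "\<bar>f x\<bar> * gauss (1 / (4 * s)) m x \<le> \<bar>f x\<bar> * (exp (- \<delta>\<^sup>2 / (8 * s)) * gauss (1 / 8) m x)"
              by (intro mult_left_mono) auto
            moreover have "0 \<le> e' * gauss (1 / (4 * s)) m x" using gp e' by simp
            ultimately show ?thesis unfolding abs_mult abs_of_pos[OF gp(1)] mult.left_commute[of "exp _" "\<bar>f x\<bar>"] by linarith
          qed
        qed
      qed (use fi gi iJ in auto)
      also have "\<dots> = e' * (LINT x|lebesgue. gauss (1 / (4 * s)) m x) + exp (- \<delta>\<^sup>2 / (8 * s)) * J"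
        using gi iJ by (simp add: J_def)
      finally have "h * \<bar>LINT x|lebesgue. f x * gauss (1 / (4 * s)) m x\<bar> \<le> h * (e' * (LINT x|lebesgue. gauss (1 / (4 * s)) m x) + exp (- \<delta>\<^sup>2 / (8 * s)) * J)"
        using h by (intro mult_left_mono) auto
      also have "\<dots> = e' * \<kappa> + (h * exp (- \<delta>\<^sup>2 / (8 * s))) * J"
        using integral_heat_gauss[OF s(1), of m] by (simp add: h_def \<kappa>_def algebra_simps)
      also have "\<dots> \<le> e' * \<kappa> + (K * sqrt s) * J" using far J0 by (intro add_left_mono mult_right_mono) auto
      finally have *: "h * \<bar>LINT x|lebesgue. f x * gauss (1 / (4 * s)) m x\<bar> \<le> e' * \<kappa> + K * sqrt s * J" .
      have "\<bar>heat_pair lam0 m (dual_embed f) s\<bar> = exp (- lam0 * s) * (h * \<bar>LINT x|lebesgue. f x * gauss (1 / (4 * s)) m x\<bar>)"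
        using s by (simp add: heat_pair_def heat_factor_def dual_embed_def h_def abs_mult)
      also have "\<dots> \<le> 1 * (h * \<bar>LINT x|lebesgue. f x * gauss (1 / (4 * s)) m x\<bar>)"
        using lam0 s h by (intro mult_right_mono) auto
      finally show ?thesis using * by simp
    qed
    have "((\<lambda>s. e' * \<kappa> + K * sqrt s * J) \<longlongrightarrow> e' * \<kappa> + K * sqrt 0 * J) (at_right 0)"
      by (intro tendsto_intros)
    moreover have "e' * \<kappa> + K * sqrt 0 * J < e" using e \<kappa> by (simp add: e'_def)
    ultimately have "\<forall>\<^sub>F s in at_right 0. e' * \<kappa> + K * sqrt s * J < e" by (rule order_tendstoD(2))
    moreover have "\<forall>\<^sub>F s in at_right (0::real). 0 < s \<and> s < 1" by (auto simp: eventually_at_right_field intro!: exI[of _ 1])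
    ultimately show "\<forall>\<^sub>F s in at_right 0. \<bar>heat_pair lam0 m (dual_embed f) s - 0\<bar> < e"
    proof eventually_elim
      case (elim s)
      then show ?case using pair[of s] by simp
    qed
  qed
qed

lemma gauss_commute: "gauss c m x = gauss c x m"
  by (simp add: gauss_def norm_minus_commute)

text \<open>By Fubini, a function orthogonal to all Gaussians is orthogonal to the Gauss transforms of the
  indicators of boxes, and these transforms converge to the indicators.\<close>

lemma AE_zero_if_orthogonal_to_gaussians:
  fixes f :: "'a::euclidean_space \<Rightarrow> real"
  assumes f: "L1_plus_Linf f" and zero: "\<And>m s. s > 0 \<Longrightarrow> (LINT x|lebesgue. f x * gauss (1 / (4 * s)) m x) = 0"
  shows "AE x in lebesgue. f x = 0"
proof (rule AE_zero_if_box_integrals_zero[OF L1_plus_Linf_locally_integrable[OF f]])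
  fix a b :: 'a
  define \<kappa> where "\<kappa> = gauss_mass TYPE('a)"
  have \<kappa>: "\<kappa> > 0" by (simp add: \<kappa>_def gauss_mass_pos)
  define i where "i = indicat_real (box a b)"
  have im: "i \<in> borel_measurable lebesgue" unfolding i_def by (intro borel_measurable_indicator) simp
  have ib: "L1_plus_Linf i" unfolding L1_plus_Linf_def
    by (intro conjI im exI[of _ "\<lambda>_. 0"] exI[of _ 1]) (auto simp: i_def indicator_def)
  define h where "h s = s powr (- real DIM('a) / 2)" for s
  define P where "P s x = h s * (LINT m|lebesgue. i m * gauss (1 / (4 * s)) x m)" for s x
  have P_pair: "P s x = heat_pair 0 x (dual_embed i) s" for s x
    by (simp add: P_def heat_pair_def heat_factor_def h_def dual_embed_def)
  obtain R where R: "R > 0" "\<And>m. m \<in> box a b \<Longrightarrow> norm m \<le> R"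
    using bounded_pos[THEN iffD1, OF bounded_box[of a b]] by blast
  define C where "C = 2 powr (real DIM('a) / 2) * \<kappa> * exp (R\<^sup>2 / 8)"
  have igi: "integrable lebesgue (\<lambda>m. i m * gauss (1 / (4 * s)) x m)" if "s > 0" for s x
    by (rule integrable_majorant[OF ib bounded_integrable_heat_gauss[OF that]])
  \<comment> \<open>For \<open>m\<close> in the box, \<open>|x|\<^sup>2 \<le> 2 |x - m|\<^sup>2 + 2 R\<^sup>2\<close> exchanges part of the Gaussian in \<open>x - m\<close> for a Gaussian in \<open>x\<close>. The kernel with time parameter \<open>2 * s\<close> is left over, and its mass is known.\<close>
  have P_bound: "\<bar>P s x\<bar> \<le> C * gauss (1 / 16) 0 x" and P_nonneg: "P s x \<ge> 0" if s: "0 < s" "s \<le> 1" for s x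
  proof -
    have h: "h s > 0" using s by (simp add: h_def)
    have g2: "integrable lebesgue (gauss (1 / (4 * (2 * s))) x)"
      using bounded_integrable_heat_gauss[of "2 * s" x] s by (simp add: bounded_integrable_def)
    have "(LINT m|lebesgue. i m * gauss (1 / (4 * s)) x m) \<le> (LINT m|lebesgue. exp (R\<^sup>2 / 8) * gauss (1 / 16) 0 x * gauss (1 / (4 * (2 * s))) x m)"
    proof (rule integral_mono[OF igi[OF s(1)]])
      fix m
      show "i m * gauss (1 / (4 * s)) x m \<le> exp (R\<^sup>2 / 8) * gauss (1 / 16) 0 x * gauss (1 / (4 * (2 * s))) x m"
      proof (cases "m \<in> box a b")
        case True
        have "norm x \<le> norm (m - x) + norm m" using norm_triangle_ineq4[of m "m - x"] by simp
        then have "(norm x)\<^sup>2 \<le> (norm (m - x) + R)\<^sup>2" using R(2)[OF True] by (intro power_mono) auto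
        also have "\<dots> \<le> 2 * (norm (m - x))\<^sup>2 + 2 * R\<^sup>2"
          using zero_le_power2[of "norm (m - x) - R"] by (simp add: power2_eq_square algebra_simps)
        finally have "gauss (1 / 8) x m \<le> exp (R\<^sup>2 / 8) * gauss (1 / 16) 0 x"
          by (simp add: gauss_def mult_exp_exp)
        moreover have "gauss (1 / (4 * s)) x m \<le> gauss (1 / 8) x m * gauss (1 / (4 * (2 * s))) x m"
          using heat_gauss_far_bound[OF s, of x m] by (simp add: gauss_def mult.commute)
        ultimately have "gauss (1 / (4 * s)) x m \<le> (exp (R\<^sup>2 / 8) * gauss (1 / 16) 0 x) * gauss (1 / (4 * (2 * s))) x m"
          using gauss_pos[of "1 / (4 * (2 * s))" x m] by (meson mult_right_mono order_trans less_imp_le)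
        then show ?thesis using True by (simp add: i_def)
      qed (simp add: i_def gauss_pos less_imp_le)
    qed (use g2 in auto)
    also have "\<dots> = exp (R\<^sup>2 / 8) * gauss (1 / 16) 0 x * (LINT m|lebesgue. gauss (1 / (4 * (2 * s))) x m)" by simp
    finally have "P s x \<le> h s * (exp (R\<^sup>2 / 8) * gauss (1 / 16) 0 x * (LINT m|lebesgue. gauss (1 / (4 * (2 * s))) x m))"
      unfolding P_def using h by (intro mult_left_mono) auto
    also have "\<dots> = C * gauss (1 / 16) 0 x"
    proof -
      have "h s = 2 powr (real DIM('a) / 2) * (2 * s) powr (- real DIM('a) / 2)"
        using s by (simp add: h_def powr_mult flip: powr_add mult.assoc)
      then have "h s * (LINT m|lebesgue. gauss (1 / (4 * (2 * s))) x m) = 2 powr (real DIM('a) / 2) * \<kappa>"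
        using integral_heat_gauss[of "2 * s" x] s by (simp add: \<kappa>_def mult.assoc)
      then show ?thesis by (simp add: C_def mult_ac)
    qed
    finally have "P s x \<le> C * gauss (1 / 16) 0 x" .
    moreover show "P s x \<ge> 0" unfolding P_def using h
      by (intro mult_nonneg_nonneg integral_nonneg_AE) (auto simp: i_def gauss_pos less_imp_le)
    ultimately show "\<bar>P s x\<bar> \<le> C * gauss (1 / 16) 0 x" by simp
  qed
  have P_lim: "((\<lambda>s. P s x) \<longlongrightarrow> \<kappa> * i x) (at_right 0)" if x: "x \<notin> frontier (box a b)" for x
  proof -
    \<comment> \<open>Off the frontier the indicator is locally constant, so that \<open>j\<close> has the point value \<open>0\<close> at \<open>x\<close>.\<close>
    define j where "j y = i y - i x" for y
    have j: "L1_plus_Linf j" unfolding j_def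
      by (rule L1_plus_Linf_diff[OF ib]) (auto simp: L1_plus_Linf_def intro!: exI[of _ "\<lambda>_. 0"] exI[of _ "\<bar>i x\<bar>"])
    have "has_point_value j x 0"
    proof -
      have "\<exists>U. open U \<and> x \<in> U \<and> (\<forall>y\<in>U. i y = i x)"
      proof (cases "x \<in> box a b")
        case True then show ?thesis by (intro exI[of _ "box a b"]) (auto simp: i_def)
      next
        case False
        then have "x \<notin> closure (box a b)" using x interior_open[OF open_box[of a b]] by (auto simp: frontier_def)
        then show ?thesis using closure_subset[of "box a b"] False by (intro exI[of _ "- closure (box a b)"]) (auto simp: i_def indicator_def)
      qed
      then show ?thesis unfolding has_point_value_def j_def by (metis (mono_tags, lifting) AE_I2 continuous_on_const diff_self)
    qed
    from concentration[OF j this, of 0] have "((\<lambda>s. heat_pair 0 x (dual_embed j) s) \<longlongrightarrow> 0) (at_right 0)" by simp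
    then have "((\<lambda>s. heat_pair 0 x (dual_embed j) s + \<kappa> * i x) \<longlongrightarrow> 0 + \<kappa> * i x) (at_right 0)" by (intro tendsto_intros)
    moreover have "\<forall>\<^sub>F s in at_right 0. heat_pair 0 x (dual_embed j) s + \<kappa> * i x = P s x"
    proof -
      have "heat_pair 0 x (dual_embed j) s + \<kappa> * i x = P s x" if "s > 0" for s
      proof -
        have g: "integrable lebesgue (gauss (1 / (4 * s)) x)"
          using bounded_integrable_heat_gauss[OF that, of x] by (simp add: bounded_integrable_def)
        have "dual_embed j (gauss (1 / (4 * s)) x) = dual_embed i (gauss (1 / (4 * s)) x) - i x * (LINT m|lebesgue. gauss (1 / (4 * s)) x m)"
          using igi[OF that, of x] g by (simp add: dual_embed_def j_def left_diff_distrib)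
        moreover have "heat_pair 0 x (dual_embed j) s = h s * dual_embed j (gauss (1 / (4 * s)) x)"
          by (simp add: heat_pair_def heat_factor_def h_def)
        moreover have "P s x = h s * dual_embed i (gauss (1 / (4 * s)) x)" by (simp add: P_def dual_embed_def)
        moreover have "\<kappa> = h s * (LINT m|lebesgue. gauss (1 / (4 * s)) x m)"
          unfolding \<kappa>_def h_def by (rule integral_heat_gauss[OF that, symmetric])
        ultimately show ?thesis by (simp only:) (simp add: algebra_simps)
      qed
      then show ?thesis by (auto simp: eventually_at_right_field intro!: exI[of _ 1])
    qed
    ultimately show ?thesis by (simp add: tendsto_cong)
  qed
  \<comment> \<open>Fubini needs a Borel representative of \<open>f\<close>.\<close>
  obtain f' where f': "f' \<in> borel_measurable lborel" "AE x in lborel. f x = f' x"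
    using completion_ex_borel_measurable_real[of f lborel] L1_plus_Linf_measurable[OF f] by auto
  have ae: "AE x in lebesgue. f x = f' x" using f'(2) by (rule AE_completion)
  have P_borel: "P s \<in> borel_measurable borel" if "s > 0" for s
  proof -
    have "(\<lambda>x. LINT m|lborel. i m * gauss (1 / (4 * s)) x m) \<in> borel_measurable borel"
      unfolding i_def gauss_def by measurable
    moreover have "(LINT m|lebesgue. i m * gauss (1 / (4 * s)) x m) = (LINT m|lborel. i m * gauss (1 / (4 * s)) x m)" for x
      unfolding i_def by (rule integral_completion) measurable
    ultimately show ?thesis unfolding P_def[abs_def] by simp
  qed
  have P_bi: "bounded_integrable (P s)" if "0 < s" "s \<le> 1" for s
    by (rule bounded_integrable_bound[OF bounded_integrable_gauss[of "1/16" C 0]])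
       (use P_bound[OF that] P_borel[OF that(1)] in \<open>auto intro: measurable_completion\<close>)
  have ortho: "(LINT x|lebesgue. f x * P s x) = 0" if s: "0 < s" "s \<le> 1" for s
  proof -
    note [measurable] = f'(1)
    have h: "h s > 0" using s by (simp add: h_def)
    define F where "F = (\<lambda>(x, m). f' x * (i m * gauss (1 / (4 * s)) x m))"
    have F[measurable]: "F \<in> borel_measurable (lborel \<Otimes>\<^sub>M lborel)"
      unfolding F_def i_def gauss_def by measurable
    have lb: "(LINT m|lborel. i m * gauss (1 / (4 * s)) x m) = P s x / h s" for x
    proof -
      have "(LINT m|lebesgue. i m * gauss (1 / (4 * s)) x m) = (LINT m|lborel. i m * gauss (1 / (4 * s)) x m)"
        unfolding i_def by (rule integral_completion) measurable
      then show ?thesis using h by (simp add: P_def)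
    qed
    have ilb: "integrable lborel (\<lambda>m. i m * gauss (1 / (4 * s)) x m)" for x
    proof -
      have "(\<lambda>m. i m * gauss (1 / (4 * s)) x m) \<in> borel_measurable lborel" unfolding i_def by measurable
      then show ?thesis using igi[OF s(1), of x] by (simp add: integrable_completion)
    qed
    have fP: "integrable lebesgue (\<lambda>x. f x * P s x)" by (rule integrable_majorant[OF f P_bi[OF s]])
    have m': "(\<lambda>x. f' x * P s x) \<in> borel_measurable lborel" using P_borel[OF s(1)] by measurable
    have aeP: "AE x in lebesgue. f x * P s x = f' x * P s x" using ae by eventually_elim simp
    have fP': "integrable lborel (\<lambda>x. f' x * P s x)"
    proof -
      have "integrable lebesgue (\<lambda>x. f' x * P s x)"
        using fP aeP m' by (subst integrable_cong_AE[where g = "\<lambda>x. f x * P s x"]) (auto intro: measurable_completion)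
      then show ?thesis using m' by (simp add: integrable_completion)
    qed
    have intF: "integrable (lborel \<Otimes>\<^sub>M lborel) F"
    proof (rule lborel_pair.Fubini_integrable[OF F])
      have "(\<lambda>x. LINT m|lborel. norm (F (x, m))) = (\<lambda>x. \<bar>f' x * P s x\<bar> / h s)"
      proof
        fix x
        have "(LINT m|lborel. norm (F (x, m))) = (LINT m|lborel. \<bar>f' x\<bar> * (i m * gauss (1 / (4 * s)) x m))"
          by (intro Bochner_Integration.integral_cong) (auto simp: F_def abs_mult i_def gauss_pos less_imp_le)
        also have "\<dots> = \<bar>f' x\<bar> * (P s x / h s)" by (simp add: lb)
        finally show "(LINT m|lborel. norm (F (x, m))) = \<bar>f' x * P s x\<bar> / h s" using P_nonneg[OF s, of x] by (simp add: abs_mult)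
      qed
      then show "integrable lborel (\<lambda>x. LINT m|lborel. norm (F (x, m)))" using fP' by simp
      show "AE x in lborel. integrable lborel (\<lambda>m. F (x, m))" using ilb by (auto simp: F_def)
    qed
    have "(LINT x|lborel. LINT m|lborel. F (x, m)) = (LINT m|lborel. LINT x|lborel. F (x, m))"
      using lborel_pair.Fubini_integral[of "\<lambda>x m. F (x, m)"] intF by simp
    moreover have "(LINT x|lborel. F (x, m)) = 0" for m
    proof -
      have "(LINT x|lborel. F (x, m)) = i m * (LINT x|lborel. f' x * gauss (1 / (4 * s)) m x)"
        unfolding F_def by (subst gauss_commute) (simp add: mult_ac flip: integral_mult_right_zero)
      also have "(LINT x|lborel. f' x * gauss (1 / (4 * s)) m x) = (LINT x|lebesgue. f' x * gauss (1 / (4 * s)) m x)"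
        by (rule integral_completion[symmetric]) measurable
      also have "\<dots> = (LINT x|lebesgue. f x * gauss (1 / (4 * s)) m x)"
      proof (rule integral_cong_AE)
        show "(\<lambda>x. f' x * gauss (1 / (4 * s)) m x) \<in> borel_measurable lebesgue" by (intro measurable_completion) measurable
        show "(\<lambda>x. f x * gauss (1 / (4 * s)) m x) \<in> borel_measurable lebesgue"
          using L1_plus_Linf_measurable[OF f] by measurable
        show "AE x in lebesgue. f' x * gauss (1 / (4 * s)) m x = f x * gauss (1 / (4 * s)) m x" using ae by eventually_elim simp
      qed
      also have "\<dots> = 0" by (rule zero[OF s(1)])
      finally show ?thesis by simp
    qed
    ultimately have "(LINT x|lborel. LINT m|lborel. F (x, m)) = 0" by simp
    then have "(LINT x|lborel. f' x * P s x / h s) = 0" by (simp add: F_def lb)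
    then have "(LINT x|lborel. f' x * P s x) = 0" using h by simp
    then have "(LINT x|lebesgue. f' x * P s x) = 0" using m' by (simp add: integral_completion)
    then show ?thesis using integral_cong_AE[OF _ _ aeP] fP m' by (simp add: measurable_completion)
  qed
  define S where "S n = inverse (real (Suc n))" for n
  have S: "0 < S n" "S n \<le> 1" for n by (auto simp: S_def field_simps)
  have S_lim: "filterlim S (at_right 0) sequentially"
    using LIMSEQ_inverse_real_of_nat S(1) unfolding S_def[abs_def] filterlim_at by (auto intro!: always_eventually)
  define G where "G n x = indicator (- frontier (box a b)) x * P (S n) x" for n x
  have nullf: "AE x in lebesgue. x \<notin> frontier (box a b)"
    using negligible_convex_frontier[OF convex_box(2), of a b] unfolding negligible_iff_null_sets by (rule AE_not_in)
  have "(\<lambda>n. LINT x|lebesgue. f x * G n x) \<longlonglongrightarrow> (LINT x|lebesgue. f x * (indicator (- frontier (box a b)) x * (\<kappa> * i x)))"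
  proof (rule integral_against_tendsto[OF f bounded_integrable_gauss[of "1/16" C 0]])
    show "G n \<in> borel_measurable lebesgue" for n
      unfolding G_def[abs_def] using P_borel[OF S(1), of n] by (intro measurable_completion) simp
    show "(\<lambda>x. indicator (- frontier (box a b)) x * (\<kappa> * i x)) \<in> borel_measurable lebesgue"
      unfolding i_def by (intro measurable_completion) simp
    show "\<bar>G n x\<bar> \<le> C * gauss (1 / 16) 0 x" for n x
      using P_bound[OF S, of n x] abs_ge_zero[of "P (S n) x"] by (auto simp: G_def indicator_def simp del: abs_ge_zero)
    show "(\<lambda>n. G n x) \<longlonglongrightarrow> indicator (- frontier (box a b)) x * (\<kappa> * i x)" for x
      using filterlim_compose[OF P_lim S_lim, of x] by (cases "x \<in> frontier (box a b)") (auto simp: G_def)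
  qed simp
  moreover have "(LINT x|lebesgue. f x * G n x) = 0" for n
  proof -
    have m1: "(\<lambda>x. f x * P (S n) x) \<in> borel_measurable lebesgue"
      by (rule borel_measurable_integrable[OF integrable_majorant[OF f P_bi[OF S]]])
    have "(\<lambda>x. indicator (- frontier (box a b)) x * (f x * P (S n) x)) \<in> borel_measurable lebesgue"
      by (intro borel_measurable_times m1 borel_measurable_indicator) auto
    then have "(LINT x|lebesgue. f x * G n x) = (LINT x|lebesgue. f x * P (S n) x)"
      using nullf m1 by (intro integral_cong_AE) (auto simp: G_def mult.left_commute elim!: eventually_mono)
    then show ?thesis using ortho[OF S] by simp
  qed
  ultimately have "(LINT x|lebesgue. f x * (indicator (- frontier (box a b)) x * (\<kappa> * i x))) = 0"
    by (simp add: LIMSEQ_const_iff)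
  moreover have "f x * (indicator (- frontier (box a b)) x * (\<kappa> * i x)) = \<kappa> * (indicator (box a b) x * f x)" for x
    using interior_open[OF open_box[of a b]] by (auto simp: i_def indicator_def frontier_def)
  ultimately show "(LINT x|lebesgue. indicator (box a b) x * f x) = 0" using \<kappa> by simp
qed

section \<open>Linear independence of exponentials\<close>

text \<open>Group the terms by the value of \<open>d\<close>. If some group had a nonzero total weight, multiply
  the sum by \<open>exp (a * u)\<close>, where \<open>u\<close> is the least exponent of such a
  group; as \<open>a \<rightarrow> \<infinity>\<close> only the weight of that group survives.\<close>

lemma exponential_sum_zero:
  fixes d C :: "'y \<Rightarrow> real"
  assumes Y: "finite Y" and zero: "\<And>a. a > 0 \<Longrightarrow> (\<Sum>y\<in>Y. C y * exp (- a * d y)) = 0"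
  shows "(\<Sum>y\<in>{y\<in>Y. d y = v}. C y) = 0"
proof (rule ccontr)
  define S where "S v = (\<Sum>y\<in>{y\<in>Y. d y = v}. C y)" for v
  define V where "V = {v \<in> d ` Y. S v \<noteq> 0}"
  assume "(\<Sum>y\<in>{y\<in>Y. d y = v}. C y) \<noteq> 0"
  then have "S v \<noteq> 0" by (simp add: S_def)
  moreover from this have "{y\<in>Y. d y = v} \<noteq> {}" unfolding S_def by (metis sum.empty)
  ultimately have V: "finite V" "V \<noteq> {}" using Y by (auto simp: V_def)
  define u where "u = Min V"
  have u: "u \<in> V" "\<And>v. v \<in> V \<Longrightarrow> u \<le> v" using V by (auto simp: u_def)
  have "(\<Sum>v\<in>V. S v * exp (- a * (v - u))) = 0" if a: "a > 0" for a
  proof -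
    have "0 = (\<Sum>y\<in>Y. C y * exp (- a * d y))" using zero[OF a] by simp
    also have "\<dots> = (\<Sum>v\<in>d ` Y. \<Sum>y\<in>{y\<in>Y. d y = v}. C y * exp (- a * d y))"
      by (rule sum.image_gen[OF Y])
    also have "\<dots> = (\<Sum>v\<in>d ` Y. S v * exp (- a * v))"
      by (intro sum.cong refl) (auto simp: S_def sum_distrib_right intro!: sum.cong)
    also have "\<dots> = (\<Sum>v\<in>V. S v * exp (- a * v))"
      by (rule sum.mono_neutral_right) (use Y in \<open>auto simp: V_def\<close>)
    finally have "exp (a * u) * (\<Sum>v\<in>V. S v * exp (- a * v)) = 0" by simp
    then show ?thesis by (simp add: sum_distrib_left mult.left_commute mult_exp_exp algebra_simps)
  qed
  then have "\<forall>\<^sub>F a in at_top. (\<Sum>v\<in>V. S v * exp (- a * (v - u))) = 0"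
    by (rule eventually_mono[OF eventually_gt_at_top[of 0]])
  moreover have "((\<lambda>a. \<Sum>v\<in>V. S v * exp (- a * (v - u))) \<longlongrightarrow> (\<Sum>v\<in>V. if v = u then S u else 0)) at_top"
    proof (rule tendsto_sum)
      fix v assume v: "v \<in> V"
      show "((\<lambda>a. S v * exp (- a * (v - u))) \<longlongrightarrow> (if v = u then S u else 0)) at_top"
      proof (cases "v = u")
        case False
        then have "v - u > 0" using u(2)[OF v] by simp
        then have "filterlim (\<lambda>a. (v - u) * a) at_top at_top"
          by (rule filterlim_tendsto_pos_mult_at_top[OF tendsto_const _ filterlim_ident])
        then have "filterlim (\<lambda>a. - ((v - u) * a)) at_bot at_top" by (simp add: filterlim_uminus_at_bot)
        then have "((\<lambda>a. exp (- ((v - u) * a))) \<longlongrightarrow> 0) at_top" by (rule filterlim_compose[OF exp_at_bot])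
        from tendsto_mult[OF tendsto_const[of "S v"] this] show ?thesis using False by (simp add: mult.commute[of _ "v - u"])
      qed simp
    qed
  ultimately have "((\<lambda>a::real. 0) \<longlongrightarrow> (\<Sum>v\<in>V. if v = u then S u else 0)) at_top"
    by (rule Lim_transform_eventually[rotated])
  then have "(\<Sum>v\<in>V. if v = u then S u else 0) = 0" by (simp add: tendsto_const_iff)
  then show False using u(1) V(1) by (simp add: V_def)
qed

section \<open>Bisecting hyperplanes\<close>

lemma coplanar_if_aff_dim_le_2:
  fixes T :: "'a::euclidean_space set"
  assumes "aff_dim T \<le> 2" shows "coplanar T"
proof -
  obtain B where B: "affine hull B = affine hull T" "\<not> affine_dependent B" "int (card B) = aff_dim T + 1"
    using aff_dim_basis_exists[of T] by blast
  have "finite B" using B(2) by (rule aff_independent_finite)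
  moreover have "card B \<le> 3" using B(3) assms by simp
  ultimately obtain u v w where "B \<subseteq> {u, v, w}"
  proof -
    consider "card B = 0" | "card B = 1" | "card B = 2" | "card B = 3" using \<open>card B \<le> 3\<close> by linarith
    then have "\<exists>u v w. B \<subseteq> {u, v, w}"
    proof cases
      case 1 then show ?thesis using \<open>finite B\<close> by auto
    next
      case 2 then show ?thesis by (auto simp: card_1_singleton_iff)
    next
      case 3 then show ?thesis by (auto simp: card_2_iff)
    next
      case 4 then show ?thesis by (auto simp: card_3_iff)
    qed
    then show ?thesis using that by blast
  qed
  then have "T \<subseteq> affine hull {u, v, w}" using hull_subset[of T affine] B(1) hull_mono[of B "{u, v, w}" affine] by blast
  then show ?thesis unfolding coplanar_def by blast
qed

text \<open>The points with equal distances to \<open>y\<close> and \<open>y'\<close> form a hyperplane, and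
  condition (D) excludes that \<open>n + 1\<close> of the given points lie on a line in the plane or
  on a plane in space.\<close>

lemma bisector_contains_few:
  fixes B :: "(real ^ 'n::finite) set" and y y' :: "real ^ 'n"
  assumes n: "CARD('n) = 2 \<or> CARD('n) = 3" and D: "condition_D B" and B: "finite B" and neq: "y \<noteq> y'"
  shows "card {b\<in>B. dist b y = dist b y'} \<le> CARD('n)"
proof (rule ccontr)
  assume "\<not> ?thesis"
  then obtain T where T: "T \<subseteq> {b\<in>B. dist b y = dist b y'}" "card T = CARD('n) + 1"
    using obtain_subset_with_card_n[of "CARD('n) + 1"] by (metis Suc_eq_plus1 not_less_eq_eq)
  define H where "H = {b. (y' - y) \<bullet> b = ((norm y')\<^sup>2 - (norm y)\<^sup>2) / 2}"
  have "T \<subseteq> H"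
  proof
    fix b assume "b \<in> T"
    then have "(dist b y)\<^sup>2 = (dist b y')\<^sup>2" using T(1) by auto
    moreover have "(dist b z)\<^sup>2 = b \<bullet> b - 2 * (z \<bullet> b) + (norm z)\<^sup>2" for z
      by (simp add: dist_norm power2_norm_eq_inner inner_diff_left inner_diff_right inner_commute)
    ultimately show "b \<in> H" by (simp add: H_def inner_diff_left)
  qed
  then have "aff_dim T \<le> aff_dim H" by (rule aff_dim_subset)
  also have "aff_dim H = int (CARD('n)) - 1"
  proof -
    have "aff_dim H = int (DIM(real ^ 'n) - 1)"
      unfolding H_def by (rule aff_dim_hyperplane) (use neq in simp)
    then show ?thesis by (simp add: of_nat_diff Suc_leI)
  qed
  finally have dim: "aff_dim T \<le> int (CARD('n)) - 1" .
  from n show False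
  proof
    assume "CARD('n) = 2"
    then show False using D T dim by (auto simp: condition_D_def collinear_aff_dim)
  next
    assume "CARD('n) = 3"
    then show False using D T dim coplanar_if_aff_dim_le_2[of T] by (auto simp: condition_D_def)
  qed
qed

section \<open>Balanced weights vanish\<close>

text \<open>Let \<open>y\<close> have negative weight. For every \<open>b\<close> the weights on the sphere
  about \<open>b\<close> through \<open>y\<close> sum to \<open>0\<close>, so this sphere contains a
  point \<open>y'\<close> of positive weight, and \<open>b\<close> lies on the hyperplane that
  bisects \<open>y\<close> and \<open>y'\<close>. Thus the bisectors of \<open>y\<close> and the
  points of positive weight cover \<open>B\<close>, and each of them contains at most
  \<open>n\<close> points of \<open>B\<close>.\<close>

lemma minority_sign_count:
  fixes B Y :: "(real ^ 'n::finite) set" and C :: "real ^ 'n \<Rightarrow> real"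
  assumes n: "CARD('n) = 2 \<or> CARD('n) = 3" and D: "condition_D B" and B: "finite B" and Y: "finite Y"
    and bal: "\<And>b v. b \<in> B \<Longrightarrow> (\<Sum>y\<in>{y\<in>Y. dist y b = v}. C y) = 0"
    and y: "y \<in> Y" "C y < 0"
  shows "card B \<le> card {y\<in>Y. C y > 0} * CARD('n)"
proof -
  define P where "P = {y\<in>Y. C y > 0}"
  have "B \<subseteq> (\<Union>y'\<in>P. {b\<in>B. dist b y = dist b y'})"
  proof
    fix b assume b: "b \<in> B"
    have "\<exists>y'\<in>P. dist y' b = dist y b"
    proof (rule ccontr)
      assume no: "\<not> (\<exists>y'\<in>P. dist y' b = dist y b)"
      have "(\<Sum>z\<in>{z\<in>Y. dist z b = dist y b}. C z) < (\<Sum>z\<in>{z\<in>Y. dist z b = dist y b}. 0)"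
        by (rule sum_strict_mono_ex1) (use Y y no in \<open>auto simp: P_def not_less\<close>)
      then show False using bal[OF b, of "dist y b"] by simp
    qed
    then obtain y' where "y' \<in> P" "dist y' b = dist y b" by blast
    moreover from this(2) have "dist b y = dist b y'" by (simp add: dist_commute[of b])
    ultimately show "b \<in> (\<Union>y'\<in>P. {b\<in>B. dist b y = dist b y'})" using b by blast
  qed
  then have "card B \<le> card (\<Union>y'\<in>P. {b\<in>B. dist b y = dist b y'})" using B Y by (intro card_mono) (auto simp: P_def)
  also have "\<dots> \<le> (\<Sum>y'\<in>P. card {b\<in>B. dist b y = dist b y'})" using Y by (intro card_UN_le) (auto simp: P_def)
  also have "\<dots> \<le> (\<Sum>y'\<in>P. CARD('n))"
    by (intro sum_mono bisector_contains_few[OF n D B]) (use y in \<open>auto simp: P_def\<close>)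
  finally show ?thesis by (simp add: P_def)
qed

text \<open>One of the two signs occurs at most \<open>r\<close> times. By \<open>minority_sign_count\<close>
  the points of the other sign do not exist, and then, as their number \<open>0\<close> is at most
  \<open>r\<close>, the same lemma with all signs reversed excludes the minority as well.\<close>

lemma balanced_weights_vanish:
  fixes B Y :: "(real ^ 'n::finite) set" and C :: "real ^ 'n \<Rightarrow> real"
  assumes n: "CARD('n) = 2 \<or> CARD('n) = 3" and D: "condition_D B" and B: "finite B" and Y: "finite Y"
    and bal: "\<And>b v. b \<in> B \<Longrightarrow> (\<Sum>y\<in>{y\<in>Y. dist y b = v}. C y) = 0"
    and few: "card Y \<le> 2 * r" and many: "card B > CARD('n) * r"
    and y: "y \<in> Y"
  shows "C y = 0"
proof (rule ccontr)
  assume "C y \<noteq> 0"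
  define P N where "P = {y\<in>Y. C y > 0}" and "N = {y\<in>Y. - C y > 0}"
  have fin: "finite P" "finite N" using Y by (auto simp: P_def N_def)
  have neg: "\<And>b v. b \<in> B \<Longrightarrow> (\<Sum>y\<in>{y\<in>Y. dist y b = v}. - C y) = 0" using bal by (simp add: sum_negf)
  have p: "N = {}" if "card P \<le> r"
  proof (rule ccontr)
    assume "N \<noteq> {}"
    then obtain z where "z \<in> Y" "C z < 0" by (auto simp: N_def)
    from minority_sign_count[OF n D B Y bal this] have "card B \<le> card P * CARD('n)" by (simp add: P_def)
    also have "\<dots> \<le> r * CARD('n)" using that by simp
    finally show False using many by (simp add: mult.commute)
  qed
  have q: "P = {}" if "card N \<le> r"
  proof (rule ccontr)
    assume "P \<noteq> {}"
    then obtain z where "z \<in> Y" "- C z < 0" by (auto simp: P_def)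
    from minority_sign_count[OF n D B Y neg this] have "card B \<le> card N * CARD('n)" by (simp add: N_def)
    also have "\<dots> \<le> r * CARD('n)" using that by simp
    finally show False using many by (simp add: mult.commute)
  qed
  have "card P + card N = card (P \<union> N)" using fin by (subst card_Un_disjoint) (auto simp: P_def N_def)
  also have "\<dots> \<le> card Y" using Y by (intro card_mono) (auto simp: P_def N_def)
  finally have "card P \<le> r \<or> card N \<le> r" using few by linarith
  then have "P = {} \<and> N = {}" using p q by (metis card.empty zero_le)
  moreover have "C y > 0 \<or> - C y > 0" using \<open>C y \<noteq> 0\<close> by linarith
  ultimately show False using y by (auto simp: P_def N_def)
qed

section \<open>Uniqueness\<close>

text \<open>The locations in each family are distinct, so a fibre of \<open>x1\<close> or \<open>x2\<close> has
  at most one element. A nonzero intensity can then only be balanced by an equal intensity at the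
  same location in the other family.\<close>

lemma merged_sources_zero_imp_equal:
  fixes x1 x2 :: "nat \<Rightarrow> 'a" and q1 q2 :: "nat \<Rightarrow> real"
  assumes inj: "inj_on x1 {1..r1}" "inj_on x2 {1..r2}"
    and nz: "\<forall>i\<in>{1..r1}. q1 i \<noteq> 0" "\<forall>i\<in>{1..r2}. q2 i \<noteq> 0"
    and zero: "\<And>y. (\<Sum>i\<in>{i\<in>{1..r1}. x1 i = y}. q1 i) - (\<Sum>i\<in>{i\<in>{1..r2}. x2 i = y}. q2 i) = 0"
  shows "r1 = r2 \<and> (\<exists>\<sigma>. \<sigma> permutes {1..r1} \<and> (\<forall>i\<in>{1..r1}. x1 i = x2 (\<sigma> i) \<and> q1 i = q2 (\<sigma> i)))"
proof -
  have single: "(\<Sum>i\<in>{i\<in>{1..r}. x i = x k}. q i) = q k" if "inj_on x {1..r}" "k \<in> {1..r}" for x :: "nat \<Rightarrow> 'a" and q :: "nat \<Rightarrow> real" and r k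
  proof -
    have "{i\<in>{1..r}. x i = x k} = {k}" using that by (auto dest: inj_onD)
    then show ?thesis by simp
  qed
  have ex1: "\<exists>j\<in>{1..r2}. x2 j = x1 i" if "i \<in> {1..r1}" for i
  proof (rule ccontr)
    assume "\<not> ?thesis"
    then have "{j\<in>{1..r2}. x2 j = x1 i} = {}" by auto
    then have "(\<Sum>j\<in>{j\<in>{1..r2}. x2 j = x1 i}. q2 j) = 0" by (simp only: sum.empty)
    then have "q1 i = 0" using zero[of "x1 i"] single[OF inj(1) that, of q1] by linarith
    then show False using nz(1) that by blast
  qed
  have ex2: "\<exists>j\<in>{1..r1}. x1 j = x2 i" if "i \<in> {1..r2}" for i
  proof (rule ccontr)
    assume "\<not> ?thesis"
    then have "{j\<in>{1..r1}. x1 j = x2 i} = {}" by auto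
    then have "(\<Sum>j\<in>{j\<in>{1..r1}. x1 j = x2 i}. q1 j) = 0" by (simp only: sum.empty)
    then have "q2 i = 0" using zero[of "x2 i"] single[OF inj(2) that, of q2] by linarith
    then show False using nz(2) that by blast
  qed
  have img: "x1 ` {1..r1} = x2 ` {1..r2}" 
  proof (intro equalityI image_subsetI)
    show "x1 i \<in> x2 ` {1..r2}" if "i \<in> {1..r1}" for i using ex1[OF that] by (metis imageI)
    show "x2 i \<in> x1 ` {1..r1}" if "i \<in> {1..r2}" for i using ex2[OF that] by (metis imageI)
  qed
  then have r: "r1 = r2" using card_image[OF inj(1)] card_image[OF inj(2)] by simp
  obtain s where s: "\<And>i. i \<in> {1..r1} \<Longrightarrow> s i \<in> {1..r2} \<and> x2 (s i) = x1 i" using ex1 by metis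
  define \<sigma> where "\<sigma> i = (if i \<in> {1..r1} then s i else i)" for i
  have "inj_on s {1..r1}"
  proof (rule inj_onI)
    fix i j assume i: "i \<in> {1..r1}" and j: "j \<in> {1..r1}" and "s i = s j"
    then have "x1 i = x1 j" using s[OF i] s[OF j] by metis
    then show "i = j" using inj_onD[OF inj(1) _ i j] by blast
  qed
  moreover have "\<sigma> i = s i" if "i \<in> {1..r1}" for i unfolding \<sigma>_def using that by (rule if_P)
  ultimately have "inj_on \<sigma> {1..r1}" by (simp only: inj_on_cong[of "{1..r1}" \<sigma> s])
  moreover have "\<sigma> ` {1..r1} \<subseteq> {1..r1}"
  proof (rule image_subsetI)
    show "\<sigma> i \<in> {1..r1}" if "i \<in> {1..r1}" for i
      unfolding \<sigma>_def if_P[OF that] using s[OF that] unfolding r by blast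
  qed
  ultimately have "bij_betw \<sigma> {1..r1} {1..r1}" unfolding bij_betw_def by (intro conjI endo_inj_surj finite_atLeastAtMost)
  then have "\<sigma> permutes {1..r1}" by (rule bij_imp_permutes) (unfold \<sigma>_def, rule if_not_P)
  moreover have "x1 i = x2 (\<sigma> i) \<and> q1 i = q2 (\<sigma> i)" if "i \<in> {1..r1}" for i
  proof -
    have e: "x2 (s i) = x1 i" "s i \<in> {1..r2}" using s[OF that] by auto
    have "q1 i = q2 (s i)"
      using zero[of "x1 i"] single[OF inj(1) that, of q1] single[OF inj(2) e(2), of q2, unfolded e(1)] by linarith
    then show ?thesis unfolding \<sigma>_def if_P[OF that] e(1) by blast
  qed
  ultimately show ?thesis using r by blast
qed

text \<open>A location common to both families contributes the difference of its two intensities. The difference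
  of the sources thus becomes a single family of weighted points without repetitions.\<close>

lemma source_density_merge:
  fixes x1 x2 :: "nat \<Rightarrow> 'a::euclidean_space" and r1 r2 :: nat and q1 q2 :: "nat \<Rightarrow> real"
  defines "Y \<equiv> x1 ` {1..r1} \<union> x2 ` {1..r2}"
    and "C \<equiv> \<lambda>y. (\<Sum>i\<in>{i\<in>{1..r1}. x1 i = y}. q1 i) - (\<Sum>i\<in>{i\<in>{1..r2}. x2 i = y}. q2 i)"
  shows "source_density lam0 r1 x1 q1 m s - source_density lam0 r2 x2 q2 m s =
    heat_factor lam0 TYPE('a) s * (\<Sum>y\<in>Y. C y * gauss (1 / (4 * s)) m y)"
proof -
  have *: "(\<Sum>i=1..r. q i * gauss (1 / (4 * s)) m (x i)) = (\<Sum>y\<in>Y. (\<Sum>i\<in>{i\<in>{1..r}. x i = y}. q i) * gauss (1 / (4 * s)) m y)"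
    if "x ` {1..r} \<subseteq> Y" for x :: "nat \<Rightarrow> 'a" and q r
  proof -
    have "(\<Sum>i=1..r. q i * gauss (1 / (4 * s)) m (x i)) = (\<Sum>y\<in>Y. \<Sum>i\<in>{i\<in>{1..r}. x i = y}. q i * gauss (1 / (4 * s)) m (x i))"
      by (rule sum.group[symmetric]) (use that in \<open>auto simp: Y_def\<close>)
    also have "\<dots> = (\<Sum>y\<in>Y. (\<Sum>i\<in>{i\<in>{1..r}. x i = y}. q i) * gauss (1 / (4 * s)) m y)"
      unfolding sum_distrib_right by (intro sum.cong refl) auto
    finally show ?thesis .
  qed
  have 1: "x1 ` {1..r1} \<subseteq> Y" and 2: "x2 ` {1..r2} \<subseteq> Y" by (auto simp: Y_def)
  show ?thesis
    unfolding source_density_def *[OF 1] *[OF 2] C_def left_diff_distrib sum_subtractf right_diff_distrib ..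
qed

lemma source_density_primitive:
  obtains A where "\<And>s. s > 0 \<Longrightarrow> (A has_real_derivative source_density lam0 n xs qs m s) (at s)"
proof -
  have "continuous_on {0<..} (source_density lam0 n xs qs m)"
    unfolding source_density_def[abs_def] gauss_def
    by (intro continuous_intros heat_factor_continuous) auto
  then show ?thesis
    using primitive_exists[of "{0<..}" "source_density lam0 n xs qs m" 1] that by auto
qed

theorem theorem3p6:
  fixes lam lam0 p q :: real
    and f0 :: "real \<Rightarrow> real ^ 'n::finite \<Rightarrow> real"
    and u0 :: "real ^ 'n \<Rightarrow> real"
    and s r r1 r2 :: nat
    and b x1 x2 :: "nat \<Rightarrow> real ^ 'n"
    and q1 q2 :: "nat \<Rightarrow> real"
    and \<psi> :: "nat \<Rightarrow> real \<Rightarrow> real"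
    and u1 u2 :: "real \<Rightarrow> real ^ 'n \<Rightarrow> real"
  assumes "CARD('n) = 2 \<or> CARD('n) = 3"
    and "lam > 0" and "lam0 \<ge> 0"
    and "1 < p" and "p < real CARD('n) / (real CARD('n) - 1)" and "1 / p + 1 / q = 1"
    and "(\<lambda>(t, x). weighted lam f0 t x) \<in> Lp 2 ({0<..} \<times> UNIV)"
    and "u0 \<in> sobolev 1 2 UNIV"
    and "inj_on b {1..s}" and "condition_D (b ` {1..s})"
    and "r1 > 0" and "r2 > 0"
    and "inj_on x1 {1..r1}" and "x1 ` {1..r1} \<inter> b ` {1..s} = {}" and "\<forall>i\<in>{1..r1}. q1 i \<noteq> 0"
    and "inj_on x2 {1..r2}" and "x2 ` {1..r2} \<inter> b ` {1..s} = {}" and "\<forall>i\<in>{1..r2}. q2 i \<noteq> 0"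
    and "u1 \<in> solution_class lam lam0 p q f0 u0 r1 x1 q1"
    and "u2 \<in> solution_class lam lam0 p q f0 u0 r2 x2 q2"
    and "\<forall>k\<in>{1..s}. AE t in time. has_point_value (u1 t) (b k) (\<psi> k t)"
    and "\<forall>k\<in>{1..s}. AE t in time. has_point_value (u2 t) (b k) (\<psi> k t)"
    and "r \<ge> max r1 r2"
    and "CARD('n) = 2 \<longrightarrow> s \<ge> 2 * r + 1" and "CARD('n) = 3 \<longrightarrow> s \<ge> 3 * r + 1"
  shows "(AE t in time. AE x in lebesgue. u1 t x = u2 t x) \<and> r1 = r2 \<and>
    (\<exists>\<sigma>. \<sigma> permutes {1..r1} \<and> (\<forall>i\<in>{1..r1}. x1 i = x2 (\<sigma> i) \<and> q1 i = q2 (\<sigma> i)))"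
proof -
  have q: "q > 1"
  proof -
    have 1: "1 / q = 1 - 1 / p" using \<open>1 / p + 1 / q = 1\<close> by linarith
    have "0 < 1 / p" "1 / p < 1" using \<open>1 < p\<close> by simp_all
    then have "0 < 1 / q" "1 / q < 1" unfolding 1 by linarith+
    then show ?thesis by (simp add: zero_less_divide_iff divide_less_eq_1 del: zero_less_divide_1_iff)
  qed
  note pq = \<open>1 < p\<close> q \<open>1 / p + 1 / q = 1\<close>
  have u0: "u0 \<in> Lp 2 UNIV" using \<open>u0 \<in> sobolev 1 2 UNIV\<close> by (simp add: sobolev_def)
  obtain v1 w1 where d1: "regular_solution lam lam0 f0 u0 v1" "singular_solution lam lam0 p q r1 x1 q1 w1"
    "AE t in time. AE x in lebesgue. u1 t x = v1 t x + w1 t x"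
    using \<open>u1 \<in> solution_class lam lam0 p q f0 u0 r1 x1 q1\<close> unfolding solution_class_def by blast
  obtain v2 w2 where d2: "regular_solution lam lam0 f0 u0 v2" "singular_solution lam lam0 p q r2 x2 q2 w2"
    "AE t in time. AE x in lebesgue. u2 t x = v2 t x + w2 t x"
    using \<open>u2 \<in> solution_class lam lam0 p q f0 u0 r2 x2 q2\<close> unfolding solution_class_def by blast
  define D where "D t = (\<lambda>x. (v1 t x + w1 t x) - (v2 t x + w2 t x))" for t
  define S1 S2 where "S1 = source_density lam0 r1 x1 q1" and "S2 = source_density lam0 r2 x2 q2"
  \<comment> \<open>The regular parts cancel in the difference, and each singular part contributes the increment of a primitive of its source density.\<close>
  have main: "AE t in time. t > 0 \<and> L1_plus_Linf (D t) \<and> (AE x in lebesgue. u1 t x - u2 t x = D t x) \<and>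
    (\<forall>m A1 A2. (\<forall>s>0. (A1 has_real_derivative S1 m s) (at s)) \<longrightarrow> (\<forall>s>0. (A2 has_real_derivative S2 m s) (at s)) \<longrightarrow>
      (\<forall>s>0. heat_pair lam0 m (dual_embed (D t)) s = (A1 (s + t) - A1 s) - (A2 (s + t) - A2 s)))"
    using AE_space[of time] regular_solutions_heat_pair[OF d1(1) d2(1) u0]
      singular_solution_heat_pair[OF d1(2) pq] singular_solution_heat_pair[OF d2(2) pq] d1(3) d2(3)
  proof eventually_elim
    case (elim t)
    have L: "L1_plus_Linf (v1 t)" "L1_plus_Linf (v2 t)" "L1_plus_Linf (w1 t)" "L1_plus_Linf (w2 t)"
      using elim(2-4) pq by (auto intro: Lp_L1_plus_Linf)
    have e: "D t = (\<lambda>x. (v1 t x - v2 t x) - (w2 t x - w1 t x))" by (auto simp: D_def)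
    have LD: "L1_plus_Linf (D t)" unfolding D_def by (intro L1_plus_Linf_diff L1_plus_Linf_add L)
    have "heat_pair lam0 m (dual_embed (D t)) s = (A1 (s + t) - A1 s) - (A2 (s + t) - A2 s)"
      if A: "\<forall>s>0. (A1 has_real_derivative S1 m s) (at s)" "\<forall>s>0. (A2 has_real_derivative S2 m s) (at s)" and s: "s > 0" for m A1 A2 s
    proof -
      have "heat_pair lam0 m (dual_embed (D t)) s =
          (heat_pair lam0 m (dual_embed (v1 t)) s - heat_pair lam0 m (dual_embed (v2 t)) s) -
          (heat_pair lam0 m (dual_embed (w2 t)) s - heat_pair lam0 m (dual_embed (w1 t)) s)"
        unfolding e heat_pair_dual_embed_diff(1)[OF L1_plus_Linf_diff[OF L(1,2)] L1_plus_Linf_diff[OF L(4,3)] s]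
          heat_pair_dual_embed_diff(1)[OF L(1,2) s] heat_pair_dual_embed_diff(1)[OF L(4,3) s] ..
      moreover have "heat_pair lam0 m (dual_embed (v1 t)) s = heat_pair lam0 m (dual_embed (v2 t)) s" using elim(2) s by blast
      moreover have "heat_pair lam0 m (dual_embed (w1 t)) s = A1 (s + t) - A1 s" using elim(3) A(1) s unfolding S1_def by blast
      moreover have "heat_pair lam0 m (dual_embed (w2 t)) s = A2 (s + t) - A2 s" using elim(4) A(2) s unfolding S2_def by blast
      ultimately show ?thesis by simp
    qed
    moreover have "AE x in lebesgue. u1 t x - u2 t x = D t x" using elim(5,6) by eventually_elim (simp add: D_def)
    ultimately show ?case using elim(1) LD by simp
  qed
  \<comment> \<open>At the centres \<open>b k\<close> the difference has the point value \<open>0\<close>, which makes the difference of the primitives constant.\<close>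
  have S_eq: "S1 (b k) s' = S2 (b k) s'" if k: "k \<in> {1..s}" and s': "s' > 0" for k s'
  proof -
    obtain A1 where A1: "\<And>s. s > 0 \<Longrightarrow> (A1 has_real_derivative S1 (b k) s) (at s)" unfolding S1_def using source_density_primitive by blast
    obtain A2 where A2: "\<And>s. s > 0 \<Longrightarrow> (A2 has_real_derivative S2 (b k) s) (at s)" unfolding S2_def using source_density_primitive by blast
    define A where "A s = A1 s - A2 s" for s
    have A: "(A has_real_derivative S1 (b k) s - S2 (b k) s) (at s)" if "s > 0" for s
      unfolding A_def by (intro derivative_intros A1 A2 that)
    define P where "P t \<longleftrightarrow> t > 0 \<and> ((\<lambda>s. A (s + t) - A s) \<longlongrightarrow> 0) (at_right 0)" for t
    have const: "AE t in time. P t"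
      unfolding P_def
      using main bspec[OF \<open>\<forall>k\<in>{1..s}. AE t in time. has_point_value (u1 t) (b k) (\<psi> k t)\<close> k]
        bspec[OF \<open>\<forall>k\<in>{1..s}. AE t in time. has_point_value (u2 t) (b k) (\<psi> k t)\<close> k]
    proof eventually_elim
      case (elim t)
      obtain U g where U: "open U" "b k \<in> U" "continuous_on U g" "AE x in lebesgue. x \<in> U \<longrightarrow> g x = u1 t x" "g (b k) = \<psi> k t"
        using elim(2) by (auto simp: has_point_value_def)
      obtain V h where V: "open V" "b k \<in> V" "continuous_on V h" "AE x in lebesgue. x \<in> V \<longrightarrow> h x = u2 t x" "h (b k) = \<psi> k t"
        using elim(3) by (auto simp: has_point_value_def)
      have ae: "AE x in lebesgue. u1 t x - u2 t x = D t x" using elim(1) by blast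
      have "AE x in lebesgue. x \<in> U \<inter> V \<longrightarrow> g x - h x = D t x"
        using U(4) V(4) ae by eventually_elim auto
      moreover have "continuous_on (U \<inter> V) (\<lambda>x. g x - h x)"
        by (intro continuous_intros continuous_on_subset[OF U(3)] continuous_on_subset[OF V(3)]) auto
      ultimately have "has_point_value (D t) (b k) 0"
        unfolding has_point_value_def using U V by (intro exI[of _ "U \<inter> V"] exI[of _ "\<lambda>x. g x - h x"]) auto
      moreover have "L1_plus_Linf (D t)" using elim(1) by blast
      ultimately have lim: "((\<lambda>s. heat_pair lam0 (b k) (dual_embed (D t)) s) \<longlongrightarrow> 0) (at_right 0)"
        using \<open>lam0 \<ge> 0\<close> by (intro concentration)
      have "heat_pair lam0 (b k) (dual_embed (D t)) s = A (s + t) - A s" if "s > 0" for s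
      proof -
        have "\<forall>s>0. (A1 has_real_derivative S1 (b k) s) (at s)" "\<forall>s>0. (A2 has_real_derivative S2 (b k) s) (at s)" using A1 A2 by blast+
        then have "heat_pair lam0 (b k) (dual_embed (D t)) s = (A1 (s + t) - A1 s) - (A2 (s + t) - A2 s)" using elim(1) that by blast
        then show ?thesis by (simp add: A_def)
      qed
      then have "\<forall>\<^sub>F s in at_right 0. heat_pair lam0 (b k) (dual_embed (D t)) s = A (s + t) - A s"
        by (auto simp: eventually_at_right_field intro!: exI[of _ 1])
      with lim have "((\<lambda>s. A (s + t) - A s) \<longlongrightarrow> 0) (at_right 0)" by (rule Lim_transform_eventually)
      then show ?case using elim(1) by blast
    qed
    have Acont: "isCont A t" if "t > 0" for t using A[OF that] by (rule DERIV_isCont)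
    \<comment> \<open>Subtracting the limits for two times eliminates \<open>A s\<close>, whose behaviour as \<open>s \<rightarrow> 0\<close> is unknown.\<close>
    have eqA: "A t = A t'" if t: "t > 0" "((\<lambda>s. A (s + t) - A s) \<longlongrightarrow> 0) (at_right 0)"
      and t': "t' > 0" "((\<lambda>s. A (s + t') - A s) \<longlongrightarrow> 0) (at_right 0)" for t t'
    proof -
      have l: "((\<lambda>s. A (s + t)) \<longlongrightarrow> A t) (at_right 0)" if "t > 0" for t
      proof -
        have "((\<lambda>s::real. s + t) \<longlongrightarrow> 0 + t) (at_right 0)" by (intro tendsto_intros)
        then have "((\<lambda>s::real. s + t) \<longlongrightarrow> t) (at_right 0)" by simp
        then show ?thesis by (rule isCont_tendsto_compose[OF Acont[OF that]])
      qed
      have "((\<lambda>s. A (s + t) - A (s + t')) \<longlongrightarrow> A t - A t') (at_right 0)" by (intro tendsto_diff l t(1) t'(1))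
      moreover have "((\<lambda>s. A (s + t) - A (s + t')) \<longlongrightarrow> 0) (at_right 0)" using tendsto_diff[OF t(2) t'(2)] by simp
      ultimately have "A t - A t' = 0" by (rule tendsto_unique[rotated]) simp
      then show ?thesis by simp
    qed
    have all: "A t = A t'" if t: "t > 0" and t': "t' > 0" for t t'
    proof -
      obtain \<tau> where \<tau>: "\<And>n. P (\<tau> n)" "\<And>n. \<tau> n > t" "\<tau> \<longlonglongrightarrow> t"
        using AE_time_dense[OF const less_imp_le[OF t]] by metis
      obtain \<tau>' where \<tau>': "\<And>n. P (\<tau>' n)" "\<And>n. \<tau>' n > t'" "\<tau>' \<longlonglongrightarrow> t'"
        using AE_time_dense[OF const less_imp_le[OF t']] by metis
      have "(\<lambda>n. A (\<tau> n)) \<longlonglongrightarrow> A t" by (rule isCont_tendsto_compose[OF Acont[OF t] \<tau>(3)])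
      moreover have "(\<lambda>n. A (\<tau>' n)) \<longlonglongrightarrow> A t'" by (rule isCont_tendsto_compose[OF Acont[OF t'] \<tau>'(3)])
      moreover have "A (\<tau> n) = A (\<tau>' n)" for n
        using \<tau>(1)[of n] \<tau>'(1)[of n] by (intro eqA) (simp_all add: P_def)
      ultimately show ?thesis by (simp add: LIMSEQ_unique)
    qed
    have "(A has_real_derivative 0) (at s')"
      by (rule has_field_derivative_transform_within_open[of "\<lambda>_. A s'" _ _ "{0<..}"]) (use s' in \<open>auto intro: all\<close>)
    then have "S1 (b k) s' - S2 (b k) s' = 0" using A[OF s'] DERIV_unique by blast
    then show ?thesis by simp
  qed
  define Y where "Y = x1 ` {1..r1} \<union> x2 ` {1..r2}"
  define C where "C y = (\<Sum>i\<in>{i\<in>{1..r1}. x1 i = y}. q1 i) - (\<Sum>i\<in>{i\<in>{1..r2}. x2 i = y}. q2 i)" for y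
  have merge: "S1 m s' - S2 m s' = heat_factor lam0 TYPE(real ^ 'n) s' * (\<Sum>y\<in>Y. C y * gauss (1 / (4 * s')) m y)" for m s'
    unfolding S1_def S2_def Y_def C_def by (rule source_density_merge)
  have Y: "finite Y" by (simp add: Y_def)
  \<comment> \<open>As functions of \<open>a = 1 / (4 * s)\<close>, the equal source densities give a vanishing sum of exponentials with exponents \<open>|y - c|\<^sup>2\<close>.\<close>
  have bal: "(\<Sum>y\<in>{y\<in>Y. dist y c = v}. C y) = 0" if c: "c \<in> b ` {1..s}" for c v
  proof (cases "v \<ge> 0")
    case True
    obtain k where k: "k \<in> {1..s}" "c = b k" using c by blast
    have "(\<Sum>y\<in>Y. C y * exp (- a * (dist y c)\<^sup>2)) = 0" if "a > 0" for a
    proof -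
      have pos: "1 / (4 * a) > 0" using that by simp
      have "heat_factor lam0 TYPE(real ^ 'n) (1 / (4 * a)) * (\<Sum>y\<in>Y. C y * gauss a c y) = 0"
        using merge[of c "1 / (4 * a)"] S_eq[OF k(1) pos] k(2) that by simp
      then have "(\<Sum>y\<in>Y. C y * gauss a c y) = 0" using heat_factor_pos[OF pos, of lam0 "TYPE(real ^ 'n)"] by simp
      then show ?thesis by (simp add: gauss_def dist_norm)
    qed
    then have "(\<Sum>y\<in>{y\<in>Y. (dist y c)\<^sup>2 = v\<^sup>2}. C y) = 0" by (rule exponential_sum_zero[OF Y])
    then show ?thesis using True by (simp add: power2_eq_iff_nonneg)
  next
    case False
    then have "{y\<in>Y. dist y c = v} = {}" by (auto simp: not_le)
    then show ?thesis by (simp only: sum.empty)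
  qed
  have cardY: "card Y \<le> 2 * r"
  proof -
    have "card Y \<le> card (x1 ` {1..r1}) + card (x2 ` {1..r2})" unfolding Y_def by (rule card_Un_le)
    also have "\<dots> \<le> r1 + r2" using card_image_le[of "{1..r1}" x1] card_image_le[of "{1..r2}" x2] by simp
    finally show ?thesis using \<open>r \<ge> max r1 r2\<close> by simp
  qed
  have cardB: "card (b ` {1..s}) > CARD('n) * r"
    using assms(1) \<open>CARD('n) = 2 \<longrightarrow> s \<ge> 2 * r + 1\<close> \<open>CARD('n) = 3 \<longrightarrow> s \<ge> 3 * r + 1\<close> card_image[OF \<open>inj_on b {1..s}\<close>] by auto
  have CY: "C y = 0" if "y \<in> Y" for y
    by (rule balanced_weights_vanish[OF assms(1) \<open>condition_D (b ` {1..s})\<close> _ Y bal cardY cardB that]) auto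
  have C0: "C y = 0" for y
  proof (cases "y \<in> Y")
    case False
    then have "{i\<in>{1..r1}. x1 i = y} = {}" "{i\<in>{1..r2}. x2 i = y} = {}" by (auto simp: Y_def)
    then show ?thesis unfolding C_def by (simp only: sum.empty diff_self)
  qed (rule CY)
  have sources: "r1 = r2 \<and> (\<exists>\<sigma>. \<sigma> permutes {1..r1} \<and> (\<forall>i\<in>{1..r1}. x1 i = x2 (\<sigma> i) \<and> q1 i = q2 (\<sigma> i)))"
    by (rule merged_sources_zero_imp_equal) (use assms C0 in \<open>auto simp: C_def\<close>)
  \<comment> \<open>With equal sources the densities agree at every centre, and the difference of the solutions becomes orthogonal to all Gaussians.\<close>
  have S_all: "S1 m s' = S2 m s'" for m s'
  proof -
    have "S1 m s' - S2 m s' = 0" unfolding merge C0 by simp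
    then show ?thesis by simp
  qed
  have "AE t in time. AE x in lebesgue. u1 t x = u2 t x"
    using main
  proof eventually_elim
    case (elim t)
    have LD: "L1_plus_Linf (D t)" and ae: "AE x in lebesgue. u1 t x - u2 t x = D t x" using elim by blast+
    have "AE x in lebesgue. D t x = 0"
    proof (rule AE_zero_if_orthogonal_to_gaussians[OF LD])
      fix m :: "real ^ 'n" and s' :: real assume s': "s' > 0"
      obtain A where A: "\<And>s. s > 0 \<Longrightarrow> (A has_real_derivative S1 m s) (at s)" unfolding S1_def using source_density_primitive by blast
      then have "\<forall>s>0. (A has_real_derivative S1 m s) (at s)" by blast
      moreover from this have "\<forall>s>0. (A has_real_derivative S2 m s) (at s)" by (simp only: S_all)
      ultimately have "heat_pair lam0 m (dual_embed (D t)) s' = (A (s' + t) - A s') - (A (s' + t) - A s')" using elim s' by blast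
      then have "heat_pair lam0 m (dual_embed (D t)) s' = 0" by simp
      then show "(LINT x|lebesgue. D t x * gauss (1 / (4 * s')) m x) = 0"
        using heat_factor_pos[OF s', of lam0 "TYPE(real ^ 'n)"] by (simp add: heat_pair_def dual_embed_def)
    qed
    with ae show ?case by eventually_elim simp
  qed
  then show ?thesis using sources by blast
qed

end
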